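(* Let $n=4$, let $g$ be a constant metric, and let $\Theta\in M_4(\mathbb{R})$ be a skewsymmetric matrix satisfying the Diophantine condition: there are $C>0,\beta>0$ with $\inf_{k\in\mathbb{Z}^4}|\Theta q-2\pi k|\ge C|q|^{-(1+\beta)}$ for all $q\in\mathbb{Z}^4\setminus\{0\}$. Let $\lambda,m\in\mathbb{R}$, let $\varphi$ be a real smooth function on $\mathbb{T}^4$, and let $$P=-g^{\mu\nu}\partial_\mu\partial_\nu+\tfrac\lambda6\big[R(\varphi\star\varphi)+L(\varphi\star\varphi)+L(\varphi)R(\varphi)\big]+m^2 .$$ Then the coefficient $a_4(P)$ of $t^0$ in the asymptotic expansion of $\mathrm{Tr}(e^{-tP})$ as $t\to0^+$ (for which the one-loop divergent part of the effective action of the noncommutative $\phi^4$ theory is $W_{\rm div}(s)=-\frac1{2s}a_4(P)$) is $$a_4(P)=\frac1{32\pi^2}\Big[v\,m^4+\frac{\lambda m^2}3\Big(2\int d^4x\sqrt g\,\varphi^2+v^{-1}\Big(\int d^4x\sqrt g\,\varphi\Big)^2\Big)$$ $$\qquad+\frac{\lambda^2}{36}\Big(2\int d^4x\sqrt g\,\varphi_\star^4+3v^{-1}\Big(\int d^4x\sqrt g\,\varphi^2\Big)^2+4v^{-1}\int d^4x\sqrt g\,\varphi_\star^3\int d^4x\sqrt g\,\varphi\Big)\Big],$$ where $v=\mathrm{vol}\,\mathbb{T}^4=(2\pi)^4\sqrt g$. In particular it contains non-local terms not of the form of those in the classical action.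
   Context: $\mathbb{T}^4=\mathbb{R}^4/(2\pi\mathbb{Z})^4$; all integrals are over $\mathbb{T}^4$. $g^{\mu\nu}$ is a constant positive definite symmetric matrix with inverse $g_{\mu\nu}$, $\sqrt g=\sqrt{\det(g_{\mu\nu})}$. The star product on $C^\infty(\mathbb{T}^4)$ is determined by $e^{ikx}\star e^{iqx}=e^{-\frac i2k\cdot\Theta q}e^{i(k+q)x}$, $k,q\in\mathbb{Z}^4$, $k\cdot\Theta q=\sum k_\mu\Theta^{\mu\nu}q_\nu$. $L(f)h=f\star h$, $R(f)h=h\star f$ act on $L^2(\mathbb{T}^4)$. $\varphi_\star^k$ is the $k$-th star-power of $\varphi$, e.g. $\varphi_\star^3=\varphi\star\varphi\star\varphi$. The operator $P$ is that of the quadratic part, in the fluctuation $\delta\phi$ about the background $\varphi$, of the classical action $S[\phi]=\int d^4x\sqrt g\,\big(\frac12(\partial_\mu\phi)^2+\frac12m^2\phi^2+\frac\lambda{24}\phi\star\phi\star\phi\star\phi\big)$, the quadratic part being $\frac12\int d^4x\sqrt g\,(\delta\phi)P(\delta\phi)$. "Local" terms are linear combinations of a field-independent constant, $\int\varphi^2$ and $\int\varphi_\star^4$.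
   Formalization: The final claim, that a_4(P) contains non-local terms, is stated for λ ≠ 0: for λ = 0 the coefficient is the field-independent constant v m^4/(32π^2), which is local. *)

theory Defs
  imports "HOL-Analysis.Analysis" "HOL-Library.Landau_Symbols"
begin

section \<open>Functions on the four-torus\<close>

text \<open>Functions on the torus are represented by functions on \<open>real ^ 4\<close>; smooth ones are
  \<open>2 pi\<close>-periodic, and integration is over a fundamental domain. Multi-indices in the integer
  lattice have type \<open>int ^ 4\<close>.\<close>

definition lat :: "int ^ 4 \<Rightarrow> real ^ 4" where
  "lat k = (\<chi> i. real_of_int (k $ i))"

definition torus :: "(real ^ 4) measure" where
  "torus = restrict_space lborel {x. \<forall>i. 0 \<le> x $ i \<and> x $ i < 2 * pi}"

definition partial :: "4 \<Rightarrow> (real ^ 4 \<Rightarrow> complex) \<Rightarrow> real ^ 4 \<Rightarrow> complex" where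
  "partial i f x = frechet_derivative f (at x) (axis i 1)"

primrec Cdiff :: "nat \<Rightarrow> (real ^ 4 \<Rightarrow> complex) \<Rightarrow> bool" where
  "Cdiff 0 f \<longleftrightarrow> continuous_on UNIV f"
| "Cdiff (Suc n) f \<longleftrightarrow> (\<forall>x. f differentiable (at x)) \<and> (\<forall>i. Cdiff n (partial i f))"

definition torus_smooth :: "(real ^ 4 \<Rightarrow> complex) \<Rightarrow> bool" where
  "torus_smooth f \<longleftrightarrow>
     (\<forall>n. Cdiff n f) \<and> (\<forall>x k. f (x + (2 * pi) *\<^sub>R lat k) = f x)"

definition real_valued :: "(real ^ 4 \<Rightarrow> complex) \<Rightarrow> bool" where
  "real_valued f \<longleftrightarrow> (\<forall>x. f x \<in> \<real>)"

definition plane_wave :: "int ^ 4 \<Rightarrow> real ^ 4 \<Rightarrow> complex" where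
  "plane_wave k x = cis (lat k \<bullet> x)"

definition fourier_coeff :: "(real ^ 4 \<Rightarrow> complex) \<Rightarrow> int ^ 4 \<Rightarrow> complex" where
  "fourier_coeff f k = (LINT x|torus. f x * cnj (plane_wave k x)) / complex_of_real ((2 * pi) ^ 4)"


section \<open>The constant metric\<close>

text \<open>Throughout, \<open>gu\<close> is the matrix with upper indices; the metric with lower indices is its
  inverse.\<close>

definition sqrt_g :: "real ^ 4 ^ 4 \<Rightarrow> real" where
  "sqrt_g gu = sqrt (det (matrix_inv gu))"

definition torus_int :: "real ^ 4 ^ 4 \<Rightarrow> (real ^ 4 \<Rightarrow> complex) \<Rightarrow> complex" where
  "torus_int gu f = (LINT x|torus. complex_of_real (sqrt_g gu) * f x)"

definition torus_vol :: "real ^ 4 ^ 4 \<Rightarrow> real" where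
  "torus_vol gu = (2 * pi) ^ 4 * sqrt_g gu"


section \<open>The star product\<close>

text \<open>The bilinear continuous extension of the product of plane waves. It is only used for smooth
  functions, whose Fourier coefficients decay rapidly, so that the double series is absolutely
  convergent.\<close>

definition star :: "real ^ 4 ^ 4 \<Rightarrow> (real ^ 4 \<Rightarrow> complex) \<Rightarrow> (real ^ 4 \<Rightarrow> complex) \<Rightarrow> real ^ 4 \<Rightarrow> complex" where
  "star \<Theta> f h x =
     (\<Sum>\<^sub>\<infinity>(k, q)\<in>UNIV. fourier_coeff f k * fourier_coeff h q *
        (exp (- (\<i> / 2) * complex_of_real (lat k \<bullet> (\<Theta> *v lat q))) * plane_wave (k + q) x))"

primrec star_pow :: "real ^ 4 ^ 4 \<Rightarrow> (real ^ 4 \<Rightarrow> complex) \<Rightarrow> nat \<Rightarrow> real ^ 4 \<Rightarrow> complex" where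
  "star_pow \<Theta> f 0 = (\<lambda>_. 1)"
| "star_pow \<Theta> f (Suc n) = star \<Theta> f (star_pow \<Theta> f n)"

definition Lmul :: "real ^ 4 ^ 4 \<Rightarrow> (real ^ 4 \<Rightarrow> complex) \<Rightarrow> (real ^ 4 \<Rightarrow> complex) \<Rightarrow> real ^ 4 \<Rightarrow> complex" where
  "Lmul \<Theta> f h = star \<Theta> f h"

definition Rmul :: "real ^ 4 ^ 4 \<Rightarrow> (real ^ 4 \<Rightarrow> complex) \<Rightarrow> (real ^ 4 \<Rightarrow> complex) \<Rightarrow> real ^ 4 \<Rightarrow> complex" where
  "Rmul \<Theta> f h = star \<Theta> h f"

definition diophantine :: "real ^ 4 ^ 4 \<Rightarrow> bool" where
  "diophantine \<Theta> \<longleftrightarrow>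
     (\<exists>C>0. \<exists>\<beta>>0. \<forall>q::int ^ 4. q \<noteq> 0 \<longrightarrow>
        (INF k::int ^ 4. norm (\<Theta> *v lat q - (2 * pi) *\<^sub>R lat k)) \<ge> C * norm (lat q) powr (- (1 + \<beta>)))"


section \<open>The operator of the quadratic part of the action\<close>

text \<open>An unbounded operator on \<open>L\<^sup>2\<close> of the torus, given on its core of smooth functions.\<close>

definition P_op ::
  "real ^ 4 ^ 4 \<Rightarrow> real ^ 4 ^ 4 \<Rightarrow> real \<Rightarrow> real \<Rightarrow> (real ^ 4 \<Rightarrow> complex) \<Rightarrow>
     (real ^ 4 \<Rightarrow> complex) \<Rightarrow> real ^ 4 \<Rightarrow> complex" where
  "P_op gu \<Theta> lam m \<phi> f x =
     - (\<Sum>\<mu>\<in>UNIV. \<Sum>\<nu>\<in>UNIV. complex_of_real (gu $ \<mu> $ \<nu>) * partial \<mu> (partial \<nu> f) x)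
     + complex_of_real (lam / 6) *
         (Rmul \<Theta> (star \<Theta> \<phi> \<phi>) f x + Lmul \<Theta> (star \<Theta> \<phi> \<phi>) f x + Lmul \<Theta> \<phi> (Rmul \<Theta> \<phi> f) x)
     + complex_of_real (m\<^sup>2) * f x"


section \<open>Operators on square-integrable functions, semigroups and traces\<close>

text \<open>Elements of \<open>L\<^sup>2\<close> are represented by functions, identified when equal almost everywhere
  on the fundamental domain.\<close>

definition L2 :: "(real ^ 4 \<Rightarrow> complex) set" where
  "L2 = {f \<in> borel_measurable torus. integrable torus (\<lambda>x. (norm (f x))\<^sup>2)}"

definition L2_inner :: "(real ^ 4 \<Rightarrow> complex) \<Rightarrow> (real ^ 4 \<Rightarrow> complex) \<Rightarrow> complex" where
  "L2_inner f h = (LINT x|torus. cnj (f x) * h x)"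

definition L2_nrm :: "(real ^ 4 \<Rightarrow> complex) \<Rightarrow> real" where
  "L2_nrm f = sqrt (LINT x|torus. (norm (f x))\<^sup>2)"

definition bounded_op :: "((real ^ 4 \<Rightarrow> complex) \<Rightarrow> real ^ 4 \<Rightarrow> complex) \<Rightarrow> bool" where
  "bounded_op T \<longleftrightarrow>
     (\<forall>f\<in>L2. T f \<in> L2) \<and>
     (\<forall>f\<in>L2. \<forall>h\<in>L2. \<forall>a b. AE x in torus. T (\<lambda>y. a * f y + b * h y) x = a * T f x + b * T h x) \<and>
     (\<exists>C. \<forall>f\<in>L2. L2_nrm (T f) \<le> C * L2_nrm f)"

text \<open>The exponential growth bound is implied by the other conditions (uniform boundedness
  principle).\<close>

definition C0_semigroup :: "(real \<Rightarrow> (real ^ 4 \<Rightarrow> complex) \<Rightarrow> real ^ 4 \<Rightarrow> complex) \<Rightarrow> bool" where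
  "C0_semigroup T \<longleftrightarrow>
     (\<forall>t\<ge>0. bounded_op (T t)) \<and>
     (\<exists>M \<omega>. \<forall>t\<ge>0. \<forall>f\<in>L2. L2_nrm (T t f) \<le> M * exp (\<omega> * t) * L2_nrm f) \<and>
     (\<forall>f\<in>L2. AE x in torus. T 0 f x = f x) \<and>
     (\<forall>s\<ge>0. \<forall>t\<ge>0. \<forall>f\<in>L2. AE x in torus. T (s + t) f x = T s (T t f) x) \<and>
     (\<forall>f\<in>L2. ((\<lambda>t. L2_nrm (\<lambda>x. T t f x - f x)) \<longlongrightarrow> 0) (at_right 0))"

text \<open>\<open>heat_semigroup P T\<close> means that \<open>T t\<close> is the operator \<open>exp (- t P)\<close>: a strongly continuous
  semigroup whose generator agrees with \<open>- P\<close> on the smooth functions. Since these are a core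
  of \<open>P\<close>, this determines the semigroup.\<close>

definition heat_semigroup ::
  "((real ^ 4 \<Rightarrow> complex) \<Rightarrow> real ^ 4 \<Rightarrow> complex) \<Rightarrow>
   (real \<Rightarrow> (real ^ 4 \<Rightarrow> complex) \<Rightarrow> real ^ 4 \<Rightarrow> complex) \<Rightarrow> bool" where
  "heat_semigroup P T \<longleftrightarrow>
     C0_semigroup T \<and>
     (\<forall>f. torus_smooth f \<longrightarrow>
        ((\<lambda>t. L2_nrm (\<lambda>x. (T t f x - f x) / complex_of_real t - (- P f x))) \<longlongrightarrow> 0) (at_right 0))"

definition orthonormal_basis :: "(nat \<Rightarrow> real ^ 4 \<Rightarrow> complex) \<Rightarrow> bool" where
  "orthonormal_basis b \<longleftrightarrow>
     (\<forall>n. b n \<in> L2) \<and>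
     (\<forall>j n. L2_inner (b j) (b n) = (if j = n then 1 else 0)) \<and>
     (\<forall>f\<in>L2. (\<lambda>N. L2_nrm (\<lambda>x. f x - (\<Sum>n<N. L2_inner (b n) f * b n x))) \<longlonglongrightarrow> 0)"

text \<open>A bounded operator is trace class iff its diagonal sums converge absolutely in every
  orthonormal basis; the sum is then independent of the basis and is the trace.\<close>

definition has_trace :: "((real ^ 4 \<Rightarrow> complex) \<Rightarrow> real ^ 4 \<Rightarrow> complex) \<Rightarrow> complex \<Rightarrow> bool" where
  "has_trace T \<tau> \<longleftrightarrow>
     (\<forall>b. orthonormal_basis b \<longrightarrow> ((\<lambda>n. L2_inner (b n) (T (b n))) has_sum \<tau>) UNIV)"


section \<open>Heat kernel coefficients\<close>

text \<open>In dimension four the expansion of the heat trace is in powers \<open>t powr ((j - 4) / 2)\<close>,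
  so that \<open>a 4\<close> is the coefficient of the constant term.\<close>

definition heat_trace_expansion ::
  "((real ^ 4 \<Rightarrow> complex) \<Rightarrow> real ^ 4 \<Rightarrow> complex) \<Rightarrow> nat \<Rightarrow> (nat \<Rightarrow> complex) \<Rightarrow> bool" where
  "heat_trace_expansion P N a \<longleftrightarrow>
     (\<exists>T K. heat_semigroup P T \<and> (\<forall>t>0. has_trace (T t) (K t)) \<and>
        (\<lambda>t. K t - (\<Sum>j\<le>N. a j * complex_of_real (t powr ((real j - 4) / 2))))
          \<in> o[at_right 0](\<lambda>t. complex_of_real (t powr ((real N - 4) / 2))))"

definition is_heat_coeff ::
  "((real ^ 4 \<Rightarrow> complex) \<Rightarrow> real ^ 4 \<Rightarrow> complex) \<Rightarrow> nat \<Rightarrow> complex \<Rightarrow> bool" where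
  "is_heat_coeff P k c \<longleftrightarrow> (\<exists>a. heat_trace_expansion P k a \<and> a k = c)"

definition heat_coeff ::
  "((real ^ 4 \<Rightarrow> complex) \<Rightarrow> real ^ 4 \<Rightarrow> complex) \<Rightarrow> nat \<Rightarrow> complex" where
  "heat_coeff P k = (THE c. is_heat_coeff P k c)"

definition W_div :: "((real ^ 4 \<Rightarrow> complex) \<Rightarrow> real ^ 4 \<Rightarrow> complex) \<Rightarrow> complex \<Rightarrow> complex" where
  "W_div P s = - (1 / (2 * s)) * heat_coeff P 4"

end

theory Submission
  imports Defs "HOL-Probability.Probability"
begin

text \<open>In the basis of plane waves \<open>P\<close> is a matrix D + V. The part D is diagonal
  with entries q(k) + m^2, where q is the quadratic form of the metric. The part V comes from the
  star multiplications: each product of a left multiplication by e_p and a right multiplication by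
  e_q shifts the frequency by p + q and multiplies by a phase. The weights alpha(p,q) are absolutely
  summable, so the row and column sums of V are bounded by one constant B (Schur's test). Hence
  exp(-tP) is given by the Dyson series \<open>U\<close>, whose n-th term \<open>S n\<close> has
  entrywise sum at most (Bt)^n/n! times Tr exp(-tD) (\<open>S_trace\<close>). As Tr exp(-tD) is
  O(t^-2), the orders n >= 3 contribute O(t) to the trace, and only the orders 0, 1 and 2 must be
  computed.

  The diagonal of V involves only q = -p, and L(e_p)R(e_-p) is translation by \<Theta>p. So the
  first-order trace is a sum over p of alpha(p,-p) times the free heat kernel \<open>theta0\<close>
  at \<Theta>p. Poisson summation (\<open>poisson_summation\<close>, \<open>theta0_bounds\<close>)
  shows that t^2 \<open>theta0\<close> tends to \<open>c0\<close> at the origin and is exponentially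
  small in the squared distance from \<Theta>p to 2 pi Z^4, divided by t. The Diophantine condition
  bounds that distance below by a power of |p|, and the rapid decay of alpha(p,-p) pays for this
  power, so that only p = 0 contributes (\<open>first_order_limit\<close>). In second order the
  kernel is evaluated at \<Theta>(p + p'), only p' = -p survives, and what remains is half of
  \<open>c0\<close> times the sum of alpha(p,q) alpha(-p,-q) (\<open>second_order_limit\<close>).
  Altogether a4 = c0 (m^4/2 + m^2 alpha(0,0) + M2/2), with c0 = v/(16 pi^2).

  For the given \<open>P\<close>, alpha(p,q) is lam/6 times a sum of three terms, supported on q =
  0, on p = 0, and of product form a_p a_q. Expanding the square
  (\<open>alpha_quadratic_sum\<close>) gives twice the integral of the fourth star power from the
  two one-sided terms. Every interaction between left and right factors gives a product of
  integrals; this is the origin of the non-local terms.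

  Two further points give the coefficient its meaning. Existence: \<open>semi\<close>, built from
  \<open>U\<close>, is a strongly continuous semigroup with the right generator, and it has a trace
  in every orthonormal basis (\<open>semi_C0\<close>, \<open>semi_generator\<close>,
  \<open>semi_has_trace\<close>). Uniqueness: the matrix entries of any heat semigroup of
  \<open>P\<close> satisfy a Duhamel equation whose only bounded solution is \<open>U\<close>
  (\<open>T_coeff_eq_U\<close>), and the coefficients of an expansion in powers of sqrt t are
  determined by its sum (\<open>expansion_coeff_unique\<close>).

  Non-locality is seen on two families of test functions. On constants the quartic part of the
  coefficient is proportional to 9 times the integral of the fourth star power, on a single real
  mode to 4 times it, with the same proportionality factor; a local expression would need equal
  ratios.\<close>

abbreviation nn_sum (binder "\<Oplus>" 10) where
  "nn_sum f \<equiv> nn_integral (count_space UNIV) f"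

abbreviation enorm :: "'a::real_normed_vector \<Rightarrow> ennreal" where
  "enorm x \<equiv> ennreal (norm x)"

section \<open>Unordered sums, counting measure and dominated convergence\<close>

no_notation suminf (binder "\<Sum>" 10)

abbreviation UNIV_sum (binder "\<Sum>" 10) where
  "UNIV_sum f \<equiv> infsum f UNIV"

text \<open>All absolute estimates are made with nonnegative integrals against counting measure,
  where Tonelli applies unconditionally. This lemma and the next one translate between that setting
  and \<open>infsum\<close>.\<close>

lemma nn_integral_count_space_infsum:
  fixes f :: "'a => 'b::real_normed_vector"
  assumes "(\<lambda>x. norm (f x)) summable_on A"
  shows "(\<integral>\<^sup>+x. enorm (f x) \<partial>count_space A) = ennreal (\<Sum>\<^sub>\<infinity>x\<in>A. norm (f x))"
proof -
  have "(\<lambda>x. norm (norm (f x))) summable_on A" using assms by simp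
  then have a: "Infinite_Set_Sum.abs_summable_on (\<lambda>x. norm (f x)) A"
    using abs_summable_equivalent[of "\<lambda>x. norm (f x)" A] by blast
  then have "integrable (count_space A) (\<lambda>x. norm (f x))"
    by (simp add: abs_summable_on_def)
  then have "(\<integral>\<^sup>+x. enorm (f x) \<partial>count_space A) = ennreal (integral\<^sup>L (count_space A) (\<lambda>x. norm (f x)))"
    by (intro nn_integral_eq_integral) auto
  also have "integral\<^sup>L (count_space A) (\<lambda>x. norm (f x)) = (\<Sum>\<^sub>\<infinity>x\<in>A. norm (f x))"
    using infsetsum_infsum[OF a] by (simp add: infsetsum_def)
  finally show ?thesis .
qed

lemma nn_integral_count_space_boundD:
  fixes f :: "'a => 'b::real_normed_vector"
  assumes "(\<integral>\<^sup>+x. enorm (f x) \<partial>count_space A) \<le> ennreal c" "0 \<le> c"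
  shows summable_on_norm_nnI: "(\<lambda>x. norm (f x)) summable_on A"
    and infsum_norm_nn_le: "(\<Sum>\<^sub>\<infinity>x\<in>A. norm (f x)) \<le> c"
proof -
  have *: "(\<Sum>x\<in>F. norm (f x)) \<le> c" if "finite F" "F \<subseteq> A" for F
  proof -
    have "ennreal (\<Sum>x\<in>F. norm (f x)) = (\<integral>\<^sup>+x. enorm (f x) \<partial>count_space F)"
      using that by (simp add: nn_integral_count_space_finite)
    also have "... = (\<integral>\<^sup>+x. enorm (f x) * indicator F x \<partial>count_space A)"
      using that by (subst nn_integral_restrict_space[symmetric]) (auto simp: restrict_count_space Int_absorb2 Int_absorb1)
    also have "... \<le> (\<integral>\<^sup>+x. enorm (f x) \<partial>count_space A)"
      by (intro nn_integral_mono) (auto simp: indicator_def)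
    also have "... \<le> ennreal c" by (fact assms(1))
    finally show ?thesis using assms(2) by simp
  qed
  show s: "(\<lambda>x. norm (f x)) summable_on A"
    by (rule nonneg_bdd_above_summable_on) (use * in \<open>auto intro!: bdd_aboveI2[where M=c]\<close>)
  show "(\<Sum>\<^sub>\<infinity>x\<in>A. norm (f x)) \<le> c"
    by (rule infsum_le_finite_sums[OF s]) (use * in auto)
qed

lemma nn_integral_count_space_swap:
  "(\<Oplus>x. (\<Oplus>y. f x y))
     = (\<Oplus>y. (\<Oplus>x. f x y))"
  using nn_integral_fst_count_space[of "\<lambda>(x,y). f x y"] nn_integral_snd_count_space[of "\<lambda>(x,y). f x y"]
  by simp

lemma nn_integral_count_space_lborel_swap:
  fixes f :: "'a::countable => 'b::euclidean_space => ennreal"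
  assumes "\<And>x. f x \<in> borel_measurable lborel"
  shows "(\<Oplus>x. (\<integral>\<^sup>+s. f x s \<partial>lborel)) = (\<integral>\<^sup>+s. (\<Oplus>x. f x s) \<partial>lborel)"
proof -
  interpret pair_sigma_finite "count_space (UNIV::'a set)" "lborel :: 'b measure"
    by (simp add: pair_sigma_finite_def sigma_finite_measure_count_space_countable lborel.sigma_finite_measure_axioms)
  have "case_prod f \<in> borel_measurable (count_space UNIV \<Otimes>\<^sub>M lborel)"
    by (rule measurable_pair_measure_countable1) (use assms in auto)
  from Fubini'[OF this] show ?thesis by simp
qed

text \<open>Dominated convergence for unordered sums along an arbitrary filter, in particular
  \<open>at_right 0\<close>. Outside a finite set the majorant has sum at most e/6, which controls
  both tails; on the finite set convergence is termwise.\<close>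

lemma infsum_dominated_tendsto:
  fixes f :: "'t => 'a => 'b::banach"
  assumes lim: "\<And>x. ((\<lambda>t. f t x) \<longlongrightarrow> g x) F"
    and bound: "eventually (\<lambda>t. \<forall>x. norm (f t x) \<le> M x) F"
    and M: "M summable_on UNIV"
  shows "((\<lambda>t. \<Sum>x. f t x) \<longlongrightarrow> (\<Sum>x. g x)) F"
proof (cases "F = bot")
  case False
  have gM: "norm (g x) \<le> M x" for x
  proof (rule tendsto_upperbound[OF tendsto_norm[OF lim]])
    show "\<forall>\<^sub>F t in F. norm (f t x) \<le> M x" using bound by eventually_elim auto
  qed (use False in auto)
  have M0: "0 \<le> M x" for x using gM[of x] norm_ge_zero order_trans by blast
  have sum1: "h summable_on A" if "\<And>x. norm (h x) \<le> M x" for h :: "'a => 'b" and A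
  proof -
    have "(\<lambda>x. norm (h x)) summable_on A"
      by (rule summable_on_comparison_test[OF summable_on_subset_banach[OF M, of A]])
        (use that in auto)
    then show ?thesis by (rule abs_summable_summable)
  qed
  show ?thesis
  proof (rule tendstoI)
    fix e :: real assume e: "e > 0"
    obtain X where X: "finite X" "dist (sum M X) (infsum M UNIV) \<le> e/6"
      using infsum_finite_approximation[OF M, of "e/6"] e by auto
    have "infsum M UNIV = infsum M X + infsum M (-X)"
      using infsum_Un_disjoint[of M X "-X"] M X by (auto intro: summable_on_subset_banach)
    then have tail: "infsum M (-X) \<le> e/6"
      using X by (simp add: dist_real_def)
    have tail2: "norm (infsum h (-X)) \<le> e/6" if "\<And>x. norm (h x) \<le> M x" for h :: "'a => 'b"
    proof -
      have "norm (infsum h (-X)) \<le> infsum M (-X)"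
        by (rule norm_infsum_le[where X="-X" and f=h and g=M])
          (use that sum1[of h] M in \<open>auto intro: summable_on_subset_banach has_sum_infsum\<close>)
      then show ?thesis using tail by linarith
    qed
    have "((\<lambda>t. \<Sum>x\<in>X. f t x) \<longlongrightarrow> (\<Sum>x\<in>X. g x)) F"
      by (intro tendsto_sum lim)
    then have "eventually (\<lambda>t. dist (\<Sum>x\<in>X. f t x) (\<Sum>x\<in>X. g x) < e/2) F"
      using e by (auto dest!: tendstoD[where e="e/2"])
    then show "eventually (\<lambda>t. dist (\<Sum>x. f t x) (\<Sum>x. g x) < e) F"
      using bound
    proof eventually_elim
      case (elim t)
      have split: "infsum h UNIV = sum h X + infsum h (-X)" if "\<And>x. norm (h x) \<le> M x" for h :: "'a => 'b"
        using infsum_Un_disjoint[of h X "-X"] X sum1[of h] that by auto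
      have "norm (infsum (f t) UNIV - infsum g UNIV)
          = norm ((sum (f t) X - sum g X) + (infsum (f t) (-X) - infsum g (-X)))"
        using elim gM by (simp add: split algebra_simps)
      also have "... \<le> norm (sum (f t) X - sum g X) + (norm (infsum (f t) (-X)) + norm (infsum g (-X)))"
        by (intro norm_triangle_mono order_refl norm_triangle_ineq4)
      also have "... < e"
        using elim tail2[of "f t"] tail2[of g] gM e by (auto simp: dist_norm)
      finally show ?case by (simp add: dist_norm)
    qed
  qed
qed auto

text \<open>The majorant makes the finite partial sums converge uniformly on the interval
  (Weierstrass), so that continuity passes to the limit and integration may be done term by
  term.\<close>

lemma
  fixes f :: "'a => real => 'b::banach"
  assumes cont: "\<And>x. continuous_on {a..b} (f x)"
    and bound: "\<And>x s. s \<in> {a..b} ==> norm (f x s) \<le> M x"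
    and M: "M summable_on UNIV"
  shows continuous_on_infsum: "continuous_on {a..b} (\<lambda>s. \<Sum>x. f x s)"
    and has_sum_integral_infsum: "((\<lambda>x. integral {a..b} (f x)) has_sum integral {a..b} (\<lambda>s. \<Sum>x. f x s)) UNIV"
proof -
  have u: "uniform_limit {a..b} (\<lambda>X s. \<Sum>x\<in>X. f x s) (\<lambda>s. \<Sum>x. f x s) (finite_subsets_at_top UNIV)"
    by (rule Weierstrass_m_test_general[OF _ M]) (use bound in auto)
  show "continuous_on {a..b} (\<lambda>s. \<Sum>x. f x s)"
    by (rule uniform_limit_theorem[OF _ u]) (auto intro!: always_eventually continuous_on_sum cont)
  obtain I J where IJ: "\<And>X. ((\<lambda>s. \<Sum>x\<in>X. f x s) has_integral I X) {a..b}"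
      "((\<lambda>s. \<Sum>x. f x s) has_integral J) {a..b}" "(I \<longlongrightarrow> J) (finite_subsets_at_top UNIV)"
    by (rule uniform_limit_integral[OF u]) (auto intro!: continuous_on_sum cont)
  have "I X = (\<Sum>x\<in>X. integral {a..b} (f x))" if "finite X" for X
  proof -
    have "((\<lambda>s. \<Sum>x\<in>X. f x s) has_integral (\<Sum>x\<in>X. integral {a..b} (f x))) {a..b}"
      by (intro has_integral_sum that integrable_integral integrable_continuous_interval cont)
    then show ?thesis using IJ(1) has_integral_unique by blast
  qed
  then have "((\<lambda>X. \<Sum>x\<in>X. integral {a..b} (f x)) \<longlongrightarrow> J) (finite_subsets_at_top UNIV)"
    using IJ(3) by (rule_tac Lim_transform_eventually) (auto intro: eventually_finite_subsets_at_top_weakI)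
  then show "((\<lambda>x. integral {a..b} (f x)) has_sum integral {a..b} (\<lambda>s. \<Sum>x. f x s)) UNIV"
    using IJ(2) by (simp add: has_sum_def integral_unique)
qed

text \<open>Convexity of exp: the exponent is the average of -(u+v)x and -(u+v)y with weights
  u/(u+v) and v/(u+v). The weight is obtained before x and y are chosen. In a double sum it
  therefore moves the whole time u + v to one of the two indices, uniformly in both, and each half
  is then handled by a row or a column bound.\<close>

lemma exp_minus_young:
  fixes u v :: real
  assumes "0 \<le> u" "0 \<le> v"
  obtains a where "0 \<le> a" "a \<le> 1"
    "\<And>x y. exp (- u * x) * exp (- v * y) \<le> a * exp (- (u + v) * x) + (1 - a) * exp (- (u + v) * y)"
proof (cases "u + v = 0")
  case True
  then have "u = 0" "v = 0" using assms by auto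
  then show ?thesis by (intro that[of 1]) auto
next
  case False
  define a where "a = u / (u + v)"
  have a: "0 \<le> a" "a \<le> 1" "u = a * (u + v)" "v = (1 - a) * (u + v)"
    using assms False by (auto simp: a_def field_simps)
  show ?thesis
  proof (rule that[of a])
    fix x y
    have "exp (- u * x) * exp (- v * y) = exp (a * (- (u+v) * x) + (1-a) * (- (u+v) * y))"
      unfolding exp_add[symmetric]
      by (rule arg_cong[where f=exp], subst (1) a(3), subst (2) a(4)) (simp add: algebra_simps)
    also have "... \<le> a * exp (- (u + v) * x) + (1 - a) * exp (- (u + v) * y)"
      using convex_onD[OF exp_convex, of "1-a" "- (u+v) * x" "- (u+v) * y"] a by simp
    finally show "exp (- u * x) * exp (- v * y) \<le> a * exp (- (u + v) * x) + (1 - a) * exp (- (u + v) * y)" .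
  qed (use a in auto)
qed

lemma has_integral_power_fact:
  fixes B t :: real
  assumes "0 \<le> t"
  shows "((\<lambda>s. B * ((B * s) ^ n / fact n)) has_integral (B * t) ^ Suc n / fact (Suc n)) {0..t}"
proof -
  have "((\<lambda>s. (B * s) ^ Suc n / fact (Suc n)) has_vector_derivative B * ((B * s) ^ n / fact n)) (at s within {0..t})" for s
  proof -
    have "((\<lambda>s. B * s) has_real_derivative B) (at s within {0..t})"
      by (auto intro!: derivative_eq_intros)
    from DERIV_cdivide[OF DERIV_power_Suc[OF this, of n], of "fact (Suc n)"]
    have "((\<lambda>s. (B * s) ^ Suc n / fact (Suc n)) has_real_derivative
       ((1 + real n) * (B * (B * s) ^ n)) / fact (Suc n)) (at s within {0..t})"
      by simp
    also have "((1 + real n) * (B * (B * s) ^ n)) / fact (Suc n) = B * ((B * s) ^ n / fact n)"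
      by (simp only: fact_Suc of_nat_mult) (simp add: divide_simps)
    finally show ?thesis by (simp add: has_real_derivative_iff_has_vector_derivative)
  qed
  from fundamental_theorem_of_calculus[OF assms this] show ?thesis by simp
qed

lemma borel_measurable_nn_integral_count_space:
  fixes f :: "'a::countable => 'b::euclidean_space => ennreal"
  assumes "\<And>x. f x \<in> borel_measurable lborel"
  shows "(\<lambda>s. \<integral>\<^sup>+x. f x s \<partial>count_space UNIV) \<in> borel_measurable lborel"
proof -
  have "(\<lambda>(x,s). f x s) \<in> borel_measurable (count_space UNIV \<Otimes>\<^sub>M lborel)"
    by (rule measurable_pair_measure_countable1) (use assms in auto)
  then have "(\<lambda>(s,x). f x s) \<in> borel_measurable (lborel \<Otimes>\<^sub>M count_space UNIV)"
    by (subst measurable_pair_swap_iff) (simp add: case_prod_beta)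
  moreover have "sigma_finite_measure (count_space (UNIV :: 'a set))"
    by (simp add: sigma_finite_measure_count_space_countable)
  ultimately show ?thesis
    using sigma_finite_measure.borel_measurable_nn_integral[of "count_space UNIV" "\<lambda>s x. f x s" lborel] by simp
qed

lemma nn_integral_count_space_indicator_singleton:
  fixes f :: "'a => ennreal"
  shows "(\<Oplus>x. f x * indicator {a} x) = f a"
    "(\<Oplus>x. f x * indicator {x} a) = f a"
proof -
  have "(\<Oplus>x. f x * indicator {a} x) = f a" for f :: "'a => ennreal"
    by (subst nn_integral_indicator_singleton) auto
  moreover have "indicator {x} a = (indicator {a} x :: ennreal)" for x by (auto simp: indicator_def)
  ultimately show "(\<Oplus>x. f x * indicator {a} x) = f a"
    "(\<Oplus>x. f x * indicator {x} a) = f a" by auto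
qed

lemma nn_integral_exp_series:
  assumes "0 \<le> (x::real)"
  shows "(\<Oplus>n. ennreal (x ^ n / fact n)) = ennreal (exp x)"
proof -
  have "(\<lambda>n. x ^ n / fact n) sums exp x"
    using exp_converges[of x] by (simp add: divide_inverse mult.commute)
  then show ?thesis
    using assms unfolding nn_integral_count_space_nat by (intro suminf_ennreal_eq) auto
qed

text \<open>If the right side is infinite nothing is claimed, and if it is finite the series
  converges absolutely. So the triangle inequality can be used before any convergence has been
  established.\<close>

lemma ennreal_norm_infsum_le:
  fixes f :: "'a => 'b::banach"
  shows "enorm (\<Sum>x. f x) \<le> (\<Oplus>x. enorm (f x))"
proof (cases "(\<Oplus>x. enorm (f x))")
  case (real c)
  then have s: "(\<lambda>x. norm (f x)) summable_on UNIV"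
    by (intro summable_on_norm_nnI[where c=c]) auto
  then show ?thesis
    using norm_infsum_bound[OF s] nn_integral_count_space_infsum[OF s] by (simp add: ennreal_leI)
next
  case top
  then show ?thesis by simp
qed

section \<open>The Dyson series of a diagonal matrix with a Schur-bounded perturbation\<close>

locale dyson =
  fixes D :: "'k::countable => real" and V :: "'k => 'k => complex" and B :: real
  assumes D_nonneg: "0 \<le> D k"
    and B_nonneg: "0 \<le> B"
    and V_col: "(\<Oplus>l. enorm (V l k)) \<le> ennreal B"
    and V_row: "(\<Oplus>k. enorm (V l k)) \<le> ennreal B"
begin

lemma V_col_summable: "(\<lambda>l. norm (V l k)) summable_on UNIV"
  and V_col_sum: "(\<Sum>l. norm (V l k)) \<le> B"
  using summable_on_norm_nnI[OF V_col B_nonneg] infsum_norm_nn_le[OF V_col B_nonneg] by auto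

text \<open>The n-th Dyson term of exp(-t(D+V)), with V placed to the right of the earlier factors.
  For a fixed row index \<open>j\<close> the recursion then involves only that row, and it matches
  the form d/dt T f = - T (P f) of the evolution equation, which needs the generator on smooth
  functions only. Convergence rests on the two Schur bounds of the locale: one \<open>B\<close> for
  all row sums and all column sums of V.\<close>

primrec S :: "nat => 'k => 'k => real => complex" where
  "S 0 = (\<lambda>j k t. if j = k then of_real (exp (- t * D k)) else 0)"
| "S (Suc n) = (\<lambda>j k t. - integral {0..t}
      (\<lambda>s. of_real (exp (- (t - s) * D k)) * (\<Sum>l. S n j l s * V l k)))"

lemma exp_D_le: "0 \<le> t ==> exp (- t * D k) \<le> 1"
  using D_nonneg[of k] by (simp add: mult_nonneg_nonneg)

lemma infsum_V:
  fixes u :: "'k => real => complex"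
  assumes "\<And>l s. s \<in> {0..t} ==> norm (u l s) \<le> C" "\<And>l. continuous_on {0..t} (u l)"
  shows continuous_on_infsum_V: "continuous_on {0..t} (\<lambda>s. \<Sum>l. u l s * V l k)"
    and norm_infsum_V_le: "s \<in> {0..t} ==> norm (\<Sum>l. u l s * V l k) \<le> C * B"
proof -
  have M: "(\<lambda>l. C * norm (V l k)) summable_on UNIV"
    by (intro summable_on_cmult_right V_col_summable)
  show "continuous_on {0..t} (\<lambda>s. \<Sum>l. u l s * V l k)"
    by (rule continuous_on_infsum[OF _ _ M])
      (auto intro!: continuous_intros assms mult_right_mono simp: norm_mult)
  assume s: "s \<in> {0..t}"
  have C: "0 \<le> C" using assms(1)[OF s, of k] norm_ge_zero order_trans by blast
  have bd: "norm (u l s * V l k) \<le> C * norm (V l k)" for l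
    using assms(1)[OF s] by (simp add: norm_mult mult_right_mono)
  have su: "(\<lambda>l. norm (u l s * V l k)) summable_on UNIV"
    by (rule summable_on_comparison_test[OF M]) (use bd in auto)
  have "norm (\<Sum>l. u l s * V l k) \<le> (\<Sum>l. norm (u l s * V l k))"
    by (rule norm_infsum_bound[OF su])
  also have "... \<le> (\<Sum>l. C * norm (V l k))"
    by (intro infsum_mono su M bd)
  also have "... = C * (\<Sum>l. norm (V l k))"
    by (simp add: infsum_cmult_right')
  also have "... \<le> C * B" by (intro mult_left_mono V_col_sum C)
  finally show "norm (\<Sum>l. u l s * V l k) \<le> C * B" .
qed

text \<open>The kernel factors into a function of t times a function of s, so that the integral is
  an elementary factor times an indefinite integral.\<close>

lemma continuous_on_duhamel_integral:
  fixes g :: "real => complex"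
  assumes "continuous_on {0..T} g"
  shows "continuous_on {0..T} (\<lambda>t. integral {0..t} (\<lambda>s. of_real (exp (- (t - s) * d)) * g s))"
proof -
  have eq: "integral {0..t} (\<lambda>s. of_real (exp (- (t - s) * d)) * g s)
      = of_real (exp (- t * d)) * integral {0..t} (\<lambda>s. of_real (exp (s * d)) * g s)" for t
  proof -
    have "complex_of_real (exp (- (t - s) * d)) = of_real (exp (- t * d)) * of_real (exp (s * d))" for s
      unfolding of_real_mult[symmetric] exp_add[symmetric] by (simp add: algebra_simps)
    then show ?thesis by (simp only: mult.assoc integral_mult_right)
  qed
  have "(\<lambda>s. complex_of_real (exp (s * d)) * g s) integrable_on {0..T}"
    by (intro integrable_continuous_interval continuous_intros assms)
  from indefinite_integral_continuous_1[OF this] show ?thesis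
    unfolding eq by (intro continuous_intros) auto
qed

lemma norm_duhamel_integral_le:
  fixes g :: "real => complex"
  assumes t: "0 \<le> t" and g: "continuous_on {0..t} g" and d: "0 \<le> d"
    and b: "\<And>s. s \<in> {0..t} ==> norm (g s) \<le> b s" and I: "(b has_integral I) {0..t}"
  shows "norm (integral {0..t} (\<lambda>s. of_real (exp (- (t - s) * d)) * g s)) \<le> I"
proof -
  have "norm (integral {0..t} (\<lambda>s. of_real (exp (- (t - s) * d)) * g s)) \<le> integral {0..t} b"
  proof (rule integral_norm_bound_integral)
    show "(\<lambda>s. of_real (exp (- (t - s) * d)) * g s) integrable_on {0..t}"
      by (intro integrable_continuous_interval continuous_intros g)
    show "b integrable_on {0..t}" using I by blast
    fix s assume s: "s \<in> {0..t}"
    have "exp (- (t - s) * d) \<le> 1" using s d by (simp add: mult_nonpos_nonneg)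
    then have "norm (of_real (exp (- (t - s) * d)) * g s) \<le> 1 * norm (g s)"
      unfolding norm_mult by (intro mult_right_mono) auto
    also have "... \<le> b s" using b s by simp
    finally show "norm (of_real (exp (- (t - s) * d)) * g s) \<le> b s" .
  qed
  with I show ?thesis by (simp add: integral_unique)
qed

text \<open>Continuity and the factorial bound are proved in one induction: both are needed, at all
  columns simultaneously, for the sum over l in the next term to converge uniformly and be
  integrable.\<close>

lemma S_continuous_bound:
  "continuous_on {0..T} (S n j k) \<and> (0 \<le> t \<longrightarrow> norm (S n j k t) \<le> (B * t) ^ n / fact n)"
proof (induction n arbitrary: j k t T)
  case 0
  show ?case using exp_D_le[of t k] by (auto intro!: continuous_intros)
next
  case (Suc n)
  have bd: "norm (S n j l s) \<le> (B * T) ^ n / fact n" if "s \<in> {0..T}" for l s T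
  proof -
    have "norm (S n j l s) \<le> (B * s) ^ n / fact n" using Suc.IH that by auto
    also have "... \<le> (B * T) ^ n / fact n"
      using that B_nonneg by (intro divide_right_mono power_mono mult_left_mono) auto
    finally show ?thesis .
  qed
  have c: "continuous_on {0..T} (\<lambda>s. \<Sum>l. S n j l s * V l k)" for T
    by (rule continuous_on_infsum_V[OF bd]) (use Suc.IH in auto)
  have "norm (S (Suc n) j k t) \<le> (B * t) ^ Suc n / fact (Suc n)" if t: "0 \<le> t"
  proof -
    have "norm (\<Sum>l. S n j l s * V l k) \<le> B * ((B * s) ^ n / fact n)" if "s \<in> {0..t}" for s
      using norm_infsum_V_le[where s=s and t=s and k=k and u="S n j" and C="(B * s) ^ n / fact n", OF bd] Suc.IH that by (auto simp: mult_ac)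
    from norm_duhamel_integral_le[OF t c D_nonneg this has_integral_power_fact[OF t]]
    show ?thesis by simp
  qed
  moreover have "continuous_on {0..T} (S (Suc n) j k)"
    unfolding S.simps by (intro continuous_intros continuous_on_duhamel_integral c)
  ultimately show ?case by blast
qed

lemma S_continuous: "continuous_on {0..T} (S n j k)"
  and S_bound: "0 \<le> t ==> norm (S n j k t) \<le> (B * t) ^ n / fact n"
  using S_continuous_bound by blast+

lemma S_bound': "s \<in> {0..T} ==> norm (S n j l s) \<le> (B * T) ^ n / fact n"
  by (rule order_trans[OF S_bound]) (use B_nonneg in \<open>auto intro!: divide_right_mono power_mono mult_left_mono\<close>)

text \<open>The cut-off to the interval makes this a Borel function on the whole line, although
  \<open>S\<close> is controlled for nonnegative times only; Tonelli on \<open>lborel\<close> can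
  then be used.\<close>

definition Sabs :: "real => nat => 'k => 'k => real => ennreal" where
  "Sabs t n j l s = enorm (S n j l s) * indicator {0..t} s"

lemma Sabs_measurable [measurable]: "Sabs t n j l \<in> borel_measurable borel"
proof -
  have "(\<lambda>s. indicator {0..t} s *\<^sub>R S n j l s) \<in> borel_measurable borel"
    by (intro borel_measurable_continuous_on_indicator S_continuous) auto
  then have "(\<lambda>s. enorm (indicator {0..t} s *\<^sub>R S n j l s)) \<in> borel_measurable borel" by measurable
  moreover have "(\<lambda>s. enorm (indicator {0..t} s *\<^sub>R S n j l s)) = Sabs t n j l"
    by (auto simp: Sabs_def fun_eq_iff indicator_def)
  ultimately show ?thesis by (simp only:)
qed

lemma S_Suc_dominated:
  assumes t: "0 \<le> t"
  shows "enorm (S (Suc n) j k t) \<le>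
    (\<integral>\<^sup>+s. (\<Oplus>l. Sabs t n j l s * (enorm (V l k) * ennreal (exp (- (t - s) * D k)))) \<partial>lborel)"
proof -
  define b where "b s = exp (- (t - s) * D k) * (\<Sum>l. norm (S n j l s) * norm (V l k))" for s
  define C where "C = (B * t) ^ n / fact n"
  have M: "(\<lambda>l. C * norm (V l k)) summable_on UNIV"
    by (intro summable_on_cmult_right V_col_summable)
  have bd: "norm (S n j l s) \<le> C" if "s \<in> {0..t}" for l s
    unfolding C_def by (rule S_bound'[OF that])
  have cb: "continuous_on {0..t} b"
    unfolding b_def
    by (intro continuous_intros continuous_on_infsum[OF _ _ M])
      (auto intro!: continuous_intros S_continuous mult_right_mono bd)
  have su: "(\<lambda>l. norm (S n j l s * V l k)) summable_on UNIV" if "s \<in> {0..t}" for s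
    by (rule summable_on_comparison_test[OF M])
      (use that bd in \<open>auto simp: norm_mult intro!: mult_right_mono\<close>)
  have I: "(b has_integral integral {0..t} b) {0..t}"
    using cb by (intro integrable_integral integrable_continuous_interval)
  have "norm (S (Suc n) j k t) \<le> integral {0..t} b"
    unfolding S.simps norm_minus_cancel
  proof (rule integral_norm_bound_integral)
    show "(\<lambda>s. of_real (exp (- (t - s) * D k)) * (\<Sum>l. S n j l s * V l k)) integrable_on {0..t}"
      by (intro integrable_continuous_interval continuous_intros continuous_on_infsum_V[OF S_bound'] S_continuous)
    show "b integrable_on {0..t}" using I by blast
    show "norm (of_real (exp (- (t - s) * D k)) * (\<Sum>l. S n j l s * V l k)) \<le> b s" if "s \<in> {0..t}" for s
      using norm_infsum_bound[OF su[OF that]] unfolding b_def norm_mult by (auto intro!: mult_left_mono)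
  qed
  then have "enorm (S (Suc n) j k t) \<le> ennreal (integral {0..t} b)" by (rule ennreal_leI)
  also have "... = (\<integral>\<^sup>+s. ennreal (b s) * indicator {0..t} s \<partial>lborel)"
    by (rule nn_integral_has_integral_lebesgue'[OF _ I, symmetric])
      (auto simp: b_def intro!: mult_nonneg_nonneg infsum_nonneg)
  also have "... = (\<integral>\<^sup>+s. (\<Oplus>l. Sabs t n j l s * (enorm (V l k) * ennreal (exp (- (t - s) * D k)))) \<partial>lborel)"
  proof (rule nn_integral_cong)
    fix s :: real
    show "ennreal (b s) * indicator {0..t} s = (\<Oplus>l. Sabs t n j l s * (enorm (V l k) * ennreal (exp (- (t - s) * D k))))"
    proof (cases "s \<in> {0..t}")
      case True
      have "(\<Oplus>l. Sabs t n j l s * (enorm (V l k) * ennreal (exp (- (t - s) * D k))))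
        = (\<Oplus>l. ennreal (exp (- (t - s) * D k)) * enorm (S n j l s * V l k))"
        using True by (intro nn_integral_cong) (auto simp: Sabs_def norm_mult ennreal_mult' mult_ac)
      also have "... = ennreal (exp (- (t - s) * D k)) * ennreal (\<Sum>l. norm (S n j l s * V l k))"
        by (simp add: nn_integral_cmult nn_integral_count_space_infsum[OF su[OF True]])
      also have "... = ennreal (b s)"
        by (simp add: b_def ennreal_mult' norm_mult)
      finally show ?thesis using True by simp
    next
      case False
      then show ?thesis by (simp add: Sabs_def)
    qed
  qed
  finally show ?thesis .
qed

text \<open>The recursion in absolute values, integrated against an arbitrary nonnegative weight,
  with Tonelli used to bring the sum over the last index innermost. Keeping the weight free lets one
  computation serve column sums, row sums and traces.\<close>

lemma S_Suc_weighted: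
  assumes t: "0 \<le> t"
  shows "(\<Oplus>j. (\<Oplus>k. enorm (S (Suc n) j k t) * w j k)) \<le>
    (\<integral>\<^sup>+s. (\<Oplus>j. (\<Oplus>l. Sabs t n j l s *
        (\<Oplus>k. enorm (V l k) * ennreal (exp (- (t - s) * D k)) * w j k))) \<partial>lborel)" (is "?L \<le> ?R")
proof -
  let ?h = "\<lambda>j k l s. Sabs t n j l s * (enorm (V l k) * ennreal (exp (- (t - s) * D k)))"
  have m: "(\<lambda>s. \<integral>\<^sup>+l. ?h j k l s \<partial>count_space UNIV) \<in> borel_measurable lborel" for j k
    by (rule borel_measurable_nn_integral_count_space) measurable
  have m2: "(\<lambda>s. \<integral>\<^sup>+k. (\<Oplus>l. ?h j k l s) * w j k \<partial>count_space UNIV) \<in> borel_measurable lborel" for j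
    by (rule borel_measurable_nn_integral_count_space) (use m in measurable)
  have "?L \<le> (\<Oplus>j. (\<Oplus>k. (\<integral>\<^sup>+s. (\<Oplus>l. ?h j k l s) \<partial>lborel) * w j k))"
    by (intro nn_integral_mono mult_right_mono S_Suc_dominated t) auto
  also have "... = (\<Oplus>j. (\<Oplus>k. (\<integral>\<^sup>+s. (\<Oplus>l. ?h j k l s) * w j k \<partial>lborel)))"
    by (intro nn_integral_cong nn_integral_multc[symmetric] m)
  also have "... = (\<Oplus>j. (\<integral>\<^sup>+s. (\<Oplus>k. (\<Oplus>l. ?h j k l s) * w j k) \<partial>lborel))"
    by (intro nn_integral_cong nn_integral_count_space_lborel_swap) (use m in measurable)
  also have "... = (\<integral>\<^sup>+s. (\<Oplus>j. (\<Oplus>k. (\<Oplus>l. ?h j k l s) * w j k)) \<partial>lborel)"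
    by (intro nn_integral_count_space_lborel_swap m2)
  also have "... = ?R"
  proof (rule nn_integral_cong, rule nn_integral_cong)
    fix s j
    have "(\<Oplus>k. (\<Oplus>l. ?h j k l s) * w j k)
      = (\<Oplus>k. (\<Oplus>l. ?h j k l s * w j k))"
      by (intro nn_integral_cong nn_integral_multc[symmetric]) auto
    also have "... = (\<Oplus>l. (\<Oplus>k. ?h j k l s * w j k))"
      by (rule nn_integral_count_space_swap)
    also have "... = (\<Oplus>l. Sabs t n j l s *
        (\<Oplus>k. enorm (V l k) * ennreal (exp (- (t - s) * D k)) * w j k))"
      by (intro nn_integral_cong) (subst nn_integral_cmult[symmetric], auto intro!: nn_integral_cong simp: mult_ac)
    finally show "(\<Oplus>k. (\<Oplus>l. ?h j k l s) * w j k) = ..." .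
  qed
  finally show ?thesis .
qed

text \<open>The common induction step. A gain of one factor \<open>B\<close> in the integrand
  becomes, after integration over s, the passage from (Bs)^n/n! to (Bt)^(n+1)/(n+1)!.\<close>

lemma S_Suc_le:
  assumes t: "0 \<le> t"
    and b: "\<And>s. s \<in> {0..t} ==> (\<Oplus>j. (\<Oplus>l. enorm (S n j l s) *
        (\<Oplus>k. enorm (V l k) * ennreal (exp (- (t - s) * D k)) * w j k))) \<le> ennreal (B * ((B * s) ^ n / fact n)) * c"
  shows "(\<Oplus>j. (\<Oplus>k. enorm (S (Suc n) j k t) * w j k)) \<le> ennreal ((B * t) ^ Suc n / fact (Suc n)) * c"
proof -
  have "(\<Oplus>j. (\<Oplus>k. enorm (S (Suc n) j k t) * w j k)) \<le> (\<integral>\<^sup>+s. (\<Oplus>j. (\<Oplus>l. Sabs t n j l s *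
        (\<Oplus>k. enorm (V l k) * ennreal (exp (- (t - s) * D k)) * w j k))) \<partial>lborel)"
    by (rule S_Suc_weighted[OF t])
  also have "... \<le> (\<integral>\<^sup>+s. ennreal (B * ((B * s) ^ n / fact n)) * indicator {0..t} s * c \<partial>lborel)"
    using b by (intro nn_integral_mono) (auto simp: Sabs_def split: split_indicator)
  also have "... = ennreal ((B * t) ^ Suc n / fact (Suc n)) * c"
    by (subst nn_integral_multc, measurable,
        subst nn_integral_has_integral_lebesgue'[OF _ has_integral_power_fact[OF t]]) (use B_nonneg in auto)
  finally show ?thesis .
qed

lemma exp_le_one_ennreal: "s \<in> {0..t} ==> ennreal (exp (- (t - s) * D k)) \<le> 1"
  using exp_D_le[of "t - s" k] by (auto simp: ennreal_1[symmetric] simp del: ennreal_1 intro!: ennreal_leI)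

lemma ennreal_B_mult: "0 \<le> s ==> ennreal ((B * s) ^ n / fact n) * ennreal B = ennreal (B * ((B * s) ^ n / fact n))"
  using B_nonneg by (subst ennreal_mult[symmetric]) (auto simp: mult_ac)

lemma S_col:
  assumes "0 \<le> t"
  shows "(\<Oplus>j. enorm (S n j k t)) \<le> ennreal ((B * t) ^ n / fact n) * 1"
  using assms
proof (induction n arbitrary: k t)
  case 0
  have "(\<Oplus>j. enorm (S 0 j k t)) = (\<Oplus>j. ennreal (exp (- t * D k)) * indicator {k} j)"
    by (intro nn_integral_cong) (auto simp: indicator_def)
  also have "... = ennreal (exp (- t * D k))" by (rule nn_integral_count_space_indicator_singleton)
  finally show ?case using exp_D_le[OF 0, of k] by (simp add: ennreal_le_1)
next
  case (Suc n)
  \<comment> \<open>The weight is the indicator of the column index \<open>k\<close>, so the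
    weighted double sum is a single column sum.\<close>
  have "(\<Oplus>j. (\<Oplus>k'. enorm (S (Suc n) j k' t) * indicator {k} k')) \<le> ennreal ((B * t) ^ Suc n / fact (Suc n)) * 1"
  proof (rule S_Suc_le[OF Suc.prems])
    fix s assume s: "s \<in> {0..t}"
    have "(\<Oplus>j. (\<Oplus>l. enorm (S n j l s) * (\<Oplus>k'. enorm (V l k') * ennreal (exp (- (t - s) * D k')) * indicator {k} k')))
        \<le> (\<Oplus>j. (\<Oplus>l. enorm (S n j l s) * (enorm (V l k) * 1)))"
      unfolding nn_integral_count_space_indicator_singleton
      by (intro nn_integral_mono mult_left_mono exp_le_one_ennreal s) auto
    also have "... = (\<Oplus>l. (\<Oplus>j. enorm (S n j l s)) * enorm (V l k))"
      by (subst nn_integral_count_space_swap) (simp add: nn_integral_multc)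
    also have "... \<le> (\<Oplus>l. ennreal ((B * s) ^ n / fact n) * 1 * enorm (V l k))"
      using s by (intro nn_integral_mono mult_right_mono Suc.IH) auto
    also have "... \<le> ennreal ((B * s) ^ n / fact n) * ennreal B"
      by (simp add: nn_integral_cmult mult_left_mono V_col)
    finally show "(\<Oplus>j. (\<Oplus>l. enorm (S n j l s) * (\<Oplus>k'. enorm (V l k') * ennreal (exp (- (t - s) * D k')) * indicator {k} k')))
        \<le> ennreal (B * ((B * s) ^ n / fact n)) * 1" using s by (simp add: ennreal_B_mult)
  qed
  then show ?case by (simp only: nn_integral_count_space_indicator_singleton)
qed

lemma S_row:
  assumes "0 \<le> t"
  shows "(\<Oplus>k. enorm (S n j k t)) \<le> ennreal ((B * t) ^ n / fact n) * 1"
  using assms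
proof (induction n arbitrary: t)
  case 0
  have "(\<Oplus>k. enorm (S 0 j k t)) = (\<Oplus>k. ennreal (exp (- t * D j)) * indicator {j} k)"
    by (intro nn_integral_cong) (auto simp: indicator_def)
  also have "... = ennreal (exp (- t * D j))" by (rule nn_integral_count_space_indicator_singleton)
  finally show ?case using exp_D_le[OF 0, of j] by (simp add: ennreal_le_1)
next
  case (Suc n)
  have "(\<Oplus>i. (\<Oplus>k. enorm (S (Suc n) i k t) * indicator {j} i)) \<le> ennreal ((B * t) ^ Suc n / fact (Suc n)) * 1"
  proof (rule S_Suc_le[OF Suc.prems])
    fix s assume s: "s \<in> {0..t}"
    have "(\<Oplus>k. enorm (V l k) * ennreal (exp (- (t - s) * D k)) * indicator {j} i) \<le> ennreal B * indicator {j} i" for i l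
    proof -
      have "(\<Oplus>k. enorm (V l k) * ennreal (exp (- (t - s) * D k)) * indicator {j} i) \<le> (\<Oplus>k. enorm (V l k) * 1 * indicator {j} i)"
        by (intro nn_integral_mono mult_right_mono mult_left_mono exp_le_one_ennreal s) auto
      then show ?thesis using V_row[of l] by (auto simp: indicator_def)
    qed
    then have "(\<Oplus>i. (\<Oplus>l. enorm (S n i l s) * (\<Oplus>k. enorm (V l k) * ennreal (exp (- (t - s) * D k)) * indicator {j} i)))
        \<le> (\<Oplus>i. (\<Oplus>l. enorm (S n i l s) * (ennreal B * indicator {j} i)))"
      by (intro nn_integral_mono mult_left_mono) auto
    also have "... = (\<Oplus>i. ((\<Oplus>l. enorm (S n i l s)) * ennreal B) * indicator {j} i)"
      by (simp add: nn_integral_multc mult.assoc)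
    also have "... = (\<Oplus>l. enorm (S n j l s)) * ennreal B"
      by (rule nn_integral_count_space_indicator_singleton)
    also have "... \<le> ennreal ((B * s) ^ n / fact n) * 1 * ennreal B"
      using s by (intro mult_right_mono Suc.IH) auto
    finally show "(\<Oplus>i. (\<Oplus>l. enorm (S n i l s) * (\<Oplus>k. enorm (V l k) * ennreal (exp (- (t - s) * D k)) * indicator {j} i)))
        \<le> ennreal (B * ((B * s) ^ n / fact n)) * 1" using s by (simp add: ennreal_B_mult)
  qed
  then have "(\<Oplus>i. (\<Oplus>k. enorm (S (Suc n) i k t)) * indicator {j} i) \<le> ennreal ((B * t) ^ Suc n / fact (Suc n)) * 1"
    by (simp only: nn_integral_multc borel_measurable_count_space)
  then show ?case by (simp only: nn_integral_count_space_indicator_singleton)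
qed

end

lemma infsum_nat_shift:
  fixes f :: "nat => 'a::banach"
  assumes "f summable_on UNIV"
  shows "(\<Sum>n. f n) = f 0 + (\<Sum>n. f (Suc n))"
proof -
  have U: "(UNIV :: nat set) = insert 0 (range Suc)"
    by (metis UNIV_nat_eq)
  have "(\<Sum>n. f n) = f 0 + infsum f (range Suc)"
    by (subst U, subst infsum_insert) (auto intro: summable_on_subset_banach[OF assms])
  also have "infsum f (range Suc) = (\<Sum>n. f (Suc n))"
    by (subst infsum_reindex) (auto simp: o_def)
  finally show ?thesis .
qed

text \<open>The hypothesis under which the iterated sums below may be exchanged: finiteness of one
  iterated sum of absolute values.\<close>

lemma summable_on_product_nnI:
  fixes f :: "'a => 'b => 'c::banach"
  assumes "(\<Oplus>x. (\<Oplus>y. enorm (f x y))) < \<infinity>"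
  shows "(\<lambda>(x,y). norm (f x y)) summable_on UNIV \<times> UNIV" "(\<lambda>(x,y). f x y) summable_on UNIV \<times> UNIV"
proof -
  have e: "(\<Oplus>p. enorm (case_prod f p))
     = (\<Oplus>x. (\<Oplus>y. enorm (f x y)))"
    using nn_integral_fst_count_space[of "\<lambda>p. enorm (case_prod f p)"] by simp
  then obtain c where "0 \<le> c" "(\<Oplus>p. enorm (case_prod f p)) = ennreal c"
    using assms by (cases "\<integral>\<^sup>+p. enorm (case_prod f p) \<partial>count_space UNIV") auto
  then have *: "(\<lambda>p. norm (case_prod f p)) summable_on UNIV" by (intro summable_on_norm_nnI[where c=c]) auto
  then show "(\<lambda>(x,y). norm (f x y)) summable_on UNIV \<times> UNIV" by (simp add: case_prod_beta')
  from * have "case_prod f summable_on UNIV" by (rule abs_summable_summable)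
  then show "(\<lambda>(x,y). f x y) summable_on UNIV \<times> UNIV" by simp
qed

lemma ennreal_exp_minus_young:
  assumes "0 \<le> u" "0 \<le> v"
  obtains a where "0 \<le> a" "a \<le> 1"
    "\<And>x y. ennreal (exp (- u * x)) * ennreal (exp (- v * y))
        \<le> ennreal a * ennreal (exp (- (u + v) * x)) + ennreal (1 - a) * ennreal (exp (- (u + v) * y))"
proof -
  obtain a where a: "0 \<le> a" "a \<le> 1"
    "\<And>x y. exp (- u * x) * exp (- v * y) \<le> a * exp (- (u + v) * x) + (1 - a) * exp (- (u + v) * y)"
    by (rule exp_minus_young[OF assms]) blast
  show ?thesis
  proof (rule that[OF a(1,2)])
    fix x y
    show "ennreal (exp (- u * x)) * ennreal (exp (- v * y))
        \<le> ennreal a * ennreal (exp (- (u + v) * x)) + ennreal (1 - a) * ennreal (exp (- (u + v) * y))"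
      using ennreal_leI[OF a(3)[of x y]] a(1,2)
      by (simp add: ennreal_mult ennreal_plus)
  qed
qed

lemma ennreal_convex_comb: "0 \<le> a ==> a \<le> 1 ==> ennreal a * x + ennreal (1 - a) * x = x"
  by (simp add: distrib_right[symmetric] ennreal_plus[symmetric] del: ennreal_plus)

section \<open>Trace bounds for the Dyson terms\<close>

context dyson
begin

text \<open>The heat trace of the unperturbed diagonal operator, with value infinity
  allowed.\<close>

definition theta :: "real => ennreal" where
  "theta u = (\<Oplus>k. ennreal (exp (- u * D k)))"

text \<open>The exponentials in a Dyson term sit at different indices, and the total time must be
  collected at one index before summing. For the induction the statement is enlarged by a kernel
  \<open>X\<close> with row and column sums at most \<open>c\<close>, followed by an extra time
  \<open>\<sigma>\<close>. In each step Young's inequality moves the neighbouring times to a common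
  index, and the product of V with \<open>X\<close> is again a kernel with Schur constant B c. When
  no factor V is left, all of the time t + \<open>\<sigma>\<close> is at one index, which gives
  \<open>theta\<close>.\<close>

lemma S_trace_kernel:
  assumes "0 \<le> t" "0 \<le> \<sigma>" "\<And>l. (\<Oplus>k. X l k) \<le> c" "\<And>k. (\<Oplus>l. X l k) \<le> c"
  shows "(\<Oplus>j. (\<Oplus>l. enorm (S n j l t) * (\<Oplus>k. X l k * ennreal (exp (- \<sigma> * D k))))) \<le> ennreal ((B * t) ^ n / fact n) * c * theta (t + \<sigma>)"
  using assms
proof (induction n arbitrary: t \<sigma> X c)
  case 0
  obtain a where a: "0 \<le> a" "a \<le> 1"
    "\<And>x y. ennreal (exp (- t * x)) * ennreal (exp (- \<sigma> * y))
        \<le> ennreal a * ennreal (exp (- (t + \<sigma>) * x)) + ennreal (1 - a) * ennreal (exp (- (t + \<sigma>) * y))"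
    using ennreal_exp_minus_young[OF 0(1,2)] by blast
  have S0: "enorm (S 0 j l t) = ennreal (exp (- t * D l)) * indicator {j} l" for j l
    by (auto simp: indicator_def)
  have "(\<Oplus>j. (\<Oplus>l. enorm (S 0 j l t) * (\<Oplus>k. X l k * ennreal (exp (- \<sigma> * D k)))))
    = (\<Oplus>j. (\<Oplus>l. (ennreal (exp (- t * D l)) * (\<Oplus>k. X l k * ennreal (exp (- \<sigma> * D k)))) * indicator {j} l))"
    unfolding S0 by (simp only: mult_ac)
  also have "... = (\<Oplus>l. ennreal (exp (- t * D l)) * (\<Oplus>k. X l k * ennreal (exp (- \<sigma> * D k))))"
    by (simp only: nn_integral_count_space_indicator_singleton)
  also have "... = (\<Oplus>l. (\<Oplus>k. X l k * (ennreal (exp (- t * D l)) * ennreal (exp (- \<sigma> * D k)))))"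
    by (intro nn_integral_cong) (subst nn_integral_cmult[symmetric], auto intro!: nn_integral_cong simp: mult_ac)
  also have "... \<le> (\<Oplus>l. (\<Oplus>k. X l k * (ennreal a * ennreal (exp (- (t + \<sigma>) * D l)) + ennreal (1 - a) * ennreal (exp (- (t + \<sigma>) * D k)))))"
    by (intro nn_integral_mono mult_left_mono a) auto
  also have "... = (\<Oplus>l. (\<Oplus>k. X l k * (ennreal a * ennreal (exp (- (t + \<sigma>) * D l)))))
     + (\<Oplus>l. (\<Oplus>k. X l k * (ennreal (1 - a) * ennreal (exp (- (t + \<sigma>) * D k)))))"
    by (simp add: distrib_left nn_integral_add)
  also have "... = (\<Oplus>l. (\<Oplus>k. X l k * (ennreal a * ennreal (exp (- (t + \<sigma>) * D l)))))
     + (\<Oplus>k. (\<Oplus>l. X l k * (ennreal (1 - a) * ennreal (exp (- (t + \<sigma>) * D k)))))"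
    by (subst (2) nn_integral_count_space_swap) simp
  also have "... = (\<Oplus>l. (\<Oplus>k. X l k) * (ennreal a * ennreal (exp (- (t + \<sigma>) * D l))))
     + (\<Oplus>k. (\<Oplus>l. X l k) * (ennreal (1 - a) * ennreal (exp (- (t + \<sigma>) * D k))))"
    by (simp only: nn_integral_multc borel_measurable_count_space)
  also have "... \<le> (\<Oplus>l. c * (ennreal a * ennreal (exp (- (t + \<sigma>) * D l))))
     + (\<Oplus>k. c * (ennreal (1 - a) * ennreal (exp (- (t + \<sigma>) * D k))))"
    by (intro add_mono nn_integral_mono mult_right_mono 0) auto
  also have "... = c * (ennreal a * theta (t + \<sigma>)) + c * (ennreal (1 - a) * theta (t + \<sigma>))"
    by (simp only: nn_integral_cmult borel_measurable_count_space theta_def)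
  also have "... = c * theta (t + \<sigma>)"
    using ennreal_convex_comb[OF a(1,2), of "theta (t + \<sigma>)"] by (simp only: distrib_left[symmetric])
  finally show ?case by simp
next
  case (Suc n)
  let ?v = "\<lambda>l k. enorm (V l k)"
  let ?e = "\<lambda>u k. ennreal (exp (- u * D k))"
  have "(\<Oplus>j. (\<Oplus>l. enorm (S (Suc n) j l t) * (\<Oplus>k. X l k * ?e \<sigma> k)))
      \<le> ennreal ((B * t) ^ Suc n / fact (Suc n)) * (c * theta (t + \<sigma>))"
  proof (rule S_Suc_le[OF Suc.prems(1)])
    fix s assume "s \<in> {0..t}"
    then have s: "0 \<le> s" "0 \<le> t - s" by auto
    define \<tau> where "\<tau> = t - s + \<sigma>"
    have \<tau>: "0 \<le> \<tau>" "s + \<tau> = t + \<sigma>" using s Suc.prems(2) by (auto simp: \<tau>_def)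
    obtain a where a: "0 \<le> a" "a \<le> 1"
      "\<And>x y. ennreal (exp (- (t - s) * x)) * ennreal (exp (- \<sigma> * y))
        \<le> ennreal a * ennreal (exp (- \<tau> * x)) + ennreal (1 - a) * ennreal (exp (- \<tau> * y))"
      unfolding \<tau>_def using ennreal_exp_minus_young[OF s(2) Suc.prems(2)] by blast
    \<comment> \<open>The two kernels that arise after Young's inequality: \<open>X1\<close> when
      the whole time is at the intermediate index, with the last index summed out, and
      \<open>X2\<close> when it is at the last index, with the intermediate index summed
      out.\<close>
    define X1 where "X1 l' l = ?v l' l * (\<Oplus>k. X l k)" for l' l
    define X2 where "X2 l' k = (\<Oplus>l. ?v l' l * X l k)" for l' k
    let ?Bc = "ennreal B * c"
    have X1row: "(\<Oplus>l. X1 l' l) \<le> ?Bc" for l'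
    proof -
      have "(\<Oplus>l. X1 l' l) \<le> (\<Oplus>l. ?v l' l * c)"
        unfolding X1_def by (intro nn_integral_mono mult_left_mono Suc.prems) auto
      also have "... \<le> ?Bc" by (simp add: nn_integral_multc mult_right_mono V_row)
      finally show ?thesis .
    qed
    have X1col: "(\<Oplus>l'. X1 l' l) \<le> ?Bc" for l
      unfolding X1_def by (simp add: nn_integral_multc) (intro mult_mono V_col Suc.prems; simp)
    have X2row: "(\<Oplus>k. X2 l' k) \<le> ?Bc" for l'
    proof -
      have "(\<Oplus>k. X2 l' k) = (\<Oplus>l. X1 l' l)"
        unfolding X1_def X2_def by (subst nn_integral_count_space_swap) (simp add: nn_integral_cmult)
      then show ?thesis using X1row by simp
    qed
    have X2col: "(\<Oplus>l'. X2 l' k) \<le> ?Bc" for k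
    proof -
      have "(\<Oplus>l'. X2 l' k) = (\<Oplus>l. (\<Oplus>l'. ?v l' l) * X l k)"
        unfolding X2_def by (subst nn_integral_count_space_swap) (simp add: nn_integral_multc)
      also have "... \<le> (\<Oplus>l. ennreal B * X l k)"
        by (intro nn_integral_mono mult_right_mono V_col) auto
      also have "... \<le> ?Bc" by (simp add: nn_integral_cmult mult_left_mono Suc.prems)
      finally show ?thesis .
    qed
    define Y where "Y l' = (\<Oplus>l. X1 l' l * ?e \<tau> l)" for l'
    define Z where "Z l' = (\<Oplus>k. X2 l' k * ?e \<tau> k)" for l'
    have inner: "(\<Oplus>l. ?v l' l * ?e (t - s) l * (\<Oplus>k. X l k * ?e \<sigma> k))
        \<le> ennreal a * Y l' + ennreal (1 - a) * Z l'" for l'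
    proof -
      have "(\<Oplus>l. ?v l' l * ?e (t - s) l * (\<Oplus>k. X l k * ?e \<sigma> k))
         = (\<Oplus>l. (\<Oplus>k. ?v l' l * X l k * (?e (t - s) l * ?e \<sigma> k)))"
        by (intro nn_integral_cong) (subst nn_integral_cmult[symmetric], auto intro!: nn_integral_cong simp: mult_ac)
      also have "... \<le> (\<Oplus>l. (\<Oplus>k. ?v l' l * X l k * (ennreal a * ?e \<tau> l + ennreal (1 - a) * ?e \<tau> k)))"
        by (intro nn_integral_mono mult_left_mono a) auto
      also have "... = (\<Oplus>l. (\<Oplus>k. (?v l' l * X l k) * (ennreal a * ?e \<tau> l)))
          + (\<Oplus>l. (\<Oplus>k. (?v l' l * X l k) * (ennreal (1 - a) * ?e \<tau> k)))"
        by (simp add: distrib_left nn_integral_add)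
      also have "... = (\<Oplus>l. (\<Oplus>k. (?v l' l * X l k) * (ennreal a * ?e \<tau> l)))
          + (\<Oplus>k. (\<Oplus>l. (?v l' l * X l k) * (ennreal (1 - a) * ?e \<tau> k)))"
        by (subst (2) nn_integral_count_space_swap) simp
      also have "... = (\<Oplus>l. ennreal a * (X1 l' l * ?e \<tau> l))
          + (\<Oplus>k. ennreal (1 - a) * (X2 l' k * ?e \<tau> k))"
      proof -
        have "(\<Oplus>k. (?v l' l * X l k) * (ennreal a * ?e \<tau> l)) = ennreal a * (X1 l' l * ?e \<tau> l)" for l
          unfolding X1_def by (subst nn_integral_multc, simp, subst nn_integral_cmult, simp) (simp only: mult_ac)
        moreover have "(\<Oplus>l. (?v l' l * X l k) * (ennreal (1 - a) * ?e \<tau> k)) = ennreal (1 - a) * (X2 l' k * ?e \<tau> k)" for k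
          unfolding X2_def by (subst nn_integral_multc, simp) (simp only: mult_ac)
        ultimately show ?thesis by (simp only:)
      qed
      also have "... = ennreal a * Y l' + ennreal (1 - a) * Z l'"
        unfolding Y_def Z_def by (simp only: nn_integral_cmult borel_measurable_count_space)
      finally show ?thesis .
    qed
    have "(\<Oplus>j. (\<Oplus>l'. enorm (S n j l' s) * (\<Oplus>l. ?v l' l * ?e (t - s) l * (\<Oplus>k. X l k * ?e \<sigma> k))))
      \<le> (\<Oplus>j. (\<Oplus>l'. enorm (S n j l' s) * (ennreal a * Y l' + ennreal (1 - a) * Z l')))"
      by (intro nn_integral_mono mult_left_mono inner) auto
    also have "... = ennreal a * (\<Oplus>j. (\<Oplus>l'. enorm (S n j l' s) * Y l'))
        + ennreal (1 - a) * (\<Oplus>j. (\<Oplus>l'. enorm (S n j l' s) * Z l'))"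
      by (simp add: distrib_left nn_integral_add nn_integral_cmult[symmetric] mult_ac)
    also have "... \<le> ennreal a * (ennreal ((B * s) ^ n / fact n) * ?Bc * theta (s + \<tau>))
        + ennreal (1 - a) * (ennreal ((B * s) ^ n / fact n) * ?Bc * theta (s + \<tau>))"
      unfolding Y_def Z_def
      by (intro add_mono mult_left_mono Suc.IH s \<tau> X1row X1col X2row X2col) auto
    also have "... = ennreal ((B * s) ^ n / fact n) * ?Bc * theta (t + \<sigma>)"
      by (simp only: ennreal_convex_comb[OF a(1,2)] \<tau>)
    also have "... = (ennreal ((B * s) ^ n / fact n) * ennreal B) * (c * theta (t + \<sigma>))"
      by (simp only: mult_ac)
    finally show "(\<Oplus>j. (\<Oplus>l'. enorm (S n j l' s) * (\<Oplus>l. ?v l' l * ?e (t - s) l * (\<Oplus>k. X l k * ?e \<sigma> k))))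
      \<le> ennreal (B * ((B * s) ^ n / fact n)) * (c * theta (t + \<sigma>))" by (simp only: ennreal_B_mult[OF s(1)])
  qed
  then show ?case by (simp only: mult.assoc)
qed

text \<open>The case of the identity kernel and no extra time. It bounds the sum of all entries,
  hence the trace in any orthonormal basis and not only the diagonal in the given one.\<close>

lemma S_trace:
  assumes "0 \<le> t"
  shows "(\<Oplus>j. (\<Oplus>k. enorm (S n j k t)))
    \<le> ennreal ((B * t) ^ n / fact n) * theta t"
proof -
  have i: "(\<Oplus>k. indicator {l} k) = (1::ennreal)" "(\<Oplus>k. indicator {k} l) = (1::ennreal)" for l :: 'k
    using nn_integral_count_space_indicator_singleton[of "\<lambda>_. 1" l] by simp_all
  have "(\<Oplus>k. indicator {l} k * ennreal (exp (- 0 * D k))) = (1::ennreal)" for l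
    using i(1)[of l] by simp
  with S_trace_kernel[OF assms order_refl, of "\<lambda>l k. indicator {l} k" 1 n] show ?thesis
    by (simp add: i)
qed

end

section \<open>Summation of the series and the Duhamel equation\<close>

context dyson
begin

definition U :: "'k => 'k => real => complex" where
  "U j k t = (\<Sum>n. S n j k t)"

lemma fact_series_summable: "(\<lambda>n. (B * t) ^ n / fact n) summable_on UNIV" if "0 \<le> t"
proof -
  have "(\<lambda>n. norm ((B * t) ^ n / fact n)) summable_on UNIV"
    by (rule summable_on_norm_nnI[where c="exp (B * t)"])
      (use nn_integral_exp_series[of "B * t"] B_nonneg that in auto)
  then show ?thesis using B_nonneg that by simp
qed

lemma fact_series_infsum: "(\<Sum>n. (B * t) ^ n / fact n) = exp (B * t)" if "0 \<le> t"
proof -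
  have "ennreal (\<Sum>n. norm ((B * t) ^ n / fact n)) = ennreal (exp (B * t))"
    by (subst nn_integral_count_space_infsum[symmetric])
      (use fact_series_summable[OF that] nn_integral_exp_series[of "B * t"] B_nonneg that in auto)
  then show ?thesis using B_nonneg that by (subst (asm) ennreal_inj) (auto intro!: infsum_nonneg)
qed

lemma S_norm_summable: "0 \<le> t ==> (\<lambda>n. norm (S n j k t)) summable_on UNIV"
  by (rule summable_on_comparison_test[OF fact_series_summable]) (auto intro: S_bound)

lemma S_summable: "0 \<le> t ==> (\<lambda>n. S n j k t) summable_on UNIV"
  using S_norm_summable by (rule abs_summable_summable)

lemma U_bound: "0 \<le> t ==> norm (U j k t) \<le> exp (B * t)"
  unfolding U_def fact_series_infsum[symmetric]
  by (rule norm_infsum_le) (auto intro!: has_sum_infsum S_summable fact_series_summable S_bound)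

lemma U_bound': "t \<in> {0..T} ==> norm (U j k t) \<le> exp (B * T)"
  by (rule order_trans[OF U_bound]) (use B_nonneg in \<open>auto intro!: mult_left_mono\<close>)

lemma U_continuous: "continuous_on {0..T} (U j k)"
proof (cases "0 \<le> T")
  case True
  then show ?thesis unfolding U_def
    by (intro continuous_on_infsum[OF S_continuous _ fact_series_summable[OF True]] S_bound')
qed auto

text \<open>Since (n+m)! >= n!, the exponential series from order m on is at most (Bt)^m exp(Bt).
  With m = 0 it bounds \<open>U\<close> itself, with m = 2 and m = 3 the remainders.\<close>

lemma fact_series_tail_nn:
  assumes t: "0 \<le> t" and f: "\<And>n. (\<Oplus>x. enorm (f n x)) \<le> ennreal ((B * t) ^ n / fact n) * c"
  shows "(\<Oplus>x. enorm (\<Sum>n. f (n + m) x :: complex)) \<le> ennreal ((B * t) ^ m * exp (B * t)) * c"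
proof -
  have coef: "ennreal ((B * t) ^ (n + m) / fact (n + m)) \<le> ennreal ((B * t) ^ m) * ennreal ((B * t) ^ n / fact n)" for n
  proof -
    have "(B * t) ^ (n + m) / fact (n + m) \<le> (B * t) ^ (n + m) / fact n"
      using B_nonneg t by (intro divide_left_mono fact_mono mult_pos_pos) auto
    then show ?thesis
      using B_nonneg t by (subst ennreal_mult[symmetric]) (auto simp: power_add mult_ac intro!: ennreal_leI)
  qed
  have "(\<Oplus>x. enorm (\<Sum>n. f (n + m) x)) \<le> (\<Oplus>x. (\<Oplus>n. enorm (f (n + m) x)))"
    by (intro nn_integral_mono ennreal_norm_infsum_le)
  also have "... = (\<Oplus>n. (\<Oplus>x. enorm (f (n + m) x)))" by (rule nn_integral_count_space_swap)
  also have "... \<le> (\<Oplus>n. ennreal ((B * t) ^ m) * ennreal ((B * t) ^ n / fact n) * c)"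
    by (intro nn_integral_mono order_trans[OF f] mult_right_mono coef) auto
  also have "... = ennreal ((B * t) ^ m * exp (B * t)) * c"
    using B_nonneg t
    by (subst nn_integral_multc, simp, subst nn_integral_cmult) (auto simp: nn_integral_exp_series ennreal_mult)
  finally show ?thesis .
qed

lemma U_col: "0 \<le> t ==> (\<Oplus>j. enorm (U j k t)) \<le> ennreal (exp (B * t))"
  using fact_series_tail_nn[OF _ S_col, where m=0] by (simp add: U_def)

lemma U_row: "0 \<le> t ==> (\<Oplus>k. enorm (U j k t)) \<le> ennreal (exp (B * t))"
  using fact_series_tail_nn[OF _ S_row, where m=0] by (simp add: U_def)

lemma U_trace:
  assumes "0 \<le> t"
  shows "(\<Oplus>j. (\<Oplus>k. enorm (U j k t))) \<le> ennreal (exp (B * t)) * theta t"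
proof -
  have p: "(\<Oplus>x. enorm (g (fst x) (snd x))) = (\<Oplus>j. (\<Oplus>k. enorm (g j k)))" for g :: "'k => 'k => complex"
    using nn_integral_fst_count_space[of "\<lambda>x. enorm (g (fst x) (snd x))"] by simp
  have "(\<Oplus>x. enorm (S n (fst x) (snd x) t)) \<le> ennreal ((B * t) ^ n / fact n) * theta t" for n
    using S_trace[OF assms, of n] p[of "\<lambda>j k. S n j k t"] by simp
  from fact_series_tail_nn[OF assms this, where m=0] p[of "\<lambda>j k. U j k t"] show ?thesis by (simp add: U_def)
qed

lemma nn_integral_diag_le:
  fixes f :: "'k => 'k => ennreal"
  shows "(\<Oplus>k. f k k) \<le> (\<Oplus>j. (\<Oplus>k. f j k))"
proof (rule nn_integral_mono)
  fix j
  show "f j j \<le> (\<Oplus>k. f j k)" using nn_integral_ge_point[of j UNIV "f j"] by simp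
qed

lemma U_tail:
  assumes t: "0 \<le> t"
  shows "U j k t - (\<Sum>n<m. S n j k t) = (\<Sum>n. S (n + m) j k t)"
proof (induction m)
  case (Suc m)
  have "(\<lambda>n. S n j k t) summable_on range (\<lambda>n. n + m)"
    by (rule summable_on_subset_banach[OF S_summable[OF t]]) auto
  then have "(\<lambda>n. S (n + m) j k t) summable_on UNIV" by (subst (asm) summable_on_reindex) (auto simp: o_def)
  from infsum_nat_shift[OF this] Suc show ?case by (simp add: algebra_simps)
qed (simp add: U_def)

text \<open>The orders from three on carry a factor t^3 against \<open>theta t\<close>. For the
  Laplacian in dimension four, where \<open>theta t\<close> is O(t^-2), the remainder is therefore
  O(t).\<close>

lemma trace_remainder:
  assumes t: "0 \<le> t"
  shows "(\<Oplus>k. enorm (U k k t - S 0 k k t - S 1 k k t - S 2 k k t)) \<le> ennreal ((B * t) ^ 3 * exp (B * t)) * theta t"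
proof -
  have "(\<Oplus>k. enorm (S n k k t)) \<le> ennreal ((B * t) ^ n / fact n) * theta t" for n
    by (rule order_trans[OF nn_integral_diag_le[of "\<lambda>j k. enorm (S n j k t)"] S_trace[OF t]])
  note tail = fact_series_tail_nn[OF t this, where m=3]
  have "(\<Sum>n<3. S n k k t) = S 0 k k t + S 1 k k t + S 2 k k t" for k
    by (simp add: numeral_3_eq_3 numeral_2_eq_2 del: S.simps)
  then show ?thesis using tail unfolding U_tail[OF t, symmetric] by (simp only: diff_diff_eq add.assoc)
qed

text \<open>The integrated form of u' = - u (D + V) for a row vector u. Boundedness uniformly in the
  index \<open>k\<close> is part of the notion: it makes the sums against the columns of V converge
  and singles out one solution.\<close>

definition duhamel :: "('k => real => complex) => bool" where
  "duhamel u \<longleftrightarrow> (\<forall>T. \<exists>C. \<forall>k. \<forall>t\<in>{0..T}. norm (u k t) \<le> C) \<and> (\<forall>k T. continuous_on {0..T} (u k)) \<and>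
     (\<forall>k. \<forall>t\<ge>0. u k t = of_real (exp (- t * D k)) * u k 0
        - integral {0..t} (\<lambda>s. of_real (exp (- (t - s) * D k)) * (\<Sum>l. u l s * V l k)))"

lemma duhamelD:
  "duhamel u ==> 0 \<le> t ==> u k t = of_real (exp (- t * D k)) * u k 0
        - integral {0..t} (\<lambda>s. of_real (exp (- (t - s) * D k)) * (\<Sum>l. u l s * V l k))"
  unfolding duhamel_def by blast

lemma infsum_V_summable:
  assumes "\<And>l. norm (u l) \<le> C"
  shows "(\<lambda>l. norm (u l * V l k)) summable_on UNIV"
  by (rule summable_on_comparison_test[OF summable_on_cmult_right[OF V_col_summable, of C k]])
    (use assms in \<open>auto simp: norm_mult intro!: mult_right_mono\<close>)

text \<open>A Gronwall argument by iteration. The difference of two solutions is bounded by C on the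
  interval; inserting a bound into its own integral equation improves C (Br)^n/n! to the next n, and
  these bounds tend to zero.\<close>

lemma duhamel_unique:
  assumes u: "duhamel u" and w: "duhamel w" and init: "\<And>k. u k 0 = w k 0" and t: "0 \<le> t"
  shows "u k t = w k t"
proof -
  define d where "d k s = u k s - w k s" for k s
  obtain C1 where C1: "\<And>k s. s \<in> {0..t} ==> norm (u k s) \<le> C1" using u unfolding duhamel_def by blast
  obtain C2 where C2: "\<And>k s. s \<in> {0..t} ==> norm (w k s) \<le> C2" using w unfolding duhamel_def by blast
  have cu: "continuous_on {0..T} (u k)" and cw: "continuous_on {0..T} (w k)" for k T
    using u w unfolding duhamel_def by blast+
  define C where "C = C1 + C2"
  have dC: "norm (d k s) \<le> C" if "s \<in> {0..t}" for k s
    using norm_triangle_ineq4[of "u k s" "w k s"] C1[OF that, of k] C2[OF that, of k] unfolding d_def C_def by linarith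
  have C0: "0 \<le> C" using order_trans[OF norm_ge_zero dC[of 0 k]] t by simp
  have dcont: "continuous_on {0..T} (d k)" for k T
    unfolding d_def by (intro continuous_intros cu cw)
  have deq: "d k r = - integral {0..r} (\<lambda>s. of_real (exp (- (r - s) * D k)) * (\<Sum>l. d l s * V l k))"
    if r: "r \<in> {0..t}" for k r
  proof -
    have su: "(\<lambda>l. u l s * V l k) summable_on UNIV" if "s \<in> {0..r}" for s
      using abs_summable_summable[OF infsum_V_summable[of "\<lambda>l. u l s" C1 k]] C1[of s] that r by auto
    have sw: "(\<lambda>l. w l s * V l k) summable_on UNIV" if "s \<in> {0..r}" for s
      using abs_summable_summable[OF infsum_V_summable[of "\<lambda>l. w l s" C2 k]] C2[of s] that r by auto
    have iu: "(\<lambda>s. of_real (exp (- (r - s) * D k)) * (\<Sum>l. u l s * V l k)) integrable_on {0..r}"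
      by (intro integrable_continuous_interval continuous_intros continuous_on_infsum_V[where C=C1]) (use C1 cu r in auto)
    have iw: "(\<lambda>s. of_real (exp (- (r - s) * D k)) * (\<Sum>l. w l s * V l k)) integrable_on {0..r}"
      by (intro integrable_continuous_interval continuous_intros continuous_on_infsum_V[where C=C2]) (use C2 cw r in auto)
    have eu: "u k r = of_real (exp (- r * D k)) * u k 0
        - integral {0..r} (\<lambda>s. of_real (exp (- (r - s) * D k)) * (\<Sum>l. u l s * V l k))"
      and ew: "w k r = of_real (exp (- r * D k)) * w k 0
        - integral {0..r} (\<lambda>s. of_real (exp (- (r - s) * D k)) * (\<Sum>l. w l s * V l k))"
      using duhamelD[OF u, of r k] duhamelD[OF w, of r k] r by (simp_all only: atLeastAtMost_iff)
    have "d k r = - (integral {0..r} (\<lambda>s. of_real (exp (- (r - s) * D k)) * (\<Sum>l. u l s * V l k))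
        - integral {0..r} (\<lambda>s. of_real (exp (- (r - s) * D k)) * (\<Sum>l. w l s * V l k)))"
      unfolding d_def by (subst eu, subst ew) (simp add: init)
    also have "... = - integral {0..r} (\<lambda>s. of_real (exp (- (r - s) * D k)) * (\<Sum>l. u l s * V l k)
        - of_real (exp (- (r - s) * D k)) * (\<Sum>l. w l s * V l k))"
      by (subst integral_diff[OF iu iw]) simp
    also have "... = - integral {0..r} (\<lambda>s. of_real (exp (- (r - s) * D k)) * (\<Sum>l. d l s * V l k))"
    proof (intro arg_cong[where f=uminus] integral_cong)
      fix s assume s: "s \<in> {0..r}"
      have "(\<Sum>l. d l s * V l k) = (\<Sum>l. u l s * V l k + - (w l s * V l k))"
        unfolding d_def by (simp add: left_diff_distrib)
      also have "... = (\<Sum>l. u l s * V l k) + - (\<Sum>l. w l s * V l k)"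
        by (subst infsum_add) (auto simp: infsum_uminus summable_on_uminus su[OF s] sw[OF s])
      finally show "of_real (exp (- (r - s) * D k)) * (\<Sum>l. u l s * V l k)
        - of_real (exp (- (r - s) * D k)) * (\<Sum>l. w l s * V l k) = of_real (exp (- (r - s) * D k)) * (\<Sum>l. d l s * V l k)"
        by (simp add: right_diff_distrib)
    qed
    finally show ?thesis .
  qed
  have it: "norm (d k r) \<le> C * ((B * r) ^ n / fact n)" if "r \<in> {0..t}" for n k r
    using that
  proof (induction n arbitrary: k r)
    case 0
    then show ?case using dC by simp
  next
    case (Suc n)
    have g: "continuous_on {0..r} (\<lambda>s. \<Sum>l. d l s * V l k)"
      by (rule continuous_on_infsum_V[where C=C]) (use dC dcont Suc.prems in auto)
    have bd: "norm (\<Sum>l. d l s * V l k) \<le> C * (B * ((B * s) ^ n / fact n))" if s: "s \<in> {0..r}" for s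
    proof -
      have "norm (\<Sum>l. d l s * V l k) \<le> (C * ((B * s) ^ n / fact n)) * B"
      proof (rule norm_infsum_V_le[where t=s and u=d])
        fix l s' assume s': "s' \<in> {0..s}"
        have "norm (d l s') \<le> C * ((B * s') ^ n / fact n)" using Suc.IH s' s Suc.prems by auto
        also have "... \<le> C * ((B * s) ^ n / fact n)"
          using s' s B_nonneg C0 by (auto intro!: mult_left_mono divide_right_mono power_mono)
        finally show "norm (d l s') \<le> C * ((B * s) ^ n / fact n)" .
      qed (use dcont s in auto)
      then show ?thesis by (simp add: mult_ac)
    qed
    have "norm (d k r) = norm (integral {0..r} (\<lambda>s. of_real (exp (- (r - s) * D k)) * (\<Sum>l. d l s * V l k)))"
      by (subst deq[OF Suc.prems]) simp
    also have "... \<le> C * ((B * r) ^ Suc n / fact (Suc n))"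
      by (rule norm_duhamel_integral_le[OF _ g D_nonneg bd has_integral_mult_right[OF has_integral_power_fact]])
        (use Suc.prems in auto)
    finally show ?case .
  qed
  have "(\<lambda>n. C * ((B * t) ^ n / fact n)) \<longlonglongrightarrow> C * 0"
  proof (intro tendsto_intros)
    show "(\<lambda>n. (B * t) ^ n / fact n) \<longlonglongrightarrow> 0"
      using summable_LIMSEQ_zero[OF summable_exp[of "B * t"]] by (simp add: divide_inverse mult.commute)
  qed
  then have "norm (d k t) \<le> C * 0"
    by (rule LIMSEQ_le_const) (use it[of t k] t in auto)
  then show ?thesis by (simp add: d_def)
qed

lemma U_zero: "U j k 0 = (if j = k then 1 else 0)"
proof -
  have "S n j k 0 = 0" if "n \<noteq> 0" for n using that by (cases n) auto
  then have "U j k 0 = (\<Sum>\<^sub>\<infinity>n\<in>{0}. S n j k 0)"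
    unfolding U_def by (intro infsum_cong_neutral) auto
  then show ?thesis by simp
qed

text \<open>Summation of the recursion over n. The order-zero term is the free evolution; in the
  others the sum is exchanged with the time integral by the uniform bounds and with the sum over l
  by absolute convergence.\<close>

lemma U_integral_equation:
  assumes t: "0 \<le> t"
  shows "U j k t = of_real (exp (- t * D k)) * (if j = k then 1 else 0)
     - integral {0..t} (\<lambda>s. of_real (exp (- (t - s) * D k)) * (\<Sum>l. U j l s * V l k))"
proof -
  define f where "f n s = complex_of_real (exp (- (t - s) * D k)) * (\<Sum>l. S n j l s * V l k)" for n s
  have fb: "norm (f n s) \<le> B * ((B * t) ^ n / fact n)" if s: "s \<in> {0..t}" for n s
  proof -
    have "norm (f n s) \<le> 1 * ((B * t) ^ n / fact n * B)"
      unfolding f_def norm_mult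
      by (intro mult_mono norm_infsum_V_le[where t=t] S_bound' S_continuous s)
        (use s exp_D_le[of "t - s" k] in auto)
    then show ?thesis by (simp add: mult_ac)
  qed
  have fc: "continuous_on {0..t} (f n)" for n
    unfolding f_def by (intro continuous_intros continuous_on_infsum_V[OF S_bound'] S_continuous)
  have M: "(\<lambda>n. B * ((B * t) ^ n / fact n)) summable_on UNIV"
    by (intro summable_on_cmult_right fact_series_summable t)
  have "((\<lambda>n. integral {0..t} (f n)) has_sum integral {0..t} (\<lambda>s. \<Sum>n. f n s)) UNIV"
    by (rule has_sum_integral_infsum[OF fc fb M])
  then have 1: "(\<Sum>n. integral {0..t} (f n)) = integral {0..t} (\<lambda>s. \<Sum>n. f n s)"
    by (rule infsumI)
  have 2: "(\<Sum>n. f n s) = of_real (exp (- (t - s) * D k)) * (\<Sum>l. U j l s * V l k)" if s: "s \<in> {0..t}" for s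
  proof -
    have "(\<Oplus>n. (\<Oplus>l. enorm (S n j l s * V l k)))
      \<le> (\<Oplus>n. (\<Oplus>l. ennreal ((B * t) ^ n / fact n) * enorm (V l k)))"
      by (intro nn_integral_mono) (auto simp: norm_mult ennreal_mult' intro!: mult_right_mono ennreal_leI S_bound' s)
    also have "... \<le> (\<Oplus>n. ennreal ((B * t) ^ n / fact n) * ennreal B)"
      by (auto simp: nn_integral_cmult intro!: nn_integral_mono mult_left_mono V_col)
    also have "... = ennreal (exp (B * t)) * ennreal B"
      using B_nonneg t by (subst nn_integral_multc) (auto simp: nn_integral_exp_series)
    also have "... < \<infinity>" by (simp add: ennreal_mult_less_top)
    finally have "(\<Sum>n. \<Sum>l. S n j l s * V l k) = (\<Sum>l. \<Sum>n. S n j l s * V l k)"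
      by (intro infsum_swap_banach summable_on_product_nnI)
    also have "... = (\<Sum>l. U j l s * V l k)"
      by (simp add: U_def infsum_cmult_left')
    finally show ?thesis by (simp add: f_def infsum_cmult_right')
  qed
  have "U j k t = S 0 j k t + (\<Sum>n. S (Suc n) j k t)"
    unfolding U_def by (rule infsum_nat_shift[OF S_summable[OF t]])
  also have "(\<Sum>n. S (Suc n) j k t) = - (\<Sum>n. integral {0..t} (f n))"
    by (simp only: S.simps f_def[abs_def] infsum_uminus)
  also have "... = - integral {0..t} (\<lambda>s. of_real (exp (- (t - s) * D k)) * (\<Sum>l. U j l s * V l k))"
    unfolding 1 by (intro arg_cong[where f=uminus] integral_cong 2)
  finally show ?thesis by simp
qed

lemma duhamel_U: "duhamel (U j)"
  unfolding duhamel_def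
proof (intro conjI allI ballI impI)
  show "\<exists>C. \<forall>k. \<forall>t\<in>{0..T}. norm (U j k t) \<le> C" for T using U_bound' by blast
  show "continuous_on {0..T} (U j k)" for T k by (rule U_continuous)
  show "U j k t = of_real (exp (- t * D k)) * U j k 0
    - integral {0..t} (\<lambda>s. of_real (exp (- (t - s) * D k)) * (\<Sum>l. U j l s * V l k))" if "0 \<le> t" for k t
    unfolding U_zero by (rule U_integral_equation[OF that])
qed

end

section \<open>Semigroup law and generator of the summed series\<close>

context dyson
begin

lemma U_row_summable: "0 \<le> t ==> (\<lambda>k. norm (U j k t)) summable_on UNIV"
  by (rule summable_on_norm_nnI[OF U_row]) auto

lemma infsum_delta: "(\<Sum>l. f l * (if l = k then 1 else 0)) = (f k :: complex)"
proof -
  have "(\<Sum>l. f l * (if l = k then 1 else 0)) = (\<Sum>\<^sub>\<infinity>l\<in>{k}. f l)"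
    by (intro infsum_cong_neutral) auto
  then show ?thesis by simp
qed

text \<open>Splitting the integral at s0 and factoring the exponential turns the history up to s0
  into the new initial value. Together with superposition and uniqueness this yields the semigroup
  law.\<close>

lemma duhamel_shift:
  assumes u: "duhamel u" and s0: "0 \<le> s0"
  shows "duhamel (\<lambda>k t. u k (s0 + t))"
  unfolding duhamel_def
proof (intro conjI allI ballI impI)
  fix T
  show "\<exists>C. \<forall>k. \<forall>t\<in>{0..T}. norm (u k (s0 + t)) \<le> C"
  proof -
    obtain C where C: "\<And>k s. s \<in> {0..s0 + T} ==> norm (u k s) \<le> C" using u unfolding duhamel_def by blast
    show ?thesis using C s0 by (intro exI[of _ C]) auto
  qed
  fix k
  have cu: "continuous_on {0..T} (u k)" for T k
    using u unfolding duhamel_def by blast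
  show "continuous_on {0..T} (\<lambda>t. u k (s0 + t))"
    by (rule continuous_on_compose2[OF cu[of "s0 + T"]]) (use s0 in \<open>auto intro!: continuous_intros\<close>)
next
  fix k t assume t: "0 \<le> (t::real)"
  obtain C where C: "\<And>k s. s \<in> {0..s0 + t} ==> norm (u k s) \<le> C" using u unfolding duhamel_def by blast
  have cu: "continuous_on {0..T} (u k)" for T k
    using u unfolding duhamel_def by blast
  define g where "g s = (\<Sum>l. u l s * V l k)" for s
  define e where "e s = complex_of_real (exp (s * D k))" for s
  have e_add: "e (a + b) = e a * e b" for a b
    by (simp add: e_def exp_add[symmetric] distrib_right of_real_mult[symmetric] del: of_real_mult)
  have e_ne: "e a \<noteq> 0" for a by (simp add: e_def)
  have cg: "continuous_on {0..s0 + t} g"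
    unfolding g_def by (rule continuous_on_infsum_V[where C=C]) (use C cu in auto)
  have eg: "(\<lambda>s. e (- (s0 + t - s)) * g s) integrable_on {0..s0 + t}"
    unfolding e_def by (intro integrable_continuous_interval continuous_intros cg)
  have "u k (s0 + t) = e (- (s0 + t)) * u k 0 - integral {0..s0 + t} (\<lambda>s. e (- (s0 + t - s)) * g s)"
    using duhamelD[OF u, of "s0 + t" k] s0 t by (simp only: e_def g_def add_nonneg_nonneg)
  also have "integral {0..s0 + t} (\<lambda>s. e (- (s0 + t - s)) * g s)
    = integral {0..s0} (\<lambda>s. e (- (s0 + t - s)) * g s) + integral {s0..s0 + t} (\<lambda>s. e (- (s0 + t - s)) * g s)"
    by (rule Henstock_Kurzweil_Integration.integral_combine[symmetric]) (use s0 t eg in auto)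
  also have "integral {0..s0} (\<lambda>s. e (- (s0 + t - s)) * g s) = e (- t) * integral {0..s0} (\<lambda>s. e (- (s0 - s)) * g s)"
  proof -
    have "e (- (s0 + t - s)) * g s = e (- t) * (e (- (s0 - s)) * g s)" for s
      using e_add[of "-t" "- (s0 - s)"] by (simp add: algebra_simps)
    then show ?thesis by (simp only: integral_mult_right)
  qed
  also have "integral {s0..s0 + t} (\<lambda>s. e (- (s0 + t - s)) * g s) = integral {0..t} (\<lambda>s. e (- (t - s)) * g (s0 + s))"
  proof -
    have ig: "(\<lambda>s. e (- (s0 + t - s)) * g s) integrable_on {s0..s0 + t}"
      by (rule integrable_subinterval_real[OF eg]) (use s0 in auto)
    have "((\<lambda>s. e (- (s0 + t - (s + s0))) * g (s + s0)) has_integral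
       integral {s0..s0 + t} (\<lambda>s. e (- (s0 + t - s)) * g s)) {s0 - s0..s0 + t - s0}"
      using has_integral_affinity'[of "\<lambda>s. e (- (s0 + t - s)) * g s" "integral {s0..s0 + t} (\<lambda>s. e (- (s0 + t - s)) * g s)" s0 "s0 + t" 1 s0]
        integrable_integral[OF ig] by simp
    then show ?thesis by (intro integral_unique[symmetric]) (simp add: add.commute)
  qed
  also have "e (- (s0 + t)) = e (- t) * e (- s0)"
    using e_add[of "-t" "-s0"] by (simp add: algebra_simps)
  finally have "u k (s0 + t) = e (- t) * (e (- s0) * u k 0 - integral {0..s0} (\<lambda>s. e (- (s0 - s)) * g s))
     - integral {0..t} (\<lambda>s. e (- (t - s)) * g (s0 + s))"
    by (simp add: algebra_simps)
  also have "e (- s0) * u k 0 - integral {0..s0} (\<lambda>s. e (- (s0 - s)) * g s) = u k s0"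
    using duhamelD[OF u s0, of k] by (simp only: e_def g_def)
  finally show "u k (s0 + t) = of_real (exp (- t * D k)) * u k (s0 + 0)
        - integral {0..t} (\<lambda>s. of_real (exp (- (t - s) * D k)) * (\<Sum>l. u l (s0 + s) * V l k))"
    by (simp only: e_def g_def add_0_right)
qed

lemma norm_infsum_U_le:
  assumes a: "(\<lambda>l. norm (a l)) summable_on UNIV" and s: "s \<in> {0..t}"
  shows "norm (\<Sum>l. a l * U l k s) \<le> (\<Sum>l. norm (a l) * exp (B * t))"
proof (rule norm_infsum_le)
  have M: "(\<lambda>l. norm (a l) * exp (B * t)) summable_on UNIV"
    by (intro summable_on_cmult_left a)
  have bd: "norm (a l * U l k s) \<le> norm (a l) * exp (B * t)" for l
    using U_bound'[OF s] by (auto simp: norm_mult intro!: mult_left_mono)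
  have "(\<lambda>l. norm (a l * U l k s)) summable_on UNIV"
    by (rule summable_on_comparison_test[OF M]) (use bd in auto)
  then show "((\<lambda>l. a l * U l k s) has_sum (\<Sum>l. a l * U l k s)) UNIV"
    by (rule has_sum_infsum[OF abs_summable_summable])
  show "((\<lambda>l. norm (a l) * exp (B * t)) has_sum (\<Sum>l. norm (a l) * exp (B * t))) UNIV"
    by (rule has_sum_infsum[OF M])
qed (use U_bound'[OF s] in \<open>auto simp: norm_mult intro!: mult_left_mono\<close>)

text \<open>The equation is linear, and an absolutely summable combination of the rows of
  \<open>U\<close> preserves the uniform bounds; the combination has initial row
  \<open>a\<close>.\<close>

lemma duhamel_superposition:
  assumes a: "(\<lambda>l. norm (a l)) summable_on UNIV"
  shows "duhamel (\<lambda>k t. \<Sum>l. a l * U l k t)"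
  unfolding duhamel_def
proof (intro conjI allI ballI impI)
  show "\<exists>C. \<forall>k. \<forall>t\<in>{0..T}. norm (\<Sum>l. a l * U l k t) \<le> C" for T
    using norm_infsum_U_le[OF a] by blast
  have M: "(\<lambda>l. norm (a l) * exp (B * t)) summable_on UNIV" for t
    by (intro summable_on_cmult_left a)
  show "continuous_on {0..T} (\<lambda>t. \<Sum>l. a l * U l k t)" for T k
    by (intro continuous_on_infsum[OF _ _ M[of T]] continuous_intros U_continuous)
      (auto simp: norm_mult intro!: mult_left_mono U_bound')
  fix k t assume t: "0 \<le> (t::real)"
  define g where "g l s = (\<Sum>m. U l m s * V m k)" for l s
  define f where "f l s = complex_of_real (exp (- (t - s) * D k)) * (a l * g l s)" for l s
  have cg: "continuous_on {0..t} (g l)" for l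
    unfolding g_def by (intro continuous_on_infsum_V[OF U_bound'] U_continuous)
  have fc: "continuous_on {0..t} (f l)" for l
    unfolding f_def by (intro continuous_intros cg)
  have fb: "norm (f l s) \<le> norm (a l) * (exp (B * t) * B)" if s: "s \<in> {0..t}" for l s
  proof -
    have "norm (f l s) \<le> 1 * (norm (a l) * (exp (B * t) * B))"
      unfolding f_def norm_mult g_def
      by (intro mult_mono norm_infsum_V_le[where t=t] U_bound' U_continuous s)
        (use s exp_D_le[of "t - s" k] in auto)
    then show ?thesis by simp
  qed
  have M2: "(\<lambda>l. norm (a l) * (exp (B * t) * B)) summable_on UNIV"
    by (intro summable_on_cmult_left a)
  note hs = has_sum_integral_infsum[OF fc fb M2]
  have f_sum: "(\<Sum>l. f l s) = of_real (exp (- (t - s) * D k)) * (\<Sum>m. (\<Sum>l. a l * U l m s) * V m k)"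
    if s: "s \<in> {0..t}" for s
  proof -
    have "(\<Oplus>l. (\<Oplus>m. enorm (a l * U l m s * V m k)))
       \<le> (\<Oplus>l. (\<Oplus>m. enorm (a l) * (ennreal (exp (B * t)) * enorm (V m k))))"
      by (intro nn_integral_mono)
        (auto simp: norm_mult ennreal_mult'[symmetric] ennreal_mult''[symmetric] mult.assoc
          intro!: ennreal_leI mult_left_mono mult_right_mono U_bound'[OF s])
    also have "... \<le> (\<Oplus>l. enorm (a l) * (ennreal (exp (B * t)) * ennreal B))"
      by (auto simp: nn_integral_cmult intro!: nn_integral_mono mult_left_mono V_col)
    also have "... = ennreal (\<Sum>l. norm (a l)) * (ennreal (exp (B * t)) * ennreal B)"
      by (simp add: nn_integral_multc nn_integral_count_space_infsum[OF a])
    also have "... < \<infinity>" by (simp add: ennreal_mult_less_top)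
    finally have "(\<Sum>l. \<Sum>m. a l * U l m s * V m k) = (\<Sum>m. \<Sum>l. a l * U l m s * V m k)"
      by (intro infsum_swap_banach summable_on_product_nnI)
    moreover have "(\<Sum>m. a l * U l m s * V m k) = a l * g l s" for l
      unfolding g_def mult.assoc by (rule infsum_cmult_right')
    moreover have "(\<Sum>l. a l * U l m s * V m k) = (\<Sum>l. a l * U l m s) * V m k" for m
      by (rule infsum_cmult_left')
    ultimately have "(\<Sum>l. a l * g l s) = (\<Sum>m. (\<Sum>l. a l * U l m s) * V m k)" by (simp only:)
    then show ?thesis unfolding f_def by (simp only: infsum_cmult_right')
  qed
  have i_eq: "integral {0..t} (\<lambda>s. \<Sum>l. f l s)
      = integral {0..t} (\<lambda>s. of_real (exp (- (t - s) * D k)) * (\<Sum>m. (\<Sum>l. a l * U l m s) * V m k))"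
    by (intro integral_cong f_sum)
  have U_eq: "a l * U l k t = of_real (exp (- t * D k)) * (a l * (if l = k then 1 else 0)) - integral {0..t} (f l)" for l
  proof -
    have "integral {0..t} (f l) = integral {0..t} (\<lambda>s. a l * (of_real (exp (- (t - s) * D k)) * g l s))"
      by (intro integral_cong) (simp only: f_def mult.left_commute)
    also have "... = a l * integral {0..t} (\<lambda>s. of_real (exp (- (t - s) * D k)) * g l s)"
      by (rule integral_mult_right)
    finally show ?thesis
      by (subst U_integral_equation[OF t]) (simp only: g_def[symmetric], simp add: algebra_simps)
  qed
  have d: "(\<lambda>l. a l * (if l = k then 1 else 0)) summable_on UNIV"
    by (rule finite_nonzero_values_imp_summable_on) (auto intro: finite_subset[of _ "{k}"])
  have "(\<Sum>l. a l * U l k t) = (\<Sum>l. of_real (exp (- t * D k)) * (a l * (if l = k then 1 else 0)) + - integral {0..t} (f l))"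
    by (subst U_eq) simp
  also have "... = of_real (exp (- t * D k)) * a k + - integral {0..t} (\<lambda>s. \<Sum>l. f l s)"
    using infsumI[OF hs] summable_on_cmult_right[OF d, of "of_real (exp (- t * D k))"] has_sum_imp_summable[OF hs]
    by (subst infsum_add) (simp_all only: infsum_uminus summable_on_uminus infsum_cmult_right' infsum_delta)
  finally show "(\<Sum>l. a l * U l k t) = of_real (exp (- t * D k)) * (\<Sum>l. a l * U l k 0)
        - integral {0..t} (\<lambda>s. of_real (exp (- (t - s) * D k)) * (\<Sum>m. (\<Sum>l. a l * U l m s) * V m k))"
    unfolding i_eq by (simp add: U_zero infsum_delta)
qed

text \<open>As functions of t both sides are bounded solutions of the Duhamel equation with the same
  initial row, namely row \<open>j\<close> of \<open>U\<close> at time s.\<close>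

theorem U_semigroup:
  assumes "0 \<le> s" "0 \<le> t"
  shows "U j k (s + t) = (\<Sum>l. U j l s * U l k t)"
  by (rule duhamel_unique[OF duhamel_shift[OF duhamel_U assms(1)] duhamel_superposition[OF U_row_summable[OF assms(1)]] _ assms(2)])
    (simp add: U_zero infsum_delta)

lemma nn_integral_delta: "(\<Oplus>j. enorm ((if j = l then c else 0)::complex)) = ennreal (norm c)"
proof -
  have "(\<Oplus>j. enorm ((if j = l then c else 0)::complex)) = (\<Oplus>j. ennreal (norm c) * indicator {l} j)"
    by (intro nn_integral_cong) (auto simp: indicator_def)
  then show ?thesis by (simp only: nn_integral_count_space_indicator_singleton)
qed

lemma nn_integral_norm_add_le:
  fixes f g :: "'k => complex"
  assumes "(\<Oplus>j. enorm (f j)) \<le> ennreal a" "(\<Oplus>j. enorm (g j)) \<le> ennreal b"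
    and "0 \<le> a" "0 \<le> b"
  shows "(\<Oplus>j. enorm (f j + g j)) \<le> ennreal (a + b)"
proof -
  have "(\<Oplus>j. enorm (f j + g j))
     \<le> (\<Oplus>j. enorm (f j) + enorm (g j))"
    by (intro nn_integral_mono) (auto simp: ennreal_plus[symmetric] norm_triangle_ineq intro!: ennreal_leI simp del: ennreal_plus)
  also have "... \<le> ennreal a + ennreal b"
    by (subst nn_integral_add) (auto intro!: add_mono assms)
  finally show ?thesis using assms by (simp add: ennreal_plus)
qed

lemma S_1_eq: "S 1 j k t = - (V j k * integral {0..t} (\<lambda>s. of_real (exp (- (t - s) * D k) * exp (- s * D j))))"
proof -
  have "((\<lambda>l. S 0 j l s * V l k) has_sum of_real (exp (- s * D j)) * V j k) UNIV" for s
    by (rule has_sum_finite_neutralI[of "{j}"]) auto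
  then have "(\<Sum>l. S 0 j l s * V l k) = of_real (exp (- s * D j)) * V j k" for s by (rule infsumI)
  then have "S 1 j k t = - integral {0..t} (\<lambda>s. V j k * of_real (exp (- (t - s) * D k) * exp (- s * D j)))"
    unfolding One_nat_def S.simps(2) by (simp add: mult_ac)
  then show ?thesis by (simp only: integral_mult_right)
qed

text \<open>A bound for the deviation from 1 of the exponential kernel in the first-order term. The
  minimum with 1 keeps it bounded although the diagonal entries may be unbounded.\<close>

definition eta :: "'k => 'k => real => real" where
  "eta j k t = min 1 (t * (D j + D k))"

lemma eta_nonneg: "0 \<le> t ==> 0 \<le> eta j k t"
  using D_nonneg[of j] D_nonneg[of k] by (simp add: eta_def)

lemma S_1_approx:
  assumes t: "0 \<le> t"
  shows "norm (S 1 j k t + of_real t * V j k) \<le> t * (eta j k t * norm (V j k))"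
proof -
  let ?g = "\<lambda>s. exp (- (t - s) * D k) * exp (- s * D j)"
  have g: "(?g has_integral integral {0..t} ?g) {0..t}"
    by (intro integrable_integral integrable_continuous_interval continuous_intros)
  have const: "((\<lambda>s. c) has_integral t * c) {0..t}" for c :: real using has_integral_const_real[of c 0 t] t by simp
  have b: "1 - eta j k t \<le> ?g s \<and> ?g s \<le> 1" if s: "s \<in> {0..t}" for s
  proof -
    let ?x = "(t - s) * D k + s * D j"
    have e: "?g s = exp (- ?x)" unfolding exp_add[symmetric] by (simp add: algebra_simps)
    have x: "0 \<le> ?x" using s D_nonneg by simp
    have "?x \<le> t * D k + t * D j" using s D_nonneg by (intro add_mono mult_right_mono) auto
    then have "1 - exp (- ?x) \<le> t * (D j + D k)" using exp_ge_add_one_self[of "- ?x"] by (simp add: algebra_simps)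
    moreover have "0 \<le> exp (- ?x)" "exp (- ?x) \<le> 1" using x by auto
    ultimately show ?thesis unfolding e eta_def by linarith
  qed
  have 1: "t * (1 - eta j k t) \<le> integral {0..t} ?g" "integral {0..t} ?g \<le> t * 1"
    by (rule has_integral_le[OF const g], use b in blast) (rule has_integral_le[OF g const], use b in blast)
  have "integral {0..t} (\<lambda>s. complex_of_real (?g s)) = of_real (integral {0..t} ?g)"
    by (rule integral_unique[OF has_integral_of_real[OF g]])
  then have "S 1 j k t + of_real t * V j k = of_real (t - integral {0..t} ?g) * V j k"
    unfolding S_1_eq by (simp add: algebra_simps)
  then have "norm (S 1 j k t + of_real t * V j k) = (t - integral {0..t} ?g) * norm (V j k)"
    using 1 by (simp add: norm_mult del: of_real_diff)
  also have "... \<le> (t * eta j k t) * norm (V j k)" using 1 by (intro mult_right_mono) (simp_all add: algebra_simps)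
  finally show ?thesis by simp
qed

text \<open>The error of the first-order term in column \<open>k\<close>, relative to t. It tends to
  zero by dominated convergence along the column of V, and it is at most \<open>B\<close>
  throughout.\<close>

definition eps :: "'k => real => real" where
  "eps k t = (\<Sum>l. eta l k t * norm (V l k))"

lemma eta_V_summable: "0 \<le> t ==> (\<lambda>l. eta l k t * norm (V l k)) summable_on UNIV"
  by (rule summable_on_comparison_test[OF V_col_summable[of k]])
    (use eta_nonneg in \<open>auto simp: eta_def intro!: mult_left_le_one_le\<close>)

lemma eps_nonneg: "0 \<le> t ==> 0 \<le> eps k t"
  unfolding eps_def by (intro infsum_nonneg mult_nonneg_nonneg eta_nonneg) auto

lemma eps_le: "0 \<le> t ==> eps k t \<le> B"
  unfolding eps_def
  by (rule order_trans[OF infsum_mono[OF eta_V_summable V_col_summable] V_col_sum])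
    (use eta_nonneg in \<open>auto simp: eta_def intro!: mult_left_le_one_le\<close>)

lemma eps_tendsto: "(eps k \<longlongrightarrow> 0) (at_right 0)"
proof -
  have "((\<lambda>t. \<Sum>l. eta l k t * norm (V l k)) \<longlongrightarrow> (\<Sum>l. 0 * norm (V l k))) (at_right 0)"
  proof (rule infsum_dominated_tendsto[OF _ _ V_col_summable])
    show "((\<lambda>t. eta l k t * norm (V l k)) \<longlongrightarrow> 0 * norm (V l k)) (at_right 0)" for l
    proof (rule tendsto_mult_right)
      have "((\<lambda>t. min 1 (t * (D l + D k))) \<longlongrightarrow> min 1 (0 * (D l + D k))) (at_right 0)"
        by (intro tendsto_intros)
      then show "(eta l k \<longlongrightarrow> 0) (at_right 0)" by (simp add: eta_def[abs_def])
    qed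
    show "\<forall>\<^sub>F t in at_right 0. \<forall>l. norm (eta l k t * norm (V l k)) \<le> norm (V l k)"
      using eventually_at_right_less[of "0::real"]
      by eventually_elim (use eta_nonneg in \<open>auto simp: abs_mult eta_def intro!: mult_left_le_one_le\<close>)
  qed
  then show ?thesis by (simp add: eps_def[abs_def])
qed

text \<open>The distance of column \<open>k\<close> of U(t) from that of 1 - t(D+V), in the sum
  norm. The three contributions are the second-order error of exp(-t D_k), the error
  \<open>eps\<close> in the term linear in V, and the Dyson orders from two on, which are O(t^2).
  Since D enters through (D_k)^2 only, the bound can be summed against rapidly decreasing
  coefficients.\<close>

lemma U_generator_column:
  assumes t: "0 < t" "t \<le> 1"
  shows "(\<Oplus>j. enorm (U j k t - (if j = k then 1 else 0) + of_real t * ((if j = k then of_real (D k) else 0) + V j k)))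
    \<le> ennreal (t * (t * (D k)\<^sup>2 + (eps k t + t * (B\<^sup>2 * exp B))))"
proof -
  have t0: "0 \<le> t" using t by simp
  have eq: "U j k t - (if j = k then 1 else 0) + of_real t * ((if j = k then of_real (D k) else 0) + V j k)
    = (if j = k then of_real (exp (- t * D k) - 1 + t * D k) else 0) + ((S 1 j k t + of_real t * V j k) + (\<Sum>n. S (n + 2) j k t))" for j
    unfolding U_tail[OF t0, symmetric] by (simp add: numeral_2_eq_2 algebra_simps del: S.simps(2))
  show ?thesis
    unfolding eq distrib_left[of t "t * (D k)\<^sup>2" "eps k t + t * (B\<^sup>2 * exp B)"]
  proof (rule nn_integral_norm_add_le)
    \<comment> \<open>From below by 1 - x <= exp(-x), from above by exp(-x) <= 1/(1+x) <= 1 - x +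
      x^2.\<close>
    have x: "\<bar>exp (- x) - 1 + x\<bar> \<le> x\<^sup>2" if "0 \<le> x" for x :: real
    proof -
      have 1: "1 - x \<le> exp (- x)" using exp_ge_add_one_self[of "-x"] by simp
      have "exp (- x) \<le> inverse (1 + x)"
        using that exp_ge_add_one_self[of x] unfolding exp_minus by (intro le_imp_inverse_le) auto
      also have "inverse (1 + x) \<le> 1 - x + x\<^sup>2"
        using that by (simp add: field_simps power2_eq_square power3_eq_cube)
      finally show ?thesis using 1 by simp
    qed
    have "norm (of_real (exp (- t * D k) - 1 + t * D k) :: complex) = \<bar>exp (- (t * D k)) - 1 + t * D k\<bar>"
      by (simp only: norm_of_real minus_mult_left)
    also have "... \<le> (t * D k)\<^sup>2" using t D_nonneg by (intro x) auto
    also have "... = t * (t * (D k)\<^sup>2)" by (simp add: power2_eq_square)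
    finally show "(\<Oplus>j. enorm (if j = k then of_real (exp (- t * D k) - 1 + t * D k) else 0 :: complex)) \<le> ennreal (t * (t * (D k)\<^sup>2))"
      unfolding nn_integral_delta by (rule ennreal_leI)
    show "(\<Oplus>j. enorm ((S 1 j k t + of_real t * V j k) + (\<Sum>n. S (n + 2) j k t))) \<le> ennreal (t * (eps k t + t * (B\<^sup>2 * exp B)))"
      unfolding distrib_left[of t "eps k t"]
    proof (rule nn_integral_norm_add_le)
      have "(\<Oplus>j. enorm (S 1 j k t + of_real t * V j k)) \<le> (\<Oplus>j. enorm (t * (eta j k t * norm (V j k))))"
        by (intro nn_integral_mono ennreal_leI order_trans[OF S_1_approx[OF t0]]) auto
      also have "... = ennreal (t * eps k t)"
        using eta_nonneg[OF t0] t0 summable_on_cmult_right[OF eta_V_summable[OF t0], of t k]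
        by (subst nn_integral_count_space_infsum) (auto simp: eps_def abs_mult infsum_cmult_right')
      finally show "(\<Oplus>j. enorm (S 1 j k t + of_real t * V j k)) \<le> ennreal (t * eps k t)" .
      have "(\<Oplus>j. enorm (\<Sum>n. S (n + 2) j k t)) \<le> ennreal ((B * t)\<^sup>2 * exp (B * t)) * 1"
        by (rule fact_series_tail_nn[OF t0 S_col[OF t0]])
      also have "... \<le> ennreal ((B * t)\<^sup>2 * exp B)"
        using B_nonneg t by (simp add: mult_left_mono mult_left_le ennreal_leI)
      also have "(B * t)\<^sup>2 * exp B = t * (t * (B\<^sup>2 * exp B))" by (simp add: power2_eq_square mult_ac)
      finally show "(\<Oplus>j. enorm (\<Sum>n. S (n + 2) j k t)) \<le> ennreal (t * (t * (B\<^sup>2 * exp B)))" .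
    qed (use eps_nonneg t B_nonneg in auto)
  qed (use eps_nonneg t B_nonneg in auto)
qed

end

section \<open>The torus\<close>

definition Qbox :: "(real ^ 4) set" where
  "Qbox = {x. \<forall>i. 0 \<le> x $ i \<and> x $ i < 2 * pi}"

lemma Qbox_borel [measurable]: "Qbox \<in> sets borel"
proof -
  have "Qbox = (\<Inter>i. {x. 0 \<le> x $ i} \<inter> {x. x $ i < 2 * pi})" by (auto simp: Qbox_def)
  moreover have "{x :: real ^ 4. 0 \<le> x $ i} \<inter> {x. x $ i < 2 * pi} \<in> sets borel" for i
    by (intro sets.Int borel_closed borel_open closed_Collect_le open_Collect_less continuous_intros)
  ultimately show ?thesis
    using sets.finite_INT[of UNIV "\<lambda>i. {x :: real ^ 4. 0 \<le> x $ i} \<inter> {x. x $ i < 2 * pi}" borel] by simp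
qed

lemma torus_eq: "torus = restrict_space lborel Qbox"
  by (simp add: torus_def Qbox_def)

lemma space_torus [simp]: "space torus = Qbox"
  by (simp add: torus_eq space_restrict_space)

lemma borel_measurable_torusI:
  "f \<in> borel_measurable borel ==> f \<in> borel_measurable torus"
  unfolding torus_eq by (rule measurable_restrict_space1) simp

lemma nn_integral_torus: "(\<integral>\<^sup>+x. f x \<partial>torus) = (\<integral>\<^sup>+x. f x * indicator Qbox x \<partial>lborel)"
  unfolding torus_eq by (subst nn_integral_restrict_space) auto

lemma emeasure_torus: "emeasure torus (space torus) = ennreal ((2 * pi) ^ 4)"
proof -
  let ?u = "\<chi> i. 2 * pi :: real ^ 4"
  have b: "(?u - 0) \<bullet> b = 2 * pi" if "b \<in> Basis" for b
    using that by (auto simp: Basis_vec_def inner_axis)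
  have p: "(\<Prod>b\<in>Basis. (?u - 0) \<bullet> b) = (2 * pi) ^ 4"
  proof -
    have "(\<Prod>b\<in>Basis. (?u - 0) \<bullet> b) = (\<Prod>b\<in>(Basis :: (real ^ 4) set). 2 * pi)" by (rule prod.cong[OF refl b])
    also have "... = (2 * pi) ^ DIM(real ^ 4)" by (rule prod_constant)
    finally show ?thesis by simp
  qed
  have l: "0 \<bullet> b \<le> ?u \<bullet> b" if "b \<in> Basis" for b
    using b[OF that] by simp
  have "emeasure torus (space torus) = emeasure lborel Qbox"
    by (simp add: torus_eq emeasure_restrict_space space_restrict_space)
  also have "... = ennreal ((2 * pi) ^ 4)"
  proof (rule antisym)
    have "emeasure lborel Qbox \<le> emeasure lborel (cbox 0 ?u)"
      by (intro emeasure_mono) (auto simp: Qbox_def cbox_def Basis_vec_def inner_axis less_imp_le)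
    also have "... = ennreal ((2 * pi) ^ 4)"
      using emeasure_lborel_cbox[OF l] p by simp
    finally show "emeasure lborel Qbox \<le> ennreal ((2 * pi) ^ 4)" .
    have "ennreal ((2 * pi) ^ 4) = emeasure lborel (box 0 ?u)"
      using emeasure_lborel_box[OF l] p by simp
    also have "... \<le> emeasure lborel Qbox"
      by (intro emeasure_mono) (auto simp: Qbox_def box_def Basis_vec_def inner_axis less_imp_le)
    finally show "ennreal ((2 * pi) ^ 4) \<le> emeasure lborel Qbox" .
  qed
  finally show ?thesis .
qed

interpretation torus: finite_measure torus
  by (rule finite_measureI) (simp only: emeasure_torus, simp)

lemma measure_torus [simp]: "measure torus (space torus) = (2 * pi) ^ 4"
  using emeasure_torus by (simp add: measure_def del: space_torus)

lemma lat_nth [simp]: "lat k $ i = real_of_int (k $ i)" by (simp add: lat_def)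

lemma lat_add: "lat (k + l) = lat k + lat l" by (simp add: lat_def vec_eq_iff)
lemma lat_minus: "lat (- k) = - lat k" by (simp add: lat_def vec_eq_iff)
lemma lat_diff: "lat (k - l) = lat k - lat l" by (simp add: lat_def vec_eq_iff)
lemma lat_zero [simp]: "lat 0 = 0" by (simp add: lat_def vec_eq_iff)

definition cell :: "real ^ 4 => int ^ 4" where
  "cell x = (\<chi> i. \<lfloor>x $ i / (2 * pi)\<rfloor>)"

text \<open>Because the box is half-open, its lattice translates cover each point exactly once; this
  is what makes the tilings below exact.\<close>

lemma Qbox_shift_iff: "x - (2 * pi) *\<^sub>R lat k \<in> Qbox \<longleftrightarrow> k = cell x"
proof -
  have "(0 \<le> x $ i - 2 * pi * real_of_int (k $ i) \<and> x $ i - 2 * pi * real_of_int (k $ i) < 2 * pi)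
      \<longleftrightarrow> k $ i = \<lfloor>x $ i / (2 * pi)\<rfloor>" for i
  proof -
    have "k $ i = \<lfloor>x $ i / (2 * pi)\<rfloor> \<longleftrightarrow> real_of_int (k $ i) \<le> x $ i / (2 * pi) \<and> x $ i / (2 * pi) < real_of_int (k $ i) + 1"
      by (metis floor_eq_iff)
    then show ?thesis by (simp add: field_simps)
  qed
  then show ?thesis by (simp add: Qbox_def cell_def vec_eq_iff)
qed

lemma nn_integral_lborel_shift:
  fixes f :: "real ^ 4 => ennreal"
  assumes [measurable]: "f \<in> borel_measurable borel"
  shows "(\<integral>\<^sup>+x. f (x + c) \<partial>lborel) = (\<integral>\<^sup>+x. f x \<partial>lborel)"
proof -
  have "(\<integral>\<^sup>+x. f x \<partial>lborel) = (\<integral>\<^sup>+x. f x \<partial>distr lborel borel ((+) c))"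
    by (simp add: lborel_distr_plus)
  also have "... = (\<integral>\<^sup>+x. f (c + x) \<partial>lborel)"
    by (rule nn_integral_distr) measurable
  finally show ?thesis by (simp only: add.commute[of c])
qed

lemma nn_integral_tiling:
  fixes f :: "real ^ 4 => ennreal"
  assumes [measurable]: "f \<in> borel_measurable borel"
  shows "(\<integral>\<^sup>+x. f x \<partial>lborel) = (\<Oplus>k. (\<integral>\<^sup>+x. f (x + (2 * pi) *\<^sub>R lat k) \<partial>torus))"
proof -
  have "(\<integral>\<^sup>+x. f x \<partial>lborel) = (\<integral>\<^sup>+x. (\<Oplus>k. f x * indicator Qbox (x - (2 * pi) *\<^sub>R lat k)) \<partial>lborel)"
  proof (rule nn_integral_cong)
    fix x
    have "(\<Oplus>k. f x * indicator Qbox (x - (2 * pi) *\<^sub>R lat k))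
        = (\<Oplus>k. f x * indicator {cell x} k)"
      by (intro nn_integral_cong) (auto simp: indicator_def Qbox_shift_iff)
    then show "f x = (\<Oplus>k. f x * indicator Qbox (x - (2 * pi) *\<^sub>R lat k))"
      by (simp only: nn_integral_count_space_indicator_singleton)
  qed
  also have "... = (\<Oplus>k. (\<integral>\<^sup>+x. f x * indicator Qbox (x - (2 * pi) *\<^sub>R lat k) \<partial>lborel))"
    by (intro nn_integral_count_space_lborel_swap[symmetric]) measurable
  also have "... = (\<Oplus>k. (\<integral>\<^sup>+x. f (x + (2 * pi) *\<^sub>R lat k) \<partial>torus))"
  proof (rule nn_integral_cong)
    fix k :: "int ^ 4"
    have "(\<integral>\<^sup>+x. f x * indicator Qbox (x - (2 * pi) *\<^sub>R lat k) \<partial>lborel)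
      = (\<integral>\<^sup>+x. f (x + (2 * pi) *\<^sub>R lat k) * indicator Qbox (x + (2 * pi) *\<^sub>R lat k - (2 * pi) *\<^sub>R lat k) \<partial>lborel)"
      by (rule nn_integral_lborel_shift[symmetric]) measurable
    then show "(\<integral>\<^sup>+x. f x * indicator Qbox (x - (2 * pi) *\<^sub>R lat k) \<partial>lborel) = (\<integral>\<^sup>+x. f (x + (2 * pi) *\<^sub>R lat k) \<partial>torus)"
      by (simp add: nn_integral_torus)
  qed
  finally show ?thesis .
qed

definition torus_periodic :: "(real ^ 4 => 'a) => bool" where
  "torus_periodic f \<longleftrightarrow> (\<forall>x k. f (x + (2 * pi) *\<^sub>R lat k) = f x)"

text \<open>The Borel map onto the fundamental box; a periodic function is its restriction to the
  box composed with this map.\<close>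

definition red :: "real ^ 4 => real ^ 4" where
  "red x = x - (2 * pi) *\<^sub>R lat (cell x)"

lemma red_in [simp]: "red x \<in> Qbox"
  unfolding red_def by (subst Qbox_shift_iff) simp

lemma torus_periodic_red: "torus_periodic f ==> f (red x) = f x"
  unfolding torus_periodic_def red_def by (metis diff_add_cancel)

lemma cell_shift: "cell (x + (2 * pi) *\<^sub>R lat k) = cell x + k"
proof -
  have "x - (2 * pi) *\<^sub>R lat (cell x) = (x + (2 * pi) *\<^sub>R lat k) - (2 * pi) *\<^sub>R lat (cell x + k)"
    by (simp add: lat_add algebra_simps)
  then show ?thesis using Qbox_shift_iff[of "x + (2 * pi) *\<^sub>R lat k" "cell x + k"] Qbox_shift_iff[of x "cell x"] by metis
qed

lemma red_periodic: "torus_periodic red"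
  unfolding torus_periodic_def red_def cell_shift by (simp add: lat_add algebra_simps)

lemma measurable_vec_lambda [measurable (raw)]:
  fixes f :: "'a => 4 => real"
  assumes "\<And>i. (\<lambda>x. f x i) \<in> borel_measurable M"
  shows "(\<lambda>x. \<chi> i. f x i) \<in> borel_measurable M"
proof -
  have "(\<lambda>x. \<chi> i. f x i) = (\<lambda>x. \<Sum>i\<in>UNIV. f x i *\<^sub>R axis i 1)"
    using basis_expansion[of "\<chi> i. f x i" for x] by (simp add: scalar_mult_eq_scaleR)
  then show ?thesis using assms by (simp add: borel_measurable_sum borel_measurable_scaleR)
qed

lemma red_measurable [measurable]: "red \<in> borel_measurable borel"
proof -
  have "(\<lambda>x :: real ^ 4. x $ i) \<in> borel_measurable borel" for i
    by (intro borel_measurable_continuous_onI continuous_intros)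
  then have [measurable]: "(\<lambda>x :: real ^ 4. real_of_int \<lfloor>x $ i / (2 * pi)\<rfloor>) \<in> borel_measurable borel" for i
    by measurable
  have "red = (\<lambda>x. x - (2 * pi) *\<^sub>R (\<chi> i. real_of_int \<lfloor>x $ i / (2 * pi)\<rfloor>))"
    by (auto simp: red_def cell_def lat_def fun_eq_iff)
  also have "... \<in> borel_measurable borel" by measurable
  finally show ?thesis .
qed

text \<open>Translating the box gives another fundamental domain. Cutting it by the tiling and
  moving the pieces back by periods reassembles the original box.\<close>

lemma nn_integral_torus_shift:
  fixes g :: "real ^ 4 => ennreal"
  assumes [measurable]: "g \<in> borel_measurable borel" and per: "torus_periodic g"
  shows "(\<integral>\<^sup>+x. g (x + a) \<partial>torus) = (\<integral>\<^sup>+x. g x \<partial>torus)"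
proof -
  have "(\<integral>\<^sup>+x. g (x + a) \<partial>torus) = (\<integral>\<^sup>+x. g (x + a) * indicator Qbox (x + a - a) \<partial>lborel)"
    by (simp add: nn_integral_torus)
  also have "... = (\<integral>\<^sup>+x. g x * indicator Qbox (x - a) \<partial>lborel)"
    by (rule nn_integral_lborel_shift[where f="\<lambda>x. g x * indicator Qbox (x - a)"]) measurable
  also have "... = (\<Oplus>k. (\<integral>\<^sup>+x. g (x + (2 * pi) *\<^sub>R lat k) * indicator Qbox (x + (2 * pi) *\<^sub>R lat k - a) \<partial>torus))"
    by (rule nn_integral_tiling) measurable
  also have "... = (\<Oplus>k. (\<integral>\<^sup>+x. g x * indicator Qbox (x - a + (2 * pi) *\<^sub>R lat k) * indicator Qbox x \<partial>lborel))"
    using per by (simp add: torus_periodic_def nn_integral_torus algebra_simps)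
  also have "... = (\<integral>\<^sup>+x. (\<Oplus>k. g x * indicator Qbox (x - a + (2 * pi) *\<^sub>R lat k) * indicator Qbox x) \<partial>lborel)"
    by (rule nn_integral_count_space_lborel_swap) measurable
  also have "... = (\<integral>\<^sup>+x. g x * indicator Qbox x \<partial>lborel)"
  proof (rule nn_integral_cong)
    fix x
    have "x - a + (2 * pi) *\<^sub>R lat k \<in> Qbox \<longleftrightarrow> k = - cell (x - a)" for k
      using Qbox_shift_iff[of "x - a" "- k"] minus_equation_iff[of k "cell (x - a)"] by (auto simp: lat_minus)
    then have "(\<Oplus>k. g x * indicator Qbox (x - a + (2 * pi) *\<^sub>R lat k) * indicator Qbox x)
      = (\<Oplus>k. g x * indicator Qbox x * indicator {- cell (x - a)} k)"
      by (intro nn_integral_cong) (auto simp: indicator_def)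
    then show "(\<Oplus>k. g x * indicator Qbox (x - a + (2 * pi) *\<^sub>R lat k) * indicator Qbox x)
      = g x * indicator Qbox x"
      by (simp only: nn_integral_count_space_indicator_singleton)
  qed
  finally show ?thesis by (simp add: nn_integral_torus)
qed

text \<open>Translation invariance as an identity of image measures. In this form it transfers at
  once to Bochner integrals of complex functions.\<close>

lemma distr_red_shift: "distr torus borel (\<lambda>x. red (x + a)) = distr torus borel red"
proof (rule measure_eqI)
  fix A assume "A \<in> sets (distr torus borel (\<lambda>x. red (x + a)))"
  then have A [measurable]: "A \<in> sets borel" by simp
  have p: "torus_periodic (\<lambda>x. indicator A (red x) :: ennreal)"
    using red_periodic by (simp add: torus_periodic_def)
  have e: "emeasure (distr torus borel h) A = (\<integral>\<^sup>+x. indicator A (h x) \<partial>torus)"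
    if "h \<in> borel_measurable torus" for h :: "real ^ 4 => real ^ 4"
  proof -
    have "emeasure (distr torus borel h) A = (\<integral>\<^sup>+x. indicator A x \<partial>distr torus borel h)"
      using A by (subst nn_integral_indicator) auto
    also have "... = (\<integral>\<^sup>+x. indicator A (h x) \<partial>torus)"
      using that by (subst nn_integral_distr) auto
    finally show ?thesis .
  qed
  show "emeasure (distr torus borel (\<lambda>x. red (x + a))) A = emeasure (distr torus borel red) A"
    using nn_integral_torus_shift[OF _ p, of a]
    by (subst (1 2) e) (auto intro!: borel_measurable_torusI)
qed simp

lemma integral_torus_shift:
  fixes h :: "real ^ 4 => complex"
  assumes [measurable]: "h \<in> borel_measurable borel" and per: "torus_periodic h"
  shows "(LINT x|torus. h (x + a)) = (LINT x|torus. h x)"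
proof -
  have "(LINT x|torus. h (x + a)) = (LINT x|torus. h (red (x + a)))"
    by (simp add: torus_periodic_red[OF per])
  also have "... = (LINT x|distr torus borel (\<lambda>x. red (x + a)). h x)"
    by (subst integral_distr) (auto intro!: borel_measurable_torusI)
  also have "... = (LINT x|torus. h (red x))"
    unfolding distr_red_shift by (subst integral_distr) (auto intro!: borel_measurable_torusI)
  also have "... = (LINT x|torus. h x)"
    by (simp add: torus_periodic_red[OF per])
  finally show ?thesis .
qed

section \<open>Plane waves\<close>

lemma plane_wave_continuous [continuous_intros]: "continuous_on A (plane_wave k)"
  unfolding plane_wave_def[abs_def] cis_conv_exp by (intro continuous_intros)

lemma plane_wave_measurable [measurable]: "plane_wave k \<in> borel_measurable borel"
  by (intro borel_measurable_continuous_onI plane_wave_continuous)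

lemma norm_plane_wave [simp]: "norm (plane_wave k x) = 1" by (simp add: plane_wave_def)

lemma plane_wave_mult: "plane_wave k x * plane_wave l x = plane_wave (k + l) x"
  by (simp add: plane_wave_def cis_mult lat_add inner_add_left)

lemma plane_wave_cnj: "cnj (plane_wave k x) = plane_wave (- k) x"
  by (simp add: plane_wave_def cis_cnj lat_minus)

lemma plane_wave_zero [simp]: "plane_wave 0 x = 1" by (simp add: plane_wave_def)

lemma plane_wave_add_arg: "plane_wave k (x + y) = plane_wave k x * plane_wave k y"
  by (simp add: plane_wave_def cis_mult inner_add_right)

lemma plane_wave_lat [simp]: "plane_wave k ((2 * pi) *\<^sub>R lat l) = 1"
proof -
  have "lat k \<bullet> ((2 * pi) *\<^sub>R lat l) = 2 * pi * real_of_int (\<Sum>i\<in>UNIV. k $ i * l $ i)"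
    by (simp add: inner_vec_def sum_distrib_left mult_ac)
  then show ?thesis
    unfolding plane_wave_def by (simp only: cis_multiple_2pi Ints_of_int)
qed

lemma plane_wave_periodic: "torus_periodic (plane_wave k)"
  by (simp add: torus_periodic_def plane_wave_add_arg)

text \<open>For k with a nonzero component, translation by half a period in that coordinate
  multiplies the wave by -1 and preserves the integral, which therefore vanishes.\<close>

lemma integral_plane_wave: "(LINT x|torus. plane_wave k x) = (if k = 0 then of_real ((2 * pi) ^ 4) else 0)"
proof (cases "k = 0")
  case True
  then show ?thesis using measure_torus by (simp add: scaleR_conv_of_real)
next
  case False
  then obtain i where i: "k $ i \<noteq> 0" by (auto simp: vec_eq_iff)
  define a :: "real ^ 4" where "a = axis i (pi / real_of_int (k $ i))"
  have "lat k \<bullet> a = pi" using i by (simp add: a_def inner_axis)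
  then have "plane_wave k a = -1" by (simp add: plane_wave_def)
  moreover have "(LINT x|torus. plane_wave k x) = (LINT x|torus. plane_wave k (x + a))"
    by (rule integral_torus_shift[symmetric]) (auto simp: plane_wave_periodic)
  ultimately have "(LINT x|torus. plane_wave k x) = - (LINT x|torus. plane_wave k x)"
    by (simp add: plane_wave_add_arg)
  then show ?thesis using False by simp
qed

section \<open>Norm and inner product of square-integrable functions\<close>

lemma L2_iff: "f \<in> L2 \<longleftrightarrow> f \<in> borel_measurable torus \<and> integrable torus (\<lambda>x. (norm (f x))\<^sup>2)"
  by (simp add: L2_def)

lemma L2D: "f \<in> L2 ==> f \<in> borel_measurable torus" "f \<in> L2 ==> integrable torus (\<lambda>x. (norm (f x))\<^sup>2)"
  by (simp_all add: L2_def)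

lemma L2_dominated:
  assumes "f \<in> borel_measurable torus" "g \<in> L2" "\<And>x. x \<in> Qbox ==> norm (f x) \<le> norm (g x)"
  shows "f \<in> L2"
  unfolding L2_iff
proof
  have [measurable]: "f \<in> borel_measurable torus" by fact
  show "integrable torus (\<lambda>x. (norm (f x))\<^sup>2)"
    by (rule Bochner_Integration.integrable_bound[OF L2D(2)[OF assms(2)]])
      (use assms(3) in \<open>auto intro!: AE_I2 power_mono\<close>)
qed fact

lemma L2_bounded:
  assumes "f \<in> borel_measurable torus" "\<And>x. x \<in> Qbox ==> norm (f x) \<le> C"
  shows "f \<in> L2" and L2_nrm_bounded: "0 \<le> C ==> L2_nrm f \<le> C * (2 * pi)\<^sup>2"
proof -
  have [measurable]: "f \<in> borel_measurable torus" by fact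
  have i: "integrable torus (\<lambda>x. (norm (f x))\<^sup>2)"
    by (rule torus.integrable_const_bound[where B="C\<^sup>2"])
      (use assms(2) in \<open>auto intro!: AE_I2 power_mono\<close>)
  then show "f \<in> L2" using assms(1) by (simp add: L2_iff)
  assume C: "0 \<le> C"
  have "(LINT x|torus. (norm (f x))\<^sup>2) \<le> (LINT x|torus. C\<^sup>2)"
    using i assms(2) by (intro integral_mono) (auto intro!: power_mono)
  also have "... = (2 * pi) ^ 4 * C\<^sup>2" using measure_torus by simp
  also have "... = (C * (2 * pi)\<^sup>2)\<^sup>2" by (simp add: power_mult_distrib)
  finally show "L2_nrm f \<le> C * (2 * pi)\<^sup>2"
    unfolding L2_nrm_def using C by (intro real_le_lsqrt) auto
qed

lemma L2_nrm_nonneg [simp]: "0 \<le> L2_nrm f" by (simp add: L2_nrm_def)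

lemma L2_nrm_sq: "(L2_nrm f)\<^sup>2 = (LINT x|torus. (norm (f x))\<^sup>2)"
  by (simp add: L2_nrm_def)

lemma L2_Cauchy_Schwarz_abs:
  assumes "f \<in> L2" "h \<in> L2"
  shows "integrable torus (\<lambda>x. norm (f x) * norm (h x))"
    "(LINT x|torus. norm (f x) * norm (h x)) \<le> L2_nrm f * L2_nrm h"
proof -
  have [measurable]: "f \<in> borel_measurable torus" "h \<in> borel_measurable torus" using assms L2D by auto
  show i: "integrable torus (\<lambda>x. norm (f x) * norm (h x))"
  proof (rule Bochner_Integration.integrable_bound)
    show "integrable torus (\<lambda>x. (norm (f x))\<^sup>2 + (norm (h x))\<^sup>2)"
      using assms L2D by auto
    show "AE x in torus. norm (norm (f x) * norm (h x)) \<le> norm ((norm (f x))\<^sup>2 + (norm (h x))\<^sup>2)"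
    proof (rule AE_I2)
      fix x
      have "2 * (norm (f x) * norm (h x)) \<le> (norm (f x))\<^sup>2 + (norm (h x))\<^sup>2"
        using sum_squares_bound[of "norm (f x)" "norm (h x)"] by (simp add: mult_ac)
      moreover have "0 \<le> norm (f x) * norm (h x)" by simp
      ultimately show "norm (norm (f x) * norm (h x)) \<le> norm ((norm (f x))\<^sup>2 + (norm (h x))\<^sup>2)"
        unfolding real_norm_def by linarith
    qed
  qed measurable
  have "ennreal ((LINT x|torus. norm (f x) * norm (h x))\<^sup>2) = (\<integral>\<^sup>+x. enorm (f x) * enorm (h x) \<partial>torus)\<^sup>2"
    using nn_integral_eq_integral[OF i] by (simp add: ennreal_mult' ennreal_power[symmetric] integral_nonneg)
  also have "... \<le> (\<integral>\<^sup>+x. (enorm (f x))\<^sup>2 \<partial>torus) * (\<integral>\<^sup>+x. (enorm (h x))\<^sup>2 \<partial>torus)"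
    by (rule Cauchy_Schwarz_nn_integral) measurable
  also have "... = ennreal ((L2_nrm f)\<^sup>2 * (L2_nrm h)\<^sup>2)"
    using nn_integral_eq_integral[OF L2D(2)[OF assms(1)]] nn_integral_eq_integral[OF L2D(2)[OF assms(2)]]
    by (simp add: L2_nrm_sq ennreal_power[symmetric] ennreal_mult'')
  finally have "(LINT x|torus. norm (f x) * norm (h x))\<^sup>2 \<le> (L2_nrm f * L2_nrm h)\<^sup>2"
    by (simp add: power_mult_distrib)
  then show "(LINT x|torus. norm (f x) * norm (h x)) \<le> L2_nrm f * L2_nrm h"
    by (rule power2_le_imp_le) simp
qed

lemma L2_inner_integrable:
  assumes "f \<in> L2" "h \<in> L2"
  shows "integrable torus (\<lambda>x. cnj (f x) * h x)"
proof (rule Bochner_Integration.integrable_bound[OF L2_Cauchy_Schwarz_abs(1)[OF assms]])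
  have [measurable]: "f \<in> borel_measurable torus" "h \<in> borel_measurable torus" using assms L2D by auto
  have "(\<lambda>x. cnj (f x)) \<in> borel_measurable torus"
    using borel_measurable_continuous_on[OF continuous_on_cnj[OF continuous_on_id], of f torus] by simp
  then show "(\<lambda>x. cnj (f x) * h x) \<in> borel_measurable torus" by measurable
qed (auto simp: norm_mult)

lemma L2_Cauchy_Schwarz: "f \<in> L2 ==> h \<in> L2 ==> norm (L2_inner f h) \<le> L2_nrm f * L2_nrm h"
  unfolding L2_inner_def
  by (rule order_trans[OF integral_norm_bound])
    (use L2_Cauchy_Schwarz_abs(2) in \<open>auto simp: norm_mult\<close>)

lemma L2_add:
  assumes "f \<in> L2" "h \<in> L2"
  shows "(\<lambda>x. f x + h x) \<in> L2" "L2_nrm (\<lambda>x. f x + h x) \<le> L2_nrm f + L2_nrm h"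
proof -
  have [measurable]: "f \<in> borel_measurable torus" "h \<in> borel_measurable torus" using assms L2D by auto
  have le: "(norm (f x + h x))\<^sup>2 \<le> (norm (f x))\<^sup>2 + 2 * (norm (f x) * norm (h x)) + (norm (h x))\<^sup>2" for x
    using power_mono[OF norm_triangle_ineq[of "f x" "h x"], of 2] by (simp add: power2_sum mult_ac)
  have i: "integrable torus (\<lambda>x. (norm (f x))\<^sup>2 + 2 * (norm (f x) * norm (h x)) + (norm (h x))\<^sup>2)"
    using L2D(2)[OF assms(1)] L2D(2)[OF assms(2)] L2_Cauchy_Schwarz_abs(1)[OF assms] by auto
  have i2: "integrable torus (\<lambda>x. (norm (f x + h x))\<^sup>2)"
    by (rule Bochner_Integration.integrable_bound[OF i]) (use le in \<open>auto intro!: AE_I2 simp: order_trans[OF le abs_ge_self]\<close>)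
  then show "(\<lambda>x. f x + h x) \<in> L2" by (auto simp: L2_iff)
  have "(L2_nrm (\<lambda>x. f x + h x))\<^sup>2 \<le> (LINT x|torus. (norm (f x))\<^sup>2 + 2 * (norm (f x) * norm (h x)) + (norm (h x))\<^sup>2)"
    unfolding L2_nrm_sq by (intro integral_mono i i2 le)
  also have "... = (L2_nrm f)\<^sup>2 + 2 * (LINT x|torus. norm (f x) * norm (h x)) + (L2_nrm h)\<^sup>2"
    using L2D(2)[OF assms(1)] L2D(2)[OF assms(2)] L2_Cauchy_Schwarz_abs(1)[OF assms] by (simp add: L2_nrm_sq)
  also have "... \<le> (L2_nrm f + L2_nrm h)\<^sup>2"
    using L2_Cauchy_Schwarz_abs(2)[OF assms] by (simp add: power2_sum)
  finally show "L2_nrm (\<lambda>x. f x + h x) \<le> L2_nrm f + L2_nrm h"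
    by (rule power2_le_imp_le) simp
qed

lemma L2_cmult:
  assumes "f \<in> L2"
  shows "(\<lambda>x. c * f x) \<in> L2" "L2_nrm (\<lambda>x. c * f x) = norm c * L2_nrm f"
proof -
  have [measurable]: "f \<in> borel_measurable torus" using assms L2D by auto
  show "(\<lambda>x. c * f x) \<in> L2" using L2D(2)[OF assms] by (simp add: L2_iff norm_mult power_mult_distrib)
  show "L2_nrm (\<lambda>x. c * f x) = norm c * L2_nrm f"
    by (simp add: L2_nrm_def norm_mult power_mult_distrib real_sqrt_mult)
qed

lemma L2_diff:
  assumes "f \<in> L2" "h \<in> L2"
  shows "(\<lambda>x. f x - h x) \<in> L2" "L2_nrm (\<lambda>x. f x - h x) \<le> L2_nrm f + L2_nrm h"
  using L2_add[OF assms(1) L2_cmult(1)[OF assms(2), of "-1"]] L2_cmult(2)[OF assms(2), of "-1"] by auto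

lemma L2_zero [simp]: "(\<lambda>x. 0) \<in> L2" "L2_nrm (\<lambda>x. 0) = 0"
  by (auto simp: L2_iff L2_nrm_def)

lemma L2_sum: "finite F ==> (\<And>k. k \<in> F ==> f k \<in> L2) ==> (\<lambda>x. \<Sum>k\<in>F. f k x) \<in> L2"
  by (induction F rule: finite_induct) (auto intro: L2_add)

lemma L2_nrm_sum: "finite F ==> (\<And>k. k \<in> F ==> f k \<in> L2) ==> L2_nrm (\<lambda>x. \<Sum>k\<in>F. f k x) \<le> (\<Sum>k\<in>F. L2_nrm (f k))"
proof (induction F rule: finite_induct)
  case (insert k F)
  then show ?case using L2_add(2)[of "f k" "\<lambda>x. \<Sum>k\<in>F. f k x"] L2_sum[of F f] by fastforce
qed simp

lemma L2_inner_self: "L2_inner f f = of_real ((L2_nrm f)\<^sup>2)"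
proof -
  have "cnj z * z = of_real ((norm z)\<^sup>2)" for z by (simp only: complex_norm_square mult.commute)
  then show ?thesis unfolding L2_nrm_sq L2_inner_def by (simp only: integral_complex_of_real)
qed

lemma L2_inner_add:
  assumes "f \<in> L2" "g \<in> L2" "h \<in> L2"
  shows "L2_inner f (\<lambda>x. g x + h x) = L2_inner f g + L2_inner f h"
    "L2_inner (\<lambda>x. g x + h x) f = L2_inner g f + L2_inner h f"
  using assms by (simp_all add: L2_inner_def distrib_left distrib_right L2_inner_integrable)

lemma L2_inner_cmult:
  "L2_inner f (\<lambda>x. c * g x) = c * L2_inner f g"
  "L2_inner (\<lambda>x. c * f x) g = cnj c * L2_inner f g"
proof -
  have "L2_inner f (\<lambda>x. c * g x) = (LINT x|torus. c * (cnj (f x) * g x))"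
    unfolding L2_inner_def by (simp add: mult_ac)
  then show "L2_inner f (\<lambda>x. c * g x) = c * L2_inner f g" by (simp add: L2_inner_def)
  have "L2_inner (\<lambda>x. c * f x) g = (LINT x|torus. cnj c * (cnj (f x) * g x))"
    unfolding L2_inner_def by (simp add: mult_ac)
  then show "L2_inner (\<lambda>x. c * f x) g = cnj c * L2_inner f g" by (simp add: L2_inner_def)
qed

lemma L2_inner_cnj: "cnj (L2_inner f g) = L2_inner g f"
  unfolding L2_inner_def by (subst Bochner_Integration.integral_cnj[symmetric]) (simp add: mult.commute)

lemma L2_inner_diff:
  assumes "f \<in> L2" "g \<in> L2" "h \<in> L2"
  shows "L2_inner f (\<lambda>x. g x - h x) = L2_inner f g - L2_inner f h"
    "L2_inner (\<lambda>x. g x - h x) f = L2_inner g f - L2_inner h f"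
  using assms by (simp_all add: L2_inner_def left_diff_distrib right_diff_distrib L2_inner_integrable)

lemma L2_inner_sum:
  assumes "finite F" "f \<in> L2" "\<And>k. k \<in> F ==> g k \<in> L2"
  shows "L2_inner f (\<lambda>x. \<Sum>k\<in>F. g k x) = (\<Sum>k\<in>F. L2_inner f (g k))"
    "L2_inner (\<lambda>x. \<Sum>k\<in>F. g k x) f = (\<Sum>k\<in>F. L2_inner (g k) f)"
  using assms by (simp_all add: L2_inner_def sum_distrib_left sum_distrib_right L2_inner_integrable)

lemma plane_wave_L2 [simp]: "plane_wave k \<in> L2"
  by (rule L2_bounded[where C=1]) (auto intro: borel_measurable_torusI)

lemma L2_inner_plane_wave: "L2_inner (plane_wave k) (plane_wave l) = (if k = l then of_real ((2 * pi) ^ 4) else 0)"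
proof -
  have "L2_inner (plane_wave k) (plane_wave l) = (LINT x|torus. plane_wave (l - k) x)"
    unfolding L2_inner_def by (simp add: plane_wave_cnj plane_wave_mult)
  then show ?thesis by (auto simp: integral_plane_wave)
qed

lemma L2_nrm_plane_wave [simp]: "L2_nrm (plane_wave k) = (2 * pi)\<^sup>2"
proof -
  have "L2_nrm (plane_wave k) = sqrt (((2 * pi)\<^sup>2)\<^sup>2)"
    using measure_torus unfolding L2_nrm_def by (simp flip: power_mult)
  then show ?thesis by (simp only: real_sqrt_abs) simp
qed

lemma fourier_coeff_inner: "fourier_coeff f k = L2_inner (plane_wave k) f / of_real ((2 * pi) ^ 4)"
  by (simp add: fourier_coeff_def L2_inner_def mult.commute)

section \<open>Completeness of the plane waves\<close>

definition trigp :: "(real ^ 4 => complex) => bool" where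
  "trigp p \<longleftrightarrow> (\<exists>F c. finite F \<and> p = (\<lambda>x. \<Sum>k\<in>F. c k * plane_wave k x))"

lemma trigp_wave: "trigp (\<lambda>x. c * plane_wave k x)"
  unfolding trigp_def by (rule exI[of _ "{k}"], rule exI[of _ "\<lambda>_. c"]) auto

lemma trigp_add: assumes "trigp p" "trigp q" shows "trigp (\<lambda>x. p x + q x)"
proof -
  obtain F c where 1: "finite F" "p = (\<lambda>x. \<Sum>k\<in>F. c k * plane_wave k x)"
    using assms(1) unfolding trigp_def by blast
  obtain G d where 2: "finite G" "q = (\<lambda>x. \<Sum>k\<in>G. d k * plane_wave k x)"
    using assms(2) unfolding trigp_def by blast
  note * = 1 2
  let ?e = "\<lambda>k. (if k \<in> F then c k else 0) + (if k \<in> G then d k else 0)"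
  have "p x + q x = (\<Sum>k\<in>F \<union> G. ?e k * plane_wave k x)" for x
  proof -
    have "(\<Sum>k\<in>F. c k * plane_wave k x) = (\<Sum>k\<in>F \<union> G. (if k \<in> F then c k else 0) * plane_wave k x)"
      using * by (intro sum.mono_neutral_cong_left) auto
    moreover have "(\<Sum>k\<in>G. d k * plane_wave k x) = (\<Sum>k\<in>F \<union> G. (if k \<in> G then d k else 0) * plane_wave k x)"
      using * by (intro sum.mono_neutral_cong_left) auto
    ultimately show ?thesis by (simp add: * distrib_right sum.distrib)
  qed
  then show ?thesis unfolding trigp_def using *(1,3) by (intro exI[of _ "F \<union> G"] exI[of _ ?e]) auto
qed

lemma trigp_zero: "trigp (\<lambda>x. 0)" using trigp_wave[of 0] by simp

lemma trigp_sum: "finite F ==> (\<And>k. k \<in> F ==> trigp (p k)) ==> trigp (\<lambda>x. \<Sum>k\<in>F. p k x)"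
  by (induction F rule: finite_induct) (auto intro: trigp_add trigp_zero)

lemma trigp_mult: assumes "trigp p" "trigp q" shows "trigp (\<lambda>x. p x * q x)"
proof -
  obtain F c where 1: "finite F" "p = (\<lambda>x. \<Sum>k\<in>F. c k * plane_wave k x)"
    using assms(1) unfolding trigp_def by blast
  obtain G d where 2: "finite G" "q = (\<lambda>x. \<Sum>k\<in>G. d k * plane_wave k x)"
    using assms(2) unfolding trigp_def by blast
  note * = 1 2
  have "p x * q x = (\<Sum>k\<in>F. \<Sum>l\<in>G. (c k * d l) * plane_wave (k + l) x)" for x
    by (simp add: * sum_product plane_wave_mult[symmetric] mult_ac)
  then show ?thesis using * by (simp only:) (intro trigp_sum trigp_wave)
qed

lemma trigp_const: "trigp (\<lambda>x. c)" using trigp_wave[of c 0] by simp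

lemma trigp_L2: "trigp p ==> p \<in> L2"
  unfolding trigp_def by (auto intro!: L2_sum L2_cmult)

text \<open>The functions in the L2 closure of the trigonometric polynomials. Completeness is proved
  by enlarging this class step by step: continuous functions, indicators of closed sets, of Borel
  sets, simple functions, all of \<open>L2\<close>.\<close>

definition app :: "(real ^ 4 => complex) => bool" where
  "app f \<longleftrightarrow> f \<in> L2 \<and> (\<forall>e>0. \<exists>p. trigp p \<and> L2_nrm (\<lambda>x. f x - p x) < e)"

lemma app_trigp: "trigp p ==> app p"
  unfolding app_def by (auto simp: trigp_L2 intro!: exI[of _ p])

lemma app_limit:
  assumes f: "f \<in> L2" and g: "\<And>e. e > 0 ==> \<exists>h. app h \<and> L2_nrm (\<lambda>x. f x - h x) < e"
  shows "app f"
  unfolding app_def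
proof (intro conjI allI impI f)
  fix e :: real assume "e > 0"
  then obtain h where h: "app h" "L2_nrm (\<lambda>x. f x - h x) < e / 2" using g[of "e/2"] by auto
  then obtain p where p: "trigp p" "L2_nrm (\<lambda>x. h x - p x) < e / 2"
    using \<open>e > 0\<close> unfolding app_def by (metis half_gt_zero)
  have hL: "h \<in> L2" using h by (simp add: app_def)
  have "L2_nrm (\<lambda>x. (f x - h x) + (h x - p x)) \<le> L2_nrm (\<lambda>x. f x - h x) + L2_nrm (\<lambda>x. h x - p x)"
    by (intro L2_add L2_diff f hL trigp_L2 p)
  then show "\<exists>p. trigp p \<and> L2_nrm (\<lambda>x. f x - p x) < e" using h p by (intro exI[of _ p]) auto
qed

lemma app_add: assumes "app f" "app g" shows "app (\<lambda>x. f x + g x)"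
  unfolding app_def
proof (intro conjI allI impI)
  have L: "f \<in> L2" "g \<in> L2" using assms by (auto simp: app_def)
  then show "(\<lambda>x. f x + g x) \<in> L2" by (rule L2_add)
  fix e :: real assume "e > 0"
  then obtain p q where p: "trigp p" "L2_nrm (\<lambda>x. f x - p x) < e / 2" and q: "trigp q" "L2_nrm (\<lambda>x. g x - q x) < e / 2"
    using assms unfolding app_def by (metis half_gt_zero)
  have "L2_nrm (\<lambda>x. (f x - p x) + (g x - q x)) \<le> L2_nrm (\<lambda>x. f x - p x) + L2_nrm (\<lambda>x. g x - q x)"
    by (intro L2_add L2_diff L trigp_L2 p q)
  then show "\<exists>r. trigp r \<and> L2_nrm (\<lambda>x. f x + g x - r x) < e"
    using p q by (intro exI[of _ "\<lambda>x. p x + q x"]) (auto simp: trigp_add algebra_simps)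
qed

lemma app_cmult: assumes "app f" shows "app (\<lambda>x. c * f x)"
  unfolding app_def
proof (intro conjI allI impI)
  have L: "f \<in> L2" using assms by (auto simp: app_def)
  then show "(\<lambda>x. c * f x) \<in> L2" by (rule L2_cmult)
  fix e :: real assume "e > 0"
  then have "e / (norm c + 1) > 0" by (simp add: add_nonneg_pos)
  then obtain p where p: "trigp p" "L2_nrm (\<lambda>x. f x - p x) < e / (norm c + 1)"
    using assms unfolding app_def by metis
  have "L2_nrm (\<lambda>x. c * f x - c * p x) = norm c * L2_nrm (\<lambda>x. f x - p x)"
    using L2_cmult(2)[OF L2_diff(1)[OF L trigp_L2[OF p(1)]], of c] by (simp add: algebra_simps)
  also have "... \<le> (norm c + 1) * L2_nrm (\<lambda>x. f x - p x)" by (intro mult_right_mono) auto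
  also have "... < e" using p(2) by (simp add: pos_less_divide_eq add_nonneg_pos mult.commute)
  finally show "\<exists>r. trigp r \<and> L2_nrm (\<lambda>x. c * f x - r x) < e"
    using p(1) by (intro exI[of _ "\<lambda>x. c * p x"]) (auto intro: trigp_mult trigp_const)
qed

lemma app_sum: "finite F ==> (\<And>k. k \<in> F ==> app (f k)) ==> app (\<lambda>x. \<Sum>k\<in>F. f k x)"
  by (induction F rule: finite_induct) (auto intro: app_add app_trigp trigp_zero)

text \<open>Dominated pointwise convergence implies L2 convergence, with majorant 4|w|^2 for the
  squared differences; so the class is closed under the limits used below.\<close>

lemma app_dominated:
  assumes f: "f \<in> borel_measurable torus" and g: "\<And>n::nat. app (g n)" and w: "w \<in> L2"
    and lim: "\<And>x. x \<in> Qbox ==> (\<lambda>n. g n x) \<longlonglongrightarrow> f x"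
    and dom: "\<And>n x. x \<in> Qbox ==> norm (g n x) \<le> norm (w x)"
  shows "app f"
proof -
  have fw: "norm (f x) \<le> norm (w x)" if "x \<in> Qbox" for x
    by (rule LIMSEQ_le_const2[OF tendsto_norm[OF lim[OF that]]]) (use dom that in auto)
  have fL: "f \<in> L2" by (rule L2_dominated[OF f w fw])
  have gL: "g n \<in> L2" for n using g by (simp add: app_def)
  have "(\<lambda>n. LINT x|torus. (norm (f x - g n x))\<^sup>2) \<longlonglongrightarrow> (LINT x|torus. 0)"
  proof (rule integral_dominated_convergence[where w="\<lambda>x. 4 * (norm (w x))\<^sup>2"])
    show "integrable torus (\<lambda>x. 4 * (norm (w x))\<^sup>2)" using L2D(2)[OF w] by simp
    show "(\<lambda>x. (norm (f x - g n x))\<^sup>2) \<in> borel_measurable torus" for n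
      using L2D(1)[OF L2_diff(1)[OF fL gL]] by measurable
    show "AE x in torus. (\<lambda>n. (norm (f x - g n x))\<^sup>2) \<longlonglongrightarrow> 0"
    proof (rule AE_I2)
      fix x assume "x \<in> space torus"
      then have "(\<lambda>n. (norm (f x - g n x))\<^sup>2) \<longlonglongrightarrow> (norm (f x - f x))\<^sup>2"
        by (intro tendsto_intros lim) simp
      then show "(\<lambda>n. (norm (f x - g n x))\<^sup>2) \<longlonglongrightarrow> 0" by simp
    qed
    show "AE x in torus. norm ((norm (f x - g n x))\<^sup>2) \<le> 4 * (norm (w x))\<^sup>2" for n
    proof (rule AE_I2)
      fix x assume x: "x \<in> space torus"
      have "norm (f x - g n x) \<le> 2 * norm (w x)"
        using norm_triangle_ineq4[of "f x" "g n x"] fw[of x] dom[of x n] x by simp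
      from power_mono[OF this, of 2] show "norm ((norm (f x - g n x))\<^sup>2) \<le> 4 * (norm (w x))\<^sup>2"
        by (simp add: power_mult_distrib)
    qed
  qed simp
  then have "(\<lambda>n. sqrt (LINT x|torus. (norm (f x - g n x))\<^sup>2)) \<longlonglongrightarrow> sqrt 0"
    by (intro tendsto_real_sqrt) simp
  then have "(\<lambda>n. L2_nrm (\<lambda>x. f x - g n x)) \<longlonglongrightarrow> 0" by (simp add: L2_nrm_def)
  then have "\<exists>h. app h \<and> L2_nrm (\<lambda>x. f x - h x) < e" if "e > 0" for e
    using LIMSEQ_D[OF _ that, of "\<lambda>n. L2_nrm (\<lambda>x. f x - g n x)" 0] g by (auto simp: abs_of_nonneg)
  then show ?thesis by (rule app_limit[OF fL])
qed

text \<open>The embedding of the torus as a product of unit circles. It turns the torus into a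
  compact set on which Stone-Weierstrass applies, real polynomials in the coordinates becoming
  trigonometric polynomials.\<close>

definition circ :: "real ^ 4 => complex ^ 4" where "circ x = (\<chi> i. cis (x $ i))"

lemma circ_continuous: "continuous_on A circ"
  unfolding circ_def cis_conv_exp by (intro continuous_intros)

lemma circ_measurable: "circ \<in> borel_measurable borel"
  by (intro borel_measurable_continuous_onI circ_continuous)

lemma trigp_circ_inner: "trigp (\<lambda>x. of_real (circ x \<bullet> b))"
proof -
  have w: "plane_wave (axis i 1) x = cis (x $ i)" "plane_wave (- axis i 1) x = cnj (cis (x $ i))" for i x
  proof -
    have "lat (axis i 1) = axis i 1" by (simp add: vec_eq_iff axis_def)
    then have "lat (axis i 1) \<bullet> x = x $ i" by (simp add: inner_axis')
    then show "plane_wave (axis i 1) x = cis (x $ i)" by (simp add: plane_wave_def)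
    then show "plane_wave (- axis i 1) x = cnj (cis (x $ i))" by (simp add: plane_wave_cnj[symmetric])
  qed
  have c: "complex_of_real (z \<bullet> u) = (cnj u / 2) * z + (u / 2) * cnj z" for z u
    by (simp add: complex_eq_iff inner_complex_def field_simps)
  have "complex_of_real (circ x \<bullet> b) = (\<Sum>i\<in>UNIV. (cnj (b $ i) / 2) * plane_wave (axis i 1) x + (b $ i / 2) * plane_wave (- axis i 1) x)" for x
    unfolding inner_vec_def w by (simp add: c circ_def)
  then show ?thesis by (simp only:) (intro trigp_sum trigp_add trigp_wave finite)
qed

lemma trigp_polynomial:
  "real_polynomial_function p ==> trigp (\<lambda>x. of_real (p (circ x)))"
proof (induction p rule: real_polynomial_function.induct)
  case (linear f)
  interpret f: bounded_linear f by fact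
  have "complex_of_real (f (circ x)) = (\<Sum>b\<in>Basis. of_real (circ x \<bullet> b) * of_real (f b))" for x
  proof -
    have "f (circ x) = f (\<Sum>b\<in>Basis. (circ x \<bullet> b) *\<^sub>R b)" by (simp add: euclidean_representation)
    also have "... = (\<Sum>b\<in>Basis. (circ x \<bullet> b) * f b)" by (simp add: f.sum f.scaleR)
    finally show ?thesis by simp
  qed
  then show ?case by (simp only:) (intro trigp_sum trigp_mult trigp_circ_inner trigp_const finite_Basis)
qed (auto intro: trigp_const trigp_add trigp_mult)

text \<open>Uniform approximation by polynomials on the compact product of circles; as the torus has
  finite volume, uniform closeness gives closeness in L2.\<close>

lemma app_continuous:
  assumes g: "continuous_on UNIV g"
  shows "app (\<lambda>x. complex_of_real (g (circ x)))"
proof -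
  let ?S = "{z :: complex ^ 4. \<forall>i. norm (z $ i) = 1}"
  have S: "compact ?S"
  proof -
    have "?S = (\<Inter>i. {z. norm (z $ i) = 1})" by auto
    moreover have "closed {z :: complex ^ 4. norm (z $ i) = 1}" for i
      by (intro closed_Collect_eq continuous_intros)
    ultimately have "closed ?S" by (simp add: closed_INT)
    moreover have "bounded ?S"
    proof (rule boundedI)
      fix z assume z: "z \<in> ?S"
      have "norm z \<le> (\<Sum>i\<in>UNIV. norm (z $ i))" unfolding norm_vec_def by (rule L2_set_le_sum) simp
      then show "norm z \<le> 4" using z by simp
    qed
    ultimately show ?thesis by (simp add: compact_eq_bounded_closed)
  qed
  have cs: "circ x \<in> ?S" for x by (simp add: circ_def)
  have m: "(\<lambda>x. complex_of_real (g (circ x))) \<in> borel_measurable torus"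
    by (intro borel_measurable_torusI borel_measurable_continuous_onI continuous_on_of_real
        continuous_on_compose2[OF g circ_continuous]) auto
  have "compact (g ` ?S)" by (intro compact_continuous_image continuous_on_subset[OF g] S) auto
  then obtain C where C0: "\<forall>y\<in>g ` ?S. norm y \<le> C"
    using compact_imp_bounded[of "g ` ?S"] bounded_iff[of "g ` ?S"] by auto
  have C: "norm (g z) \<le> C" if "z \<in> ?S" for z by (rule bspec[OF C0 imageI[OF that]])
  have L: "(\<lambda>x. complex_of_real (g (circ x))) \<in> L2"
    by (rule L2_bounded[OF m, where C=C]) (use C[OF cs] in auto)
  show ?thesis
  proof (rule app_limit[OF L])
    fix e :: real assume e: "e > 0"
    define d where "d = e / (2 * (2 * pi)\<^sup>2)"
    have d: "d > 0" using e by (simp add: d_def)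
    obtain p where p: "real_polynomial_function p" "\<And>z. z \<in> ?S ==> \<bar>g z - p z\<bar> < d"
      using Stone_Weierstrass_real_polynomial_function[OF S continuous_on_subset[OF g] d] by auto
    have t: "trigp (\<lambda>x. of_real (p (circ x)))" by (rule trigp_polynomial[OF p(1)])
    have "L2_nrm (\<lambda>x. of_real (g (circ x)) - of_real (p (circ x))) \<le> d * (2 * pi)\<^sup>2"
    proof (rule L2_nrm_bounded)
      show "(\<lambda>x. complex_of_real (g (circ x)) - of_real (p (circ x))) \<in> borel_measurable torus"
        using L2_diff(1)[OF L trigp_L2[OF t]] by (rule L2D)
      show "norm (complex_of_real (g (circ x)) - of_real (p (circ x))) \<le> d" for x
        using p(2)[OF cs, of x] by (simp only: of_real_diff[symmetric] norm_of_real)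
    qed (use d in auto)
    also have "... < e" using e by (simp add: d_def)
    finally show "\<exists>h. app h \<and> L2_nrm (\<lambda>x. of_real (g (circ x)) - h x) < e"
      using app_trigp[OF t] by blast
  qed
qed

text \<open>A pi-lambda argument. The closed sets form an intersection-stable generator, and the
  indicator of a nonempty closed set is the limit of the continuous functions max 0 (1 - n dist).
  Complements and disjoint unions remain in the class by linearity and dominated
  convergence.\<close>

lemma app_indicator_circ:
  assumes A: "A \<in> sets borel"
  shows "app (\<lambda>x. indicator A (circ x))"
proof -
  have m: "(\<lambda>x. indicator A (circ x) :: complex) \<in> borel_measurable torus" if "A \<in> sets borel" for A
    using measurable_comp[OF circ_measurable borel_measurable_indicator[OF that]]
    by (intro borel_measurable_torusI) (simp add: comp_def)
  have A': "A \<in> sigma_sets UNIV (Collect closed)"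
    using A by (subst (asm) borel_eq_closed) (simp add: sets_measure_of_conv)
  have sb: "sigma_sets UNIV (Collect closed) = sets (borel :: (complex ^ 4) measure)"
    by (subst borel_eq_closed) (simp add: sets_measure_of_conv)
  have one: "(\<lambda>x. 1) \<in> L2" using trigp_L2[OF trigp_const] .
  have Ist: "Int_stable (Collect (closed :: (complex ^ 4) set => bool))" by (auto simp: Int_stable_def)
  have sub: "Collect (closed :: (complex ^ 4) set => bool) \<subseteq> Pow UNIV" by simp
  show ?thesis using Ist sub A'
  proof (induction rule: sigma_sets_induct_disjoint)
    case (basic C)
    then have C: "closed C" by simp
    show ?case
    proof (cases "C = {}")
      case True
      then show ?thesis using app_trigp[OF trigp_zero] by simp
    next
      case False
      let ?g = "\<lambda>n z. max 0 (1 - real n * infdist z C)"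
      show ?thesis
      proof (rule app_dominated[OF _ _ one])
        show "(\<lambda>x. indicator C (circ x) :: complex) \<in> borel_measurable torus" using C by (intro m) auto
        show "app (\<lambda>x. of_real (?g n (circ x)))" for n
          by (rule app_continuous) (intro continuous_intros)
        show "(\<lambda>n. complex_of_real (?g n (circ x))) \<longlonglongrightarrow> indicator C (circ x)" for x
        proof (cases "circ x \<in> C")
          case True
          then show ?thesis by simp
        next
          case F: False
          then have pos: "infdist (circ x) C > 0"
            using infdist_pos_not_in_closed[OF C False F] by simp
          then obtain N where N: "1 / infdist (circ x) C < real N" using reals_Archimedean2 by blast
          have "?g n (circ x) = 0" if "n \<ge> N" for n
          proof -
            have "1 / infdist (circ x) C < real n" using N that by linarith
            then show ?thesis using pos by (simp add: field_simps)
          qed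
          then have "\<forall>\<^sub>F n in sequentially. complex_of_real (?g n (circ x)) = indicator C (circ x)"
            using F unfolding eventually_sequentially by (intro exI[of _ N]) (auto simp del: max.bounded_iff)
          then show ?thesis by (rule tendsto_eventually)
        qed
        show "norm (complex_of_real (?g n (circ x))) \<le> norm (1 :: complex)" for n x
          using infdist_nonneg[of "circ x" C] by (simp add: norm_of_real mult_nonneg_nonneg)
      qed
    qed
  next
    case empty
    then show ?case using app_trigp[OF trigp_zero] by simp
  next
    case (compl A)
    have "(\<lambda>x. indicator (UNIV - A) (circ x) :: complex) = (\<lambda>x. 1 + (- 1) * indicator A (circ x))"
      by (auto simp: indicator_def fun_eq_iff)
    then show ?case using app_add[OF app_trigp[OF trigp_const[of 1]] app_cmult[OF compl(2), of "-1"]] by simp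
  next
    case (union A)
    show ?case
    proof (rule app_dominated[OF _ _ one])
      show "(\<lambda>x. indicator (\<Union>i. A i) (circ x) :: complex) \<in> borel_measurable torus"
        using union(2) unfolding sb by (intro m) auto
      show "app (\<lambda>x. \<Sum>i<n. indicator (A i) (circ x))" for n
        by (intro app_sum union(3)) auto
      have eq: "(\<Sum>i<n. indicator (A i) z) = (indicator (\<Union>i<n. A i) z :: complex)" for n z
        using union(1) by (intro indicator_UN_disjoint[symmetric]) (auto simp: disjoint_family_on_def)
      show "(\<lambda>n. \<Sum>i<n. indicator (A i) (circ x)) \<longlonglongrightarrow> (indicator (\<Union>i. A i) (circ x) :: complex)" for x
        unfolding eq by (rule LIMSEQ_indicator_UN)
      show "norm (\<Sum>i<n. indicator (A i) (circ x) :: complex) \<le> norm (1::complex)" for n x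
        unfolding eq by (auto simp: indicator_def)
    qed
  qed
qed

text \<open>A Borel left inverse of \<open>circ\<close> on the box, reading off the angle from the
  cosine and the sign of the sine. Clamping the real part to [-1,1] keeps arccos continuous on the
  whole space, so that measurability is immediate. Every Borel subset of the box is thereby, within
  the box, the preimage under \<open>circ\<close> of a Borel set.\<close>

definition uncirc :: "complex ^ 4 => real ^ 4" where
  "uncirc z = (\<chi> i. let a = arccos (max (- 1) (min 1 (Re (z $ i)))) in if 0 \<le> Im (z $ i) then a else 2 * pi - a)"

lemma uncirc_circ: "x \<in> Qbox ==> uncirc (circ x) = x"
proof -
  assume x: "x \<in> Qbox"
  have "(let a = arccos (max (- 1) (min 1 (Re (cis y)))) in if 0 \<le> Im (cis y) then a else 2 * pi - a) = y"
    if y: "0 \<le> y" "y < 2 * pi" for y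
  proof -
    have c: "max (- 1) (min 1 (Re (cis y))) = cos y"
by (simp add: min_absorb2 max_absorb2)
    show ?thesis
    proof (cases "y \<le> pi")
      case True
      then show ?thesis using y by (simp only: c Let_def) (simp add: arccos_cos sin_ge_zero)
    next
      case False
      have "sin y < 0" using sin_lt_zero[of y] False y by simp
      moreover have "arccos (cos y) = 2 * pi - y"
        using arccos_cos[of "2 * pi - y"] False y by (simp add: cos_diff)
      ultimately show ?thesis by (simp only: c Let_def) simp
    qed
  qed
  then show ?thesis using x by (simp add: uncirc_def circ_def vec_eq_iff Qbox_def)
qed

lemma uncirc_measurable: "uncirc \<in> borel_measurable borel"
proof -
  have 1: "(\<lambda>z :: complex ^ 4. arccos (max (- 1) (min 1 (Re (z $ i))))) \<in> borel_measurable borel" for i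
    by (intro borel_measurable_continuous_onI continuous_on_arccos continuous_intros) auto
  have 2: "(\<lambda>z :: complex ^ 4. Im (z $ i)) \<in> borel_measurable borel" for i
    by (intro borel_measurable_continuous_onI continuous_intros)
  show ?thesis
    unfolding uncirc_def Let_def
    by (rule measurable_vec_lambda) (use 1 2 in measurable)
qed

lemma app_cong:
  assumes "app g" "\<And>x. x \<in> Qbox ==> f x = g x"
  shows "app f"
proof (rule app_dominated[where g="\<lambda>_. g" and w=g])
  have "g \<in> borel_measurable torus" using assms(1) by (simp add: app_def L2D)
  then show "f \<in> borel_measurable torus"
    by (subst measurable_cong[where g=g]) (use assms(2) in auto)
  show "g \<in> L2" using assms(1) by (simp add: app_def)
qed (use assms in auto)

lemma app_indicator:
  assumes "A \<in> sets torus"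
  shows "app (indicator A)"
proof -
  have A: "A \<in> sets borel" using assms by (simp add: torus_eq sets_restrict_space_iff)
  have B: "uncirc -` A \<in> sets borel" using measurable_sets[OF uncirc_measurable A] by simp
  show ?thesis
    by (rule app_cong[OF app_indicator_circ[OF B]]) (auto simp: indicator_def uncirc_circ)
qed

text \<open>A square-integrable function is the pointwise limit of simple functions bounded by 2|f|,
  and these are finite combinations of indicators.\<close>

theorem app_L2: assumes f: "f \<in> L2" shows "app f"
proof -
  obtain G where G: "\<And>i. simple_function torus (G i)" "\<And>x. x \<in> space torus ==> (\<lambda>i. G i x) \<longlonglongrightarrow> f x"
    "\<And>i x. x \<in> space torus ==> dist (G i x) 0 \<le> 2 * dist (f x) 0"
    using borel_measurable_implies_sequence_metric[OF L2D(1)[OF f], of 0] by blast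
  have "app (G i)" for i
  proof (rule app_cong)
    show "app (\<lambda>x. \<Sum>y\<in>G i ` space torus. y * indicator (G i -` {y} \<inter> space torus) x)"
    proof (rule app_sum)
      show "finite (G i ` space torus)" using G(1) by (simp add: simple_function_def)
      fix y assume "y \<in> G i ` space torus"
      then have "G i -` {y} \<inter> space torus \<in> sets torus" using G(1)[of i] unfolding simple_function_def by blast
      then show "app (\<lambda>x. y * indicator (G i -` {y} \<inter> space torus) x)"
        by (intro app_cmult app_indicator)
    qed
    show "G i x = (\<Sum>y\<in>G i ` space torus. y * indicator (G i -` {y} \<inter> space torus) x)" if "x \<in> Qbox" for x
    proof -
      have "G i x = (\<Sum>y\<in>G i ` space torus. indicator (G i -` {y} \<inter> space torus) x *\<^sub>R y)"
        by (rule simple_function_indicator_representation_banach[OF G(1)]) (use that in simp)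
      also have "... = (\<Sum>y\<in>G i ` space torus. y * indicator (G i -` {y} \<inter> space torus) x)"
        by (intro sum.cong refl) (simp add: indicator_def)
      finally show ?thesis .
    qed
  qed
  then show ?thesis
    by (rule app_dominated[OF L2D(1)[OF f] _ L2_cmult(1)[OF f, of 2]]) (use G in \<open>auto simp: norm_mult\<close>)
qed

section \<open>Bessel, Parseval and absolutely convergent Fourier series\<close>

lemma bessel_identity:
  assumes f: "f \<in> L2" and F: "finite F"
  shows "(L2_nrm (\<lambda>x. f x - (\<Sum>k\<in>F. c k * plane_wave k x)))\<^sup>2
    = (L2_nrm f)\<^sup>2 - (2 * pi) ^ 4 * (\<Sum>k\<in>F. (norm (fourier_coeff f k))\<^sup>2)
      + (2 * pi) ^ 4 * (\<Sum>k\<in>F. (norm (c k - fourier_coeff f k))\<^sup>2)"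
proof -
  let ?p = "\<lambda>x. \<Sum>k\<in>F. c k * plane_wave k x"
  let ?v = "complex_of_real ((2 * pi) ^ 4)"
  have v: "?v \<noteq> 0" by simp
  have pL: "?p \<in> L2" by (intro L2_sum F L2_cmult) auto
  have wf: "L2_inner (plane_wave k) f = ?v * fourier_coeff f k" for k
    using v by (simp add: fourier_coeff_inner)
  have pf: "L2_inner ?p f = (\<Sum>k\<in>F. cnj (c k) * (?v * fourier_coeff f k))"
    by (subst L2_inner_sum(2)[OF F f]) (auto simp: L2_inner_cmult wf intro: L2_cmult)
  have fp: "L2_inner f ?p = (\<Sum>k\<in>F. c k * (?v * cnj (fourier_coeff f k)))"
    using arg_cong[OF pf, of cnj] by (simp add: L2_inner_cnj)
  have pp: "L2_inner ?p ?p = (\<Sum>k\<in>F. cnj (c k) * (?v * c k))"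
  proof -
    have "L2_inner (plane_wave k) ?p = ?v * (if k \<in> F then c k else 0)" for k
    proof -
      have "L2_inner (plane_wave k) ?p = (\<Sum>l\<in>F. c l * L2_inner (plane_wave k) (plane_wave l))"
        by (subst L2_inner_sum(1)[OF F]) (auto simp: L2_inner_cmult intro: L2_cmult)
      also have "... = (\<Sum>l\<in>F. if l = k then c k * ?v else 0)"
        by (intro sum.cong) (auto simp: L2_inner_plane_wave)
      finally show ?thesis using F by (simp add: sum.delta)
    qed
    then show ?thesis
      by (subst L2_inner_sum(2)[OF F pL]) (auto simp: L2_inner_cmult intro!: L2_cmult sum.cong)
  qed
  have "complex_of_real ((L2_nrm (\<lambda>x. f x - ?p x))\<^sup>2) = L2_inner f f - L2_inner f ?p - (L2_inner ?p f - L2_inner ?p ?p)"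
    unfolding L2_inner_self[symmetric]
    by (simp only: L2_inner_diff[OF L2_diff(1)[OF f pL] f pL] L2_inner_diff(2)[OF f f pL] L2_inner_diff(2)[OF pL f pL]) simp
  also have "... = of_real ((L2_nrm f)\<^sup>2) - ?v * (\<Sum>k\<in>F. c k * cnj (fourier_coeff f k) + cnj (c k) * fourier_coeff f k - cnj (c k) * c k)"
    unfolding pf fp pp L2_inner_self by (simp add: sum_distrib_left sum.distrib sum_subtractf algebra_simps)
  also have "... = of_real ((L2_nrm f)\<^sup>2) - ?v * (\<Sum>k\<in>F. of_real ((norm (fourier_coeff f k))\<^sup>2 - (norm (c k - fourier_coeff f k))\<^sup>2))"
  proof -
    have "a * cnj b + cnj a * b - cnj a * a = of_real ((norm b)\<^sup>2 - (norm (a - b))\<^sup>2)" for a b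
      unfolding of_real_diff complex_norm_square by (simp add: algebra_simps)
    then show ?thesis by (simp only:)
  qed
  also have "... = of_real ((L2_nrm f)\<^sup>2 - (2 * pi) ^ 4 * (\<Sum>k\<in>F. (norm (fourier_coeff f k))\<^sup>2)
      + (2 * pi) ^ 4 * (\<Sum>k\<in>F. (norm (c k - fourier_coeff f k))\<^sup>2))"
    by (simp add: sum_subtractf algebra_simps)
  finally show ?thesis by (simp only: of_real_eq_iff)
qed

text \<open>By the Bessel identity the Fourier partial sum over F is the best approximation with
  frequencies in F, and enlarging F only improves it. So the error falls below that of any
  approximating trigonometric polynomial once F contains its frequencies.\<close>

lemma fourier_partial_sum_limit:
  assumes f: "f \<in> L2"
  shows "((\<lambda>F. L2_nrm (\<lambda>x. f x - (\<Sum>k\<in>F. fourier_coeff f k * plane_wave k x))) \<longlongrightarrow> 0) (finite_subsets_at_top UNIV)"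
proof (rule tendstoI)
  fix e :: real assume e: "e > 0"
  obtain p where p: "trigp p" "L2_nrm (\<lambda>x. f x - p x) < e"
    using app_L2[OF f] e unfolding app_def by blast
  then obtain G c where G: "finite G" "p = (\<lambda>x. \<Sum>k\<in>G. c k * plane_wave k x)"
    unfolding trigp_def by blast
  show "\<forall>\<^sub>F F in finite_subsets_at_top UNIV. dist (L2_nrm (\<lambda>x. f x - (\<Sum>k\<in>F. fourier_coeff f k * plane_wave k x))) 0 < e"
    unfolding eventually_finite_subsets_at_top
  proof (intro exI[of _ G] conjI allI impI G(1))
    fix F assume F: "finite F \<and> G \<subseteq> F \<and> F \<subseteq> UNIV"
    have "(L2_nrm (\<lambda>x. f x - (\<Sum>k\<in>F. fourier_coeff f k * plane_wave k x)))\<^sup>2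
        = (L2_nrm f)\<^sup>2 - (2 * pi) ^ 4 * (\<Sum>k\<in>F. (norm (fourier_coeff f k))\<^sup>2)"
      using bessel_identity[OF f, of F "fourier_coeff f"] F by simp
    also have "... \<le> (L2_nrm f)\<^sup>2 - (2 * pi) ^ 4 * (\<Sum>k\<in>G. (norm (fourier_coeff f k))\<^sup>2)"
      using F by (intro diff_left_mono mult_left_mono sum_mono2) auto
    also have "... \<le> (L2_nrm (\<lambda>x. f x - p x))\<^sup>2"
      unfolding G(2) bessel_identity[OF f G(1)] by (simp add: sum_nonneg)
    finally have "L2_nrm (\<lambda>x. f x - (\<Sum>k\<in>F. fourier_coeff f k * plane_wave k x)) \<le> L2_nrm (\<lambda>x. f x - p x)"
      by (rule power2_le_imp_le) simp
    then show "dist (L2_nrm (\<lambda>x. f x - (\<Sum>k\<in>F. fourier_coeff f k * plane_wave k x))) 0 < e"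
      using p(2) by (simp add: dist_real_def)
  qed simp
qed

text \<open>Replacing f by its partial sum changes the inner product by at most the L2 error times
  the norm of h, by Cauchy-Schwarz.\<close>

lemma parseval_inner:
  assumes f: "f \<in> L2" and h: "h \<in> L2"
  shows "((\<lambda>k. of_real ((2 * pi) ^ 4) * (cnj (fourier_coeff f k) * fourier_coeff h k)) has_sum L2_inner f h) UNIV"
  unfolding has_sum_def
proof (rule Lim_transform)
  let ?p = "\<lambda>F x. \<Sum>k\<in>F. fourier_coeff f k * plane_wave k x"
  let ?S = "\<lambda>F. \<Sum>k\<in>F. of_real ((2 * pi) ^ 4) * (cnj (fourier_coeff f k) * fourier_coeff h k)"
  show "((\<lambda>F. L2_inner f h) \<longlongrightarrow> L2_inner f h) (finite_subsets_at_top UNIV)" by simp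
  have lim: "((\<lambda>F. L2_nrm (\<lambda>x. f x - ?p F x) * L2_nrm h) \<longlongrightarrow> 0 * L2_nrm h) (finite_subsets_at_top UNIV)"
    by (intro tendsto_intros fourier_partial_sum_limit f)
  have "norm (?S F - L2_inner f h) \<le> L2_nrm (\<lambda>x. f x - ?p F x) * L2_nrm h" if F: "finite F" for F
  proof -
    have pL: "?p F \<in> L2" by (intro L2_sum F L2_cmult) auto
    have wh: "L2_inner (plane_wave k) h = of_real ((2 * pi) ^ 4) * fourier_coeff h k" for k
      by (simp add: fourier_coeff_inner)
    have "L2_inner (?p F) h = ?S F"
      by (subst L2_inner_sum(2)[OF F h])
        (auto simp: L2_inner_cmult wh intro!: L2_cmult sum.cong)
    then have "L2_inner f h - ?S F = L2_inner (\<lambda>x. f x - ?p F x) h"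
      using L2_inner_diff(2)[OF h f pL] by simp
    then show ?thesis using L2_Cauchy_Schwarz[OF L2_diff(1)[OF f pL] h] by (simp add: norm_minus_commute)
  qed
  then have "\<forall>\<^sub>F F in finite_subsets_at_top UNIV. norm (?S F - L2_inner f h) \<le> L2_nrm (\<lambda>x. f x - ?p F x) * L2_nrm h"
    by (intro eventually_finite_subsets_at_top_weakI) auto
  then show "((\<lambda>F. ?S F - L2_inner f h) \<longlongrightarrow> 0) (finite_subsets_at_top UNIV)"
    by (rule Lim_null_comparison) (use lim in simp)
qed

lemma parseval_norm:
  assumes f: "f \<in> L2"
  shows "((\<lambda>k. (2 * pi) ^ 4 * (norm (fourier_coeff f k))\<^sup>2) has_sum (L2_nrm f)\<^sup>2) UNIV"
proof -
  have "((\<lambda>k. complex_of_real ((2 * pi) ^ 4 * (norm (fourier_coeff f k))\<^sup>2)) has_sum of_real ((L2_nrm f)\<^sup>2)) UNIV"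
  proof -
    have "complex_of_real ((2 * pi) ^ 4 * (norm (fourier_coeff f k))\<^sup>2) = of_real ((2 * pi) ^ 4) * (cnj (fourier_coeff f k) * fourier_coeff f k)" for k
      by (simp only: of_real_mult complex_norm_square mult.commute[of "cnj _"])
    then show ?thesis using parseval_inner[OF f f] by (simp only: L2_inner_self)
  qed
  then show ?thesis by (simp only: has_sum_of_real_iff)
qed

lemma L2_eqI:
  assumes f: "f \<in> L2" and h: "h \<in> L2" and eq: "\<And>k. fourier_coeff f k = fourier_coeff h k"
  shows "AE x in torus. f x = h x"
proof -
  have d: "(\<lambda>x. f x - h x) \<in> L2" by (intro L2_diff f h)
  have "fourier_coeff (\<lambda>x. f x - h x) k = 0" for k
    using eq[of k] by (simp add: fourier_coeff_inner L2_inner_diff[OF plane_wave_L2 f h])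
  then have "((\<lambda>k. 0) has_sum (L2_nrm (\<lambda>x. f x - h x))\<^sup>2) (UNIV :: (int ^ 4) set)"
    using parseval_norm[OF d] by simp
  then have "(LINT x|torus. (norm (f x - h x))\<^sup>2) = 0"
    using infsumI has_sum_unique[OF has_sum_0] by (metis L2_nrm_sq has_sum_0_simp has_sum_unique)
  then have "AE x in torus. (norm (f x - h x))\<^sup>2 = 0"
    using L2D(2)[OF d] by (subst (asm) integral_nonneg_eq_0_iff_AE) auto
  then show ?thesis by eventually_elim simp
qed

lemma norm_fourier_coeff_le:
  assumes "f \<in> borel_measurable torus" "\<And>x. x \<in> Qbox ==> norm (f x) \<le> C" "0 \<le> C"
  shows "norm (fourier_coeff f k) \<le> C"
proof -
  have "norm (L2_inner (plane_wave k) f) \<le> L2_nrm (plane_wave k) * L2_nrm f"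
    by (intro L2_Cauchy_Schwarz L2_bounded(1)[OF assms(1,2)]) auto
  also have "... \<le> (2 * pi)\<^sup>2 * (C * (2 * pi)\<^sup>2)"
    using L2_nrm_bounded[OF assms(1,2,3)] by (auto intro!: mult_left_mono)
  also have "... = C * (2 * pi) ^ 4" by (simp add: power_mult_distrib)
  finally show ?thesis by (simp add: fourier_coeff_inner norm_divide norm_mult norm_power pos_divide_le_eq mult_ac)
qed

lemma fourier_coeff_add: "f \<in> L2 ==> g \<in> L2 ==> fourier_coeff (\<lambda>x. f x + g x) k = fourier_coeff f k + fourier_coeff g k"
  by (simp add: fourier_coeff_inner L2_inner_add add_divide_distrib)

lemma fourier_coeff_diff: "f \<in> L2 ==> g \<in> L2 ==> fourier_coeff (\<lambda>x. f x - g x) k = fourier_coeff f k - fourier_coeff g k"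
  by (simp add: fourier_coeff_inner L2_inner_diff diff_divide_distrib)

lemma fourier_coeff_cmult: "fourier_coeff (\<lambda>x. c * f x) k = c * fourier_coeff f k"
  by (simp add: fourier_coeff_inner L2_inner_cmult)

lemma fourier_coeff_sum: "finite F ==> (\<And>a. a \<in> F ==> f a \<in> L2) ==> fourier_coeff (\<lambda>x. \<Sum>a\<in>F. f a x) k = (\<Sum>a\<in>F. fourier_coeff (f a) k)"
  by (simp add: fourier_coeff_inner L2_inner_sum sum_divide_distrib)

lemma fourier_coeff_plane_wave: "fourier_coeff (plane_wave l) k = (if l = k then 1 else 0)"
  by (simp add: fourier_coeff_inner L2_inner_plane_wave)

text \<open>The frequencies are allowed to repeat along the index set, since the series defining the
  star product is indexed by pairs (k,q) with frequency k + q. Uniform convergence lets a Fourier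
  coefficient be taken term by term.\<close>

lemma
  fixes c :: "'a => complex" and \<kappa> :: "'a => int ^ 4"
  assumes c: "(\<lambda>a. norm (c a)) summable_on UNIV"
  shows continuous_wave_series: "continuous_on UNIV (\<lambda>x. \<Sum>a. c a * plane_wave (\<kappa> a) x)"
    and norm_wave_series_le: "norm (\<Sum>a. c a * plane_wave (\<kappa> a) x) \<le> (\<Sum>a. norm (c a))"
    and wave_series_L2: "(\<lambda>x. \<Sum>a. c a * plane_wave (\<kappa> a) x) \<in> L2"
    and fourier_coeff_wave_series: "((\<lambda>a. if \<kappa> a = r then c a else 0) has_sum fourier_coeff (\<lambda>x. \<Sum>a. c a * plane_wave (\<kappa> a) x) r) UNIV"
proof -
  let ?s = "\<lambda>x. \<Sum>a. c a * plane_wave (\<kappa> a) x"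
  have u: "uniform_limit UNIV (\<lambda>X x. \<Sum>a\<in>X. c a * plane_wave (\<kappa> a) x) ?s (finite_subsets_at_top UNIV)"
    by (rule Weierstrass_m_test_general[OF _ c]) (simp add: norm_mult)
  show cont: "continuous_on UNIV ?s"
    by (rule uniform_limit_theorem[OF _ u]) (auto intro!: always_eventually continuous_intros)
  then have m: "?s \<in> borel_measurable torus"
    by (intro borel_measurable_torusI borel_measurable_continuous_onI)
  show b: "norm (?s x) \<le> (\<Sum>a. norm (c a))" for x
    using norm_infsum_bound[of "\<lambda>a. c a * plane_wave (\<kappa> a) x" UNIV] c by (simp add: norm_mult)
  show L: "?s \<in> L2" by (rule L2_bounded(1)[OF m b])
  show "((\<lambda>a. if \<kappa> a = r then c a else 0) has_sum fourier_coeff ?s r) UNIV"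
    unfolding has_sum_def
  proof (rule tendstoI)
    fix e :: real assume e: "e > 0"
    have "\<forall>\<^sub>F X in finite_subsets_at_top UNIV. \<forall>x\<in>UNIV. dist (\<Sum>a\<in>X. c a * plane_wave (\<kappa> a) x) (?s x) < e / 2"
      using uniform_limitD[OF u, of "e/2"] e by simp
    moreover have "\<forall>\<^sub>F X in finite_subsets_at_top UNIV. finite (X :: 'a set)"
      by (rule eventually_finite_subsets_at_top_weakI)
    ultimately show "\<forall>\<^sub>F X in finite_subsets_at_top UNIV. dist (\<Sum>a\<in>X. if \<kappa> a = r then c a else 0) (fourier_coeff ?s r) < e"
    proof eventually_elim
      case (elim X)
      have pL: "(\<lambda>x. \<Sum>a\<in>X. c a * plane_wave (\<kappa> a) x) \<in> L2" using elim by (intro L2_sum L2_cmult) auto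
      have "fourier_coeff (\<lambda>x. (\<Sum>a\<in>X. c a * plane_wave (\<kappa> a) x) - ?s x) r
          = (\<Sum>a\<in>X. fourier_coeff (\<lambda>x. c a * plane_wave (\<kappa> a) x) r) - fourier_coeff ?s r"
        using elim by (subst fourier_coeff_diff[OF pL L], subst fourier_coeff_sum) (auto intro: L2_cmult)
      also have "(\<Sum>a\<in>X. fourier_coeff (\<lambda>x. c a * plane_wave (\<kappa> a) x) r) = (\<Sum>a\<in>X. if \<kappa> a = r then c a else 0)"
        by (intro sum.cong) (auto simp: fourier_coeff_cmult fourier_coeff_plane_wave)
      finally have "dist (\<Sum>a\<in>X. if \<kappa> a = r then c a else 0) (fourier_coeff ?s r)
         = norm (fourier_coeff (\<lambda>x. (\<Sum>a\<in>X. c a * plane_wave (\<kappa> a) x) - ?s x) r)"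
        by (simp add: dist_norm)
      also have "... \<le> e / 2"
        by (rule norm_fourier_coeff_le[OF L2D(1)[OF L2_diff(1)[OF pL L]]])
          (use elim(1) e in \<open>auto simp: dist_norm intro: less_imp_le\<close>)
      also have "... < e" using e by simp
      finally show ?case .
    qed
  qed
qed

lemma fourier_coeff_series:
  assumes "(\<lambda>k. norm (c k)) summable_on UNIV"
  shows "fourier_coeff (\<lambda>x. \<Sum>k. c k * plane_wave k x) r = c r"
proof -
  have "((\<lambda>k. if k = r then c k else 0) has_sum fourier_coeff (\<lambda>x. \<Sum>k. c k * plane_wave k x) r) UNIV"
    using fourier_coeff_wave_series[OF assms, of "\<lambda>k. k" r] by simp
  moreover have "((\<lambda>k. if k = r then c k else 0) has_sum c r) UNIV"
    by (rule has_sum_finite_neutralI[of "{r}"]) auto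
  ultimately show ?thesis by (rule has_sum_unique)
qed

text \<open>The square sum is at most the square of the sum. It turns entrywise estimates of
  coefficients into L2 estimates, as used for the generator.\<close>

lemma L2_nrm_le_coeff:
  assumes f: "f \<in> L2" and s: "(\<lambda>k. norm (fourier_coeff f k)) summable_on UNIV"
  shows "L2_nrm f \<le> (2 * pi)\<^sup>2 * (\<Sum>k. norm (fourier_coeff f k))"
proof -
  let ?S = "\<Sum>k. norm (fourier_coeff f k)"
  have le: "norm (fourier_coeff f k) \<le> ?S" for k
    using finite_sum_le_infsum[OF s, of "{k}"] by simp
  have S0: "0 \<le> ?S" by (intro infsum_nonneg) auto
  have su: "(\<lambda>k. ?S * norm (fourier_coeff f k)) summable_on UNIV" by (intro summable_on_cmult_right s)
  have "(L2_nrm f)\<^sup>2 = (\<Sum>k. (2 * pi) ^ 4 * (norm (fourier_coeff f k))\<^sup>2)"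
    using infsumI[OF parseval_norm[OF f]] by simp
  also have "... \<le> (\<Sum>k. (2 * pi) ^ 4 * (?S * norm (fourier_coeff f k)))"
    using le by (intro infsum_mono has_sum_imp_summable[OF parseval_norm[OF f]] summable_on_cmult_right su)
      (auto simp: power2_eq_square intro!: mult_left_mono mult_right_mono)
  also have "... = ((2 * pi)\<^sup>2 * ?S)\<^sup>2"
    unfolding infsum_cmult_right' by (simp add: power2_eq_square power4_eq_xxxx mult_ac)
  finally show ?thesis by (rule power2_le_imp_le) (use S0 in auto)
qed

section \<open>Fourier coefficients of smooth functions\<close>

lemma torus_smooth_continuous: "torus_smooth f ==> continuous_on UNIV f"
  unfolding torus_smooth_def using Cdiff.simps(1) by blast

lemma torus_smooth_differentiable: "torus_smooth f ==> f differentiable (at x)"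
  unfolding torus_smooth_def using Cdiff.simps(2) by blast

lemma torus_smooth_periodic: "torus_smooth f ==> torus_periodic f"
  unfolding torus_smooth_def torus_periodic_def by blast

lemma torus_smooth_partial:
  assumes f: "torus_smooth f"
  shows "torus_smooth (partial i f)"
  unfolding torus_smooth_def
proof (intro conjI allI)
  fix n
  have "Cdiff (Suc n) f" using f unfolding torus_smooth_def by blast
  then show "Cdiff n (partial i f)" by simp
next
  fix x k
  let ?c = "(2 * pi) *\<^sub>R lat k"
  have "(f has_derivative frechet_derivative f (at (x + ?c))) (at (x + ?c))"
    using torus_smooth_differentiable[OF f] frechet_derivative_works by blast
  then have "((\<lambda>y. f (y + ?c)) has_derivative frechet_derivative f (at (x + ?c))) (at x)"
    by (rule has_derivative_compose[rotated]) (auto intro!: derivative_eq_intros)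
  moreover have "(\<lambda>y. f (y + ?c)) = f"
    using torus_smooth_periodic[OF f] by (auto simp: torus_periodic_def)
  ultimately have "(f has_derivative frechet_derivative f (at (x + ?c))) (at x)" by simp
  then show "partial i f (x + ?c) = partial i f x"
    unfolding partial_def using frechet_derivative_at by metis
qed

lemma continuous_periodic_bounded:
  fixes f :: "real ^ 4 => complex"
  assumes "continuous_on UNIV f" "torus_periodic f"
  obtains C where "0 \<le> C" "\<And>x. norm (f x) \<le> C"
proof -
  let ?K = "cbox 0 (\<chi> i. 2 * pi) :: (real ^ 4) set"
  have "compact (f ` ?K)" by (intro compact_continuous_image continuous_on_subset[OF assms(1)]) auto
  then have "bounded (f ` ?K)" by (rule compact_imp_bounded)
  then obtain C where C: "\<forall>y\<in>f ` ?K. norm y \<le> C" unfolding bounded_iff by blast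
  have "Qbox \<subseteq> ?K" by (auto simp: Qbox_def cbox_def Basis_vec_def inner_axis less_imp_le)
  then have "norm (f x) \<le> C" for x
    using bspec[OF C imageI, of "red x"] red_in[of x] unfolding torus_periodic_red[OF assms(2), of x] by blast
  then show ?thesis using that[of C] norm_ge_zero order_trans by blast
qed

text \<open>Integration by parts through translation invariance: every difference quotient of a
  periodic function has integral zero, and the quotients are bounded by the maximum of the
  derivative, so dominated convergence gives the claim for the derivative.\<close>

lemma integral_torus_partial_zero:
  fixes h :: "real ^ 4 => complex"
  assumes der: "\<And>x. (h has_derivative h' x) (at x)" and per: "torus_periodic h"
    and cont: "continuous_on UNIV (\<lambda>x. h' x (axis i 1))" and perd: "torus_periodic (\<lambda>x. h' x (axis i 1))"
  shows "(LINT x|torus. h' x (axis i 1)) = 0"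
proof -
  let ?a = "axis i 1 :: real ^ 4"
  let ?D = "\<lambda>x. h' x ?a"
  obtain M where M: "0 \<le> M" "\<And>x. norm (?D x) \<le> M" by (rule continuous_periodic_bounded[OF cont perd]) blast
  have hc: "continuous_on UNIV h"
    by (intro continuous_at_imp_continuous_on ballI has_derivative_continuous[OF der])
  have hm: "h \<in> borel_measurable borel" by (intro borel_measurable_continuous_onI hc)
  have line: "((\<lambda>u. h (x + u *\<^sub>R ?a)) has_vector_derivative ?D (x + u *\<^sub>R ?a)) (at u)" for x u
  proof -
    have "((\<lambda>u. x + u *\<^sub>R ?a) has_derivative (\<lambda>t. t *\<^sub>R ?a)) (at u)"
      by (auto intro!: derivative_eq_intros)
    from has_derivative_compose[OF this der]
    have "((\<lambda>u. h (x + u *\<^sub>R ?a)) has_derivative (\<lambda>t. h' (x + u *\<^sub>R ?a) (t *\<^sub>R ?a))) (at u)" .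
    moreover have "h' y (t *\<^sub>R ?a) = t *\<^sub>R ?D y" for y t
      using has_derivative_bounded_linear[OF der] linear_cmul bounded_linear.linear by blast
    ultimately show ?thesis by (simp add: has_vector_derivative_def)
  qed
  define F where "F n x = real (Suc n) *\<^sub>R (h (x + inverse (real (Suc n)) *\<^sub>R ?a) - h x)" for n x
  have Flim: "(\<lambda>n. F n x) \<longlonglongrightarrow> ?D x" for x
  proof -
    have "((\<lambda>u. h (x + u *\<^sub>R ?a)) has_vector_derivative ?D x) (at 0)" using line[of x 0] by simp
    then have 1: "((\<lambda>u. norm (h (x + u *\<^sub>R ?a) - h x - u *\<^sub>R ?D x) / norm u) \<longlongrightarrow> 0) (at 0)"
      unfolding has_vector_derivative_def has_derivative_at by simp
    have 2: "filterlim (\<lambda>n. inverse (real (Suc n))) (at 0) sequentially"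
      by (rule filterlim_atI[OF LIMSEQ_inverse_real_of_nat]) auto
    have "norm (h (x + inverse (real (Suc n)) *\<^sub>R ?a) - h x - inverse (real (Suc n)) *\<^sub>R ?D x) / norm (inverse (real (Suc n)))
      = norm (F n x - ?D x)" for n
    proof -
      have "F n x - ?D x = real (Suc n) *\<^sub>R (h (x + inverse (real (Suc n)) *\<^sub>R ?a) - h x - inverse (real (Suc n)) *\<^sub>R ?D x)"
        unfolding F_def scaleR_diff_right scaleR_scaleR by simp
      then show ?thesis by (simp only: norm_scaleR) (simp add: divide_inverse)
    qed
    then have "(\<lambda>n. norm (F n x - ?D x)) \<longlonglongrightarrow> 0"
      using filterlim_compose[OF 1 2] by (simp only:)
    then show ?thesis by (simp only: LIM_zero_iff tendsto_norm_zero_iff)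
  qed
  have Fb: "norm (F n x) \<le> M" for n x
  proof -
    let ?s = "inverse (real (Suc n))"
    have s: "0 < ?s" by simp
    have "norm (h (x + ?s *\<^sub>R ?a) - h (x + 0 *\<^sub>R ?a)) \<le> M * ?s - M * 0"
    proof (rule differentiable_bound_general[OF s])
      show "continuous_on {0..?s} (\<lambda>u. h (x + u *\<^sub>R ?a))"
        by (rule continuous_on_compose2[OF hc]) (auto intro!: continuous_intros)
      show "continuous_on {0..?s} (\<lambda>u. M * u)" by (intro continuous_intros)
      show "((\<lambda>u. M * u) has_vector_derivative M) (at u)" for u
        by (auto intro!: derivative_eq_intros simp: has_vector_derivative_def)
    qed (use line M in auto)
    then show ?thesis by (simp only: F_def norm_scaleR) (simp add: field_simps)
  qed
  have Fm: "F n \<in> borel_measurable torus" for n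
    unfolding F_def
    by (intro borel_measurable_torusI borel_measurable_continuous_onI continuous_intros hc continuous_on_compose2[OF hc]) auto
  have Dm: "?D \<in> borel_measurable torus"
    by (intro borel_measurable_torusI borel_measurable_continuous_onI cont)
  have lim: "(\<lambda>n. LINT x|torus. F n x) \<longlonglongrightarrow> (LINT x|torus. ?D x)"
    by (rule integral_dominated_convergence[where w="\<lambda>_. M"]) (use Dm Fm Fb Flim in auto)
  have "(LINT x|torus. F n x) = 0" for n
  proof -
    obtain C where C: "\<And>x. norm (h x) \<le> C" by (rule continuous_periodic_bounded[OF hc per]) blast
    have i1: "integrable torus h"
      by (rule torus.integrable_const_bound[where B=C]) (use C hm borel_measurable_torusI in auto)
    have i2: "integrable torus (\<lambda>x. h (x + c))" for c
    proof (rule torus.integrable_const_bound[where B=C])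
      show "(\<lambda>x. h (x + c)) \<in> borel_measurable torus"
        by (intro borel_measurable_torusI borel_measurable_continuous_onI continuous_on_compose2[OF hc] continuous_intros) auto
    qed (use C in auto)
    show ?thesis
      unfolding F_def using integral_torus_shift[OF hm per]
      by (simp add: i1 i2)
  qed
  then show ?thesis using lim LIMSEQ_unique[OF lim, of 0] by simp
qed

lemma plane_wave_has_derivative: "(plane_wave k has_derivative (\<lambda>h. \<i> * of_real (lat k \<bullet> h) * plane_wave k x)) (at x)"
proof -
  have "((\<lambda>x. \<i> * complex_of_real (lat k \<bullet> x)) has_derivative (\<lambda>h. \<i> * of_real (lat k \<bullet> h))) (at x)"
    by (intro has_derivative_mult_right has_derivative_of_real has_derivative_inner_right has_derivative_ident)
  from has_derivative_compose[OF this DERIV_exp[unfolded has_field_derivative_def]] show ?thesis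
    by (simp add: plane_wave_def[abs_def] cis_conv_exp mult.commute)
qed

lemma fourier_coeff_partial:
  assumes f: "torus_smooth f"
  shows "fourier_coeff (partial i f) k = \<i> * of_int (k $ i) * fourier_coeff f k"
proof -
  let ?f' = "\<lambda>x. frechet_derivative f (at x)"
  let ?h' = "\<lambda>x h. f x * (\<i> * of_real (lat (- k) \<bullet> h) * plane_wave (- k) x) + ?f' x h * plane_wave (- k) x"
  have fd: "(f has_derivative ?f' x) (at x)" for x
    using torus_smooth_differentiable[OF f] frechet_derivative_works by blast
  have fc: "continuous_on UNIV f" by (rule torus_smooth_continuous[OF f])
  have pc: "continuous_on UNIV (partial i f)" by (intro torus_smooth_continuous torus_smooth_partial f)
  have fp: "f (x + (2 * pi) *\<^sub>R lat l) = f x" for x l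
    using torus_smooth_periodic[OF f] by (simp add: torus_periodic_def)
  have pp: "partial i f (x + (2 * pi) *\<^sub>R lat l) = partial i f x" for x l
    using torus_smooth_periodic[OF torus_smooth_partial[OF f]] by (simp add: torus_periodic_def)
  have eq: "?h' x (axis i 1) = partial i f x * plane_wave (- k) x - \<i> * of_int (k $ i) * (f x * plane_wave (- k) x)" for x
    by (simp add: partial_def inner_axis algebra_simps)
  have "(LINT x|torus. ?h' x (axis i 1)) = 0"
  proof (rule integral_torus_partial_zero)
    show "((\<lambda>x. f x * plane_wave (- k) x) has_derivative ?h' x) (at x)" for x
      by (rule has_derivative_mult[OF fd plane_wave_has_derivative])
    show "torus_periodic (\<lambda>x. f x * plane_wave (- k) x)"
      using plane_wave_periodic[of "- k"] by (simp add: torus_periodic_def fp)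
    show "continuous_on UNIV (\<lambda>x. ?h' x (axis i 1))"
      unfolding eq by (intro continuous_intros fc pc)
    show "torus_periodic (\<lambda>x. ?h' x (axis i 1))"
      unfolding eq using plane_wave_periodic[of "- k"] by (simp add: torus_periodic_def fp pp)
  qed
  moreover have "integrable torus (\<lambda>x. g x * plane_wave (- k) x)" if g: "continuous_on UNIV g" "torus_periodic g" for g
  proof -
    obtain C where C: "\<And>x. norm (g x) \<le> C" by (rule continuous_periodic_bounded[OF g]) blast
    show ?thesis
      by (rule torus.integrable_const_bound[where B=C])
        (use C g in \<open>auto simp: norm_mult intro!: borel_measurable_torusI borel_measurable_continuous_onI continuous_intros\<close>)
  qed
  ultimately have "(LINT x|torus. partial i f x * plane_wave (- k) x) = \<i> * of_int (k $ i) * (LINT x|torus. f x * plane_wave (- k) x)"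
    using fc pc torus_smooth_periodic[OF f] torus_smooth_periodic[OF torus_smooth_partial[OF f]] unfolding eq by simp
  then show ?thesis by (simp add: fourier_coeff_def plane_wave_cnj)
qed

lemma torus_smooth_L2: "torus_smooth f ==> f \<in> L2"
proof -
  assume f: "torus_smooth f"
  obtain C where "\<And>x. norm (f x) \<le> C"
    by (rule continuous_periodic_bounded[OF torus_smooth_continuous[OF f] torus_smooth_periodic[OF f]]) blast
  then show ?thesis
    by (intro L2_bounded(1)[where C=C] borel_measurable_torusI borel_measurable_continuous_onI torus_smooth_continuous f)
qed

lemma fourier_coeff_bounded:
  assumes f: "torus_smooth f"
  obtains C where "\<And>k. norm (fourier_coeff f k) \<le> C"
proof -
  obtain C where "0 \<le> C" "\<And>x. norm (f x) \<le> C"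
    by (rule continuous_periodic_bounded[OF torus_smooth_continuous[OF f] torus_smooth_periodic[OF f]]) blast
  then show ?thesis
    by (intro that[of C] norm_fourier_coeff_le borel_measurable_torusI borel_measurable_continuous_onI torus_smooth_continuous f) auto
qed

lemma fourier_coeff_power_bounded:
  assumes "torus_smooth f"
  obtains C where "\<And>k. \<bar>real_of_int (k $ i)\<bar> ^ n * norm (fourier_coeff f k) \<le> C"
proof -
  have sm: "torus_smooth ((partial i ^^ n) f)" for n
    by (induction n) (auto intro: assms torus_smooth_partial)
  have "norm (fourier_coeff ((partial i ^^ n) f) k) = \<bar>real_of_int (k $ i)\<bar> ^ n * norm (fourier_coeff f k)" for n k
    by (induction n) (auto simp: fourier_coeff_partial[OF sm] norm_mult)
  then show ?thesis using fourier_coeff_bounded[OF sm[of n]] that by metis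
qed

definition wt :: "int ^ 4 => real" where "wt k = 1 + (norm (lat k))\<^sup>2"

lemma wt_ge_1: "1 \<le> wt k" by (simp add: wt_def)

lemma wt_pos [simp]: "0 < wt k" using wt_ge_1[of k] by linarith

lemma wt_eq: "wt k = 1 + (\<Sum>i\<in>UNIV. (real_of_int (k $ i))\<^sup>2)"
  unfolding wt_def by (simp add: norm_vec_def L2_set_def sum_nonneg)

text \<open>Differentiation multiplies a coefficient by a frequency component, and all derivatives
  of a smooth periodic function are bounded. A power of \<open>wt\<close> is then reduced to powers
  of single components.\<close>

lemma fourier_coeff_wt_bounded:
  assumes "torus_smooth f"
  obtains C where "0 \<le> C" "\<And>k. wt k ^ n * norm (fourier_coeff f k) \<le> C"
proof -
  obtain C0 where C0: "\<And>k. norm (fourier_coeff f k) \<le> C0" by (rule fourier_coeff_bounded[OF assms]) blast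
  have "\<exists>C. \<forall>k. \<bar>real_of_int (k $ i)\<bar> ^ (2 * n) * norm (fourier_coeff f k) \<le> C" for i
    by (rule fourier_coeff_power_bounded[OF assms, of i "2 * n"]) blast
  then obtain C where C: "\<And>i k. \<bar>real_of_int (k $ i)\<bar> ^ (2 * n) * norm (fourier_coeff f k) \<le> C i" by metis
  have C00: "0 \<le> C0" using C0 norm_ge_zero order_trans by blast
  have Ci0: "0 \<le> C i" for i using order_trans[OF _ C[of 0 i]] by simp
  have "wt k ^ n * norm (fourier_coeff f k) \<le> 5 ^ n * (C0 + (\<Sum>i\<in>UNIV. C i))" for k
  proof -
    \<comment> \<open>The weight is 1 plus four squares, hence at most 5 times the largest of 1 and
      these squares; the constant 5^n comes from here.\<close>
    let ?M = "insert 1 (range (\<lambda>i. (real_of_int (k $ i))\<^sup>2))"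
    define m where "m = Max ?M"
    have le: "x \<le> m" if "x \<in> ?M" for x unfolding m_def by (rule Max_ge) (use that in auto)
    have m1: "1 \<le> m" by (rule le) simp
    have "wt k \<le> 1 + (\<Sum>i\<in>(UNIV :: 4 set). m)"
      unfolding wt_eq by (intro add_mono sum_mono le) auto
    also have "... \<le> 5 * m" using m1 by simp
    finally have "wt k ^ n \<le> (5 * m) ^ n" by (intro power_mono) (auto intro: less_imp_le)
    also have "... = 5 ^ n * m ^ n" by (simp add: power_mult_distrib)
    finally have 1: "wt k ^ n * norm (fourier_coeff f k) \<le> 5 ^ n * (m ^ n * norm (fourier_coeff f k))"
      by (simp add: mult_right_mono flip: mult.assoc)
    have "m \<in> ?M" unfolding m_def by (rule Max_in) auto
    then have "m ^ n * norm (fourier_coeff f k) \<le> C0 + (\<Sum>i\<in>UNIV. C i)"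
    proof
      assume "m = 1"
      then have "m ^ n * norm (fourier_coeff f k) \<le> C0" using C0 by simp
      then show ?thesis using Ci0 sum_nonneg[of UNIV C] by (simp add: add_increasing2)
    next
      assume "m \<in> range (\<lambda>i. (real_of_int (k $ i))\<^sup>2)"
      then obtain i where "m = (real_of_int (k $ i))\<^sup>2" by auto
      then have "m ^ n * norm (fourier_coeff f k) \<le> C i" using C[of k i] by (simp add: power_mult)
      also have "C i \<le> (\<Sum>i\<in>UNIV. C i)" by (rule member_le_sum) (use Ci0 in auto)
      finally show ?thesis using C00 by linarith
    qed
    then have "5 ^ n * (m ^ n * norm (fourier_coeff f k)) \<le> 5 ^ n * (C0 + (\<Sum>i\<in>UNIV. C i))"
      by (intro mult_left_mono) auto
    with 1 show ?thesis by linarith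
  qed
  moreover have "0 \<le> 5 ^ n * (C0 + (\<Sum>i\<in>UNIV. C i))"
    using C00 Ci0 by (intro mult_nonneg_nonneg add_nonneg_nonneg sum_nonneg) auto
  ultimately show ?thesis using that by blast
qed

lemma summable_inverse_one_plus_int_square: "(\<lambda>n :: int. 1 / (1 + (real_of_int n)\<^sup>2)) summable_on UNIV"
proof -
  have "(\<lambda>n :: nat. 1 / (real (n + 1))\<^sup>2) summable_on UNIV"
    using summable_ignore_initial_segment[OF inverse_power_summable[of 2, where 'a=real], of 1]
    by (intro summable_nonneg_imp_summable_on) (auto simp: divide_inverse)
  then have s: "(\<lambda>n :: nat. 2 * (1 / (real (n + 1))\<^sup>2)) summable_on UNIV" by (rule summable_on_cmult_right)
  have "1 / (1 + (real n)\<^sup>2) \<le> 2 * (1 / (real (n + 1))\<^sup>2)" for n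
  proof -
    have "(real (n + 1))\<^sup>2 \<le> 2 * (1 + (real n)\<^sup>2)"
      using sum_squares_bound[of "real n" 1] by (simp add: power2_sum)
    then show ?thesis by (simp add: field_simps add_pos_nonneg)
  qed
  then have n: "(\<lambda>n :: nat. 1 / (1 + (real n)\<^sup>2)) summable_on UNIV"
    by (intro summable_on_comparison_test[OF s]) auto
  have "(\<lambda>n :: int. 1 / (1 + (real_of_int n)\<^sup>2)) summable_on range int"
    by (subst summable_on_reindex) (use n in \<open>auto simp: o_def inj_on_def\<close>)
  moreover have "(\<lambda>n :: int. 1 / (1 + (real_of_int n)\<^sup>2)) summable_on range (\<lambda>n. - int n)"
    by (subst summable_on_reindex) (use n in \<open>auto simp: o_def inj_on_def\<close>)
  moreover have "range int \<union> range (\<lambda>n. - int n) = UNIV"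
    by (metis (no_types, lifting) UNIV_eq_I Un_iff int_cases2 rangeI)
  ultimately show ?thesis by (metis summable_on_union)
qed

text \<open>The fourth power of the weight dominates the product of 1 + k_i^2 over the four
  coordinates, so finite sums are bounded by the fourth power of a convergent one-dimensional
  sum.\<close>

lemma summable_inverse_wt: "(\<lambda>k. 1 / wt k ^ 4) summable_on UNIV"
proof (rule nonneg_bdd_above_summable_on)
  let ?g = "\<lambda>n :: int. 1 / (1 + (real_of_int n)\<^sup>2)"
  define C where "C = infsum ?g UNIV"
  have g: "sum ?g A \<le> C" if "finite A" for A
    unfolding C_def by (rule finite_sum_le_infsum[OF summable_inverse_one_plus_int_square that]) auto
  have "(\<Sum>k\<in>F. 1 / wt k ^ 4) \<le> C ^ 4" if F: "finite F" for F
  proof -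
    let ?A = "\<lambda>i. (\<lambda>k. k $ i) ` F"
    have le: "1 / wt k ^ 4 \<le> (\<Prod>i\<in>UNIV. ?g (k $ i))" for k
    proof -
      have "(\<Prod>i\<in>(UNIV :: 4 set). 1 + (real_of_int (k $ i))\<^sup>2) \<le> (\<Prod>i\<in>(UNIV :: 4 set). wt k)"
        unfolding wt_eq by (intro prod_mono) (auto intro!: member_le_sum)
      then have "(\<Prod>i\<in>(UNIV :: 4 set). 1 + (real_of_int (k $ i))\<^sup>2) \<le> wt k ^ 4" by simp
      moreover have "0 < (\<Prod>i\<in>(UNIV :: 4 set). 1 + (real_of_int (k $ i))\<^sup>2)" by (intro prod_pos) (auto simp: add_pos_nonneg)
      ultimately show ?thesis by (simp add: prod_dividef frac_le)
    qed
    have "(\<Sum>k\<in>F. 1 / wt k ^ 4) \<le> (\<Sum>k\<in>F. \<Prod>i\<in>UNIV. ?g (k $ i))" by (intro sum_mono le)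
    also have "... = (\<Sum>h\<in>(\<lambda>k. vec_nth k) ` F. \<Prod>i\<in>UNIV. ?g (h i))"
      by (subst sum.reindex) (auto simp: inj_on_def vec_eq_iff fun_eq_iff)
    also have "... \<le> (\<Sum>h\<in>PiE UNIV ?A. \<Prod>i\<in>UNIV. ?g (h i))"
      using F by (intro sum_mono2 finite_PiE prod_nonneg) auto
    also have "... = (\<Prod>i\<in>UNIV. \<Sum>n\<in>?A i. ?g n)"
      using F by (subst prod_sum_PiE) auto
    also have "... \<le> (\<Prod>i\<in>(UNIV :: 4 set). C)"
      using F by (intro prod_mono conjI g sum_nonneg) auto
    finally show ?thesis by simp
  qed
  then show "bdd_above (sum (\<lambda>k. 1 / wt k ^ 4) ` {F. F \<subseteq> UNIV \<and> finite F})"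
    by (intro bdd_aboveI2[where M="C ^ 4"]) auto
qed (simp add: less_imp_le)

text \<open>Boundedness with four additional powers of the weight pays for summability.\<close>

lemma fourier_coeff_wt_summable:
  assumes "torus_smooth f"
  shows "(\<lambda>k. wt k ^ n * norm (fourier_coeff f k)) summable_on UNIV"
proof -
  obtain C where C: "0 \<le> C" "\<And>k. wt k ^ (n + 4) * norm (fourier_coeff f k) \<le> C"
    by (rule fourier_coeff_wt_bounded[OF assms]) blast
  show ?thesis
  proof (rule summable_on_comparison_test[OF summable_on_cmult_right[OF summable_inverse_wt, of C]])
    fix k
    have "wt k ^ n * norm (fourier_coeff f k) * wt k ^ 4 \<le> C" using C(2)[of k] by (simp add: power_add mult_ac)
    moreover have "0 < wt k ^ 4" by (intro zero_less_power wt_pos)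
    ultimately show "wt k ^ n * norm (fourier_coeff f k) \<le> C * (1 / wt k ^ 4)" by (simp only: mult_1_right times_divide_eq_right pos_le_divide_eq)
  qed (simp add: less_imp_le)
qed

lemma fourier_coeff_summable: "torus_smooth f ==> (\<lambda>k. norm (fourier_coeff f k)) summable_on UNIV"
  using fourier_coeff_wt_summable[of f 0] by simp

text \<open>From (1 + y/4)^4 <= exp y with y = a \<open>wt k\<close>; the constant 256 is 4^4, and
  exp a compensates the 1 in the weight.\<close>

lemma exp_le_wt:
  assumes "0 < a"
  shows "exp (- a * (norm (lat k))\<^sup>2) \<le> 256 * exp a / a ^ 4 * (1 / wt k ^ 4)"
proof -
  define y where "y = a * wt k"
  have y: "0 < y" using assms by (simp add: y_def)
  have "(y / 4) ^ 4 \<le> (1 + y / 4) ^ 4" using y by (intro power_mono) auto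
  also have "... \<le> exp y" using exp_ge_one_plus_x_over_n_power_n[of 4 y] y by simp
  finally have "exp (- y) \<le> 256 / y ^ 4"
    using y by (simp add: exp_minus field_simps)
  moreover have "exp (- a * (norm (lat k))\<^sup>2) = exp a * exp (- y)"
    unfolding exp_add[symmetric] y_def wt_def by (simp add: algebra_simps)
  ultimately have "exp (- a * (norm (lat k))\<^sup>2) \<le> exp a * (256 / y ^ 4)"
    by (simp only:) (intro mult_left_mono, auto)
  then show ?thesis by (simp add: y_def power_mult_distrib mult.commute)
qed

lemma gaussian_summable:
  assumes "0 < a"
  shows "(\<lambda>k. exp (- a * (norm (lat k))\<^sup>2)) summable_on UNIV"
  by (rule summable_on_comparison_test[OF summable_on_cmult_right[OF summable_inverse_wt] exp_le_wt[OF assms]]) auto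

section \<open>The star product on Fourier coefficients\<close>

definition sb :: "real ^ 4 ^ 4 => int ^ 4 => int ^ 4 => real" where
  "sb \<Theta> k q = lat k \<bullet> (\<Theta> *v lat q)"

definition ph :: "real ^ 4 ^ 4 => int ^ 4 => int ^ 4 => complex" where
  "ph \<Theta> k q = cis (- sb \<Theta> k q / 2)"

text \<open>Twisted convolution: the star product expressed on Fourier coefficients.\<close>

definition tconv :: "real ^ 4 ^ 4 => (int ^ 4 => complex) => (int ^ 4 => complex) => int ^ 4 => complex" where
  "tconv \<Theta> a b r = (\<Sum>k. a k * b (r - k) * ph \<Theta> k (r - k))"

lemma norm_ph [simp]: "norm (ph \<Theta> k q) = 1" by (simp add: ph_def)

lemma sb_add: "sb \<Theta> (k + l) q = sb \<Theta> k q + sb \<Theta> l q" "sb \<Theta> k (q + r) = sb \<Theta> k q + sb \<Theta> k r"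
  by (simp_all add: sb_def lat_add inner_add_left inner_add_right matrix_vector_right_distrib)

lemma sb_diff: "sb \<Theta> (k - l) q = sb \<Theta> k q - sb \<Theta> l q" "sb \<Theta> k (q - r) = sb \<Theta> k q - sb \<Theta> k r"
  by (simp_all add: sb_def lat_diff inner_diff_left inner_diff_right matrix_vector_mult_diff_distrib)

lemma sb_minus: "sb \<Theta> (- k) q = - sb \<Theta> k q" "sb \<Theta> k (- q) = - sb \<Theta> k q"
  using sb_diff(1)[of \<Theta> 0 k q] sb_diff(2)[of \<Theta> k 0 q] by (simp_all add: sb_def)

lemma sb_zero [simp]: "sb \<Theta> 0 q = 0" "sb \<Theta> k 0 = 0" by (simp_all add: sb_def)

lemma ph_zero [simp]: "ph \<Theta> 0 q = 1" "ph \<Theta> k 0 = 1" by (simp_all add: ph_def)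

lemma ph_add: "ph \<Theta> (k + l) q = ph \<Theta> k q * ph \<Theta> l q" "ph \<Theta> k (q + r) = ph \<Theta> k q * ph \<Theta> k r"
  by (simp_all add: ph_def cis_mult sb_add add_divide_distrib diff_divide_distrib)

lemma sb_skew:
  assumes "transpose \<Theta> = - \<Theta>"
  shows "sb \<Theta> q k = - sb \<Theta> k q"
proof -
  have "sb \<Theta> q k = (lat q v* \<Theta>) \<bullet> lat k" by (simp add: sb_def dot_lmul_matrix)
  also have "... = (transpose \<Theta> *v lat q) \<bullet> lat k" by (simp add: transpose_matrix_vector)
  also have "... = - ((\<Theta> *v lat q) \<bullet> lat k)"
    unfolding assms by (simp add: matrix_vector_mult_def inner_vec_def sum_negf)
  finally show ?thesis by (simp add: sb_def inner_commute)
qed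

lemma sb_self: "transpose \<Theta> = - \<Theta> ==> sb \<Theta> k k = 0"
  using sb_skew[of \<Theta> k k] by simp

lemma nn_integral_shift_lattice: "(\<Oplus>r. f (r - k)) = (\<integral>\<^sup>+r. f r \<partial>count_space (UNIV :: (int ^ 4) set))"
  by (rule nn_integral_bij_count_space) (auto intro!: bij_betw_byWitness[where f'="\<lambda>r. r + k"])

lemma nn_integral_reflect_lattice: "(\<Oplus>r. f (k - r)) = (\<integral>\<^sup>+r. f r \<partial>count_space (UNIV :: (int ^ 4) set))"
  by (rule nn_integral_bij_count_space) (auto intro!: bij_betw_byWitness[where f'="\<lambda>r. k - r"])

lemma summable_norm_iff_nn:
  fixes f :: "'a => 'b::real_normed_vector"
  shows "(\<lambda>x. norm (f x)) summable_on UNIV \<longleftrightarrow> (\<Oplus>x. enorm (f x)) < \<infinity>"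
proof
  assume "(\<Oplus>x. enorm (f x)) < \<infinity>"
  then obtain c where "0 \<le> c" "(\<Oplus>x. enorm (f x)) = ennreal c"
    by (cases "\<integral>\<^sup>+x. enorm (f x) \<partial>count_space UNIV") auto
  then show "(\<lambda>x. norm (f x)) summable_on UNIV" by (intro summable_on_norm_nnI[where c=c]) auto
qed (simp add: nn_integral_count_space_infsum)

lemma summable_norm_bounded:
  fixes a :: "'a => complex"
  assumes "(\<lambda>k. norm (a k)) summable_on UNIV"
  shows "norm (a k) \<le> (\<Sum>k. norm (a k))"
  using finite_sum_le_infsum[OF assms, of "{k}"] by simp

lemma summable_norm_product:
  fixes a :: "'a => complex" and b :: "'b => complex"
  assumes "(\<lambda>k. norm (a k)) summable_on UNIV" "(\<lambda>k. norm (b k)) summable_on UNIV"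
  shows "(\<lambda>(k,q). norm (a k * b q)) summable_on UNIV"
proof -
  have "(\<Oplus>k. (\<Oplus>q. enorm (a k * b q)))
     = (\<Oplus>k. enorm (a k)) * (\<Oplus>q. enorm (b q))"
    by (simp add: norm_mult ennreal_mult' nn_integral_cmult nn_integral_multc)
  also have "... < \<infinity>"
    using assms by (simp add: summable_norm_iff_nn ennreal_mult_less_top)
  finally show ?thesis using summable_on_product_nnI(1)[of "\<lambda>k q. a k * b q"] by simp
qed

context
  fixes \<Theta> :: "real ^ 4 ^ 4"
begin

abbreviation "PH \<equiv> ph \<Theta>"

lemma tconv_summand_summable:
  assumes a: "(\<lambda>k. norm (a k)) summable_on UNIV" and b: "(\<lambda>k. norm (b k)) summable_on UNIV"
  shows "(\<lambda>k. norm (a k * b (r - k) * PH k (r - k))) summable_on UNIV"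
  by (rule summable_on_comparison_test[OF summable_on_cmult_left[OF a, of "\<Sum>k. norm (b k)"]])
    (use summable_norm_bounded[OF b] in \<open>auto simp: norm_mult intro!: mult_left_mono\<close>)

lemma tconv_has_sum_pairs:
  assumes a: "(\<lambda>k. norm (a k)) summable_on UNIV" and b: "(\<lambda>k. norm (b k)) summable_on UNIV"
  shows "((\<lambda>p. if fst p + snd p = r then a (fst p) * b (snd p) * PH (fst p) (snd p) else 0) has_sum tconv \<Theta> a b r) UNIV"
proof -
  have "((\<lambda>k. a k * b (r - k) * PH k (r - k)) has_sum tconv \<Theta> a b r) UNIV"
    unfolding tconv_def by (intro has_sum_infsum abs_summable_summable[OF tconv_summand_summable[OF a b]])
  then have "((\<lambda>p. a (fst p) * b (snd p) * PH (fst p) (snd p)) has_sum tconv \<Theta> a b r) (range (\<lambda>k. (k, r - k)))"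
    by (subst has_sum_reindex) (auto simp: inj_on_def o_def)
  also have "?this \<longleftrightarrow> ?thesis"
    by (rule has_sum_cong_neutral) (auto simp: image_iff algebra_simps)
  finally show ?thesis .
qed

lemma tconv_summable:
  assumes a: "(\<lambda>k. norm (a k)) summable_on UNIV" and b: "(\<lambda>k. norm (b k)) summable_on UNIV"
  shows "(\<lambda>r. norm (tconv \<Theta> a b r)) summable_on UNIV"
proof -
  have "(\<Oplus>r. enorm (tconv \<Theta> a b r))
     \<le> (\<Oplus>r. (\<Oplus>k. enorm (a k * b (r - k) * PH k (r - k))))"
    unfolding tconv_def by (intro nn_integral_mono ennreal_norm_infsum_le)
  also have "... = (\<Oplus>k. (\<Oplus>r. enorm (a k) * enorm (b (r - k))))"
    by (subst nn_integral_count_space_swap) (simp add: norm_mult ennreal_mult')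
  also have "... = (\<Oplus>k. enorm (a k) * (\<Oplus>r. enorm (b r)))"
    using nn_integral_shift_lattice[of "\<lambda>r. enorm (b r)"] by (simp add: nn_integral_cmult)
  also have "... = (\<Oplus>k. enorm (a k)) * (\<Oplus>q. enorm (b q))"
    by (simp add: nn_integral_multc)
  also have "... < \<infinity>"
    using assms by (simp add: summable_norm_iff_nn ennreal_mult_less_top)
  finally show ?thesis unfolding summable_norm_iff_nn .
qed

lemma
  assumes f: "(\<lambda>k. norm (fourier_coeff f k)) summable_on UNIV" and h: "(\<lambda>k. norm (fourier_coeff h k)) summable_on UNIV"
  shows fourier_coeff_star: "fourier_coeff (star \<Theta> f h) r = tconv \<Theta> (fourier_coeff f) (fourier_coeff h) r"
    and star_L2: "star \<Theta> f h \<in> L2"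
proof -
  let ?c = "\<lambda>p. fourier_coeff f (fst p) * fourier_coeff h (snd p) * PH (fst p) (snd p)"
  have c: "(\<lambda>p. norm (?c p)) summable_on UNIV"
    using summable_norm_product[OF f h] by (simp add: norm_mult case_prod_beta')
  have "exp (- (\<i> / 2) * complex_of_real (lat k \<bullet> (\<Theta> *v lat q))) = PH k q" for k q
    by (simp add: ph_def sb_def cis_conv_exp)
  then have s: "star \<Theta> f h = (\<lambda>x. \<Sum>p. ?c p * plane_wave (fst p + snd p) x)"
    unfolding star_def by (simp add: case_prod_beta' mult.assoc)
  show "star \<Theta> f h \<in> L2" unfolding s by (rule wave_series_L2[OF c])
  have "((\<lambda>p. if fst p + snd p = r then ?c p else 0) has_sum fourier_coeff (star \<Theta> f h) r) UNIV"
    unfolding s by (rule fourier_coeff_wave_series[OF c])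
  then show "fourier_coeff (star \<Theta> f h) r = tconv \<Theta> (fourier_coeff f) (fourier_coeff h) r"
    using tconv_has_sum_pairs[OF f h] has_sum_unique by blast
qed

text \<open>The entry (k,l) of the sum of \<alpha>(p,q) L(e_p) R(e_q). Frequency conservation forces
  q = k - l - p. The phase of the product of e_p, e_l and e_q is ph(p,q) ph(p,l) ph(l,q), and for
  skew \<Theta> the last two factors combine to ph(p-q,l).\<close>

definition Vmat :: "(int ^ 4 => int ^ 4 => complex) => int ^ 4 => int ^ 4 => complex" where
  "Vmat \<alpha> k l = (\<Sum>p. \<alpha> p (k - l - p) * PH p (k - l - p) * PH (p - (k - l - p)) l)"

text \<open>The three terms are left multiplication by the star square (q = 0), right multiplication
  by it (p = 0), and left and right multiplication by the field. All three fit the single form used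
  for the heat trace.\<close>

definition alpha :: "real => (int ^ 4 => complex) => int ^ 4 => int ^ 4 => complex" where
  "alpha lam a p q = of_real (lam / 6) *
     ((if q = 0 then tconv \<Theta> a a p else 0) + (if p = 0 then tconv \<Theta> a a q else 0) + a p * a q)"

lemma alpha_summable:
  assumes a: "(\<lambda>k. norm (a k)) summable_on UNIV"
  shows "(\<lambda>(p,q). norm (alpha lam a p q)) summable_on UNIV"
proof -
  let ?\<psi> = "tconv \<Theta> a a"
  have psi: "(\<lambda>k. norm (?\<psi> k)) summable_on UNIV" by (rule tconv_summable[OF a a])
  have 1: "(\<lambda>(p,q). norm (if q = 0 then ?\<psi> p else 0)) summable_on (UNIV :: ((int ^ 4) \<times> (int ^ 4)) set)"
  proof -
    have "(\<lambda>(p,q). norm (if q = 0 then ?\<psi> p else 0)) summable_on range (\<lambda>p. (p, 0 :: int ^ 4))"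
      by (subst summable_on_reindex) (auto simp: inj_on_def o_def psi)
    also have "?this \<longleftrightarrow> ?thesis" by (rule summable_on_cong_neutral) auto
    finally show ?thesis .
  qed
  have 2: "(\<lambda>(p,q). norm (if p = 0 then ?\<psi> q else 0)) summable_on (UNIV :: ((int ^ 4) \<times> (int ^ 4)) set)"
  proof -
    have "(\<lambda>(p,q). norm (if p = 0 then ?\<psi> q else 0)) summable_on range (\<lambda>q. (0 :: int ^ 4, q))"
      by (subst summable_on_reindex) (auto simp: inj_on_def o_def psi)
    also have "?this \<longleftrightarrow> ?thesis" by (rule summable_on_cong_neutral) auto
    finally show ?thesis .
  qed
  have "(\<lambda>z. norm (of_real (lam / 6) :: complex) * ((case z of (p,q) => norm (if q = 0 then ?\<psi> p else 0))
      + (case z of (p,q) => norm (if p = 0 then ?\<psi> q else 0)) + (case z of (p,q) => norm (a p * a q)))) summable_on (UNIV :: ((int ^ 4) \<times> (int ^ 4)) set)"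
    by (intro summable_on_cmult_right summable_on_add 1 2 summable_norm_product a)
  then show ?thesis
  proof (rule summable_on_comparison_test)
    fix z :: "(int ^ 4) \<times> (int ^ 4)"
    obtain p q where z: "z = (p, q)" by (cases z)
    show "(case z of (p,q) => norm (alpha lam a p q)) \<le> norm (of_real (lam / 6) :: complex) * ((case z of (p,q) => norm (if q = 0 then ?\<psi> p else 0))
      + (case z of (p,q) => norm (if p = 0 then ?\<psi> q else 0)) + (case z of (p,q) => norm (a p * a q)))"
      unfolding z alpha_def prod.case norm_mult[of "of_real (lam / 6)"]
      by (intro mult_left_mono order_trans[OF norm_triangle_ineq] add_mono norm_triangle_ineq order_refl norm_ge_zero)
  qed auto
qed

text \<open>All phases have modulus one. With p fixed, k - l - p runs once through the lattice when
  k does and once when l does, so both Schur bounds equal the total sum of |\<alpha>|.\<close>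

lemma Vmat_nn:
  assumes "(\<lambda>(p,q). norm (\<alpha> p q)) summable_on UNIV"
  shows Vmat_col_nn: "(\<Oplus>k. enorm (Vmat \<alpha> k l)) \<le> ennreal (\<Sum>\<^sub>\<infinity>(p,q). norm (\<alpha> p q))"
    and Vmat_row_nn: "(\<Oplus>l. enorm (Vmat \<alpha> k l)) \<le> ennreal (\<Sum>\<^sub>\<infinity>(p,q). norm (\<alpha> p q))"
proof -
  have tot: "(\<Oplus>p. (\<Oplus>q. enorm (\<alpha> p q))) = ennreal (\<Sum>\<^sub>\<infinity>(p,q). norm (\<alpha> p q))"
    using nn_integral_fst_count_space[of "\<lambda>(p,q). enorm (\<alpha> p q)"]
      nn_integral_count_space_infsum[of "case_prod \<alpha>" UNIV] assms by (simp add: case_prod_beta')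
  have le: "enorm (Vmat \<alpha> k l) \<le> (\<Oplus>p. enorm (\<alpha> p (k - l - p)))" for k l
  proof -
    have "enorm (Vmat \<alpha> k l) \<le> (\<Oplus>p. enorm (\<alpha> p (k - l - p) * PH p (k - l - p) * PH (p - (k - l - p)) l))"
      unfolding Vmat_def by (rule ennreal_norm_infsum_le)
    then show ?thesis by (simp add: norm_mult)
  qed
  have "(\<Oplus>k. enorm (Vmat \<alpha> k l))
      \<le> (\<Oplus>k. (\<Oplus>p. enorm (\<alpha> p (k - l - p))))"
    by (intro nn_integral_mono le)
  also have "... = (\<Oplus>p. (\<Oplus>k. enorm (\<alpha> p (k - (l + p)))))"
    by (subst nn_integral_count_space_swap) (simp add: diff_diff_eq)
  also have "... = (\<Oplus>p. (\<Oplus>q. enorm (\<alpha> p q)))"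
    by (intro nn_integral_cong nn_integral_shift_lattice)
  finally show "(\<Oplus>k. enorm (Vmat \<alpha> k l)) \<le> ennreal (\<Sum>\<^sub>\<infinity>(p,q). norm (\<alpha> p q))"
    unfolding tot .
  have "(\<Oplus>l. enorm (Vmat \<alpha> k l))
      \<le> (\<Oplus>l. (\<Oplus>p. enorm (\<alpha> p (k - l - p))))"
    by (intro nn_integral_mono le)
  also have "... = (\<Oplus>p. (\<Oplus>l. enorm (\<alpha> p ((k - p) - l))))"
    by (subst nn_integral_count_space_swap) (intro nn_integral_cong, simp add: algebra_simps)
  also have "... = (\<Oplus>p. (\<Oplus>q. enorm (\<alpha> p q)))"
    by (intro nn_integral_cong nn_integral_reflect_lattice)
  finally show "(\<Oplus>l. enorm (Vmat \<alpha> k l)) \<le> ennreal (\<Sum>\<^sub>\<infinity>(p,q). norm (\<alpha> p q))"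
    unfolding tot .
qed

lemma infsum_singleton_support:
  fixes f :: "'a => complex"
  assumes "\<And>x. x \<noteq> a ==> f x = 0"
  shows "infsum f UNIV = f a" "f summable_on UNIV"
proof -
  have "(f has_sum f a) UNIV" by (rule has_sum_finite_neutralI[of "{a}"]) (use assms in auto)
  then show "infsum f UNIV = f a" "f summable_on UNIV" by (auto simp: infsumI has_sum_imp_summable)
qed

lemma infsum_reflect_lattice:
  fixes f :: "int ^ 4 => complex"
  shows "(\<Sum>l. f (k - l)) = (\<Sum>l. f l)"
  by (rule infsum_reindex_bij_betw) (auto intro!: bij_betw_byWitness[where f'="\<lambda>r. k - r"])

text \<open>Comparison of phases, term by term. The one-sided terms follow from skew symmetry; for
  the two-sided one, ph(p-q,l) = ph(p,l) ph(l,q) regroups the product as p acting on the product of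
  l and q, after an absolutely convergent exchange of sums.\<close>

lemma Vmat_alpha_apply:
  assumes skew: "transpose \<Theta> = - \<Theta>"
    and a: "(\<lambda>k. norm (a k)) summable_on UNIV" and f: "(\<lambda>k. norm (f k)) summable_on UNIV"
  shows "(\<Sum>l. Vmat (alpha lam a) k l * f l) = of_real (lam / 6) *
     (tconv \<Theta> f (tconv \<Theta> a a) k + tconv \<Theta> (tconv \<Theta> a a) f k + tconv \<Theta> a (tconv \<Theta> f a) k)"
proof -
  let ?\<psi> = "tconv \<Theta> a a"
  have psi: "(\<lambda>k. norm (?\<psi> k)) summable_on UNIV" by (rule tconv_summable[OF a a])
  let ?T1 = "\<lambda>l. ?\<psi> (k - l) * PH (k - l) l"
  let ?T2 = "\<lambda>l. ?\<psi> (k - l) * PH l (k - l)"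
  let ?t3 = "\<lambda>l p. a p * a (k - l - p) * PH p (k - l - p) * PH (p - (k - l - p)) l"
  let ?T3 = "\<lambda>l. \<Sum>p. ?t3 l p"
  have s3: "(\<lambda>p. ?t3 l p) summable_on UNIV" for l
    by (rule abs_summable_summable[OF summable_on_comparison_test[OF tconv_summand_summable[OF a a, of "k - l"]]])
      (auto simp: norm_mult)
  have V: "Vmat (alpha lam a) k l = of_real (lam / 6) * (?T1 l + ?T2 l + ?T3 l)" for l
  proof -
    let ?h1 = "\<lambda>p. (if k - l - p = 0 then ?\<psi> p else 0) * PH p (k - l - p) * PH (p - (k - l - p)) l"
    let ?h2 = "\<lambda>p. (if p = 0 then ?\<psi> (k - l - p) else 0) * PH p (k - l - p) * PH (p - (k - l - p)) l"
    have h1: "infsum ?h1 UNIV = ?h1 (k - l)" "?h1 summable_on UNIV" by (rule infsum_singleton_support; auto)+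
    have h2: "infsum ?h2 UNIV = ?h2 0" "?h2 summable_on UNIV" by (rule infsum_singleton_support; auto)+
    have "PH (l - k) l = PH l (k - l)"
      using sb_skew[OF skew, of l "k - l"] sb_minus(1)[of \<Theta> "k - l" l] by (simp add: ph_def)
    then have e2: "?h2 0 = ?T2 l" by simp
    have e1: "?h1 (k - l) = ?T1 l" by simp
    have "Vmat (alpha lam a) k l = (\<Sum>p. of_real (lam / 6) * (?h1 p + ?h2 p + ?t3 l p))"
      unfolding Vmat_def alpha_def by (intro infsum_cong) (simp add: algebra_simps)
    also have "... = of_real (lam / 6) * (infsum ?h1 UNIV + infsum ?h2 UNIV + ?T3 l)"
      by (simp only: infsum_cmult_right' infsum_add[OF summable_on_add[OF h1(2) h2(2)] s3] infsum_add[OF h1(2) h2(2)])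
    finally show ?thesis by (simp only: h1(1) h2(1) e1 e2)
  qed
  have S1: "(\<Sum>l. ?T1 l * f l) = tconv \<Theta> ?\<psi> f k"
    using infsum_reflect_lattice[of "\<lambda>l. ?\<psi> l * f (k - l) * PH l (k - l)" k]
    by (simp add: tconv_def mult_ac)
  have S2: "(\<Sum>l. ?T2 l * f l) = tconv \<Theta> f ?\<psi> k"
    by (simp add: tconv_def mult_ac)
  have s1: "(\<lambda>l. ?T1 l * f l) summable_on UNIV" and s2: "(\<lambda>l. ?T2 l * f l) summable_on UNIV"
    by (rule abs_summable_summable[OF summable_on_comparison_test[OF tconv_summand_summable[OF f psi, of k]]];
        auto simp: norm_mult)+
  have fin3: "(\<Oplus>p. (\<Oplus>l. enorm (?t3 l p * f l))) < \<infinity>"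
  proof -
    have "(\<Oplus>p. (\<Oplus>l. enorm (?t3 l p * f l)))
      \<le> (\<Oplus>p. (\<Oplus>l. enorm (a p) * ennreal (\<Sum>k. norm (a k)) * enorm (f l)))"
      using summable_norm_bounded[OF a]
      by (intro nn_integral_mono) (auto simp: norm_mult ennreal_mult' intro!: mult_right_mono mult_left_mono ennreal_leI)
    also have "... = (\<Oplus>p. enorm (a p)) * ennreal (\<Sum>k. norm (a k)) * (\<Oplus>l. enorm (f l))"
      by (simp add: nn_integral_cmult nn_integral_multc)
    also have "... < \<infinity>"
      using a f by (simp add: summable_norm_iff_nn ennreal_mult_less_top)
    finally show ?thesis .
  qed
  have sw: "(\<lambda>(p,l). ?t3 l p * f l) summable_on UNIV \<times> UNIV"
    by (rule summable_on_product_nnI[OF fin3])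
  have fin3': "(\<Oplus>l. (\<Oplus>p. enorm (?t3 l p * f l))) < \<infinity>"
    by (subst nn_integral_count_space_swap) (rule fin3)
  have s3': "(\<lambda>l. ?T3 l * f l) summable_on UNIV"
    using summable_on_Sigma_banach[OF summable_on_product_nnI(2)[OF fin3']] by (simp add: infsum_cmult_left')
  have S3: "(\<Sum>l. ?T3 l * f l) = tconv \<Theta> a (tconv \<Theta> f a) k"
  proof -
    have "(\<Sum>l. ?T3 l * f l) = (\<Sum>l. \<Sum>p. ?t3 l p * f l)"
      by (simp only: infsum_cmult_left')
    also have "... = (\<Sum>p. \<Sum>l. ?t3 l p * f l)"
      by (rule infsum_swap_banach[OF summable_on_product_nnI(2)[OF fin3']])
    also have "... = (\<Sum>p. \<Sum>l. a p * PH p (k - p) * (f l * a (k - p - l) * PH l (k - p - l)))"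
    proof (intro infsum_cong)
      fix p l
      define q where "q = k - l - p"
      have k: "k - p = l + q" "k - p - l = q" by (auto simp: q_def)
      have "PH (p - q) l = PH p l * PH l q"
        using sb_skew[OF skew, of l q] by (simp add: ph_def cis_mult sb_diff diff_divide_distrib)
      then show "?t3 l p * f l = a p * PH p (k - p) * (f l * a (k - p - l) * PH l (k - p - l))"
        unfolding k q_def[symmetric] ph_add by (simp add: mult_ac)
    qed
    also have "... = (\<Sum>p. a p * tconv \<Theta> f a (k - p) * PH p (k - p))"
    proof (rule infsum_cong)
      fix p
      have "(\<Sum>l. a p * PH p (k - p) * (f l * a (k - p - l) * PH l (k - p - l))) = a p * PH p (k - p) * tconv \<Theta> f a (k - p)"
        unfolding tconv_def by (rule infsum_cmult_right')
      then show "(\<Sum>l. a p * PH p (k - p) * (f l * a (k - p - l) * PH l (k - p - l))) = a p * tconv \<Theta> f a (k - p) * PH p (k - p)"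
        by (simp only: mult.assoc mult.commute[of "PH p (k - p)"])
    qed
    also have "... = tconv \<Theta> a (tconv \<Theta> f a) k"
      by (rule tconv_def[symmetric])
    finally show ?thesis .
  qed
  have "(\<Sum>l. Vmat (alpha lam a) k l * f l) = (\<Sum>l. of_real (lam / 6) * (?T2 l * f l + ?T1 l * f l + ?T3 l * f l))"
    unfolding V by (intro infsum_cong) (simp only: algebra_simps)
  also have "... = of_real (lam / 6) * ((\<Sum>l. ?T2 l * f l) + (\<Sum>l. ?T1 l * f l) + (\<Sum>l. ?T3 l * f l))"
    by (simp only: infsum_cmult_right' infsum_add[OF summable_on_add[OF s2 s1] s3'] infsum_add[OF s2 s1])
  finally show ?thesis by (simp only: S1 S2 S3)
qed

definition qform :: "real ^ 4 ^ 4 => int ^ 4 => real" where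
  "qform gu k = lat k \<bullet> (gu *v lat k)"

text \<open>The second derivatives contribute the quadratic form \<open>qform\<close> with a
  positive sign, the squared factor i cancelling the minus sign in \<open>P_op\<close>; the star
  multiplications contribute the matrix \<open>Vmat\<close>.\<close>

lemma
  assumes skew: "transpose \<Theta> = - \<Theta>" and phi: "torus_smooth \<phi>" and f: "torus_smooth f"
  shows P_op_L2: "P_op gu \<Theta> lam m \<phi> f \<in> L2"
    and fourier_coeff_P_op: "fourier_coeff (P_op gu \<Theta> lam m \<phi> f) k = of_real (qform gu k + m\<^sup>2) * fourier_coeff f k
      + (\<Sum>l. Vmat (alpha lam (fourier_coeff \<phi>)) k l * fourier_coeff f l)"
proof -
  let ?a = "fourier_coeff \<phi>" and ?f = "fourier_coeff f"
  have a: "(\<lambda>k. norm (?a k)) summable_on UNIV" by (rule fourier_coeff_summable[OF phi])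
  have fs: "(\<lambda>k. norm (?f k)) summable_on UNIV" by (rule fourier_coeff_summable[OF f])
  have pp: "fourier_coeff (star \<Theta> \<phi> \<phi>) = tconv \<Theta> ?a ?a" "star \<Theta> \<phi> \<phi> \<in> L2"
    using fourier_coeff_star[OF a a] star_L2[OF a a] by auto
  have psi: "(\<lambda>k. norm (fourier_coeff (star \<Theta> \<phi> \<phi>) k)) summable_on UNIV"
    unfolding pp by (rule tconv_summable[OF a a])
  have fa: "fourier_coeff (star \<Theta> f \<phi>) = tconv \<Theta> ?f ?a"
    using fourier_coeff_star[OF fs a] by auto
  have fas: "(\<lambda>k. norm (fourier_coeff (star \<Theta> f \<phi>) k)) summable_on UNIV"
    unfolding fa by (rule tconv_summable[OF fs a])
  let ?R = "star \<Theta> f (star \<Theta> \<phi> \<phi>)" and ?L = "star \<Theta> (star \<Theta> \<phi> \<phi>) f" and ?LR = "star \<Theta> \<phi> (star \<Theta> f \<phi>)"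
  have L: "?R \<in> L2" "?L \<in> L2" "?LR \<in> L2"
    by (rule star_L2 fs psi a fas)+
  let ?p = "\<lambda>\<mu> \<nu> x. complex_of_real (gu $ \<mu> $ \<nu>) * partial \<mu> (partial \<nu> f) x"
  have pL: "?p \<mu> \<nu> \<in> L2" for \<mu> \<nu>
    by (intro L2_cmult torus_smooth_L2 torus_smooth_partial f)
  have fL: "f \<in> L2" by (rule torus_smooth_L2[OF f])
  have eq: "P_op gu \<Theta> lam m \<phi> f = (\<lambda>x. (- 1) * (\<Sum>\<mu>\<in>UNIV. \<Sum>\<nu>\<in>UNIV. ?p \<mu> \<nu> x)
     + (of_real (lam / 6) * (?R x + ?L x + ?LR x) + of_real (m\<^sup>2) * f x))"
    unfolding P_op_def[abs_def] Lmul_def Rmul_def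
    by (rule ext) (simp only: mult_minus_left mult_1_left add.assoc)
  have s1: "(\<lambda>x. \<Sum>\<nu>\<in>UNIV. ?p \<mu> \<nu> x) \<in> L2" for \<mu> by (rule L2_sum) (auto intro: pL)
  have s2: "(\<lambda>x. \<Sum>\<mu>\<in>UNIV. \<Sum>\<nu>\<in>UNIV. ?p \<mu> \<nu> x) \<in> L2" by (rule L2_sum) (auto intro: s1)
  have s3: "(\<lambda>x. of_real (lam / 6) * (?R x + ?L x + ?LR x)) \<in> L2" by (intro L2_cmult L2_add L)
  have s4: "(\<lambda>x. of_real (m\<^sup>2) * f x) \<in> L2" by (intro L2_cmult fL)
  show "P_op gu \<Theta> lam m \<phi> f \<in> L2"
    unfolding eq by (intro L2_add s3 s4 L2_cmult s2)
  have d: "fourier_coeff (\<lambda>x. \<Sum>\<mu>\<in>UNIV. \<Sum>\<nu>\<in>UNIV. ?p \<mu> \<nu> x) k = - of_real (qform gu k) * ?f k"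
  proof -
    have "fourier_coeff (\<lambda>x. \<Sum>\<mu>\<in>UNIV. \<Sum>\<nu>\<in>UNIV. ?p \<mu> \<nu> x) k = (\<Sum>\<mu>\<in>UNIV. \<Sum>\<nu>\<in>UNIV. fourier_coeff (?p \<mu> \<nu>) k)"
      by (subst fourier_coeff_sum[OF finite s1], subst fourier_coeff_sum[OF finite pL]) simp
    also have "... = (\<Sum>\<mu>\<in>UNIV. \<Sum>\<nu>\<in>UNIV. of_real (gu $ \<mu> $ \<nu>) * (\<i> * of_int (k $ \<mu>) * (\<i> * of_int (k $ \<nu>) * ?f k)))"
      by (simp only: fourier_coeff_cmult fourier_coeff_partial[OF torus_smooth_partial[OF f]] fourier_coeff_partial[OF f])
    also have "... = (\<Sum>\<mu>\<in>UNIV. \<Sum>\<nu>\<in>UNIV. - of_real (real_of_int (k $ \<mu>) * (gu $ \<mu> $ \<nu> * real_of_int (k $ \<nu>))) * ?f k)"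
      by (intro sum.cong refl) (simp add: algebra_simps)
    also have "... = - of_real (qform gu k) * ?f k"
      by (simp add: qform_def inner_vec_def matrix_vector_mult_def sum_distrib_left sum_distrib_right sum_negf)
    finally show ?thesis .
  qed
  have "fourier_coeff (P_op gu \<Theta> lam m \<phi> f) k = (- 1) * (- of_real (qform gu k) * ?f k)
     + (of_real (lam / 6) * (tconv \<Theta> ?f (tconv \<Theta> ?a ?a) k + tconv \<Theta> (tconv \<Theta> ?a ?a) ?f k + tconv \<Theta> ?a (tconv \<Theta> ?f ?a) k)
       + of_real (m\<^sup>2) * ?f k)"
    unfolding eq
    by (simp only: fourier_coeff_add L2_add L2_cmult s2 s3 s4 L fL fourier_coeff_cmult d
        fourier_coeff_star[OF fs psi] fourier_coeff_star[OF psi fs] fourier_coeff_star[OF a fas] pp fa)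
  then show "fourier_coeff (P_op gu \<Theta> lam m \<phi> f) k = of_real (qform gu k + m\<^sup>2) * ?f k
      + (\<Sum>l. Vmat (alpha lam ?a) k l * ?f l)"
    unfolding Vmat_alpha_apply[OF skew a fs] by (simp add: algebra_simps)
qed

end

section \<open>Poisson summation\<close>

lemma lborel_linear:
  fixes N N' :: "real ^ 4 ^ 4"
  assumes inv: "N ** N' = mat 1"
  shows "lborel = density (distr lborel borel ((*v) N)) (\<lambda>_. ennreal \<bar>det N\<bar>)"
proof (rule lborel_eqI)
  have inv': "N' ** N = mat 1" using inv matrix_left_right_inverse by blast
  have dd: "\<bar>det N\<bar> * \<bar>det N'\<bar> = 1"
    using arg_cong[OF inv, of det] by (simp add: det_mul abs_mult[symmetric])
  have lin: "linear ((*v) N')" by (rule matrix_vector_mul_linear)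
  have mN: "(*v) N \<in> borel_measurable borel"
    by (intro borel_measurable_continuous_onI linear_continuous_on linear_linear[THEN iffD2] matrix_vector_mul_linear)
  fix l u :: "real ^ 4" assume le: "\<And>b. b \<in> Basis ==> l \<bullet> b \<le> u \<bullet> b"
  have pre: "(*v) N -` box l u = (*v) N' ` box l u"
  proof (intro equalityI subsetI)
    fix x assume x: "x \<in> (*v) N -` box l u"
    have "x = N' *v (N *v x)" by (simp add: matrix_vector_mul_assoc inv')
    then show "x \<in> (*v) N' ` box l u" using x by blast
  next
    fix x assume "x \<in> (*v) N' ` box l u"
    then show "x \<in> (*v) N -` box l u" by (auto simp: matrix_vector_mul_assoc inv)
  qed
  have b: "box l u \<in> lmeasurable" by simp
  have ml: "(*v) N' ` box l u \<in> lmeasurable" by (rule measurable_linear_image[OF lin b])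
  have bs: "(*v) N -` box l u \<in> sets borel" using measurable_sets[OF mN, of "box l u"] by simp
  have "emeasure lborel ((*v) N -` box l u) = emeasure lebesgue ((*v) N -` box l u)"
    using bs by simp
  also have "... = ennreal (measure lebesgue ((*v) N' ` box l u))"
    unfolding pre using ml by (simp add: emeasure_eq_measure2 fmeasurableD2)
  also have "... = ennreal (\<bar>det N'\<bar> * measure lebesgue (box l u))"
    by (simp add: measure_linear_image[OF lin b])
  also have "measure lebesgue (box l u) = (\<Prod>b\<in>Basis. (u - l) \<bullet> b)"
    using le by (simp add: measure_lborel_box)
  finally have e: "emeasure lborel ((*v) N -` box l u) = ennreal (\<bar>det N'\<bar> * (\<Prod>b\<in>Basis. (u - l) \<bullet> b))" .
  have "emeasure (density (distr lborel borel ((*v) N)) (\<lambda>_. ennreal \<bar>det N\<bar>)) (box l u)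
      = ennreal \<bar>det N\<bar> * emeasure (distr lborel borel ((*v) N)) (box l u)"
    by (subst emeasure_density) (auto simp: nn_integral_cmult_indicator)
  also have "emeasure (distr lborel borel ((*v) N)) (box l u) = emeasure lborel ((*v) N -` box l u)"
    using mN by (subst emeasure_distr) auto
  also have "ennreal \<bar>det N\<bar> * emeasure lborel ((*v) N -` box l u) = ennreal ((\<bar>det N\<bar> * \<bar>det N'\<bar>) * (\<Prod>b\<in>Basis. (u - l) \<bullet> b))"
    unfolding e by (simp add: ennreal_mult'[symmetric] mult.assoc)
  finally show "emeasure (density (distr lborel borel ((*v) N)) (\<lambda>_. ennreal \<bar>det N\<bar>)) (box l u) = (\<Prod>b\<in>Basis. (u - l) \<bullet> b)"
    by (simp add: dd)
qed simp

text \<open>The characteristic function of the standard normal distribution, rescaled by sqrt(2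
  pi).\<close>

lemma gaussian_ft_1d:
  "integrable lborel (\<lambda>s. complex_of_real (exp (- s\<^sup>2 / 2)) * cis (u * s))"
  "(LINT s|lborel. complex_of_real (exp (- s\<^sup>2 / 2)) * cis (u * s)) = of_real (sqrt (2 * pi) * exp (- u\<^sup>2 / 2))"
proof -
  let ?g = "\<lambda>s. complex_of_real (exp (- s\<^sup>2 / 2)) * cis (u * s)"
  have "?g \<in> borel_measurable borel"
    unfolding cis_conv_exp by (intro borel_measurable_continuous_onI continuous_intros) auto
  then have m: "?g \<in> borel_measurable lborel" by (simp only: measurable_lborel2)
  have e: "exp (- s\<^sup>2 / 2) = sqrt (2 * pi) * std_normal_density s" for s
    by (simp add: std_normal_density_def)
  have "integrable lborel (\<lambda>s. sqrt (2 * pi) * std_normal_density s)" by simp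
  then show i: "integrable lborel ?g"
    by (rule Bochner_Integration.integrable_bound) (use m e in \<open>auto simp: norm_mult\<close>)
  have c: "(\<lambda>x. cis (u * x)) \<in> borel_measurable borel"
    unfolding cis_conv_exp by (intro borel_measurable_continuous_onI continuous_intros)
  have "char std_normal_distribution u = (LINT x|lborel. std_normal_density x *\<^sub>R cis (u * x))"
    unfolding char_def using c by (subst integral_density) (auto simp: cis_conv_exp)
  also have "... = (LINT x|lborel. of_real (1 / sqrt (2 * pi)) * ?g x)"
    by (simp only: std_normal_density_def scaleR_conv_of_real of_real_mult mult.assoc)
  also have "... = of_real (1 / sqrt (2 * pi)) * (LINT x|lborel. ?g x)"
    by simp
  finally have "of_real (exp (- u\<^sup>2 / 2)) = of_real (1 / sqrt (2 * pi)) * (LINT x|lborel. ?g x)"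
    unfolding char_std_normal_distribution by simp
  then have "of_real (sqrt (2 * pi)) * of_real (exp (- u\<^sup>2 / 2)) = of_real (sqrt (2 * pi)) * (of_real (1 / sqrt (2 * pi)) * (LINT x|lborel. ?g x))"
    by (simp only:)
  also have "... = (LINT x|lborel. ?g x)"
    by (simp flip: mult.assoc of_real_mult)
  finally show "(LINT s|lborel. ?g s) = of_real (sqrt (2 * pi) * exp (- u\<^sup>2 / 2))" by simp
qed

lemma gaussian_ft_4d:
  fixes u :: "real ^ 4"
  shows "integrable lborel (\<lambda>y. complex_of_real (exp (- (norm y)\<^sup>2 / 2)) * cis (u \<bullet> y))"
  "(LINT y|lborel. complex_of_real (exp (- (norm y)\<^sup>2 / 2)) * cis (u \<bullet> y)) = of_real ((2 * pi)\<^sup>2 * exp (- (norm u)\<^sup>2 / 2))"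
proof -
  let ?f = "\<lambda>b s. complex_of_real (exp (- s\<^sup>2 / 2)) * cis ((u \<bullet> b) * s)"
  let ?B = "Basis :: (real ^ 4) set"
  let ?T = "\<lambda>x. \<Sum>b\<in>?B. x b *\<^sub>R b"
  let ?g = "\<lambda>y. complex_of_real (exp (- (norm y)\<^sup>2 / 2)) * cis (u \<bullet> y)"
  interpret product_sigma_finite "\<lambda>b :: real ^ 4. lborel :: real measure"
    by standard
  have g: "?g y = (\<Prod>b\<in>?B. ?f b (y \<bullet> b))" for y
  proof -
    have 1: "(norm y)\<^sup>2 = (\<Sum>b\<in>?B. (y \<bullet> b)\<^sup>2)"
      unfolding power2_norm_eq_inner by (subst euclidean_inner) (simp add: power2_eq_square)
    have 2: "u \<bullet> y = (\<Sum>b\<in>?B. (u \<bullet> b) * (y \<bullet> b))" by (rule euclidean_inner)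
    have "exp (- (norm y)\<^sup>2 / 2) = (\<Prod>b\<in>?B. exp (- (y \<bullet> b)\<^sup>2 / 2))"
      unfolding 1 by (simp add: exp_sum[symmetric] sum_negf sum_divide_distrib)
    moreover have "cis (u \<bullet> y) = (\<Prod>b\<in>?B. cis ((u \<bullet> b) * (y \<bullet> b)))"
      unfolding 2 cis_conv_exp by (simp add: exp_sum[symmetric] sum_distrib_left)
    ultimately show ?thesis by (simp add: prod.distrib)
  qed
  have gT: "?g (?T x) = (\<Prod>b\<in>?B. ?f b (x b))" for x
    unfolding g by (intro prod.cong refl) (simp add: inner_sum_left_Basis)
  have mg: "?g \<in> borel_measurable borel"
    unfolding cis_conv_exp by (intro borel_measurable_continuous_onI continuous_intros) auto
  have mT: "?T \<in> measurable (Pi\<^sub>M ?B (\<lambda>b. lborel)) borel" by measurable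
  have lb: "(lborel :: (real ^ 4) measure) = distr (Pi\<^sub>M ?B (\<lambda>b. lborel)) borel ?T" by (rule lborel_eq)
  have "integrable (Pi\<^sub>M ?B (\<lambda>b. lborel)) (\<lambda>x. \<Prod>b\<in>?B. ?f b (x b))"
    by (rule product_integrable_prod[OF finite_Basis gaussian_ft_1d(1)])
  then show "integrable lborel ?g"
    by (subst lb, subst integrable_distr_eq[OF mT mg]) (simp only: gT)
  have "(LINT y|lborel. ?g y) = (LINT x|Pi\<^sub>M ?B (\<lambda>b. lborel). (\<Prod>b\<in>?B. ?f b (x b)))"
    by (subst lb, subst integral_distr[OF mT mg]) (simp only: gT)
  also have "... = (\<Prod>b\<in>?B. LINT s|lborel. ?f b s)"
    by (rule product_integral_prod[OF finite_Basis gaussian_ft_1d(1)])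
  also have "... = (\<Prod>b\<in>?B. of_real (sqrt (2 * pi) * exp (- (u \<bullet> b)\<^sup>2 / 2)))"
    by (simp only: gaussian_ft_1d(2))
  also have "... = of_real ((\<Prod>b\<in>?B. sqrt (2 * pi)) * (\<Prod>b\<in>?B. exp (- (u \<bullet> b)\<^sup>2 / 2)))"
    by (simp only: of_real_prod prod.distrib of_real_mult)
  also have "(\<Prod>b\<in>?B. sqrt (2 * pi)) = (2 * pi)\<^sup>2"
  proof -
    have "(\<Prod>b\<in>?B. sqrt (2 * pi)) = sqrt (2 * pi) ^ DIM(real ^ 4)" by (rule prod_constant)
    also have "... = sqrt (2 * pi) ^ 4" by simp
    also have "... = (2 * pi)\<^sup>2" by (simp add: power4_eq_xxxx power2_eq_square)
    finally show ?thesis .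
  qed
  also have "(\<Prod>b\<in>?B. exp (- (u \<bullet> b)\<^sup>2 / 2)) = exp (- (norm u)\<^sup>2 / 2)"
  proof -
    have 1: "(norm u)\<^sup>2 = (\<Sum>b\<in>?B. (u \<bullet> b)\<^sup>2)"
      unfolding power2_norm_eq_inner by (subst euclidean_inner) (simp add: power2_eq_square)
    show ?thesis unfolding 1 by (simp add: exp_sum[symmetric] sum_negf sum_divide_distrib)
  qed
  finally show "(LINT y|lborel. ?g y) = of_real ((2 * pi)\<^sup>2 * exp (- (norm u)\<^sup>2 / 2))" .
qed

lemma lborel_tiling:
  "lborel = distr (count_space (UNIV :: (int ^ 4) set) \<Otimes>\<^sub>M torus) borel (\<lambda>(k, x). x + (2 * pi) *\<^sub>R lat k)"
  (is "_ = distr ?P borel ?T")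
proof (rule measure_eqI)
  have mT: "?T \<in> measurable ?P borel"
  proof (rule measurable_pair_measure_countable1)
    fix k :: "int ^ 4"
    have "(\<lambda>x. x + (2 * pi) *\<^sub>R lat k) \<in> borel_measurable borel"
      by (intro borel_measurable_continuous_onI continuous_intros)
    then show "(\<lambda>y. ?T (k, y)) \<in> borel_measurable torus" by (simp add: borel_measurable_torusI)
  qed simp
  fix A :: "(real ^ 4) set" assume "A \<in> sets lborel"
  then have A: "A \<in> sets borel" by simp
  have mi: "(\<lambda>p. indicator A (?T p) :: ennreal) \<in> borel_measurable ?P"
    using measurable_comp[OF mT borel_measurable_indicator[OF A]] by (simp add: comp_def)
  have "emeasure lborel A = (\<integral>\<^sup>+x. indicator A x \<partial>lborel)" using A by simp
  also have "... = (\<Oplus>k. (\<integral>\<^sup>+x. indicator A (x + (2 * pi) *\<^sub>R lat k) \<partial>torus))"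
    using A by (intro nn_integral_tiling) auto
  also have "... = (\<Oplus>k. (\<integral>\<^sup>+x. indicator A (?T (k, x)) \<partial>torus))" by simp
  also have "... = (\<integral>\<^sup>+p. indicator A (?T p) \<partial>?P)"
    by (rule torus.nn_integral_fst[OF mi])
  also have "... = (\<integral>\<^sup>+x. indicator A x \<partial>distr ?P borel ?T)"
    using A by (subst nn_integral_distr[OF mT]) auto
  also have "... = emeasure (distr ?P borel ?T) A" using A by simp
  finally show "emeasure lborel A = emeasure (distr ?P borel ?T) A" .
qed simp

text \<open>The unfolding step of Poisson summation: an integral over the whole space is the
  integral over the torus of the periodisation. Fubini is applied on the product of counting measure
  and the box.\<close>

lemma integral_tiling:
  fixes F :: "real ^ 4 => complex"
  assumes F: "integrable lborel F"
    and s: "\<And>x. (\<lambda>k. norm (F (x + (2 * pi) *\<^sub>R lat k))) summable_on UNIV"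
  shows "(LINT x|lborel. F x) = (LINT x|torus. (\<Sum>k. F (x + (2 * pi) *\<^sub>R lat k)))"
proof -
  let ?P = "count_space (UNIV :: (int ^ 4) set) \<Otimes>\<^sub>M torus"
  let ?T = "\<lambda>(k, x). x + (2 * pi) *\<^sub>R lat k"
  interpret pair_sigma_finite "count_space (UNIV :: (int ^ 4) set)" torus
    by (simp add: pair_sigma_finite_def sigma_finite_measure_count_space_countable torus.sigma_finite_measure_axioms)
  have mT: "?T \<in> measurable ?P borel"
  proof (rule measurable_pair_measure_countable1)
    fix k :: "int ^ 4"
    have "(\<lambda>x. x + (2 * pi) *\<^sub>R lat k) \<in> borel_measurable borel"
      by (intro borel_measurable_continuous_onI continuous_intros)
    then show "(\<lambda>y. ?T (k, y)) \<in> borel_measurable torus" by (simp add: borel_measurable_torusI)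
  qed simp
  have mF: "F \<in> borel_measurable borel" using F by simp
  have iP: "integrable ?P (\<lambda>p. F (?T p))"
    using F by (subst (asm) lborel_tiling, subst (asm) integrable_distr_eq[OF mT mF])
  have "(LINT x|lborel. F x) = (LINT p|?P. F (?T p))"
    by (subst lborel_tiling, subst integral_distr[OF mT mF]) simp
  also have "... = (LINT x|torus. (LINT k|count_space UNIV. F (x + (2 * pi) *\<^sub>R lat k)))"
    using integral_snd[of "\<lambda>k x. F (x + (2 * pi) *\<^sub>R lat k)"] iP by (simp add: case_prod_beta')
  also have "... = (LINT x|torus. (\<Sum>k. F (x + (2 * pi) *\<^sub>R lat k)))"
  proof (rule Bochner_Integration.integral_cong[OF refl])
    fix x
    have "Infinite_Set_Sum.abs_summable_on (\<lambda>k. F (x + (2 * pi) *\<^sub>R lat k)) UNIV"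
      using s[of x] abs_summable_equivalent[of "\<lambda>k. F (x + (2 * pi) *\<^sub>R lat k)" UNIV] by blast
    from infsetsum_infsum[OF this]
    show "(LINT k|count_space UNIV. F (x + (2 * pi) *\<^sub>R lat k)) = (\<Sum>k. F (x + (2 * pi) *\<^sub>R lat k))"
      by (simp add: infsetsum_def)
  qed
  finally show ?thesis .
qed

text \<open>Equal coefficients give equality almost everywhere on the box, hence everywhere almost
  surely by periodicity; the set where two continuous functions differ is open, and an open null set
  is empty.\<close>

lemma continuous_periodic_eqI:
  fixes f g :: "real ^ 4 => complex"
  assumes f: "continuous_on UNIV f" "torus_periodic f" and g: "continuous_on UNIV g" "torus_periodic g"
    and eq: "\<And>k. fourier_coeff f k = fourier_coeff g k"
  shows "f x = g x"
proof -
  have L: "h \<in> L2" if h: "continuous_on UNIV h" "torus_periodic h" for h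
  proof -
    obtain C where "\<And>x. norm (h x) \<le> C" by (rule continuous_periodic_bounded[OF h]) blast
    then show ?thesis
      by (intro L2_bounded(1)[where C=C] borel_measurable_torusI borel_measurable_continuous_onI h)
  qed
  have ae: "AE x in torus. f x = g x" by (rule L2_eqI[OF L[OF f] L[OF g] eq])
  let ?N = "{x. f x \<noteq> g x}"
  have op: "open ?N" by (intro open_Collect_neq f g)
  have ind: "indicator ?N (x + (2 * pi) *\<^sub>R lat k) = (indicator ?N x :: ennreal)" for x k
    using f(2) g(2) by (simp add: torus_periodic_def indicator_def)
  have "emeasure lborel ?N = (\<integral>\<^sup>+x. indicator ?N x \<partial>lborel)" using op by simp
  also have "... = (\<integral>\<^sup>+k. (\<integral>\<^sup>+x. indicator ?N (x + (2 * pi) *\<^sub>R lat k) \<partial>torus) \<partial>count_space (UNIV :: (int ^ 4) set))"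
    using op by (intro nn_integral_tiling) auto
  also have "... = (\<integral>\<^sup>+k. 0 \<partial>count_space (UNIV :: (int ^ 4) set))"
  proof (rule nn_integral_cong)
    fix k :: "int ^ 4"
    have "(\<integral>\<^sup>+x. indicator ?N (x + (2 * pi) *\<^sub>R lat k) \<partial>torus) = (\<integral>\<^sup>+x. 0 \<partial>torus)"
      unfolding ind by (rule nn_integral_cong_AE) (use ae in eventually_elim, simp)
    then show "(\<integral>\<^sup>+x. indicator ?N (x + (2 * pi) *\<^sub>R lat k) \<partial>torus) = 0" by simp
  qed
  finally have "emeasure lborel ?N = 0" by simp
  then have "?N \<in> null_sets lborel" using op by (simp add: null_sets_def)
  then have "negligible ?N" by (simp add: negligible_iff_null_sets null_sets_completionI)
  then have "?N = {}" using op open_not_negligible by blast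
  then show ?thesis by blast
qed

lemma dist_box_bound: "x \<in> Qbox ==> norm x \<le> 8 * pi"
proof -
  assume x: "x \<in> Qbox"
  have "norm x \<le> (\<Sum>i\<in>UNIV. \<bar>x $ i\<bar>)" by (rule norm_le_l1_cart)
  also have "... \<le> (\<Sum>i\<in>(UNIV :: 4 set). 2 * pi)" using x by (intro sum_mono) (auto simp: Qbox_def less_imp_le)
  finally show ?thesis by simp
qed

lemma norm_shift_lower:
  "2 * pi\<^sup>2 * (norm (lat k))\<^sup>2 - (norm \<xi>)\<^sup>2 \<le> (norm (\<xi> + (2 * pi) *\<^sub>R lat k))\<^sup>2"
proof -
  have "(norm ((2 * pi) *\<^sub>R lat k))\<^sup>2 \<le> (norm (\<xi> + (2 * pi) *\<^sub>R lat k) + norm \<xi>)\<^sup>2"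
    using norm_triangle_ineq4[of "\<xi> + (2 * pi) *\<^sub>R lat k" \<xi>] by (intro power_mono) auto
  also have "... \<le> 2 * (norm (\<xi> + (2 * pi) *\<^sub>R lat k))\<^sup>2 + 2 * (norm \<xi>)\<^sup>2"
    using sum_squares_bound[of "norm (\<xi> + (2 * pi) *\<^sub>R lat k)" "norm \<xi>"] by (simp add: power2_sum)
  finally show ?thesis by (simp add: power_mult_distrib)
qed

lemma exp_shift_le:
  assumes "0 < s" "norm \<xi> \<le> R"
  shows "exp (- s * (norm (\<xi> + (2 * pi) *\<^sub>R lat k))\<^sup>2) \<le> exp (s * R\<^sup>2) * exp (- (s * (2 * pi\<^sup>2)) * (norm (lat k))\<^sup>2)"
proof -
  have "(norm \<xi>)\<^sup>2 \<le> R\<^sup>2" using assms(2) by (intro power_mono) auto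
  with norm_shift_lower[of k \<xi>] have "2 * pi\<^sup>2 * (norm (lat k))\<^sup>2 - R\<^sup>2 \<le> (norm (\<xi> + (2 * pi) *\<^sub>R lat k))\<^sup>2" by linarith
  then have "s * (2 * pi\<^sup>2 * (norm (lat k))\<^sup>2 - R\<^sup>2) \<le> s * (norm (\<xi> + (2 * pi) *\<^sub>R lat k))\<^sup>2"
    using assms(1) by (intro mult_left_mono) auto
  then show ?thesis unfolding exp_add[symmetric] by (simp add: algebra_simps)
qed

lemma exp_shift_majorant_summable:
  assumes "0 < s"
  shows "(\<lambda>k. exp (s * R\<^sup>2) * exp (- (s * (2 * pi\<^sup>2)) * (norm (lat k))\<^sup>2)) summable_on UNIV"
  by (intro summable_on_cmult_right gaussian_summable) (use assms in simp)

lemma gsum_summable: "0 < s ==> (\<lambda>k. exp (- s * (norm (\<xi> + (2 * pi) *\<^sub>R lat k))\<^sup>2)) summable_on UNIV"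
  by (rule summable_on_comparison_test[OF exp_shift_majorant_summable exp_shift_le]) auto

text \<open>The sum is periodic in \<xi> by reindexing, so \<xi> may be moved into the box, where
  its norm is at most 8 pi and one Gaussian majorant serves all points.\<close>

lemma gsum_bounded:
  assumes s: "0 < s"
  obtains C where "0 \<le> C" "\<And>\<xi>. (\<Sum>k. exp (- s * (norm (\<xi> + (2 * pi) *\<^sub>R lat k))\<^sup>2)) \<le> C"
proof -
  let ?g = "\<lambda>\<xi> k. exp (- s * (norm (\<xi> + (2 * pi) *\<^sub>R lat k))\<^sup>2)"
  let ?m = "\<lambda>k. exp (s * (8 * pi)\<^sup>2) * exp (- (s * (2 * pi\<^sup>2)) * (norm (lat k))\<^sup>2)"
  have "(\<Sum>k. ?g \<xi> k) \<le> infsum ?m UNIV" for \<xi>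
  proof -
    have sh: "?g (red \<xi>) k = ?g \<xi> (k - cell \<xi>)" for k
      unfolding red_def lat_diff by (simp add: algebra_simps)
    have "(\<Sum>k. ?g \<xi> k) = (\<Sum>k. ?g \<xi> (k - cell \<xi>))"
      by (rule infsum_reindex_bij_betw[symmetric]) (auto intro!: bij_betw_byWitness[where f'="\<lambda>k. k + cell \<xi>"])
    also have "... = (\<Sum>k. ?g (red \<xi>) k)" by (simp only: sh)
    also have "... \<le> infsum ?m UNIV"
      by (intro infsum_mono gsum_summable exp_shift_majorant_summable exp_shift_le s dist_box_bound red_in)
    finally show ?thesis .
  qed
  moreover have "0 \<le> infsum ?m UNIV" by (intro infsum_nonneg) auto
  ultimately show ?thesis using that by blast
qed

section \<open>Constant metric and the free heat kernel on the torus\<close>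

locale metric =
  fixes gu :: "real ^ 4 ^ 4"
  assumes gu_sym: "transpose gu = gu"
    and gu_pos: "\<And>x. x \<noteq> 0 ==> 0 < x \<bullet> (gu *v x)"
begin

abbreviation bf :: "real ^ 4 => real ^ 4 => real" where "bf x y \<equiv> x \<bullet> (gu *v y)"

lemma bf_sym: "bf x y = bf y x"
proof -
  have "bf x y = (x v* gu) \<bullet> y" by (simp add: dot_lmul_matrix)
  also have "x v* gu = transpose gu *v x" by (simp add: transpose_matrix_vector)
  finally show ?thesis by (simp add: gu_sym inner_commute)
qed

lemma bf_sum_right: "bf x (\<Sum>j\<in>J. c j *\<^sub>R v j) = (\<Sum>j\<in>J. c j * bf x (v j))"
  by (simp add: linear_sum[OF matrix_vector_mul_linear] inner_sum_right matrix_vector_mult_scaleR)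

text \<open>The support clause, that the vectors for J vanish outside the coordinates in J, carries
  the induction: the next axis vector minus its projections has coordinate 1 at the new index, so it
  is nonzero and can be normalised.\<close>

lemma gram_schmidt:
  assumes "finite J"
  shows "\<exists>v. (\<forall>i\<in>J. \<forall>j\<in>J. bf (v i) (v j) = (if i = j then 1 else 0)) \<and> (\<forall>i\<in>J. \<forall>l. l \<notin> J \<longrightarrow> v i $ l = 0)"
  using assms
proof (induction J rule: finite_induct)
  case (insert i J)
  then obtain v where v: "\<And>i j. i \<in> J ==> j \<in> J ==> bf (v i) (v j) = (if i = j then 1 else 0)"
    and v0: "\<And>i l. i \<in> J ==> l \<notin> J ==> v i $ l = 0" by metis
  let ?e = "axis i 1 :: real ^ 4"
  define w where "w = ?e - (\<Sum>j\<in>J. bf (v j) ?e *\<^sub>R v j)"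
  have "w $ i = 1" using v0 insert.hyps by (simp add: w_def)
  then have "w \<noteq> 0" by auto
  then have ww: "0 < bf w w" by (rule gu_pos)
  have vw: "bf (v l) w = 0" if "l \<in> J" for l
  proof -
    have "bf (v l) w = bf (v l) ?e - (\<Sum>j\<in>J. bf (v j) ?e * bf (v l) (v j))"
      unfolding w_def by (simp add: matrix_vector_mult_diff_distrib inner_diff_right bf_sum_right)
    also have "(\<Sum>j\<in>J. bf (v j) ?e * bf (v l) (v j)) = (\<Sum>j\<in>J. if j = l then bf (v l) ?e else 0)"
      using v that by (intro sum.cong) auto
    finally show ?thesis using that insert.hyps by simp
  qed
  have w0: "w $ l = 0" if "l \<notin> insert i J" for l
    using v0 that by (simp add: w_def axis_def)
  define u where "u = w /\<^sub>R sqrt (bf w w)"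
  have uu: "bf u u = 1" using ww by (simp add: u_def matrix_vector_mult_scaleR field_simps)
  have vu: "bf (v l) u = 0" if "l \<in> J" for l using vw[OF that] by (simp add: u_def matrix_vector_mult_scaleR)
  have uv: "bf u (v l) = 0" if "l \<in> J" for l using vu[OF that] bf_sym by metis
  have u0: "u $ l = 0" if "l \<notin> insert i J" for l using w0[OF that] by (simp add: u_def)
  show ?case
    by (rule exI[of _ "v(i := u)"]) (use v v0 uu vu uv u0 insert.hyps in auto)
qed simp

text \<open>The columns of M are orthonormal for \<open>gu\<close>. Hence the metric with lower
  indices is M times its transpose, whose determinant is (det M)^2.\<close>

lemma orthonormalising_matrix:
  obtains M Mi :: "real ^ 4 ^ 4" where "Mi ** M = mat 1" "M ** Mi = mat 1" "gu = transpose Mi ** Mi"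
    "Mi = transpose M ** gu" "sqrt_g gu = \<bar>det M\<bar>"
proof -
  obtain v :: "4 => real ^ 4" where "\<forall>i\<in>UNIV. \<forall>j\<in>UNIV. bf (v i) (v j) = (if i = j then 1 else 0)"
    using gram_schmidt[OF finite_class.finite_UNIV] by blast
  then have v: "bf (v i) (v j) = (if i = j then 1 else 0)" for i j by simp
  define M :: "real ^ 4 ^ 4" where "M = (\<chi> r c. v c $ r)"
  define Mi where "Mi = transpose M ** gu"
  have "(transpose M ** (gu ** M)) $ c $ d = bf (v c) (v d)" for c d
    by (simp add: matrix_matrix_mult_def M_def transpose_def inner_vec_def matrix_vector_mult_def)
  then have "transpose M ** (gu ** M) = mat 1"
    unfolding v by (simp add: vec_eq_iff mat_def)
  then have 1: "Mi ** M = mat 1" by (simp add: Mi_def matrix_mul_assoc)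
  then have 2: "M ** Mi = mat 1" using matrix_left_right_inverse by blast
  have 3: "gu = transpose Mi ** Mi"
  proof -
    have "transpose Mi ** Mi = gu ** (M ** Mi)"
      by (simp add: Mi_def matrix_transpose_mul gu_sym matrix_mul_assoc)
    then show ?thesis by (simp add: 2 matrix_mul_rid)
  qed
  let ?I = "M ** transpose M"
  have a: "?I ** gu = mat 1" using 2 by (simp add: Mi_def matrix_mul_assoc)
  have b: "gu ** ?I = mat 1" using a matrix_left_right_inverse by blast
  have "matrix_inv gu ** gu = mat 1"
    using someI[of "\<lambda>A'. gu ** A' = mat 1 \<and> A' ** gu = mat 1" ?I] a b unfolding matrix_inv_def by blast
  then have "matrix_inv gu ** gu ** ?I = ?I" by (simp add: matrix_mul_lid)
  then have "matrix_inv gu = ?I"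
    unfolding matrix_mul_assoc[symmetric, of "matrix_inv gu"] b by (simp add: matrix_mul_rid)
  then have "sqrt_g gu = \<bar>det M\<bar>"
    by (simp add: sqrt_g_def det_mul det_transpose)
  then show ?thesis using that 1 2 3 Mi_def by blast
qed

lemma sqrt_g_pos: "0 < sqrt_g gu"
proof -
  obtain M Mi :: "real ^ 4 ^ 4" where M: "Mi ** M = mat 1" "sqrt_g gu = \<bar>det M\<bar>"
    by (rule orthonormalising_matrix) blast
  have "det Mi * det M = 1" using arg_cong[OF M(1), of det] by (simp add: det_mul)
  then show ?thesis using M(2) by auto
qed

lemma qform_bounds:
  obtains c C where "0 < c" "0 < C" "\<And>k. c * (norm (lat k))\<^sup>2 \<le> qform gu k" "\<And>k. qform gu k \<le> C * (norm (lat k))\<^sup>2"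
proof -
  obtain M Mi :: "real ^ 4 ^ 4" where M: "M ** Mi = mat 1" "gu = transpose Mi ** Mi"
    by (rule orthonormalising_matrix) blast
  have q: "qform gu k = (norm (Mi *v lat k))\<^sup>2" for k
  proof -
    have "gu *v x = transpose Mi *v (Mi *v x)" for x by (subst M(2)) (simp add: matrix_vector_mul_assoc)
    then have "qform gu k = lat k \<bullet> (transpose Mi *v (Mi *v lat k))" by (simp add: qform_def)
    also have "... = (Mi *v lat k) \<bullet> (Mi *v lat k)"
      by (simp add: transpose_matrix_vector inner_commute[of "lat k"] dot_lmul_matrix)
    finally show ?thesis by (simp add: power2_norm_eq_inner)
  qed
  obtain B where B: "B > 0" "\<And>x. norm (M *v x) \<le> B * norm x"
    using linear_bounded_pos[OF matrix_vector_mul_linear[of M]] by blast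
  obtain B' where B': "B' > 0" "\<And>x. norm (Mi *v x) \<le> B' * norm x"
    using linear_bounded_pos[OF matrix_vector_mul_linear[of Mi]] by blast
  have l: "(1 / B\<^sup>2) * (norm (lat k))\<^sup>2 \<le> qform gu k" for k
  proof -
    have "norm (lat k) = norm (M *v (Mi *v lat k))" by (simp add: matrix_vector_mul_assoc M)
    also have "... \<le> B * norm (Mi *v lat k)" by (rule B)
    finally have "(norm (lat k))\<^sup>2 \<le> (B * norm (Mi *v lat k))\<^sup>2" by (intro power_mono) auto
    then show ?thesis using B(1) by (simp add: q power_mult_distrib field_simps)
  qed
  have u: "qform gu k \<le> B'\<^sup>2 * (norm (lat k))\<^sup>2" for k
    using power_mono[OF B'(2)[of "lat k"], of 2] by (simp add: q power_mult_distrib)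
  show ?thesis by (rule that[of "1 / B\<^sup>2" "B'\<^sup>2"]) (use B(1) B'(1) l u in auto)
qed

text \<open>The heat kernel of the flat Laplacian on the torus, up to its volume normalisation; at
  \<xi> = 0 it is the free heat trace.\<close>

definition theta0 :: "real => real ^ 4 => complex" where
  "theta0 t \<xi> = (\<Sum>k. of_real (exp (- t * qform gu k)) * plane_wave k \<xi>)"

lemma qform_nonneg: "0 \<le> qform gu k"
proof -
  obtain c where c: "0 < c" "c * (norm (lat k))\<^sup>2 \<le> qform gu k"
    using qform_bounds by metis
  have "0 \<le> c * (norm (lat k))\<^sup>2" using c(1) by simp
  with c(2) show ?thesis by linarith
qed

lemma exp_qform_summable: "0 < t ==> (\<lambda>k. exp (- t * qform gu k)) summable_on UNIV"
proof -
  assume t: "0 < t"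
  obtain c where c: "0 < c" "\<And>k. c * (norm (lat k))\<^sup>2 \<le> qform gu k"
    using qform_bounds by metis
  have "exp (- t * qform gu k) \<le> exp (- (t * c) * (norm (lat k))\<^sup>2)" for k
    using mult_left_mono[OF c(2)[of k], of t] t by (simp add: mult_ac)
  then show ?thesis
    by (intro summable_on_comparison_test[OF gaussian_summable[of "t * c"]]) (use t c in auto)
qed

text \<open>The kernel is rewritten as a periodised Gaussian \<open>G\<close> of width sqrt t.
  Unfolding and the Gaussian Fourier transform show that the periodisation has coefficients
  proportional to exp(-t q(k)), and both sides are continuous and periodic. Of \<open>G\<close> only
  the value 1 at the origin and a Gaussian upper bound are passed on.\<close>

theorem poisson_summation:
  obtains \<mu> :: real and G :: "real => real ^ 4 => real" where "0 < \<mu>"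
    "\<And>t \<eta>. 0 < t ==> 0 \<le> G t \<eta> \<and> G t \<eta> \<le> exp (- (\<mu> / t) * (norm \<eta>)\<^sup>2)" "\<And>t. G t 0 = 1"
    "\<And>t \<xi>. 0 < t ==> of_real (t\<^sup>2) * theta0 t \<xi> = of_real (pi\<^sup>2 * sqrt_g gu) * (\<Sum>k. of_real (G t (\<xi> + (2 * pi) *\<^sub>R lat k)))"
proof -
  obtain M Mi :: "real ^ 4 ^ 4" where M: "Mi ** M = mat 1" "M ** Mi = mat 1" "gu = transpose Mi ** Mi" "sqrt_g gu = \<bar>det M\<bar>"
    by (rule orthonormalising_matrix) blast
  have MT: "transpose M ** transpose Mi = mat 1" "transpose Mi ** transpose M = mat 1"
    by (simp_all add: matrix_transpose_mul[symmetric] M transpose_mat)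
  have q: "qform gu k = (norm (Mi *v lat k))\<^sup>2" for k
  proof -
    have "gu *v x = transpose Mi *v (Mi *v x)" for x by (subst M(3)) (simp add: matrix_vector_mul_assoc)
    then have "qform gu k = lat k \<bullet> (transpose Mi *v (Mi *v lat k))" by (simp add: qform_def)
    also have "... = (Mi *v lat k) \<bullet> (Mi *v lat k)"
      by (simp add: transpose_matrix_vector inner_commute[of "lat k"] dot_lmul_matrix)
    finally show ?thesis by (simp add: power2_norm_eq_inner)
  qed
  obtain B where B: "B > 0" "\<And>x. norm (transpose Mi *v x) \<le> B * norm x"
    using linear_bounded_pos[OF matrix_vector_mul_linear[of "transpose Mi"]] by blast
  define \<mu> where "\<mu> = 1 / (4 * B\<^sup>2)"
  have mu: "0 < \<mu>" using B(1) by (simp add: \<mu>_def)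
  have low: "(norm \<eta>)\<^sup>2 \<le> B\<^sup>2 * (norm (transpose M *v \<eta>))\<^sup>2" for \<eta>
  proof -
    have "norm \<eta> = norm (transpose Mi *v (transpose M *v \<eta>))"
      by (simp add: matrix_vector_mul_assoc MT del: transpose_matrix_vector)
    also have "... \<le> B * norm (transpose M *v \<eta>)" by (rule B)
    finally have "(norm \<eta>)\<^sup>2 \<le> (B * norm (transpose M *v \<eta>))\<^sup>2" by (intro power_mono) auto
    then show ?thesis by (simp add: power_mult_distrib)
  qed
  define G where "G t \<eta> = exp (- (norm (transpose M *v \<eta>))\<^sup>2 / (4 * t))" for t :: real and \<eta>
  have Gle: "G t \<eta> \<le> exp (- (\<mu> / t) * (norm \<eta>)\<^sup>2)" if t: "0 < t" for t \<eta>
    using low[of \<eta>] t B(1) by (simp add: G_def \<mu>_def field_simps)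
  show ?thesis
  proof (rule that[OF mu, of G])
    show "0 \<le> G t \<eta> \<and> G t \<eta> \<le> exp (- (\<mu> / t) * (norm \<eta>)\<^sup>2)" if "0 < t" for t \<eta>
      using Gle[OF that] by (simp add: G_def)
    show "G t 0 = 1" for t by (simp add: G_def)
    fix t :: real and \<xi> assume t: "0 < t"
    define H where "H \<xi> = (\<Sum>k. complex_of_real (G t (\<xi> + (2 * pi) *\<^sub>R lat k)))" for \<xi>
    define s where "s = \<mu> / t"
    have s: "0 < s" using mu t by (simp add: s_def)
    have Gs: "norm (complex_of_real (G t (\<xi> + (2 * pi) *\<^sub>R lat k))) \<le> exp (- s * (norm (\<xi> + (2 * pi) *\<^sub>R lat k))\<^sup>2)" for \<xi> k
      using Gle[OF t, of "\<xi> + (2 * pi) *\<^sub>R lat k"] by (simp add: s_def G_def)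
    have Gsum: "(\<lambda>k. norm (complex_of_real (G t (\<xi> + (2 * pi) *\<^sub>R lat k)))) summable_on UNIV" for \<xi>
      by (rule summable_on_comparison_test[OF gsum_summable[OF s] Gs]) auto
    have Gc: "continuous_on UNIV (G t)"
      unfolding G_def using t
      by (intro continuous_intros linear_continuous_on linear_linear[THEN iffD2] matrix_vector_mul_linear) auto
    have Hper: "torus_periodic H"
      unfolding torus_periodic_def
    proof (intro allI)
      fix x l
      have "H (x + (2 * pi) *\<^sub>R lat l) = (\<Sum>k. complex_of_real (G t (x + (2 * pi) *\<^sub>R lat (k + l))))"
        unfolding H_def lat_add by (simp add: algebra_simps)
      also have "... = H x"
        unfolding H_def by (rule infsum_reindex_bij_betw) (auto intro!: bij_betw_byWitness[where f'="\<lambda>k. k - l"])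
      finally show "H (x + (2 * pi) *\<^sub>R lat l) = H x" .
    qed
    have Hc: "continuous_on UNIV H"
    proof -
      have cR: "continuous_on (ball 0 R) H" for R
      proof -
        have u: "uniform_limit (ball 0 R) (\<lambda>X \<xi>. \<Sum>k\<in>X. complex_of_real (G t (\<xi> + (2 * pi) *\<^sub>R lat k))) H (finite_subsets_at_top UNIV)"
          unfolding H_def
        proof (rule Weierstrass_m_test_general[OF _ exp_shift_majorant_summable[OF s, of R]])
          fix k \<xi> assume "\<xi> \<in> ball (0 :: real ^ 4) R"
          then have "norm \<xi> \<le> R" by simp
          then show "norm (complex_of_real (G t (\<xi> + (2 * pi) *\<^sub>R lat k))) \<le> exp (s * R\<^sup>2) * exp (- (s * (2 * pi\<^sup>2)) * (norm (lat k))\<^sup>2)"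
            using order_trans[OF Gs exp_shift_le[OF s]] by blast
        qed
        show ?thesis
          by (rule uniform_limit_theorem[OF _ u])
            (auto intro!: always_eventually continuous_intros continuous_on_compose2[OF Gc])
      qed
      then have "isCont H x" for x
      proof -
        have "x \<in> ball 0 (norm x + 1)" by simp
        with cR[where R="norm x + 1"] show ?thesis
          using continuous_on_eq_continuous_at[OF open_ball] by blast
      qed
      then show ?thesis by (simp add: continuous_at_imp_continuous_on)
    qed
    have Hfc: "fourier_coeff H k = of_real (t\<^sup>2 / (pi\<^sup>2 * sqrt_g gu) * exp (- t * qform gu k))" for k
    proof -
      let ?F = "\<lambda>x. complex_of_real (G t x) * plane_wave (- k) x"
      \<comment> \<open>The substitution x = N y turns the Gaussian into exp(-|y|^2/2) and the wave
        of frequency k into one with |u|^2 = 2 t q(k).\<close>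
      define N where "N = mat (sqrt (2 * t)) ** transpose Mi"
      define N' where "N' = transpose M ** mat (1 / sqrt (2 * t))"
      have mm: "mat a ** mat b = (mat (a * b) :: real ^ 4 ^ 4)" for a b
        by (simp add: matrix_matrix_mult_def mat_def vec_eq_iff if_distrib[of "\<lambda>a. a * _"] cong: if_cong)
      have "N ** N' = mat (sqrt (2 * t)) ** (transpose Mi ** transpose M) ** mat (1 / sqrt (2 * t))"
        by (simp add: N_def N'_def matrix_mul_assoc)
      also have "... = mat 1" using t by (simp add: MT mm matrix_mul_rid)
      finally have NN: "N ** N' = mat 1" .
      have mv: "mat a *v x = a *\<^sub>R (x :: real ^ 4)" for a x
        by (simp add: matrix_vector_mult_def mat_def vec_eq_iff if_distrib[of "\<lambda>a. a * _"] cong: if_cong)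
      have Nv: "N *v y = sqrt (2 * t) *\<^sub>R (transpose Mi *v y)" for y
        by (simp add: N_def mv matrix_vector_mul_assoc[symmetric] del: transpose_matrix_vector)
      have GN: "G t (N *v y) = exp (- (norm y)\<^sup>2 / 2)" for y
        using t by (simp add: G_def Nv matrix_vector_mult_scaleR matrix_vector_mul_assoc MT power_mult_distrib del: transpose_matrix_vector)
      define u where "u = - (sqrt (2 * t) *\<^sub>R (Mi *v lat k))"
      have pN: "plane_wave (- k) (N *v y) = cis (u \<bullet> y)" for y
        by (simp add: plane_wave_def lat_minus Nv u_def transpose_matrix_vector inner_commute[of "lat k"] dot_lmul_matrix inner_commute[of y])
      have FN: "?F (N *v y) = complex_of_real (exp (- (norm y)\<^sup>2 / 2)) * cis (u \<bullet> y)" for y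
        by (simp only: GN pN)
      have Fm: "?F \<in> borel_measurable borel"
        by (intro borel_measurable_continuous_onI continuous_intros Gc)
      have mN: "(*v) N \<in> borel_measurable lborel"
        by (simp, intro borel_measurable_continuous_onI linear_continuous_on linear_linear[THEN iffD2] matrix_vector_mul_linear)
      have lb: "lborel = density (distr lborel borel ((*v) N)) (\<lambda>_. ennreal \<bar>det N\<bar>)" by (rule lborel_linear[OF NN])
      have i0: "integrable (distr lborel borel ((*v) N)) ?F"
        by (subst integrable_distr_eq[OF mN Fm]) (simp only: FN gaussian_ft_4d)
      have iF: "integrable lborel ?F"
        by (subst lb, subst integrable_density) (use Fm i0 in auto)
      have "(LINT x|lborel. ?F x) = (LINT x|distr lborel borel ((*v) N). \<bar>det N\<bar> *\<^sub>R ?F x)"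
        by (subst lb, subst integral_density) (use Fm in auto)
      also have "... = \<bar>det N\<bar> *\<^sub>R (LINT x|distr lborel borel ((*v) N). ?F x)" by simp
      also have "(LINT x|distr lborel borel ((*v) N). ?F x) = (LINT y|lborel. ?F (N *v y))"
        by (rule integral_distr[OF mN Fm])
      also have "... = of_real ((2 * pi)\<^sup>2 * exp (- (norm u)\<^sup>2 / 2))"
        by (simp only: FN gaussian_ft_4d)
      also have "(norm u)\<^sup>2 = 2 * t * qform gu k"
        using t by (simp add: u_def q power_mult_distrib)
      finally have I: "(LINT x|lborel. ?F x) = of_real (\<bar>det N\<bar> * ((2 * pi)\<^sup>2 * exp (- t * qform gu k)))"
        by (simp add: scaleR_conv_of_real)
      have detN: "\<bar>det N\<bar> = 4 * t\<^sup>2 / sqrt_g gu"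
      proof -
        have "det (mat (sqrt (2 * t)) :: real ^ 4 ^ 4) = (\<Prod>i\<in>(UNIV :: 4 set). sqrt (2 * t))"
          by (subst det_diagonal) (auto simp: mat_def)
        also have "... = sqrt (2 * t) ^ 4" by simp
        also have "... = 4 * t\<^sup>2" using t by (simp add: power4_eq_xxxx power2_eq_square)
        finally have "det N = 4 * t\<^sup>2 * det Mi" by (simp add: N_def det_mul det_transpose)
        moreover have "\<bar>det Mi\<bar> * \<bar>det M\<bar> = 1" using arg_cong[OF M(1), of det] by (simp add: det_mul abs_mult[symmetric])
        ultimately show ?thesis using sqrt_g_pos M(4) by (simp add: abs_mult field_simps)
      qed
      have "(LINT x|lborel. ?F x) = (LINT x|torus. (\<Sum>l. ?F (x + (2 * pi) *\<^sub>R lat l)))"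
        by (rule integral_tiling[OF iF]) (use Gsum in \<open>simp add: norm_mult\<close>)
      also have "... = (LINT x|torus. H x * plane_wave (- k) x)"
        unfolding H_def by (simp add: plane_wave_add_arg infsum_cmult_left')
      finally have "fourier_coeff H k = of_real (\<bar>det N\<bar> * ((2 * pi)\<^sup>2 * exp (- t * qform gu k))) / of_real ((2 * pi) ^ 4)"
        unfolding I fourier_coeff_def plane_wave_cnj by simp
      also have "... = of_real (t\<^sup>2 / (pi\<^sup>2 * sqrt_g gu) * exp (- t * qform gu k))"
        unfolding of_real_divide[symmetric] detN by (simp add: power2_eq_square power4_eq_xxxx mult_ac)
      finally show ?thesis .
    qed
    let ?c = "complex_of_real (t\<^sup>2 / (pi\<^sup>2 * sqrt_g gu))"
    have su: "(\<lambda>k. norm (complex_of_real (exp (- t * qform gu k)))) summable_on UNIV"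
      using exp_qform_summable[OF t] by simp
    have "H \<xi> = ?c * theta0 t \<xi>"
    proof (rule continuous_periodic_eqI[OF Hc Hper])
      show "continuous_on UNIV (\<lambda>\<xi>. ?c * theta0 t \<xi>)"
        unfolding theta0_def by (intro continuous_intros continuous_wave_series[OF su])
      show "torus_periodic (\<lambda>\<xi>. ?c * theta0 t \<xi>)"
        using plane_wave_periodic by (simp add: theta0_def torus_periodic_def)
      show "fourier_coeff H k = fourier_coeff (\<lambda>\<xi>. ?c * theta0 t \<xi>) k" for k
        unfolding fourier_coeff_cmult theta0_def fourier_coeff_series[OF su] Hfc by simp
    qed
    then have "of_real (t\<^sup>2) * theta0 t \<xi> = of_real (pi\<^sup>2 * sqrt_g gu) * H \<xi>"
      using sqrt_g_pos by (simp add: field_simps)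
    then show "of_real (t\<^sup>2) * theta0 t \<xi> = of_real (pi\<^sup>2 * sqrt_g gu) * (\<Sum>k. of_real (G t (\<xi> + (2 * pi) *\<^sub>R lat k)))"
      by (simp only: H_def)
  qed
qed

end

lemma lat_norm_ge_1: "k \<noteq> 0 ==> 1 \<le> norm (lat k)"
proof -
  assume "k \<noteq> 0"
  then obtain i where "k $ i \<noteq> 0" by (auto simp: vec_eq_iff)
  then have "1 \<le> \<bar>lat k $ i\<bar>" by (simp flip: of_int_abs)
  also have "... \<le> norm (lat k)" by (rule component_le_norm_cart)
  finally show ?thesis .
qed

context metric
begin

text \<open>The volume divided by (4 pi)^2, the leading coefficient of the free heat trace in
  dimension four.\<close>

definition c0 :: real where "c0 = pi\<^sup>2 * sqrt_g gu"

text \<open>Uniform small-time behaviour: exponential decay in \<delta>^2/t when \<xi> stays at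
  distance \<delta> from the lattice 2 pi Z^4, and the limit \<open>c0\<close> with exponentially
  small error at \<xi> = 0, where one summand equals 1 and all others are at distance at least 1.
  The constants depend neither on \<xi> nor on \<delta>, so that the bound can be summed over \<xi>
  = \<Theta>p.\<close>

lemma theta0_bounds:
  obtains C \<kappa> where "0 \<le> C" "0 < \<kappa>"
    "\<And>t \<xi> \<delta>. 0 < t ==> t \<le> 1 ==> 0 \<le> \<delta> ==> (\<And>k. \<delta> \<le> norm (\<xi> + (2 * pi) *\<^sub>R lat k)) ==> 
        norm (of_real (t\<^sup>2) * theta0 t \<xi>) \<le> C * exp (- (\<kappa> * \<delta>\<^sup>2) / t)"
    "\<And>t. 0 < t ==> t \<le> 1 ==> norm (of_real (t\<^sup>2) * theta0 t 0 - of_real c0) \<le> C * exp (- \<kappa> / t)"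
proof -
  obtain \<mu> :: real and G where mu: "0 < \<mu>"
    and G: "\<And>t \<eta>. 0 < t ==> 0 \<le> G t \<eta> \<and> G t \<eta> \<le> exp (- (\<mu> / t) * (norm \<eta>)\<^sup>2)" and G0: "\<And>t. G t 0 = 1"
    and P: "\<And>t \<xi>. 0 < t ==> of_real (t\<^sup>2) * theta0 t \<xi> = of_real (pi\<^sup>2 * sqrt_g gu) * (\<Sum>k. of_real (G t (\<xi> + (2 * pi) *\<^sub>R lat k)))"
    by (rule poisson_summation) blast
  have mu2: "0 < \<mu> / 2" using mu by simp
  obtain A where A: "0 \<le> A" "\<And>\<xi>. (\<Sum>k. exp (- (\<mu> / 2) * (norm (\<xi> + (2 * pi) *\<^sub>R lat k))\<^sup>2)) \<le> A"
    by (rule gsum_bounded[OF mu2]) blast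
  have c0: "0 < c0" using sqrt_g_pos by (simp add: c0_def)
  have tail: "norm (\<Sum>\<^sub>\<infinity>k\<in>K. complex_of_real (G t (\<xi> + (2 * pi) *\<^sub>R lat k))) \<le> A * exp (- ((\<mu> / 2) * \<delta>\<^sup>2) / t)"
    "(\<lambda>k. complex_of_real (G t (\<xi> + (2 * pi) *\<^sub>R lat k))) summable_on K"
    if t: "0 < t" "t \<le> 1" and \<delta>: "0 \<le> \<delta>" "\<And>k. k \<in> K ==> \<delta> \<le> norm (\<xi> + (2 * pi) *\<^sub>R lat k)" for t :: real and \<xi> and \<delta> :: real and K
  proof -
    let ?e = "\<lambda>k. exp (- (\<mu> / 2) * (norm (\<xi> + (2 * pi) *\<^sub>R lat k))\<^sup>2)"
    let ?E = "exp (- ((\<mu> / 2) * \<delta>\<^sup>2) / t)"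
    have b: "norm (complex_of_real (G t (\<xi> + (2 * pi) *\<^sub>R lat k))) \<le> ?E * ?e k" if k: "k \<in> K" for k
    proof -
      let ?n = "norm (\<xi> + (2 * pi) *\<^sub>R lat k)"
      have n: "\<delta>\<^sup>2 \<le> ?n\<^sup>2" using \<delta> k by (intro power_mono) auto
      have 1: "(\<mu> / 2) * \<delta>\<^sup>2 / t \<le> (\<mu> / 2) * ?n\<^sup>2 / t"
        using n mu t by (intro divide_right_mono mult_left_mono) auto
      have "(\<mu> / 2) * ?n\<^sup>2 * t \<le> (\<mu> / 2) * ?n\<^sup>2 * 1"
        using mu t by (intro mult_left_mono) auto
      then have 2: "(\<mu> / 2) * ?n\<^sup>2 \<le> (\<mu> / 2) * ?n\<^sup>2 / t"
        using t by (simp add: pos_le_divide_eq)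
      have "(\<mu> / t) * ?n\<^sup>2 = (\<mu> / 2) * ?n\<^sup>2 / t + (\<mu> / 2) * ?n\<^sup>2 / t" by (simp add: field_simps)
      \<comment> \<open>The Gaussian exponent is split in halves: one keeps the decay in
        \<delta>^2/t, the other is weakened by t <= 1 to a time-independent Gaussian whose lattice
        sum is bounded by \<open>A\<close>.\<close>
      with 1 2 have "- (\<mu> / t) * ?n\<^sup>2 \<le> - ((\<mu> / 2) * \<delta>\<^sup>2) / t + - (\<mu> / 2) * ?n\<^sup>2" by simp
      then have "exp (- (\<mu> / t) * ?n\<^sup>2) \<le> ?E * ?e k" unfolding exp_add[symmetric] by (rule exp_le_cancel_iff[THEN iffD2])
      then show ?thesis using G[OF t(1), of "\<xi> + (2 * pi) *\<^sub>R lat k"] by simp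
    qed
    have es: "?e summable_on UNIV" by (rule gsum_summable[OF mu2])
    have eK: "(\<lambda>k. ?E * ?e k) summable_on K"
      by (intro summable_on_cmult_right summable_on_subset_banach[OF es]) auto
    have ns: "(\<lambda>k. norm (complex_of_real (G t (\<xi> + (2 * pi) *\<^sub>R lat k)))) summable_on K"
      by (rule summable_on_comparison_test[OF eK b]) auto
    then show "(\<lambda>k. complex_of_real (G t (\<xi> + (2 * pi) *\<^sub>R lat k))) summable_on K"
      by (rule abs_summable_summable)
    have "norm (\<Sum>\<^sub>\<infinity>k\<in>K. complex_of_real (G t (\<xi> + (2 * pi) *\<^sub>R lat k))) \<le> (\<Sum>\<^sub>\<infinity>k\<in>K. norm (complex_of_real (G t (\<xi> + (2 * pi) *\<^sub>R lat k))))"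
      by (rule norm_infsum_bound[OF ns])
    also have "... \<le> (\<Sum>\<^sub>\<infinity>k\<in>K. ?E * ?e k)" by (rule infsum_mono[OF ns eK b])
    also have "... = ?E * (\<Sum>\<^sub>\<infinity>k\<in>K. ?e k)" by (rule infsum_cmult_right')
    also have "(\<Sum>\<^sub>\<infinity>k\<in>K. ?e k) \<le> (\<Sum>k. ?e k)"
      by (rule infsum_mono2[OF summable_on_subset_banach[OF es] es]) auto
    also have "... \<le> A" by (rule A)
    finally show "norm (\<Sum>\<^sub>\<infinity>k\<in>K. complex_of_real (G t (\<xi> + (2 * pi) *\<^sub>R lat k))) \<le> A * ?E"
      by (simp add: mult.commute)
  qed
  show ?thesis
  proof (rule that[of "c0 * A" "\<mu> / 2"])
    show "0 \<le> c0 * A" using c0 A by simp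
    show "0 < \<mu> / 2" by (rule mu2)
  next
    fix t :: real and \<xi> :: "real ^ 4" and \<delta> :: real assume t: "0 < t" "t \<le> 1" and d: "0 \<le> \<delta>" "\<And>k. \<delta> \<le> norm (\<xi> + (2 * pi) *\<^sub>R lat k)"
    have "norm (of_real (t\<^sup>2) * theta0 t \<xi>) = c0 * norm (\<Sum>k. complex_of_real (G t (\<xi> + (2 * pi) *\<^sub>R lat k)))"
      unfolding P[OF t(1)] norm_mult c0_def[symmetric] using c0 by simp
    also have "... \<le> c0 * (A * exp (- ((\<mu> / 2) * \<delta>\<^sup>2) / t))"
      using c0 by (intro mult_left_mono tail(1)[OF t d]) auto
    finally show "norm (of_real (t\<^sup>2) * theta0 t \<xi>) \<le> c0 * A * exp (- (\<mu> / 2 * \<delta>\<^sup>2) / t)" by (simp add: mult.assoc)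
  next
    fix t :: real assume t: "0 < t" "t \<le> 1"
    let ?h = "\<lambda>k. complex_of_real (G t (0 + (2 * pi) *\<^sub>R lat k))"
    have far: "1 \<le> norm (0 + (2 * pi) *\<^sub>R lat k)" if "k \<in> - {0}" for k
    proof -
      have "1 \<le> norm (lat k)" using that by (intro lat_norm_ge_1) auto
      moreover have "1 \<le> 2 * pi" using pi_gt3 by simp
      ultimately have "1 * 1 \<le> (2 * pi) * norm (lat k)" by (intro mult_mono) auto
      then show ?thesis by simp
    qed
    have "(\<Sum>k. ?h k) = (\<Sum>\<^sub>\<infinity>k\<in>insert 0 (- {0}). ?h k)" by (simp add: insert_absorb Compl_eq_Diff_UNIV)
    also have "... = ?h 0 + (\<Sum>\<^sub>\<infinity>k\<in>- {0}. ?h k)"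
      by (rule infsum_insert[OF tail(2)[OF t zero_le_one far]]) auto
    finally have s: "(\<Sum>k. ?h k) = 1 + (\<Sum>\<^sub>\<infinity>k\<in>- {0}. ?h k)" by (simp add: G0)
    have "of_real (t\<^sup>2) * theta0 t 0 - of_real c0 = of_real c0 * (\<Sum>\<^sub>\<infinity>k\<in>- {0}. ?h k)"
      unfolding P[OF t(1)] s c0_def by (simp add: algebra_simps)
    then have "norm (of_real (t\<^sup>2) * theta0 t 0 - of_real c0) = c0 * norm (\<Sum>\<^sub>\<infinity>k\<in>- {0}. ?h k)"
      using c0 by (simp add: norm_mult)
    also have "... \<le> c0 * (A * exp (- ((\<mu> / 2) * 1\<^sup>2) / t))"
      using c0 by (intro mult_left_mono tail(1)[OF t zero_le_one far]) auto
    finally show "norm (of_real (t\<^sup>2) * theta0 t 0 - of_real c0) \<le> c0 * A * exp (- (\<mu> / 2) / t)" by (simp add: mult.assoc)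
  qed
qed

lemma c0_pos: "0 < c0" using sqrt_g_pos by (simp add: c0_def)

lemma theta0_zero_eq: "0 < t ==> theta0 t 0 = of_real (\<Sum>k. exp (- t * qform gu k))"
proof -
  assume t: "0 < t"
  have "((\<lambda>k. complex_of_real (exp (- t * qform gu k))) has_sum of_real (\<Sum>k. exp (- t * qform gu k))) UNIV"
    by (intro has_sum_of_real has_sum_infsum exp_qform_summable t)
  then show ?thesis by (simp add: theta0_def plane_wave_def infsumI)
qed

lemma heat_sum_bound:
  obtains C where "0 \<le> C" "\<And>t. 0 < t ==> t \<le> 1 ==> (\<Sum>k. exp (- t * qform gu k)) \<le> C / t\<^sup>2"
proof -
  obtain C \<kappa> where C: "0 \<le> C" "0 < \<kappa>" "\<And>t. 0 < t ==> t \<le> 1 ==> norm (of_real (t\<^sup>2) * theta0 t 0 - of_real c0) \<le> C * exp (- \<kappa> / t)"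
    by (rule theta0_bounds) blast
  show ?thesis
  proof (rule that[of "C + c0"])
    show "0 \<le> C + c0" using C c0_pos by simp
    fix t :: real assume t: "0 < t" "t \<le> 1"
    let ?s = "\<Sum>k. exp (- t * qform gu k)"
    have "norm (complex_of_real (t\<^sup>2 * ?s - c0)) \<le> C * exp (- \<kappa> / t)"
      using C(3)[OF t] theta0_zero_eq[OF t(1)] by simp
    also have "... \<le> C * 1" using C t by (intro mult_left_mono) auto
    finally have "\<bar>t\<^sup>2 * ?s - c0\<bar> \<le> C" by (simp only: norm_of_real mult_1_right)
    then have "t\<^sup>2 * ?s \<le> C + c0" by linarith
    then show "?s \<le> (C + c0) / t\<^sup>2" using t by (simp add: pos_le_divide_eq mult.commute)
  qed
qed

end

section \<open>Trace of the first-order term and the Diophantine condition\<close>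

lemma exp_neg_le_inverse_square: "0 < x ==> exp (- x) \<le> 4 / x\<^sup>2" for x :: real
proof -
  assume x: "0 < x"
  have "(x / 2)\<^sup>2 \<le> (1 + x / 2)\<^sup>2" using x by (intro power_mono) auto
  also have "... \<le> exp x" using exp_ge_one_plus_x_over_n_power_n[of 2 x] x by simp
  finally show ?thesis using x by (simp add: exp_minus field_simps)
qed

text \<open>The heat trace is treated for a general absolutely summable combination of two-sided
  multiplications. The decay of \<alpha>(p,-p) faster than any power of the weight is what
  compensates the small distances allowed by the Diophantine condition.\<close>

locale nc_heat = metric gu for gu :: "real ^ 4 ^ 4" +
  fixes \<Theta> :: "real ^ 4 ^ 4" and \<alpha> :: "int ^ 4 => int ^ 4 => complex" and m :: real
  assumes skew: "transpose \<Theta> = - \<Theta>"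
    and dioph: "diophantine \<Theta>"
    and \<alpha>_summable: "(\<lambda>(p,q). norm (\<alpha> p q)) summable_on UNIV"
    and \<alpha>_diag: "\<And>n. (\<lambda>p. wt p ^ n * norm (\<alpha> p (- p))) summable_on UNIV"
begin

definition Bc :: real where "Bc = (\<Sum>\<^sub>\<infinity>(p,q). norm (\<alpha> p q))"

abbreviation "VV \<equiv> Vmat \<Theta> \<alpha>"
abbreviation DD :: "int ^ 4 => real" where "DD k \<equiv> qform gu k + m\<^sup>2"

sublocale dyson DD VV Bc
proof
  show "0 \<le> DD k" for k using qform_nonneg[of k] by simp
  show "0 \<le> Bc" unfolding Bc_def by (intro infsum_nonneg) auto
  show "(\<Oplus>l. enorm (VV l k)) \<le> ennreal Bc" for k
    unfolding Bc_def by (rule Vmat_col_nn[OF \<alpha>_summable])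
  show "(\<Oplus>k. enorm (VV l k)) \<le> ennreal Bc" for l
    unfolding Bc_def by (rule Vmat_row_nn[OF \<alpha>_summable])
qed

lemma exp_DD: "exp (- t * DD k) = exp (- t * m\<^sup>2) * exp (- t * qform gu k)"
  unfolding exp_add[symmetric] by (simp add: algebra_simps)

lemma exp_DD_summable: "0 < t ==> (\<lambda>k. exp (- t * DD k)) summable_on UNIV"
  unfolding exp_DD by (intro summable_on_cmult_right exp_qform_summable)

lemma DD_sum_bound:
  obtains C where "0 \<le> C" "\<And>t. 0 < t ==> t \<le> 1 ==> (\<Sum>k. exp (- t * DD k)) \<le> C / t\<^sup>2"
proof -
  obtain C where C: "0 \<le> C" "\<And>t. 0 < t ==> t \<le> 1 ==> (\<Sum>k. exp (- t * qform gu k)) \<le> C / t\<^sup>2"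
    by (rule heat_sum_bound) blast
  show ?thesis
  proof (rule that[OF C(1)])
    fix t :: real assume t: "0 < t" "t \<le> 1"
    have "(\<Sum>k. exp (- t * DD k)) \<le> (\<Sum>k. exp (- t * qform gu k))"
      using t by (intro infsum_mono exp_DD_summable exp_qform_summable) auto
    also have "... \<le> C / t\<^sup>2" by (rule C(2)[OF t])
    finally show "(\<Sum>k. exp (- t * DD k)) \<le> C / t\<^sup>2" .
  qed
qed

lemma theta_eq: "0 < t ==> theta t = ennreal (\<Sum>k. exp (- t * DD k))"
  unfolding theta_def using nn_integral_count_space_infsum[of "\<lambda>k. exp (- t * DD k)" UNIV] exp_DD_summable by simp

text \<open>The Diophantine condition in the form in which it is used. The fourth power of
  1/\<delta> appears because exp(-\<kappa>\<delta>^2/t) will be estimated by an inverse square of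
  its exponent.\<close>

lemma dioph_bound:
  obtains C n where "0 < C" "\<And>p. p \<noteq> 0 ==> \<exists>\<delta>>0. (\<forall>k. \<delta> \<le> norm (\<Theta> *v lat p + (2 * pi) *\<^sub>R lat k)) \<and> 1 / \<delta> ^ 4 \<le> C * wt p ^ n"
proof -
  obtain C \<beta> where C: "C > 0" "\<beta> > 0" and d: "\<And>q. q \<noteq> 0 ==> 
        (INF k::int ^ 4. norm (\<Theta> *v lat q - (2 * pi) *\<^sub>R lat k)) \<ge> C * norm (lat q) powr (- (1 + \<beta>))"
    using dioph unfolding diophantine_def by blast
  \<comment> \<open>Chosen so that |p|^(4(1+\<beta>)) is at most |p|^(2n), which is at most the n-th
    power of the weight.\<close>
  define n where "n = nat \<lceil>2 * (1 + \<beta>)\<rceil>"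
  have n: "2 * (1 + \<beta>) \<le> real n" unfolding n_def using C by linarith
  show ?thesis
  proof (rule that[of "1 / C ^ 4" n])
    show "0 < 1 / C ^ 4" using C by simp
    fix p :: "int ^ 4" assume p: "p \<noteq> 0"
    have np: "1 \<le> norm (lat p)" by (rule lat_norm_ge_1[OF p])
    define \<delta> where "\<delta> = C * norm (lat p) powr (- (1 + \<beta>))"
    have "0 < norm (lat p)" using np by linarith
    then have d0: "\<delta> > 0" using C by (simp add: \<delta>_def)
    have "\<delta> \<le> norm (\<Theta> *v lat p + (2 * pi) *\<^sub>R lat k)" for k
    proof -
      have "\<delta> \<le> (INF k::int ^ 4. norm (\<Theta> *v lat p - (2 * pi) *\<^sub>R lat k))"
        unfolding \<delta>_def by (rule d[OF p])
      also have "... \<le> norm (\<Theta> *v lat p - (2 * pi) *\<^sub>R lat (- k))"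
        by (rule cINF_lower) (auto intro!: bdd_belowI2[where m=0])
      finally show ?thesis by (simp add: lat_minus)
    qed
    moreover have "1 / \<delta> ^ 4 \<le> 1 / C ^ 4 * wt p ^ n"
    proof -
      have "\<delta> ^ 4 = C ^ 4 * norm (lat p) powr (- (4 * (1 + \<beta>)))"
        using \<open>0 < norm (lat p)\<close> powr_powr[of "norm (lat p)" "- (1 + \<beta>)" 4]
        by (simp only: \<delta>_def power_mult_distrib flip: powr_numeral) (simp add: algebra_simps)
      then have "1 / \<delta> ^ 4 = 1 / C ^ 4 * norm (lat p) powr (4 * (1 + \<beta>))"
        unfolding powr_minus by (simp add: divide_inverse)
      also have "norm (lat p) powr (4 * (1 + \<beta>)) \<le> norm (lat p) powr (real (2 * n))"
        using n np by (intro powr_mono) auto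
      also have "... = norm (lat p) ^ (2 * n)" using np by (intro powr_realpow) linarith
      also have "... = ((norm (lat p))\<^sup>2) ^ n" by (simp add: power_mult)
      also have "... \<le> wt p ^ n" by (intro power_mono) (auto simp: wt_def)
      finally show ?thesis using C by (simp add: mult_left_mono divide_right_mono)
    qed
    ultimately show "\<exists>\<delta>>0. (\<forall>k. \<delta> \<le> norm (\<Theta> *v lat p + (2 * pi) *\<^sub>R lat k)) \<and> 1 / \<delta> ^ 4 \<le> 1 / C ^ 4 * wt p ^ n"
      using d0 by blast
  qed
qed

lemma ph_double: "ph \<Theta> (p + p) k = plane_wave k (\<Theta> *v lat p)"
proof -
  have "ph \<Theta> (p + p) k = cis (- sb \<Theta> p k)" by (simp only: ph_def sb_add cis_mult) simp
  also have "- sb \<Theta> p k = sb \<Theta> k p" using sb_skew[OF skew, of k p] by simp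
  finally show ?thesis by (simp add: plane_wave_def sb_def)
qed

text \<open>Conjugating e_k by e_p gives e_k times its value at \<Theta>p: the two-sided
  multiplication with q = -p is translation by \<Theta>p. This brings the free kernel at \<Theta>p
  into the trace.\<close>

lemma VV_diag: "VV k k = (\<Sum>p. \<alpha> p (- p) * plane_wave k (\<Theta> *v lat p))"
proof -
  have "ph \<Theta> p (- p) = 1" for p by (simp add: ph_def sb_minus sb_self[OF skew])
  then show ?thesis by (simp add: Vmat_def flip: ph_double)
qed

lemma \<alpha>_diag0: "(\<lambda>p. norm (\<alpha> p (- p))) summable_on UNIV"
  using \<alpha>_diag[of 0] by simp

lemma S1_diag: "0 \<le> t ==> S 1 k k t = - (of_real t * (VV k k * of_real (exp (- t * DD k))))"
proof -
  assume t: "0 \<le> t"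
  have "exp (- (t - s) * DD k) * exp (- s * DD k) = exp (- t * DD k)" for s
    unfolding exp_add[symmetric] by (simp add: algebra_simps)
  then show ?thesis unfolding S_1_eq using t by (simp add: scaleR_conv_of_real)
qed

text \<open>On the diagonal the two exponentials in the first-order term combine to exp(-t D_k), so
  the time integral is a factor t; exchanging the sums over k and p produces
  \<open>theta0\<close>.\<close>

lemma trace_S1:
  assumes t: "0 < t"
  shows "(\<Sum>k. S 1 k k t) = - (of_real (t * exp (- t * m\<^sup>2)) * (\<Sum>p. \<alpha> p (- p) * theta0 t (\<Theta> *v lat p)))"
proof -
  let ?f = "\<lambda>k p. \<alpha> p (- p) * (of_real (exp (- t * qform gu k)) * plane_wave k (\<Theta> *v lat p))"
  have "(\<Oplus>k. (\<Oplus>p. enorm (?f k p)))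
     = (\<Oplus>k. enorm (exp (- t * qform gu k))) * (\<Oplus>p. enorm (\<alpha> p (- p)))"
    by (simp add: norm_mult ennreal_mult' nn_integral_cmult nn_integral_multc mult.commute)
  also have "... < \<infinity>"
  proof -
    have "(\<lambda>k. norm (exp (- t * qform gu k))) summable_on UNIV" using exp_qform_summable[OF t] by simp
    then show ?thesis using \<alpha>_diag0 by (simp only: summable_norm_iff_nn ennreal_mult_less_top infinity_ennreal_def) simp
  qed
  finally have sw: "(\<lambda>(k,p). ?f k p) summable_on UNIV \<times> UNIV" by (rule summable_on_product_nnI(2))
  have "(\<Sum>k. S 1 k k t) = (\<Sum>k. - (of_real (t * exp (- t * m\<^sup>2)) * (\<Sum>p. ?f k p)))"
  proof (rule infsum_cong)
    fix k
    have "(\<Sum>p. ?f k p) = of_real (exp (- t * qform gu k)) * VV k k"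
      unfolding VV_diag by (simp only: infsum_cmult_right'[symmetric] mult.left_commute)
    then show "S 1 k k t = - (of_real (t * exp (- t * m\<^sup>2)) * (\<Sum>p. ?f k p))"
      unfolding S1_diag[OF less_imp_le[OF t]] exp_DD by (simp del: S.simps add: mult_ac)
  qed
  also have "... = - (of_real (t * exp (- t * m\<^sup>2)) * (\<Sum>k. \<Sum>p. ?f k p))"
    by (simp only: infsum_uminus infsum_cmult_right')
  also have "(\<Sum>k. \<Sum>p. ?f k p) = (\<Sum>p. \<Sum>k. ?f k p)" by (rule infsum_swap_banach[OF sw])
  also have "... = (\<Sum>p. \<alpha> p (- p) * theta0 t (\<Theta> *v lat p))"
    by (simp only: infsum_cmult_right' theta0_def)
  finally show ?thesis .
qed

lemma exp_inverse_over_tendsto: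
  assumes "0 < \<kappa>"
  shows "((\<lambda>t. exp (- \<kappa> / t) / t) \<longlongrightarrow> 0) (at_right (0::real))"
    "((\<lambda>t. exp (- \<kappa> / t) / t\<^sup>2) \<longlongrightarrow> 0) (at_right (0::real))"
proof -
  have b: "exp (- \<kappa> / t) \<le> 256 / \<kappa> ^ 4 * t ^ 4" if t: "0 < t" for t
  proof -
    let ?y = "\<kappa> / t"
    have y: "0 < ?y" using assms t by simp
    have "(?y / 4) ^ 4 \<le> (1 + ?y / 4) ^ 4" using y by (intro power_mono) auto
    also have "... \<le> exp ?y" using exp_ge_one_plus_x_over_n_power_n[of 4 ?y] y by simp
    finally show ?thesis using t assms by (simp add: exp_minus field_simps)
  qed
  show "((\<lambda>t. exp (- \<kappa> / t) / t) \<longlongrightarrow> 0) (at_right 0)"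
  proof (rule Lim_null_comparison)
    show "\<forall>\<^sub>F t in at_right 0. norm (exp (- \<kappa> / t) / t) \<le> 256 / \<kappa> ^ 4 * t ^ 3"
      using eventually_at_right_less[of "0::real"]
    proof eventually_elim
      case (elim t)
      have "exp (- \<kappa> / t) / t \<le> (256 / \<kappa> ^ 4 * t ^ 4) / t" using b[OF elim] elim by (intro divide_right_mono) auto
      also have "... = 256 / \<kappa> ^ 4 * t ^ 3" using elim by (simp add: power4_eq_xxxx power3_eq_cube)
      finally show ?case using elim by simp
    qed
    have "((\<lambda>t. 256 / \<kappa> ^ 4 * t ^ 3) \<longlongrightarrow> 256 / \<kappa> ^ 4 * 0 ^ 3) (at_right 0)" by (intro tendsto_intros)
    then show "((\<lambda>t. 256 / \<kappa> ^ 4 * t ^ 3) \<longlongrightarrow> 0) (at_right 0)" by simp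
  qed
  show "((\<lambda>t. exp (- \<kappa> / t) / t\<^sup>2) \<longlongrightarrow> 0) (at_right 0)"
  proof (rule Lim_null_comparison)
    show "\<forall>\<^sub>F t in at_right 0. norm (exp (- \<kappa> / t) / t\<^sup>2) \<le> 256 / \<kappa> ^ 4 * t ^ 2"
      using eventually_at_right_less[of "0::real"]
    proof eventually_elim
      case (elim t)
      have "exp (- \<kappa> / t) / t\<^sup>2 \<le> (256 / \<kappa> ^ 4 * t ^ 4) / t\<^sup>2" using b[OF elim] elim by (intro divide_right_mono) auto
      also have "... = 256 / \<kappa> ^ 4 * t ^ 2" using elim by (simp add: power4_eq_xxxx power2_eq_square)
      finally show ?case using elim by simp
    qed
    have "((\<lambda>t. 256 / \<kappa> ^ 4 * t ^ 2) \<longlongrightarrow> 256 / \<kappa> ^ 4 * 0 ^ 2) (at_right 0)" by (intro tendsto_intros)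
    then show "((\<lambda>t. 256 / \<kappa> ^ 4 * t ^ 2) \<longlongrightarrow> 0) (at_right 0)" by simp
  qed
qed

lemma eventually_unit: "\<forall>\<^sub>F t in at_right (0::real). 0 < t \<and> t \<le> 1"
  using eventually_at_right_less[of "0::real"] eventually_at_right_field[of "\<lambda>t. t \<le> 1" "0::real"]
  by (auto intro: eventually_conj exI[of _ 1])

text \<open>The same exponentially small error in the three scalings in which the kernel at the
  origin enters orders 0, 1 and 2 of the Dyson series.\<close>

lemma theta0_zero_limit: "((\<lambda>t. theta0 t 0 - of_real (c0 / t\<^sup>2)) \<longlongrightarrow> 0) (at_right 0)"
  "((\<lambda>t. of_real t * theta0 t 0 - of_real (c0 / t)) \<longlongrightarrow> 0) (at_right 0)"
  "((\<lambda>t. of_real (t\<^sup>2) * theta0 t 0) \<longlongrightarrow> of_real c0) (at_right 0)"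
proof -
  obtain C \<kappa> where C: "0 \<le> C" "0 < \<kappa>" "\<And>t. 0 < t ==> t \<le> 1 ==> norm (of_real (t\<^sup>2) * theta0 t 0 - of_real c0) \<le> C * exp (- \<kappa> / t)"
    by (rule theta0_bounds) blast
  show 1: "((\<lambda>t. theta0 t 0 - of_real (c0 / t\<^sup>2)) \<longlongrightarrow> 0) (at_right 0)"
  proof (rule Lim_null_comparison)
    show "\<forall>\<^sub>F t in at_right 0. norm (theta0 t 0 - of_real (c0 / t\<^sup>2)) \<le> C * (exp (- \<kappa> / t) / t\<^sup>2)"
      using eventually_unit
    proof eventually_elim
      case (elim t)
      have "theta0 t 0 - of_real (c0 / t\<^sup>2) = (of_real (t\<^sup>2) * theta0 t 0 - of_real c0) / of_real (t\<^sup>2)"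
        using elim by (simp add: field_simps)
      then have "norm (theta0 t 0 - of_real (c0 / t\<^sup>2)) = norm (of_real (t\<^sup>2) * theta0 t 0 - of_real c0) / t\<^sup>2"
        by (simp add: norm_divide norm_power)
      also have "... \<le> C * exp (- \<kappa> / t) / t\<^sup>2" using C(3)[of t] elim by (intro divide_right_mono) auto
      finally show ?case by simp
    qed
    have "((\<lambda>t. C * (exp (- \<kappa> / t) / t\<^sup>2)) \<longlongrightarrow> C * 0) (at_right 0)" by (intro tendsto_intros exp_inverse_over_tendsto C)
    then show "((\<lambda>t. C * (exp (- \<kappa> / t) / t\<^sup>2)) \<longlongrightarrow> 0) (at_right 0)" by simp
  qed
  have "((\<lambda>t. of_real t * (theta0 t 0 - of_real (c0 / t\<^sup>2))) \<longlongrightarrow> of_real 0 * 0) (at_right 0)"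
    by (intro tendsto_intros 1)
  then show "((\<lambda>t. of_real t * theta0 t 0 - of_real (c0 / t)) \<longlongrightarrow> 0) (at_right 0)"
    by (rule Lim_transform_eventually[OF _ eventually_mono[OF eventually_unit], THEN tendsto_eq_rhs])
      (auto simp: field_simps power2_eq_square)
  have "((\<lambda>t. of_real (t\<^sup>2) * (theta0 t 0 - of_real (c0 / t\<^sup>2)) + of_real c0) \<longlongrightarrow> of_real (0\<^sup>2) * 0 + of_real c0) (at_right 0)"
    by (intro tendsto_intros 1)
  then show "((\<lambda>t. of_real (t\<^sup>2) * theta0 t 0) \<longlongrightarrow> of_real c0) (at_right 0)"
    by (rule Lim_transform_eventually[OF _ eventually_mono[OF eventually_unit], THEN tendsto_eq_rhs])
      (auto simp: field_simps)
qed

lemma theta0_nonzero_limit: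
  assumes "p \<noteq> 0"
  shows "((\<lambda>t. of_real (t\<^sup>2) * theta0 t (\<Theta> *v lat p)) \<longlongrightarrow> 0) (at_right 0)"
proof -
  obtain C \<kappa> where C: "0 \<le> C" "0 < \<kappa>" "\<And>t \<xi> \<delta>. 0 < t ==> t \<le> 1 ==> 0 \<le> \<delta> ==> (\<And>k. \<delta> \<le> norm (\<xi> + (2 * pi) *\<^sub>R lat k)) ==> 
        norm (of_real (t\<^sup>2) * theta0 t \<xi>) \<le> C * exp (- (\<kappa> * \<delta>\<^sup>2) / t)"
    by (rule theta0_bounds) blast
  obtain \<delta> where d: "\<delta> > 0" "\<And>k. \<delta> \<le> norm (\<Theta> *v lat p + (2 * pi) *\<^sub>R lat k)"
    using dioph_bound assms by metis
  have k: "0 < \<kappa> * \<delta>\<^sup>2" using C d by simp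
  show ?thesis
  proof (rule Lim_null_comparison)
    show "\<forall>\<^sub>F t in at_right 0. norm (of_real (t\<^sup>2) * theta0 t (\<Theta> *v lat p)) \<le> C * (exp (- (\<kappa> * \<delta>\<^sup>2) / t) / t)"
      using eventually_unit
    proof eventually_elim
      case (elim t)
      have "norm (of_real (t\<^sup>2) * theta0 t (\<Theta> *v lat p)) \<le> C * exp (- (\<kappa> * \<delta>\<^sup>2) / t)"
        using C(3)[of t \<delta> "\<Theta> *v lat p"] elim d by auto
      also have "... \<le> C * (exp (- (\<kappa> * \<delta>\<^sup>2) / t) / t)"
        using elim C(1) by (intro mult_left_mono) (auto simp: field_simps mult_left_le)
      finally show ?case .
    qed
    have "((\<lambda>t. C * (exp (- (\<kappa> * \<delta>\<^sup>2) / t) / t)) \<longlongrightarrow> C * 0) (at_right 0)" by (intro tendsto_intros exp_inverse_over_tendsto k)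
    then show "((\<lambda>t. C * (exp (- (\<kappa> * \<delta>\<^sup>2) / t) / t)) \<longlongrightarrow> 0) (at_right 0)" by simp
  qed
qed

text \<open>The frequency p = 0 gives the singular term. For p nonzero, exp(-x) <= 4/x^2 with x =
  \<kappa>\<delta>^2/t bounds t \<open>theta0\<close> by A t times a power of the weight of p.
  Summed against the rapidly decreasing \<alpha>(p,-p) this is O(t), which is where uniformity of
  the Diophantine bound in p enters.\<close>

lemma first_order_limit:
  "((\<lambda>t. of_real t * (\<Sum>p. \<alpha> p (- p) * theta0 t (\<Theta> *v lat p)) - of_real (c0 / t) * \<alpha> 0 0) \<longlongrightarrow> 0) (at_right 0)"
proof -
  obtain C \<kappa> where C: "0 \<le> C" "0 < \<kappa>" "\<And>t \<xi> \<delta>. 0 < t ==> t \<le> 1 ==> 0 \<le> \<delta> ==> (\<And>k. \<delta> \<le> norm (\<xi> + (2 * pi) *\<^sub>R lat k)) ==> 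
        norm (of_real (t\<^sup>2) * theta0 t \<xi>) \<le> C * exp (- (\<kappa> * \<delta>\<^sup>2) / t)"
    by (rule theta0_bounds) blast
  obtain E n where E: "0 < E" "\<And>p. p \<noteq> 0 ==> \<exists>\<delta>>0. (\<forall>k. \<delta> \<le> norm (\<Theta> *v lat p + (2 * pi) *\<^sub>R lat k)) \<and> 1 / \<delta> ^ 4 \<le> E * wt p ^ n"
    by (rule dioph_bound) blast
  define A where "A = 4 * C * E / \<kappa>\<^sup>2"
  have A0: "0 \<le> A" using C E by (simp add: A_def)
  have far: "norm (of_real t * theta0 t (\<Theta> *v lat p)) \<le> A * t * wt p ^ n" if t: "0 < t" "t \<le> 1" and p: "p \<noteq> 0" for t p
  proof -
    obtain \<delta> where d: "\<delta> > 0" "\<And>k. \<delta> \<le> norm (\<Theta> *v lat p + (2 * pi) *\<^sub>R lat k)" "1 / \<delta> ^ 4 \<le> E * wt p ^ n"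
      using E(2)[OF p] by blast
    have "norm (of_real (t\<^sup>2) * theta0 t (\<Theta> *v lat p)) \<le> C * exp (- (\<kappa> * \<delta>\<^sup>2 / t))"
      using C(3)[OF t _ d(2)] d(1) by simp
    also have "... \<le> C * (4 / (\<kappa> * \<delta>\<^sup>2 / t)\<^sup>2)"
      using C d t by (intro mult_left_mono exp_neg_le_inverse_square) auto
    also have "... = 4 * C / \<kappa>\<^sup>2 * t\<^sup>2 * (1 / \<delta> ^ 4)"
      by (simp add: power_divide power_mult_distrib)
    also have "... \<le> 4 * C / \<kappa>\<^sup>2 * t\<^sup>2 * (E * wt p ^ n)"
      using C d by (intro mult_left_mono) auto
    also have "... = t\<^sup>2 * (A * wt p ^ n)" by (simp add: A_def)
    finally have "t * norm (of_real t * theta0 t (\<Theta> *v lat p)) \<le> t * (A * t * wt p ^ n)"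
      using t by (simp add: norm_mult norm_power power2_eq_square mult_ac)
    then show ?thesis using t by simp
  qed
  let ?f = "\<lambda>t p. \<alpha> p (- p) * (of_real t * theta0 t (\<Theta> *v lat p))"
  define W where "W = (\<Sum>\<^sub>\<infinity>p\<in>-{0}. wt p ^ n * norm (\<alpha> p (- p)))"
  have wsum: "(\<lambda>p. A * t * (wt p ^ n * norm (\<alpha> p (- p)))) summable_on -{0}" for t
    by (intro summable_on_cmult_right summable_on_subset_banach[OF \<alpha>_diag]) auto
  have bd: "norm (?f t p) \<le> A * t * (wt p ^ n * norm (\<alpha> p (- p)))" if "0 < t" "t \<le> 1" "p \<in> -{0}" for t p
    using mult_left_mono[OF far[of t p], of "norm (\<alpha> p (- p))"] that by (simp add: norm_mult mult_ac)
  have ns: "(\<lambda>p. norm (?f t p)) summable_on -{0}" if "0 < t" "t \<le> 1" for t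
    by (rule summable_on_comparison_test[OF wsum bd[OF that]]) auto
  have rest: "norm (\<Sum>\<^sub>\<infinity>p\<in>-{0}. ?f t p) \<le> A * t * W" if t: "0 < t" "t \<le> 1" for t
  proof -
    have "norm (\<Sum>\<^sub>\<infinity>p\<in>-{0}. ?f t p) \<le> (\<Sum>\<^sub>\<infinity>p\<in>-{0}. norm (?f t p))" by (rule norm_infsum_bound[OF ns[OF t]])
    also have "... \<le> (\<Sum>\<^sub>\<infinity>p\<in>-{0}. A * t * (wt p ^ n * norm (\<alpha> p (- p))))"
      by (rule infsum_mono[OF ns[OF t] wsum bd[OF t]])
    also have "... = A * t * W" unfolding W_def by (rule infsum_cmult_right')
    finally show ?thesis .
  qed
  have split: "of_real t * (\<Sum>p. \<alpha> p (- p) * theta0 t (\<Theta> *v lat p)) - of_real (c0 / t) * \<alpha> 0 0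
     = \<alpha> 0 0 * (of_real t * theta0 t 0 - of_real (c0 / t)) + (\<Sum>\<^sub>\<infinity>p\<in>-{0}. ?f t p)" if t: "0 < t" "t \<le> 1" for t
  proof -
    have "of_real t * (\<Sum>p. \<alpha> p (- p) * theta0 t (\<Theta> *v lat p)) = (\<Sum>p. ?f t p)"
      by (simp only: infsum_cmult_right'[symmetric] mult.left_commute)
    also have "... = (\<Sum>\<^sub>\<infinity>p\<in>insert 0 (-{0}). ?f t p)" by (simp add: insert_absorb Compl_eq_Diff_UNIV)
    also have "... = ?f t 0 + (\<Sum>\<^sub>\<infinity>p\<in>-{0}. ?f t p)"
      by (rule infsum_insert[OF abs_summable_summable[OF ns[OF t]]]) auto
    finally show ?thesis by (simp add: algebra_simps)
  qed
  have l2: "((\<lambda>t. \<Sum>\<^sub>\<infinity>p\<in>-{0}. ?f t p) \<longlongrightarrow> 0) (at_right 0)"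
  proof (rule Lim_null_comparison)
    show "\<forall>\<^sub>F t in at_right 0. norm (\<Sum>\<^sub>\<infinity>p\<in>-{0}. ?f t p) \<le> A * t * W"
      using eventually_unit by eventually_elim (use rest in auto)
    have "((\<lambda>t. A * t * W) \<longlongrightarrow> A * 0 * W) (at_right 0)" by (intro tendsto_intros)
    then show "((\<lambda>t. A * t * W) \<longlongrightarrow> 0) (at_right 0)" by simp
  qed
  have "((\<lambda>t. \<alpha> 0 0 * (of_real t * theta0 t 0 - of_real (c0 / t)) + (\<Sum>\<^sub>\<infinity>p\<in>-{0}. ?f t p)) \<longlongrightarrow> \<alpha> 0 0 * 0 + 0) (at_right 0)"
    by (intro tendsto_intros theta0_zero_limit l2)
  then show ?thesis
    by (rule Lim_transform_eventually[OF _ eventually_mono[OF eventually_unit], THEN tendsto_eq_rhs])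
      (use split in auto)
qed

end

section \<open>Trace of the second-order term\<close>

lemma infsum_triple:
  fixes f :: "'a => 'b => 'c => complex"
  assumes "(\<lambda>(x,y,z). f x y z) summable_on UNIV"
  shows "(\<Sum>x. \<Sum>y. \<Sum>z. f x y z) = (\<Sum>\<^sub>\<infinity>(x,y,z). f x y z)"
proof -
  have s: "(\<lambda>(y,z). f x y z) summable_on UNIV \<times> UNIV" for x
  proof -
    have "(\<lambda>(x,y,z). f x y z) summable_on range (Pair x)" using assms by (rule summable_on_subset_banach) simp
    then show ?thesis by (subst (asm) summable_on_reindex) (auto simp: inj_on_def o_def)
  qed
  have "(\<lambda>(x,w). case w of (y,z) => f x y z) summable_on UNIV \<times> UNIV" using assms by simp
  from infsum_Sigma'_banach[OF this] infsum_Sigma'_banach[OF s] show ?thesis by simp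
qed

text \<open>On the segment between A and B the exponential is at most the larger endpoint value, and
  the mean value estimate follows. The sum of the two endpoint values is used because either
  diagonal entry may be the smaller one.\<close>

lemma exp_minus_segment_bounds:
  fixes A B x :: real
  assumes "min A B \<le> x" "x \<le> max A B"
  shows "exp (- x) \<le> exp (- A) + exp (- B)" "\<bar>exp (- x) - exp (- B)\<bar> \<le> \<bar>A - B\<bar> * (exp (- A) + exp (- B))"
proof -
  show 1: "exp (- x) \<le> exp (- A) + exp (- B)"
  proof (cases "A \<le> B")
    case True
    then have "exp (- x) \<le> exp (- A)" using assms by simp
    then show ?thesis using exp_ge_zero[of "- B"] by linarith
  next
    case False
    then have "exp (- x) \<le> exp (- B)" using assms by simp
    then show ?thesis using exp_ge_zero[of "- A"] by linarith
  qed
  have gen: "\<bar>exp (- u) - exp (- v)\<bar> \<le> \<bar>u - v\<bar> * max (exp (- u)) (exp (- v))" for u v :: real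
  proof -
    have *: "exp (- u) - exp (- v) \<le> (v - u) * exp (- u)" if "u \<le> v" for u v :: real
    proof -
      have "1 - exp (- (v - u)) \<le> v - u" using exp_ge_add_one_self[of "- (v - u)"] by linarith
      then have "exp (- u) * (1 - exp (- (v - u))) \<le> exp (- u) * (v - u)" by (intro mult_left_mono) auto
      moreover have "exp (- u) * exp (- (v - u)) = exp (- v)" unfolding exp_add[symmetric] by simp
      ultimately show ?thesis by (simp add: algebra_simps)
    qed
    show ?thesis using *[of u v] *[of v u] by (cases "u \<le> v") (auto simp: max_def abs_if)
  qed
  have "\<bar>exp (- x) - exp (- B)\<bar> \<le> \<bar>x - B\<bar> * max (exp (- x)) (exp (- B))" by (rule gen)
  also have "... \<le> \<bar>A - B\<bar> * (exp (- A) + exp (- B))"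
    using assms 1 by (intro mult_mono) (auto simp: min_def max_def split: if_splits)
  finally show "\<bar>exp (- x) - exp (- B)\<bar> \<le> \<bar>A - B\<bar> * (exp (- A) + exp (- B))" .
qed

text \<open>The inner time integral of the second-order Dyson term: a path that starts and ends at a
  level a and spends an intermediate time at a level b. The outer integral is
  \<open>heat_J\<close>.\<close>

definition heat_I :: "real => real => real => real" where
  "heat_I a b s = integral {0..s} (\<lambda>u. exp (- (s - u) * b) * exp (- u * a))"

definition heat_J :: "real => real => real => real" where
  "heat_J a b t = integral {0..t} (\<lambda>s. exp (- (t - s) * a) * heat_I a b s)"

lemma heat_I_continuous: "continuous_on {0..t} (heat_I a b)"
proof -
  have "heat_I a b s = exp (- s * b) * integral {0..s} (\<lambda>u. exp (u * b) * exp (- u * a))" for s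
  proof -
    have "exp (- (s - u) * b) * exp (- u * a) = exp (- s * b) * (exp (u * b) * exp (- u * a))" for u
      unfolding exp_add[symmetric] by (simp add: algebra_simps)
    then show ?thesis unfolding heat_I_def by (simp only: integral_mult_right)
  qed
  then have "heat_I a b = (\<lambda>s. exp (- s * b) * integral {0..s} (\<lambda>u. exp (u * b) * exp (- u * a)))" by blast
  moreover have "continuous_on {0..t} (\<lambda>s. integral {0..s} (\<lambda>u. exp (u * b) * exp (- u * a)))"
    by (intro indefinite_integral_continuous_1 integrable_continuous_interval continuous_intros)
  ultimately show ?thesis by (auto intro!: continuous_intros)
qed

text \<open>Over the simplex 0 <= u <= s <= t, of area t^2/2, the total exponent (t-s+u)a + (s-u)b
  lies between ta and tb. Replacing it by tb costs at most t|a-b| times the sum of the endpoint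
  exponentials.\<close>

lemma
  fixes a b t :: real
  assumes t: "0 \<le> t"
  defines "K \<equiv> exp (- t * a) + exp (- t * b)"
  shows heat_J_nonneg: "0 \<le> heat_J a b t"
    and heat_J_le: "heat_J a b t \<le> t\<^sup>2 * K"
    and heat_J_approx: "\<bar>heat_J a b t - t\<^sup>2 / 2 * exp (- t * b)\<bar> \<le> t\<^sup>2 * (t * \<bar>a - b\<bar> * K)"
proof -
  let ?E = "\<lambda>s u. exp (- (t - s) * a) * (exp (- (s - u) * b) * exp (- u * a))"
  have K0: "0 \<le> K" by (simp add: K_def)
  have E: "?E s u \<le> K" "\<bar>?E s u - exp (- t * b)\<bar> \<le> t * \<bar>a - b\<bar> * K" if "0 \<le> u" "u \<le> s" "s \<le> t" for s u
  proof -
    let ?x = "(t - s + u) * a + (s - u) * b"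
    have x: "?E s u = exp (- ?x)" unfolding exp_add[symmetric] by (simp add: algebra_simps)
    have "min (t * a) (t * b) \<le> ?x \<and> ?x \<le> max (t * a) (t * b)"
    proof (cases "a \<le> b")
      case True
      have "(t - s + u) * a \<le> (t - s + u) * b" "(s - u) * a \<le> (s - u) * b" "t * a \<le> t * b"
        using that True t by (auto intro!: mult_left_mono)
      then show ?thesis by (simp add: algebra_simps min_def max_def)
    next
      case False
      have "(t - s + u) * b \<le> (t - s + u) * a" "(s - u) * b \<le> (s - u) * a" "t * b \<le> t * a"
        using that False t by (auto intro!: mult_left_mono)
      then show ?thesis by (simp add: algebra_simps min_def max_def)
    qed
    from exp_minus_segment_bounds[OF conjunct1[OF this] conjunct2[OF this]]
    have "exp (- ?x) \<le> K" "\<bar>exp (- ?x) - exp (- (t * b))\<bar> \<le> \<bar>t * a - t * b\<bar> * K" by (auto simp: K_def)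
    moreover have "\<bar>t * a - t * b\<bar> = t * \<bar>a - b\<bar>" using t by (simp add: abs_mult flip: right_diff_distrib)
    ultimately show "?E s u \<le> K" "\<bar>?E s u - exp (- t * b)\<bar> \<le> t * \<bar>a - b\<bar> * K" unfolding x by simp_all
  qed
  let ?F = "\<lambda>s. exp (- (t - s) * a) * heat_I a b s"
  have F: "(?E s has_integral ?F s) {0..s}" for s
    unfolding heat_I_def
    by (intro has_integral_mult_right integrable_integral integrable_continuous_interval continuous_intros)
  have F0: "0 \<le> ?F s" if "0 \<le> s" for s
    by (rule has_integral_nonneg[OF F]) auto
  have J: "(?F has_integral heat_J a b t) {0..t}"
    unfolding heat_J_def
    by (intro integrable_integral integrable_continuous_interval continuous_intros heat_I_continuous)
  show "0 \<le> heat_J a b t" by (rule has_integral_nonneg[OF J]) (use F0 in auto)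
  have const: "((\<lambda>u. c) has_integral s * c) {0..s}" if "0 \<le> s" for s c :: real
    using has_integral_const_real[of c 0 s] that by simp
  have F1: "?F s \<le> t * K" if s: "0 \<le> s" "s \<le> t" for s
  proof -
    have "?F s \<le> s * K" by (rule has_integral_le[OF F const]) (use E s in auto)
    also have "... \<le> t * K" using s K0 by (intro mult_right_mono)
    finally show ?thesis .
  qed
  have "heat_J a b t \<le> t * (t * K)" by (rule has_integral_le[OF J const]) (use F1 t in auto)
  then show "heat_J a b t \<le> t\<^sup>2 * K" by (simp add: power2_eq_square mult.assoc)
  let ?R = "t * \<bar>a - b\<bar> * K"
  have R0: "0 \<le> ?R" using t K0 by simp
  have F2: "norm (?F s - s * exp (- t * b)) \<le> t * ?R" if s: "0 \<le> s" "s \<le> t" for s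
  proof -
    have "norm (?F s - s * exp (- t * b)) \<le> ?R * measure lborel {0..s}"
      by (rule has_integral_bound_real[OF R0 finite.emptyI has_integral_diff[OF F const]]) (use E s in auto)
    also have "... \<le> t * ?R" using s R0 by (simp add: mult.commute[of ?R] mult_right_mono del: mult_le_cancel_right)
    finally show ?thesis .
  qed
  have id: "((\<lambda>s. s * exp (- t * b)) has_integral t\<^sup>2 / 2 * exp (- t * b)) {0..t}"
    using ident_has_integral[OF t] by (intro has_integral_mult_left) simp
  have "norm (heat_J a b t - t\<^sup>2 / 2 * exp (- t * b)) \<le> t * ?R * measure lborel {0..t}"
    by (rule has_integral_bound_real[OF _ finite.emptyI has_integral_diff[OF J id]]) (use F2 t R0 in auto)
  then show "\<bar>heat_J a b t - t\<^sup>2 / 2 * exp (- t * b)\<bar> \<le> t\<^sup>2 * ?R"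
    using t by (simp add: power2_eq_square mult_ac)
qed

context metric
begin

text \<open>Cauchy-Schwarz for the metric with a free parameter: the cross term between l and r is
  absorbed by a small multiple of q(l) and a large multiple of q(r).\<close>

lemma qform_shift:
  assumes e: "0 < \<epsilon>"
  shows "\<bar>qform gu (l + r) - qform gu l\<bar> \<le> \<epsilon> * qform gu l + (1 + 1 / \<epsilon>) * qform gu r"
proof -
  let ?b = "lat l \<bullet> (gu *v lat r)"
  have sym: "lat r \<bullet> (gu *v lat l) = ?b"
    using dot_lmul_matrix[of "lat r" gu "lat l"] gu_sym by (metis inner_commute transpose_matrix_vector)
  have sq: "0 \<le> (\<epsilon> *\<^sub>R lat l + s *\<^sub>R lat r) \<bullet> (gu *v (\<epsilon> *\<^sub>R lat l + s *\<^sub>R lat r))" for s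
    using gu_pos[of "\<epsilon> *\<^sub>R lat l + s *\<^sub>R lat r"] by (cases "\<epsilon> *\<^sub>R lat l + s *\<^sub>R lat r = 0") auto
  have ex: "(\<epsilon> *\<^sub>R lat l + s *\<^sub>R lat r) \<bullet> (gu *v (\<epsilon> *\<^sub>R lat l + s *\<^sub>R lat r))
      = \<epsilon>\<^sup>2 * qform gu l + 2 * \<epsilon> * s * ?b + s\<^sup>2 * qform gu r" for s
    by (simp add: qform_def matrix_vector_right_distrib matrix_vector_mult_scaleR inner_add_left inner_add_right sym power2_eq_square algebra_simps)
  have "2 * \<epsilon> * \<bar>?b\<bar> \<le> \<epsilon>\<^sup>2 * qform gu l + qform gu r"
    using sq[of 1] sq[of "-1"] unfolding ex by (simp add: abs_if)
  then have "2 * \<bar>?b\<bar> \<le> \<epsilon> * qform gu l + 1 / \<epsilon> * qform gu r"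
    using e by (simp add: field_simps power2_eq_square)
  moreover have "qform gu (l + r) - qform gu l = 2 * ?b + qform gu r"
    by (simp add: qform_def lat_add matrix_vector_right_distrib inner_add_left inner_add_right sym)
  ultimately show ?thesis using qform_nonneg[of r] by (simp add: algebra_simps abs_if split: if_splits)
qed

text \<open>The choice \<epsilon> = sqrt t balances the two terms of \<open>qform_shift\<close>.
  Half of the exponential absorbs the factor t q(l), the other half remains so that the bound is
  summable over l; the gain is sqrt t.\<close>

lemma exp_qform_shift:
  assumes t: "0 < t" "t \<le> 1"
  shows "t * \<bar>qform gu (l + r) - qform gu l\<bar> * exp (- t * qform gu l) \<le> sqrt t * (1 + 2 * qform gu r) * exp (- (t / 2) * qform gu l)"
proof -
  let ?q = "qform gu l" and ?r = "qform gu r"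
  have st: "0 < sqrt t" "t / sqrt t = sqrt t" "t \<le> sqrt t"
    using t by (auto simp: real_div_sqrt intro!: real_le_rsqrt simp: power2_eq_square mult_le_one mult_left_le)
  have q: "0 \<le> ?q" "0 \<le> ?r" by (rule qform_nonneg)+
  have e: "t * ?q * exp (- (t / 2) * ?q) \<le> 1"
  proof -
    let ?x = "(t / 2) * ?q"
    have x: "0 \<le> ?x" using q t by simp
    have "(1 + ?x / 2)\<^sup>2 \<le> exp ?x" using exp_ge_one_plus_x_over_n_power_n[of 2 ?x] x by simp
    moreover have "2 * ?x \<le> (1 + ?x / 2)\<^sup>2"
      using zero_le_power2[of "1 - ?x / 2"] by (simp add: power2_eq_square algebra_simps)
    ultimately have "2 * ?x * exp (- ?x) \<le> exp ?x * exp (- ?x)" by (intro mult_right_mono) auto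
    then show ?thesis by (simp add: exp_minus)
  qed
  have h: "exp (- t * ?q) = exp (- (t / 2) * ?q) * exp (- (t / 2) * ?q)" unfolding exp_add[symmetric] by (simp add: field_simps)
  have h1: "exp (- (t / 2) * ?q) \<le> 1" using q t by simp
  have "t * \<bar>qform gu (l + r) - ?q\<bar> \<le> t * (sqrt t * ?q + (1 + 1 / sqrt t) * ?r)"
    using qform_shift[OF st(1), of l r] t by (intro mult_left_mono) auto
  also have "... = sqrt t * (t * ?q) + (t + t / sqrt t) * ?r" by (simp add: algebra_simps)
  also have "... \<le> sqrt t * (t * ?q) + (sqrt t + sqrt t) * ?r"
    unfolding st(2) using st q by (intro add_left_mono mult_right_mono add_mono) auto
  finally have "t * \<bar>qform gu (l + r) - ?q\<bar> * exp (- t * ?q) \<le> (sqrt t * (t * ?q) + (sqrt t + sqrt t) * ?r) * exp (- t * ?q)"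
    by (intro mult_right_mono) auto
  also have "... = sqrt t * (t * ?q * exp (- (t / 2) * ?q) + 2 * ?r * exp (- (t / 2) * ?q)) * exp (- (t / 2) * ?q)"
    unfolding h by (simp add: algebra_simps)
  also have "... \<le> sqrt t * (1 + 2 * ?r * 1) * exp (- (t / 2) * ?q)"
    using st q h1 by (intro mult_right_mono mult_left_mono add_mono e) auto
  finally show ?thesis by simp
qed

end

context nc_heat
begin

abbreviation "JJ t k l \<equiv> heat_J (DD k) (DD l) t"

lemma integral_complex_heat_I: "integral {0..s} (\<lambda>u. complex_of_real (exp (- (s - u) * b) * exp (- u * a))) = of_real (heat_I a b s)"
  unfolding heat_I_def
  by (rule integral_unique[OF has_integral_of_real[OF integrable_integral]])
    (intro integrable_continuous_interval continuous_intros)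

lemma S2_diag:
  assumes t: "0 \<le> t"
  shows "S 2 k k t = (\<Sum>l. VV k l * VV l k * of_real (JJ t k l))"
proof -
  let ?f = "\<lambda>l s. of_real (exp (- (t - s) * DD k)) * (S 1 k l s * VV l k)"
  have D: "0 \<le> DD k" using qform_nonneg[of k] by simp
  have c: "continuous_on {0..t} (?f l)" for l
    by (intro continuous_intros S_continuous)
  have b: "norm (?f l s) \<le> (Bc * t) * norm (VV l k)" if s: "s \<in> {0..t}" for l s
  proof -
    have "exp (- (t - s) * DD k) \<le> 1" using s by (intro exp_D_le) auto
    moreover have "norm (S 1 k l s) \<le> Bc * t" using S_bound'[OF s, of 1 k l] by simp
    ultimately have "exp (- (t - s) * DD k) * (norm (S 1 k l s) * norm (VV l k)) \<le> 1 * ((Bc * t) * norm (VV l k))"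
      using B_nonneg t by (intro mult_mono mult_nonneg_nonneg) auto
    then show ?thesis by (simp add: norm_mult del: S.simps One_nat_def)
  qed
  have M: "(\<lambda>l. (Bc * t) * norm (VV l k)) summable_on UNIV" by (intro summable_on_cmult_right V_col_summable)
  have i: "integral {0..t} (?f l) = - (VV k l * VV l k * of_real (JJ t k l))" for l
  proof -
    have "?f l s = (- (VV k l * VV l k)) * of_real (exp (- (t - s) * DD k) * heat_I (DD k) (DD l) s)" for s
      unfolding S_1_eq integral_complex_heat_I by (simp add: mult_ac)
    moreover have "((\<lambda>s. complex_of_real (exp (- (t - s) * DD k) * heat_I (DD k) (DD l) s)) has_integral of_real (JJ t k l)) {0..t}"
      unfolding heat_J_def
      by (intro has_integral_of_real integrable_integral integrable_continuous_interval continuous_intros heat_I_continuous)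
    ultimately show ?thesis by (simp only: integral_mult_right integral_unique) simp
  qed
  have "S 2 k k t = - integral {0..t} (\<lambda>s. \<Sum>l. ?f l s)"
    using fun_cong[OF fun_cong[OF fun_cong[OF S.simps(2)[of 1], of k], of k], of t]
    by (simp only: infsum_cmult_right' Suc_1)
  also have "integral {0..t} (\<lambda>s. \<Sum>l. ?f l s) = (\<Sum>l. - (VV k l * VV l k * of_real (JJ t k l)))"
    using infsumI[OF has_sum_integral_infsum[OF c b M]] by (simp only: i)
  finally show ?thesis by (simp only: infsum_uminus minus_minus)
qed

text \<open>What is left of the product of two opposite matrix entries with frequency transfer r
  after the dependence on the base frequency l has been split off as a plane wave.\<close>

definition W2 :: "int ^ 4 => int ^ 4 => int ^ 4 => complex" where
  "W2 r p p' = \<alpha> p (r - p) * ph \<Theta> p (r - p) * (\<alpha> p' (- r - p') * ph \<Theta> p' (- r - p') * ph \<Theta> (p' - (- r - p')) r)"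

lemma norm_W2: "norm (W2 r p p') = norm (\<alpha> p (r - p)) * norm (\<alpha> p' (- r - p'))"
  by (simp add: W2_def norm_mult)

lemma \<alpha>_nn: "(\<Oplus>p. (\<Oplus>q. enorm (\<alpha> p q))) = ennreal Bc"
  using nn_integral_fst_count_space[of "\<lambda>(p,q). enorm (\<alpha> p q)"]
    nn_integral_count_space_infsum[of "case_prod \<alpha>" UNIV] \<alpha>_summable by (simp add: case_prod_beta' Bc_def)

text \<open>For fixed r and p the sum over p' is at most the total mass of \<alpha>, and the
  remaining sum over r and p runs once through all pairs.\<close>

lemma W2_summable: "(\<lambda>(r,p,p'). norm (W2 r p p')) summable_on UNIV"
proof -
  let ?N = "\<lambda>p q. enorm (\<alpha> p q)"
  have le: "?N p' (- r - p') \<le> (\<Oplus>q. ?N p' q)" for r p'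
    using nn_integral_ge_point[of "- r - p'" UNIV "?N p'"] by simp
  have "(\<Oplus>x. enorm (case x of (r,p,p') => W2 r p p'))
     = (\<Oplus>r. (\<Oplus>y. enorm (case y of (p,p') => W2 r p p')))"
    using nn_integral_fst_count_space[of "\<lambda>(r,p,p'). enorm (W2 r p p')"] by (simp add: case_prod_beta')
  also have "... = (\<Oplus>r. (\<Oplus>p. (\<Oplus>p'. enorm (W2 r p p'))))"
    using nn_integral_fst_count_space[of "\<lambda>(p,p'). enorm (W2 r p p')" for r] by (simp add: case_prod_beta')
  also have "... \<le> (\<Oplus>r. (\<Oplus>p. ?N p (r - p) * ennreal Bc))"
  proof (intro nn_integral_mono)
    fix r p
    have "(\<Oplus>p'. enorm (W2 r p p')) = ?N p (r - p) * (\<Oplus>p'. ?N p' (- r - p'))"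
      by (simp add: norm_W2 ennreal_mult' nn_integral_cmult)
    also have "... \<le> ?N p (r - p) * ennreal Bc"
      unfolding \<alpha>_nn[symmetric] by (intro mult_left_mono nn_integral_mono le) auto
    finally show "(\<Oplus>p'. enorm (W2 r p p')) \<le> ?N p (r - p) * ennreal Bc" .
  qed
  also have "... = (\<Oplus>p. (\<Oplus>r. ?N p (r - p))) * ennreal Bc"
    by (simp add: nn_integral_multc nn_integral_count_space_swap[of "\<lambda>r p. ?N p (r - p)"])
  also have "(\<Oplus>p. (\<Oplus>r. ?N p (r - p))) = ennreal Bc"
    unfolding \<alpha>_nn[symmetric] by (intro nn_integral_cong nn_integral_shift_lattice)
  also have "ennreal Bc * ennreal Bc < \<infinity>" by (simp add: ennreal_mult_less_top)
  finally show ?thesis unfolding summable_norm_iff_nn[symmetric] by (simp add: case_prod_beta')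
qed

text \<open>The l-dependent phases have first arguments that add up to 2(p + p'), and a phase with
  doubled argument is a plane wave evaluated at \<Theta>(p + p').\<close>

lemma VV_product: "VV (l + r) l * VV l (l + r) = (\<Sum>p. \<Sum>p'. W2 r p p' * plane_wave l (\<Theta> *v lat (p + p')))"
proof -
  have 1: "VV (l + r) l = (\<Sum>p. \<alpha> p (r - p) * ph \<Theta> p (r - p) * ph \<Theta> (p - (r - p)) l)"
    by (simp add: Vmat_def)
  have 2: "VV l (l + r) = (\<Sum>p'. \<alpha> p' (- r - p') * ph \<Theta> p' (- r - p') * ph \<Theta> (p' - (- r - p')) (l + r))"
    by (simp add: Vmat_def)
  have 3: "ph \<Theta> (p - (r - p)) l * ph \<Theta> (p' - (- r - p')) l = plane_wave l (\<Theta> *v lat (p + p'))" for p p'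
  proof -
    have "p - (r - p) + (p' - (- r - p')) = (p + p') + (p + p')" by (simp add: algebra_simps)
    then show ?thesis by (simp only: ph_add(1)[symmetric] ph_double[symmetric])
  qed
  have 4: "\<alpha> p (r - p) * ph \<Theta> p (r - p) * ph \<Theta> (p - (r - p)) l * (\<alpha> p' (- r - p') * ph \<Theta> p' (- r - p') * ph \<Theta> (p' - (- r - p')) (l + r))
     = W2 r p p' * plane_wave l (\<Theta> *v lat (p + p'))" for p p'
    unfolding W2_def 3[symmetric] ph_add(2)[of \<Theta> "p' - (- r - p')" l r] by (simp only: mult_ac)
  show ?thesis unfolding 1 2 infsum_cmult_left'[symmetric] unfolding infsum_cmult_right'[symmetric] 4 ..
qed

text \<open>The sum over the base frequency in the second-order trace. To leading order it is t^2/2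
  times the massive free kernel at \<Theta>x.\<close>

definition YY :: "real => int ^ 4 => int ^ 4 => complex" where
  "YY t r x = (\<Sum>l. plane_wave l (\<Theta> *v lat x) * of_real (JJ t (l + r) l))"

lemma exp_DD_shift:
  assumes t: "0 < t"
  shows "(\<lambda>l. exp (- t * DD (l + r))) summable_on UNIV" "(\<Sum>l. exp (- t * DD (l + r))) = (\<Sum>l. exp (- t * DD l))"
proof -
  have b: "bij_betw (\<lambda>l. l + r) UNIV (UNIV :: (int ^ 4) set)"
    by (auto intro!: bij_betw_byWitness[where f'="\<lambda>l. l - r"])
  show "(\<lambda>l. exp (- t * DD (l + r))) summable_on UNIV"
    using exp_DD_summable[OF t] summable_on_reindex_bij_betw[OF b, of "\<lambda>l. exp (- t * DD l)"] by simp
  show "(\<Sum>l. exp (- t * DD (l + r))) = (\<Sum>l. exp (- t * DD l))"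
    by (rule infsum_reindex_bij_betw[OF b, of "\<lambda>l. exp (- t * DD l)"])
qed

lemma JJ_sum:
  assumes t: "0 < t"
  shows "(\<lambda>l. JJ t (l + r) l) summable_on UNIV" "(\<Sum>l. JJ t (l + r) l) \<le> 2 * t\<^sup>2 * (\<Sum>l. exp (- t * DD l))"
proof -
  let ?g = "\<lambda>l. t\<^sup>2 * (exp (- t * DD (l + r)) + exp (- t * DD l))"
  have g: "?g summable_on UNIV"
    by (intro summable_on_cmult_right summable_on_add exp_DD_shift exp_DD_summable t)
  have le: "JJ t (l + r) l \<le> ?g l" for l using heat_J_le[of t] t by simp
  show s: "(\<lambda>l. JJ t (l + r) l) summable_on UNIV"
    by (rule summable_on_comparison_test[OF g le]) (use heat_J_nonneg t in auto)
  have "(\<Sum>l. JJ t (l + r) l) \<le> (\<Sum>l. ?g l)" by (rule infsum_mono[OF s g le])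
  also have "... = t\<^sup>2 * ((\<Sum>l. exp (- t * DD (l + r))) + (\<Sum>l. exp (- t * DD l)))"
    by (simp only: infsum_cmult_right' infsum_add[OF exp_DD_shift(1)[OF t] exp_DD_summable[OF t]])
  finally show "(\<Sum>l. JJ t (l + r) l) \<le> 2 * t\<^sup>2 * (\<Sum>l. exp (- t * DD l))"
    unfolding exp_DD_shift(2)[OF t] by simp
qed

lemma YY_bound: "0 < t ==> norm (YY t r x) \<le> 2 * t\<^sup>2 * (\<Sum>l. exp (- t * DD l))"
proof -
  assume t: "0 < t"
  have n: "norm (plane_wave l (\<Theta> *v lat x) * of_real (JJ t (l + r) l)) = JJ t (l + r) l" for l
    using heat_J_nonneg[of t] t by (simp add: norm_mult plane_wave_def)
  have "norm (YY t r x) \<le> (\<Sum>l. norm (plane_wave l (\<Theta> *v lat x) * of_real (JJ t (l + r) l)))"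
    unfolding YY_def by (rule norm_infsum_bound) (use JJ_sum(1)[OF t] n in simp)
  then show ?thesis unfolding n using JJ_sum(2)[OF t, of r] by linarith
qed

text \<open>With k = l + r the diagonal sum becomes a sum over the frequency transfer r and the base
  frequency l. The two exchanges of sums rest on separate absolute bounds: on V and the free heat
  trace before the product is expanded, on \<open>W2\<close> and \<open>JJ\<close>
  afterwards.\<close>

lemma trace_S2:
  assumes t: "0 < t"
  shows "(\<Sum>k. S 2 k k t) = (\<Sum>\<^sub>\<infinity>(r,p,p'). W2 r p p' * YY t r (p + p'))"
proof -
  let ?h = "\<lambda>l r p p'. W2 r p p' * (plane_wave l (\<Theta> *v lat (p + p')) * of_real (JJ t (l + r) l))"
  let ?H = "\<lambda>x l. case x of (r,p,p') => ?h l r p p'"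
  have J0: "0 \<le> JJ t (l + r) l" for l r using heat_J_nonneg[of t] t by simp
  have nH: "norm (?H x l) = norm (case x of (r,p,p') => W2 r p p') * norm (JJ t (l + fst x) l)" for x l
    by (cases x) (simp add: norm_mult plane_wave_def)
  define C where "C = 2 * t\<^sup>2 * (\<Sum>l. exp (- t * DD l))"
  have Jnn: "(\<Oplus>l. enorm (JJ t (l + r) l)) \<le> ennreal C" for r
  proof -
    have "(\<lambda>l. norm (JJ t (l + r) l)) summable_on UNIV" using JJ_sum(1)[OF t] J0 by simp
    from nn_integral_count_space_infsum[OF this] show ?thesis using JJ_sum(2)[OF t] J0 by (simp add: C_def ennreal_leI)
  qed
  have "(\<Oplus>x. (\<Oplus>l. enorm (?H x l)))
     \<le> (\<Oplus>x. enorm (case x of (r,p,p') => W2 r p p') * ennreal C)"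
    unfolding nH by (intro nn_integral_mono) (simp add: ennreal_mult' nn_integral_cmult mult_left_mono Jnn del: real_norm_def)
  also have "... < \<infinity>"
    using W2_summable summable_norm_iff_nn[of "\<lambda>(r,p,p'). W2 r p p'"]
    by (simp add: nn_integral_multc ennreal_mult_less_top case_prod_beta')
  finally have sum: "(\<lambda>(x,l). ?H x l) summable_on UNIV \<times> UNIV" by (rule summable_on_product_nnI(2))
  have slice: "(\<lambda>(r,p,p'). ?h l r p p') summable_on UNIV" for l
  proof -
    have "(\<lambda>(x,l). ?H x l) summable_on range (\<lambda>x. (x, l))" using sum by (rule summable_on_subset_banach) simp
    then show ?thesis by (subst (asm) summable_on_reindex) (auto simp: inj_on_def o_def case_prod_beta')
  qed
  let ?G = "\<lambda>k l. VV k l * VV l k * of_real (JJ t k l)"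
  have G: "(\<Oplus>k. (\<Oplus>l. enorm (?G k l))) < \<infinity>"
  proof -
    let ?v = "\<lambda>k l. enorm (VV k l)"
    define e where "e k = ennreal (exp (- t * DD k))" for k
    have B1: "norm (VV k l) \<le> Bc" for k l
    proof -
      have "?v k l \<le> ennreal Bc" using nn_integral_ge_point[of l UNIV "?v k"] V_row[of k] by (simp add: order_trans)
      then show ?thesis by (simp add: B_nonneg)
    qed
    have le: "enorm (?G k l) \<le> ennreal (Bc * t\<^sup>2) * (?v l k * e k) + ennreal (Bc * t\<^sup>2) * (?v l k * e l)" for k l
    proof -
      have "norm (?G k l) = norm (VV k l) * norm (VV l k) * JJ t k l"
        using heat_J_nonneg[of t] t by (simp add: norm_mult)
      also have "... \<le> Bc * norm (VV l k) * (t\<^sup>2 * (exp (- t * DD k) + exp (- t * DD l)))"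
        using heat_J_nonneg[of t] heat_J_le[of t] t B_nonneg B1 by (intro mult_mono mult_nonneg_nonneg) auto
      also have "... = (Bc * t\<^sup>2) * (norm (VV l k) * exp (- t * DD k)) + (Bc * t\<^sup>2) * (norm (VV l k) * exp (- t * DD l))"
        by (simp add: algebra_simps)
      finally show ?thesis unfolding e_def using B_nonneg by (simp flip: ennreal_mult ennreal_plus add: ennreal_leI)
    qed
    have a: "(\<Oplus>k. (\<Oplus>l. ?v l k * e k)) \<le> ennreal Bc * theta t"
    proof -
      have "(\<Oplus>k. (\<Oplus>l. ?v l k * e k)) \<le> (\<Oplus>k. ennreal Bc * e k)"
        by (intro nn_integral_mono) (simp add: nn_integral_multc mult_right_mono V_col)
      then show ?thesis by (simp add: nn_integral_cmult theta_def e_def)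
    qed
    have b: "(\<Oplus>k. (\<Oplus>l. ?v l k * e l)) \<le> ennreal Bc * theta t"
    proof -
      have "(\<Oplus>l. (\<Oplus>k. ?v l k * e l)) \<le> (\<Oplus>l. ennreal Bc * e l)"
        by (intro nn_integral_mono) (simp add: nn_integral_multc mult_right_mono V_row)
      then show ?thesis by (subst nn_integral_count_space_swap) (simp add: nn_integral_cmult theta_def e_def)
    qed
    have "(\<Oplus>k. (\<Oplus>l. enorm (?G k l)))
      \<le> (\<Oplus>k. (\<Oplus>l. ennreal (Bc * t\<^sup>2) * (?v l k * e k) + ennreal (Bc * t\<^sup>2) * (?v l k * e l)))"
      by (intro nn_integral_mono le)
    also have "... \<le> ennreal (Bc * t\<^sup>2) * (ennreal Bc * theta t) + ennreal (Bc * t\<^sup>2) * (ennreal Bc * theta t)"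
      by (simp add: nn_integral_add nn_integral_cmult) (intro add_mono mult_left_mono a b; simp)
    also have "... < \<infinity>" unfolding theta_eq[OF t] by (simp add: ennreal_mult_less_top)
    finally show ?thesis .
  qed
  have Gs: "(\<lambda>(k,l). ?G k l) summable_on UNIV \<times> UNIV" by (rule summable_on_product_nnI(2)[OF G])
  have "(\<Sum>k. S 2 k k t) = (\<Sum>k. \<Sum>l. ?G k l)" using t by (intro infsum_cong S2_diag) simp
  also have "... = (\<Sum>l. \<Sum>k. ?G k l)" by (rule infsum_swap_banach[OF Gs])
  also have "... = (\<Sum>l. \<Sum>x. ?H x l)"
  proof (rule infsum_cong)
    fix l
    have bij: "bij_betw (\<lambda>r. l + r) UNIV (UNIV :: (int ^ 4) set)"
      by (auto intro!: bij_betw_byWitness[where f'="\<lambda>k. k - l"])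
    have "(\<Sum>k. ?G k l) = (\<Sum>r. ?G (l + r) l)" by (rule infsum_reindex_bij_betw[OF bij, symmetric])
    also have "... = (\<Sum>r. \<Sum>p. \<Sum>p'. ?h l r p p')"
      unfolding VV_product infsum_cmult_left'[symmetric] mult.assoc ..
    also have "... = (\<Sum>x. ?H x l)" by (rule infsum_triple[OF slice])
    finally show "(\<Sum>k. ?G k l) = (\<Sum>x. ?H x l)" .
  qed
  also have "... = (\<Sum>x. \<Sum>l. ?H x l)" by (rule infsum_swap_banach[OF sum, symmetric])
  also have "... = (\<Sum>\<^sub>\<infinity>(r,p,p'). W2 r p p' * YY t r (p + p'))"
    by (rule infsum_cong) (simp add: case_prod_beta' YY_def infsum_cmult_right' cong: )
  finally show ?thesis .
qed

end

section \<open>Small-time limits and the expansion of the heat trace\<close>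

context nc_heat
begin

lemma exp_minus_expansion:
  fixes a :: real
  shows "((\<lambda>t. (exp (- t * a) - 1 + t * a) / t) \<longlongrightarrow> 0) (at_right 0)"
    "((\<lambda>t. (exp (- t * a) - 1 + t * a - t\<^sup>2 * a\<^sup>2 / 2) / t\<^sup>2) \<longlongrightarrow> 0) (at_right 0)"
proof -
  have b: "\<bar>exp (- t * a) - (\<Sum>k<n. (- t * a) ^ k / fact k)\<bar> \<le> exp \<bar>a\<bar> * \<bar>a\<bar> ^ n * t ^ n" if t: "0 < t" "t \<le> 1" for t n
  proof -
    obtain \<theta> where \<theta>: "\<bar>\<theta>\<bar> \<le> \<bar>- t * a\<bar>" "exp (- t * a) = (\<Sum>k<n. (- t * a) ^ k / fact k) + exp \<theta> / fact n * (- t * a) ^ n"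
      using Maclaurin_exp_le[of "- t * a" n] by (elim exE conjE) (rule that)
    have "t * \<bar>a\<bar> \<le> 1 * \<bar>a\<bar>" using t by (intro mult_right_mono) auto
    moreover have "\<bar>- t * a\<bar> = t * \<bar>a\<bar>" using t by (simp add: abs_mult)
    ultimately have "\<theta> \<le> \<bar>a\<bar>" using \<theta>(1) by linarith
    then have "exp \<theta> / fact n \<le> exp \<bar>a\<bar> / 1" by (intro frac_le) (auto simp: fact_ge_1)
    then have "exp \<theta> / fact n * \<bar>- t * a\<bar> ^ n \<le> exp \<bar>a\<bar> * \<bar>- t * a\<bar> ^ n" by (intro mult_right_mono) auto
    then show ?thesis using \<theta>(2) t by (simp add: abs_mult power_abs power_mult_distrib mult_ac)
  qed
  show "((\<lambda>t. (exp (- t * a) - 1 + t * a) / t) \<longlongrightarrow> 0) (at_right 0)"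
  proof (rule Lim_null_comparison)
    show "\<forall>\<^sub>F t in at_right 0. norm ((exp (- t * a) - 1 + t * a) / t) \<le> exp \<bar>a\<bar> * \<bar>a\<bar>\<^sup>2 * t"
      using eventually_unit
    proof eventually_elim
      case (elim t)
      have "\<bar>exp (- t * a) - 1 + t * a\<bar> / t \<le> exp \<bar>a\<bar> * \<bar>a\<bar>\<^sup>2 * t\<^sup>2 / t"
        using b[of t 2] elim by (intro divide_right_mono) (auto simp: numeral_2_eq_2)
      then show ?case using elim by (simp add: power2_eq_square)
    qed
    show "((\<lambda>t. exp \<bar>a\<bar> * \<bar>a\<bar>\<^sup>2 * t) \<longlongrightarrow> 0) (at_right 0)" by (auto intro!: tendsto_eq_intros)
  qed
  show "((\<lambda>t. (exp (- t * a) - 1 + t * a - t\<^sup>2 * a\<^sup>2 / 2) / t\<^sup>2) \<longlongrightarrow> 0) (at_right 0)"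
  proof (rule Lim_null_comparison)
    show "\<forall>\<^sub>F t in at_right 0. norm ((exp (- t * a) - 1 + t * a - t\<^sup>2 * a\<^sup>2 / 2) / t\<^sup>2) \<le> exp \<bar>a\<bar> * \<bar>a\<bar> ^ 3 * t"
      using eventually_unit
    proof eventually_elim
      case (elim t)
      have "\<bar>exp (- t * a) - 1 + t * a - t\<^sup>2 * a\<^sup>2 / 2\<bar> / t\<^sup>2 \<le> exp \<bar>a\<bar> * \<bar>a\<bar> ^ 3 * t ^ 3 / t\<^sup>2"
        using b[of t 3] elim by (intro divide_right_mono) (auto simp: numeral_2_eq_2 numeral_3_eq_3 power_mult_distrib algebra_simps)
      then show ?case using elim by (simp add: power2_eq_square power3_eq_cube)
    qed
    show "((\<lambda>t. exp \<bar>a\<bar> * \<bar>a\<bar> ^ 3 * t) \<longlongrightarrow> 0) (at_right 0)" by (auto intro!: tendsto_eq_intros)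
  qed
qed

lemma qform_minus: "qform gu (- r) = qform gu r"
  using matrix_vector_mult_diff_distrib[where A=gu and x=0 and y="lat r"] by (simp add: qform_def lat_minus)

text \<open>In the time integral D at l + r is replaced by D at l. The error is estimated by
  \<open>exp_qform_shift\<close> at l and, with r reversed, at l + r; summing the remaining half
  exponentials costs t^-2, which cancels the prefactor t^2 and leaves sqrt t.\<close>

lemma YY_approx:
  obtains C where "\<And>t. 0 < t ==> t \<le> 1 ==> 
    norm (YY t r x - of_real (t\<^sup>2 / 2 * exp (- t * m\<^sup>2)) * theta0 t (\<Theta> *v lat x)) \<le> C * sqrt t"
proof -
  obtain C where C: "0 \<le> C" "\<And>t. 0 < t ==> t \<le> 1 ==> (\<Sum>k. exp (- t * qform gu k)) \<le> C / t\<^sup>2"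
    by (rule heat_sum_bound) blast
  let ?R = "1 + 2 * qform gu r"
  have R: "0 \<le> ?R" using qform_nonneg[of r] by simp
  show ?thesis
  proof (rule that[of "8 * ?R * C"])
    fix t :: real assume t: "0 < t" "t \<le> 1"
    let ?e = "\<lambda>l. exp (- (t / 2) * qform gu l)"
    let ?p = "\<lambda>l. plane_wave l (\<Theta> *v lat x)"
    let ?f = "\<lambda>l. ?p l * of_real (JJ t (l + r) l)"
    let ?g = "\<lambda>l. of_real (t\<^sup>2 / 2 * exp (- t * m\<^sup>2)) * (of_real (exp (- t * qform gu l)) * ?p l)"
    let ?b = "\<lambda>l. t\<^sup>2 * (sqrt t * ?R) * (?e l + ?e (l + r))"
    have np: "norm (?p l) = 1" for l by (simp add: plane_wave_def)
    have d: "norm (?f l - ?g l) \<le> ?b l" for l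
    proof -
      let ?a = "DD (l + r)" and ?c = "DD l"
      have le: "exp (- t * (qform gu k + m\<^sup>2)) \<le> exp (- t * qform gu k)" for k using t by simp
      have ac: "?a - ?c = qform gu (l + r) - qform gu l" by simp
      have w: "t * \<bar>?a - ?c\<bar> * exp (- t * (qform gu k + m\<^sup>2)) \<le> t * \<bar>?a - ?c\<bar> * exp (- t * qform gu k)" for k
        by (rule mult_left_mono[OF le]) (use t in simp)
      have 1: "t * \<bar>?a - ?c\<bar> * exp (- t * ?c) \<le> sqrt t * ?R * ?e l"
        using w[of l] exp_qform_shift[OF t, of l r] unfolding ac by (rule order_trans)
      have "\<bar>qform gu (l + r + - r) - qform gu (l + r)\<bar> = \<bar>?a - ?c\<bar>" by simp
      with exp_qform_shift[OF t, of "l + r" "- r"]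
      have "t * \<bar>?a - ?c\<bar> * exp (- t * qform gu (l + r)) \<le> sqrt t * ?R * ?e (l + r)"
        by (simp only: qform_minus)
      then have 2: "t * \<bar>?a - ?c\<bar> * exp (- t * ?a) \<le> sqrt t * ?R * ?e (l + r)"
        by (rule order_trans[OF w])
      have "?f l - ?g l = ?p l * of_real (JJ t (l + r) l - t\<^sup>2 / 2 * exp (- t * ?c))"
        unfolding exp_DD by (simp add: algebra_simps)
      then have "norm (?f l - ?g l) = \<bar>JJ t (l + r) l - t\<^sup>2 / 2 * exp (- t * ?c)\<bar>" by (simp only: norm_mult np norm_of_real mult_1)
      also have "... \<le> t\<^sup>2 * (t * \<bar>?a - ?c\<bar> * (exp (- t * ?a) + exp (- t * ?c)))" using heat_J_approx[of t ?a ?c] t by simp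
      also have "... \<le> t\<^sup>2 * (sqrt t * ?R * ?e l + sqrt t * ?R * ?e (l + r))"
        unfolding distrib_left[of "t * \<bar>?a - ?c\<bar>"] using add_mono[OF 1 2] by (intro mult_left_mono) auto
      finally show ?thesis by (simp add: algebra_simps)
    qed
    have bij: "bij_betw (\<lambda>l. l + r) UNIV (UNIV :: (int ^ 4) set)"
      by (auto intro!: bij_betw_byWitness[where f'="\<lambda>l. l - r"])
    have es: "?e summable_on UNIV" using exp_qform_summable[of "t / 2"] t by simp
    have es': "(\<lambda>l. ?e (l + r)) summable_on UNIV" using es summable_on_reindex_bij_betw[OF bij, of ?e] by simp
    have ei: "(\<Sum>l. ?e (l + r)) = (\<Sum>l. ?e l)" by (rule infsum_reindex_bij_betw[OF bij])
    have bs: "?b summable_on UNIV" by (intro summable_on_cmult_right summable_on_add es es')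
    have f: "?f summable_on UNIV"
    proof (rule abs_summable_summable)
      have "norm (?f l) = JJ t (l + r) l" for l using heat_J_nonneg[of t] t by (simp add: norm_mult np)
      then show "(\<lambda>l. norm (?f l)) summable_on UNIV" using JJ_sum(1)[OF t(1)] by simp
    qed
    have g: "?g summable_on UNIV"
    proof (rule summable_on_cmult_right, rule abs_summable_summable)
      show "(\<lambda>l. norm (of_real (exp (- t * qform gu l)) * ?p l)) summable_on UNIV"
        using exp_qform_summable[OF t(1)] by (simp add: norm_mult np)
    qed
    have ns: "(\<lambda>l. norm (?f l - ?g l)) summable_on UNIV" by (rule summable_on_comparison_test[OF bs d]) auto
    have "YY t r x - of_real (t\<^sup>2 / 2 * exp (- t * m\<^sup>2)) * theta0 t (\<Theta> *v lat x) = (\<Sum>l. ?f l) - (\<Sum>l. ?g l)"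
      unfolding YY_def theta0_def infsum_cmult_right' ..
    also have "... = (\<Sum>l. ?f l - ?g l)"
      using infsum_add[OF abs_summable_summable[OF ns] g] by simp
    finally have "norm (YY t r x - of_real (t\<^sup>2 / 2 * exp (- t * m\<^sup>2)) * theta0 t (\<Theta> *v lat x)) \<le> (\<Sum>l. norm (?f l - ?g l))"
      using norm_infsum_bound[OF ns] by simp
    also have "... \<le> (\<Sum>l. ?b l)" by (rule infsum_mono[OF ns bs d])
    also have "... = t\<^sup>2 * (sqrt t * ?R) * (2 * (\<Sum>l. ?e l))"
      by (simp only: infsum_cmult_right' infsum_add[OF es es'] ei mult_2)
    also have "... \<le> t\<^sup>2 * (sqrt t * ?R) * (2 * (C / (t / 2)\<^sup>2))"
      using t R C(2)[of "t / 2"] by (intro mult_left_mono mult_nonneg_nonneg) auto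
    also have "... = 8 * ?R * C * sqrt t" using t by (simp add: power2_eq_square field_simps)
    finally show "norm (YY t r x - of_real (t\<^sup>2 / 2 * exp (- t * m\<^sup>2)) * theta0 t (\<Theta> *v lat x)) \<le> 8 * ?R * C * sqrt t" .
  qed
qed

text \<open>The behaviour of t^2 \<open>theta0\<close>: its limit is c0 at the origin and zero at
  \<Theta>x for nonzero x, because \<Theta>x then has positive distance from the lattice.\<close>

lemma YY_limit: "((\<lambda>t. YY t r x) \<longlongrightarrow> (if x = 0 then of_real (c0 / 2) else 0)) (at_right 0)"
proof -
  obtain C where C: "\<And>t. 0 < t ==> t \<le> 1 ==> 
    norm (YY t r x - of_real (t\<^sup>2 / 2 * exp (- t * m\<^sup>2)) * theta0 t (\<Theta> *v lat x)) \<le> C * sqrt t"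
    by (rule YY_approx) blast
  let ?main = "\<lambda>t. of_real (t\<^sup>2 / 2 * exp (- t * m\<^sup>2)) * theta0 t (\<Theta> *v lat x)"
  have 1: "((\<lambda>t. YY t r x - ?main t) \<longlongrightarrow> 0) (at_right 0)"
  proof (rule Lim_null_comparison)
    show "\<forall>\<^sub>F t in at_right 0. norm (YY t r x - ?main t) \<le> C * sqrt t"
      using eventually_unit by eventually_elim (use C in auto)
    show "((\<lambda>t. C * sqrt t) \<longlongrightarrow> 0) (at_right 0)" by (auto intro!: tendsto_eq_intros)
  qed
  have th: "((\<lambda>t. of_real (t\<^sup>2) * theta0 t (\<Theta> *v lat x)) \<longlongrightarrow> (if x = 0 then of_real c0 else 0)) (at_right 0)"
    using theta0_zero_limit(3) theta0_nonzero_limit[of x] by (cases "x = 0") auto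
  have "((\<lambda>t. of_real (exp (- t * m\<^sup>2) / 2) * (of_real (t\<^sup>2) * theta0 t (\<Theta> *v lat x))) \<longlongrightarrow>
      of_real (exp (- 0 * m\<^sup>2) / 2) * (if x = 0 then of_real c0 else 0)) (at_right 0)"
    by (intro tendsto_intros th) auto
  from tendsto_add[OF 1 this] show ?thesis by (simp add: mult_ac if_distrib cong: if_cong)
qed

definition M2 :: complex where "M2 = (\<Sum>p. \<Sum>q. \<alpha> p q * \<alpha> (- p) (- q))"

text \<open>Dominated convergence: \<open>YY\<close> is bounded uniformly for t <= 1,
  \<open>W2\<close> is summable, and each term converges. Only p' = -p survives; for this choice the
  phases in \<open>W2\<close> cancel, and q = r - p turns the remaining double sum into
  \<open>M2\<close>.\<close>

lemma second_order_limit: "((\<lambda>t. \<Sum>k. S 2 k k t) \<longlongrightarrow> of_real (c0 / 2) * M2) (at_right 0)"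
proof -
  let ?L = "\<lambda>x::int ^ 4. if x = 0 then of_real (c0 / 2) else (0::complex)"
  obtain C where C: "0 \<le> C" "\<And>t. 0 < t ==> t \<le> 1 ==> (\<Sum>k. exp (- t * DD k)) \<le> C / t\<^sup>2"
    by (rule DD_sum_bound) blast
  have Yb: "norm (YY t r x) \<le> 2 * C" if t: "0 < t" "t \<le> 1" for t r x
  proof -
    have "norm (YY t r x) \<le> 2 * t\<^sup>2 * (C / t\<^sup>2)"
      using YY_bound[OF t(1), of r x] mult_left_mono[OF C(2)[OF t], of "2 * t\<^sup>2"] by simp
    then show ?thesis using t by simp
  qed
  have lim: "((\<lambda>t. \<Sum>\<^sub>\<infinity>(r,p,p'). W2 r p p' * YY t r (p + p')) \<longlongrightarrow> (\<Sum>\<^sub>\<infinity>(r,p,p'). W2 r p p' * ?L (p + p'))) (at_right 0)"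
  proof (rule infsum_dominated_tendsto)
    show "((\<lambda>t. case x of (r,p,p') => W2 r p p' * YY t r (p + p')) \<longlongrightarrow> (case x of (r,p,p') => W2 r p p' * ?L (p + p'))) (at_right 0)" for x
      by (cases x) (simp only: prod.case, intro tendsto_mult tendsto_const YY_limit)
    show "\<forall>\<^sub>F t in at_right 0. \<forall>x. norm (case x of (r,p,p') => W2 r p p' * YY t r (p + p')) \<le> (case x of (r,p,p') => norm (W2 r p p')) * (2 * C)"
      using eventually_unit by eventually_elim (auto simp: norm_mult intro!: mult_left_mono Yb)
    show "(\<lambda>x. (case x of (r,p,p') => norm (W2 r p p')) * (2 * C)) summable_on UNIV"
      by (intro summable_on_cmult_left W2_summable)
  qed
  have sL: "(\<lambda>(r,p,p'). W2 r p p' * ?L (p + p')) summable_on UNIV"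
  proof (rule abs_summable_summable, rule summable_on_comparison_test)
    show "(\<lambda>x. (case x of (r,p,p') => norm (W2 r p p')) * c0) summable_on UNIV"
      by (intro summable_on_cmult_left W2_summable)
    show "norm (case x of (r,p,p') => W2 r p p' * ?L (p + p')) \<le> (case x of (r,p,p') => norm (W2 r p p')) * c0" for x
      using c0_pos by (auto simp: norm_mult split: prod.split intro!: mult_left_mono)
  qed auto
  have W: "W2 r p (- p) = \<alpha> p (r - p) * \<alpha> (- p) (- (r - p))" for r p
  proof -
    have "ph \<Theta> p (r - p) * (ph \<Theta> (- p) (p - r) * ph \<Theta> (- p - (p - r)) r) = 1"
      by (simp only: ph_def cis_mult sb_diff sb_minus sb_self[OF skew]) simp
    then have "\<alpha> p (r - p) * \<alpha> (- p) (p - r) * (ph \<Theta> p (r - p) * (ph \<Theta> (- p) (p - r) * ph \<Theta> (- p - (p - r)) r)) = \<alpha> p (r - p) * \<alpha> (- p) (p - r)"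
      by simp
    then show ?thesis by (simp add: W2_def mult_ac)
  qed
  have s\<alpha>: "(\<lambda>(p,q). \<alpha> p q * \<alpha> (- p) (- q)) summable_on UNIV \<times> UNIV"
  proof (rule abs_summable_summable, rule summable_on_comparison_test)
    show "(\<lambda>x. (case x of (p,q) => norm (\<alpha> p q)) * Bc) summable_on UNIV \<times> UNIV"
      using \<alpha>_summable by (intro summable_on_cmult_left) simp
    have "0 \<le> (case x of (p,q) => norm (\<alpha> p q))" for x by (cases x) simp
    then have "norm (\<alpha> p q) \<le> Bc" for p q
      using finite_sum_le_infsum[OF \<alpha>_summable, of "{(p,q)}"] by (simp add: Bc_def)
    then show "norm (case x of (p,q) => \<alpha> p q * \<alpha> (- p) (- q)) \<le> (case x of (p,q) => norm (\<alpha> p q)) * Bc" for x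
      by (auto simp: norm_mult split: prod.split intro!: mult_left_mono)
  qed auto
  have sw: "(\<lambda>(p,r). \<alpha> p (r - p) * \<alpha> (- p) (- (r - p))) summable_on UNIV \<times> UNIV"
  proof -
    have "bij_betw (\<lambda>(p,r). (p, r - p)) (UNIV \<times> UNIV) (UNIV \<times> (UNIV :: (int ^ 4) set))"
      by (auto intro!: bij_betw_byWitness[where f'="\<lambda>(p,q). (p, q + p)"])
    from summable_on_reindex_bij_betw[OF this, of "\<lambda>(p,q). \<alpha> p q * \<alpha> (- p) (- q)"] s\<alpha>
    show ?thesis by (simp add: case_prod_beta')
  qed
  have "(\<Sum>\<^sub>\<infinity>(r,p,p'). W2 r p p' * ?L (p + p')) = (\<Sum>r. \<Sum>p. \<Sum>p'. W2 r p p' * ?L (p + p'))"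
    by (rule infsum_triple[OF sL, symmetric])
  also have "... = (\<Sum>r. \<Sum>p. of_real (c0 / 2) * (\<alpha> p (r - p) * \<alpha> (- p) (- (r - p))))"
  proof (intro infsum_cong)
    fix r p
    have "(\<Sum>p'. W2 r p p' * ?L (p + p')) = W2 r p (- p) * ?L (p + - p)"
    proof (rule infsum_singleton_support(1))
      fix p' assume "p' \<noteq> - p"
      then have "p + p' \<noteq> 0" by (metis add_eq_0_iff)
      then show "W2 r p p' * ?L (p + p') = 0" by simp
    qed
    then show "(\<Sum>p'. W2 r p p' * ?L (p + p')) = of_real (c0 / 2) * (\<alpha> p (r - p) * \<alpha> (- p) (- (r - p)))"
      by (simp add: W mult_ac)
  qed
  also have "... = of_real (c0 / 2) * (\<Sum>r. \<Sum>p. \<alpha> p (r - p) * \<alpha> (- p) (- (r - p)))"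
    by (simp only: infsum_cmult_right')
  also have "(\<Sum>r. \<Sum>p. \<alpha> p (r - p) * \<alpha> (- p) (- (r - p))) = (\<Sum>p. \<Sum>r. \<alpha> p (r - p) * \<alpha> (- p) (- (r - p)))"
    by (rule infsum_swap_banach[OF sw, symmetric])
  also have "... = M2"
    unfolding M2_def
    by (intro infsum_cong infsum_reindex_bij_betw bij_betw_byWitness[where f'="\<lambda>q. q + _"]) auto
  finally have e: "(\<Sum>\<^sub>\<infinity>(r,p,p'). W2 r p p' * ?L (p + p')) = of_real (c0 / 2) * M2" .
  have "\<forall>\<^sub>F t in at_right 0. (\<Sum>\<^sub>\<infinity>(r,p,p'). W2 r p p' * YY t r (p + p')) = (\<Sum>k. S 2 k k t)"
    using eventually_unit by eventually_elim (simp only: trace_S2)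
  from Lim_transform_eventually[OF lim this] show ?thesis unfolding e .
qed

lemma S_diag_summable: "0 < t ==> (\<lambda>k. S n k k t) summable_on UNIV"
proof (rule abs_summable_summable)
  assume t: "0 < t"
  have "(\<Oplus>k. enorm (S n k k t)) \<le> ennreal ((Bc * t) ^ n / fact n) * theta t"
    using order_trans[OF nn_integral_diag_le[of "\<lambda>j k. enorm (S n j k t)"] S_trace] t by simp
  also have "... < \<infinity>" unfolding theta_eq[OF t] by (simp add: ennreal_mult_less_top)
  finally show "(\<lambda>k. norm (S n k k t)) summable_on UNIV" by (simp only: summable_norm_iff_nn)
qed

definition heat_K :: "real => complex" where "heat_K t = (\<Sum>k. U k k t)"

text \<open>The expansion is assembled from order 0 (free trace times exp(-t m^2)), order 1, order 2
  and a remainder O(t). The Taylor expansion of exp(-t m^2) multiplies the singular terms c0/t^2 and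
  c0/t and is therefore needed to second and first order respectively.\<close>

lemma heat_K_limit:
  "((\<lambda>t. heat_K t - (of_real (c0 / t\<^sup>2) - of_real (c0 / t) * (of_real (m\<^sup>2) + \<alpha> 0 0)
      + of_real c0 * (of_real (m ^ 4 / 2) + of_real (m\<^sup>2) * \<alpha> 0 0 + M2 / 2))) \<longlongrightarrow> 0) (at_right 0)"
proof -
  obtain C where C: "0 \<le> C" "\<And>t. 0 < t ==> t \<le> 1 ==> (\<Sum>k. exp (- t * DD k)) \<le> C / t\<^sup>2"
    by (rule DD_sum_bound) blast
  let ?R = "\<lambda>t k. U k k t - S 0 k k t - S 1 k k t - S 2 k k t"
  let ?T = "\<lambda>n t. \<Sum>k. S n k k t"
  have R: "(\<lambda>k. norm (?R t k)) summable_on UNIV" "(\<Sum>k. norm (?R t k)) \<le> Bc ^ 3 * exp Bc * C * t"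
    if t: "0 < t" "t \<le> 1" for t
  proof -
    have "(\<Oplus>k. enorm (?R t k)) \<le> ennreal ((Bc * t) ^ 3 * exp (Bc * t)) * theta t"
      by (rule trace_remainder) (use t in simp)
    also have "... \<le> ennreal ((Bc * t) ^ 3 * exp (Bc * t)) * ennreal (C / t\<^sup>2)"
      unfolding theta_eq[OF t(1)] by (intro mult_left_mono ennreal_leI C(2) t) simp
    also have "... = ennreal ((Bc * t) ^ 3 * exp (Bc * t) * (C / t\<^sup>2))"
      using t B_nonneg C by (subst ennreal_mult) auto
    also have "... \<le> ennreal (Bc ^ 3 * exp Bc * C * t)"
    proof (rule ennreal_leI)
      have "(Bc * t) ^ 3 * exp (Bc * t) * (C / t\<^sup>2) = Bc ^ 3 * exp (Bc * t) * C * t"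
        using t by (simp add: power2_eq_square power3_eq_cube field_simps)
      also have "... \<le> Bc ^ 3 * exp Bc * C * t"
        using t B_nonneg C by (intro mult_right_mono mult_left_mono) (auto simp: mult_left_le)
      finally show "(Bc * t) ^ 3 * exp (Bc * t) * (C / t\<^sup>2) \<le> Bc ^ 3 * exp Bc * C * t" .
    qed
    finally have le: "(\<Oplus>k. enorm (?R t k)) \<le> ennreal (Bc ^ 3 * exp Bc * C * t)" .
    have 0: "0 \<le> Bc ^ 3 * exp Bc * C * t" using t B_nonneg C by simp
    show "(\<lambda>k. norm (?R t k)) summable_on UNIV" by (rule summable_on_norm_nnI[OF le 0])
    show "(\<Sum>k. norm (?R t k)) \<le> Bc ^ 3 * exp Bc * C * t" by (rule infsum_norm_nn_le[OF le 0])
  qed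
  have split: "heat_K t = ?T 0 t + ?T 1 t + ?T 2 t + (\<Sum>k. ?R t k)" if t: "0 < t" "t \<le> 1" for t
  proof -
    note s = S_diag_summable[OF t(1)] and r = abs_summable_summable[OF R(1)[OF t]]
    have "heat_K t = (\<Sum>k. S 0 k k t + S 1 k k t + S 2 k k t + ?R t k)"
      unfolding heat_K_def by (intro infsum_cong) (simp del: S.simps One_nat_def)
    also have "... = ?T 0 t + ?T 1 t + ?T 2 t + (\<Sum>k. ?R t k)"
      by (simp only: infsum_add[OF summable_on_add[OF summable_on_add[OF s s] s] r] infsum_add[OF summable_on_add[OF s s] s] infsum_add[OF s s])
    finally show ?thesis .
  qed
  have Rl: "((\<lambda>t. \<Sum>k. ?R t k) \<longlongrightarrow> 0) (at_right 0)"
  proof (rule Lim_null_comparison)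
    show "\<forall>\<^sub>F t in at_right 0. norm (\<Sum>k. ?R t k) \<le> Bc ^ 3 * exp Bc * C * t"
      using eventually_unit
    proof eventually_elim
      case (elim t)
      then have t: "0 < t" "t \<le> 1" by auto
      show ?case by (rule order_trans[OF norm_infsum_bound[OF R(1)[OF t]] R(2)[OF t]])
    qed
    show "((\<lambda>t. Bc ^ 3 * exp Bc * C * t) \<longlongrightarrow> 0) (at_right 0)" by (auto intro!: tendsto_eq_intros)
  qed
  let ?E = "\<lambda>t. exp (- t * m\<^sup>2)"
  have T0: "?T 0 t = of_real (?E t) * theta0 t 0" if "0 < t" for t
  proof -
    have "?T 0 t = (\<Sum>k. of_real (?E t) * (of_real (exp (- t * qform gu k)) * plane_wave k 0))"
      unfolding S.simps(1) exp_DD by (intro infsum_cong) (simp add: plane_wave_def)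
    then show ?thesis by (simp only: infsum_cmult_right' theta0_def)
  qed
  let ?Z = "\<lambda>t. theta0 t 0 - of_real (c0 / t\<^sup>2)"
  let ?L1 = "\<lambda>t. of_real t * (\<Sum>p. \<alpha> p (- p) * theta0 t (\<Theta> *v lat p)) - of_real (c0 / t) * \<alpha> 0 0"
  let ?e2 = "\<lambda>t. (?E t - 1 + t * m\<^sup>2 - t\<^sup>2 * (m\<^sup>2)\<^sup>2 / 2) / t\<^sup>2" and ?e1 = "\<lambda>t. (?E t - 1 + t * m\<^sup>2) / t"
  let ?rhs = "\<lambda>t. of_real (?E t) * ?Z t + of_real c0 * of_real (?e2 t) - of_real (?E t) * ?L1 t
     - of_real c0 * \<alpha> 0 0 * of_real (?e1 t) + (?T 2 t - of_real (c0 / 2) * M2) + (\<Sum>k. ?R t k)"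
  have T2: "((\<lambda>t. ?T 2 t - of_real (c0 / 2) * M2) \<longlongrightarrow> 0) (at_right 0)"
    using second_order_limit by (rule LIM_zero)
  have "(?rhs \<longlongrightarrow> of_real (exp (- 0 * m\<^sup>2)) * 0 + of_real c0 * of_real 0 - of_real (exp (- 0 * m\<^sup>2)) * 0
     - of_real c0 * \<alpha> 0 0 * of_real 0 + 0 + 0) (at_right 0)"
    by (intro tendsto_intros theta0_zero_limit(1) exp_minus_expansion first_order_limit T2 Rl)
  then have lim: "(?rhs \<longlongrightarrow> 0) (at_right 0)" by simp
  show ?thesis
  proof (rule Lim_transform_eventually[OF lim])
    show "\<forall>\<^sub>F t in at_right 0. ?rhs t = heat_K t - (of_real (c0 / t\<^sup>2) - of_real (c0 / t) * (of_real (m\<^sup>2) + \<alpha> 0 0)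
      + of_real c0 * (of_real (m ^ 4 / 2) + of_real (m\<^sup>2) * \<alpha> 0 0 + M2 / 2))"
      using eventually_unit
    proof eventually_elim
      case (elim t)
      then have t: "0 < t" "t \<le> 1" by auto
      \<comment> \<open>With all limits abstracted to letters the claim becomes an identity between
        rational expressions in \<tau>.\<close>
      define a b z1 z2 z3 E :: complex where "a = \<alpha> 0 0" and "b = M2" and "z1 = theta0 t 0"
        and "z2 = (\<Sum>p. \<alpha> p (- p) * theta0 t (\<Theta> *v lat p))" and "z3 = ?T 2 t + (\<Sum>k. ?R t k)" and "E = of_real (?E t)"
      define \<tau> \<mu> \<gamma> :: complex where "\<tau> = of_real t" and "\<mu> = of_real m" and "\<gamma> = of_real c0"
      have [simp]: "\<tau> \<noteq> 0" using t by (simp add: \<tau>_def)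
      have K: "heat_K t = E * z1 - \<tau> * E * z2 + z3"
        unfolding split[OF t] T0[OF t(1)] trace_S1[OF t(1)] by (simp add: z1_def z2_def z3_def E_def \<tau>_def)
      have r: "?rhs t = E * (z1 - \<gamma> / \<tau>\<^sup>2) + \<gamma> * ((E - 1 + \<tau> * \<mu>\<^sup>2 - \<tau>\<^sup>2 * (\<mu>\<^sup>2)\<^sup>2 / 2) / \<tau>\<^sup>2) - E * (\<tau> * z2 - \<gamma> / \<tau> * a)
         - \<gamma> * a * ((E - 1 + \<tau> * \<mu>\<^sup>2) / \<tau>) - \<gamma> / 2 * b + z3"
        by (simp add: a_def b_def z1_def z2_def z3_def E_def \<tau>_def \<mu>_def \<gamma>_def del: S.simps)
      have g: "of_real (c0 / t\<^sup>2) - of_real (c0 / t) * (of_real (m\<^sup>2) + \<alpha> 0 0)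
        + of_real c0 * (of_real (m ^ 4 / 2) + of_real (m\<^sup>2) * \<alpha> 0 0 + M2 / 2)
        = \<gamma> / \<tau>\<^sup>2 - \<gamma> / \<tau> * (\<mu>\<^sup>2 + a) + \<gamma> * (\<mu> ^ 4 / 2 + \<mu>\<^sup>2 * a + b / 2)"
        by (simp add: a_def b_def \<tau>_def \<mu>_def \<gamma>_def)
      have e2: "(E - 1 + \<tau> * \<mu>\<^sup>2 - \<tau>\<^sup>2 * (\<mu>\<^sup>2)\<^sup>2 / 2) / \<tau>\<^sup>2 = E / \<tau>\<^sup>2 - 1 / \<tau>\<^sup>2 + \<mu>\<^sup>2 / \<tau> - \<mu> ^ 4 / 2"
        by (simp add: add_divide_distrib diff_divide_distrib power2_eq_square power4_eq_xxxx)
      have e1: "(E - 1 + \<tau> * \<mu>\<^sup>2) / \<tau> = E / \<tau> - 1 / \<tau> + \<mu>\<^sup>2"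
        by (simp add: add_divide_distrib diff_divide_distrib)
      show ?case unfolding r K g e2 e1 by (simp add: algebra_simps)
    qed
  qed
qed

end

section \<open>Matrix entries of an arbitrary heat semigroup\<close>

lemma
  assumes "f \<in> L2" "g \<in> L2" "AE x in torus. f x = g x"
  shows fourier_coeff_AE: "fourier_coeff f k = fourier_coeff g k"
    and L2_nrm_AE: "L2_nrm f = L2_nrm g"
    and L2_inner_AE: "h \<in> L2 ==> L2_inner h f = L2_inner h g"
proof -
  have m [measurable]: "f \<in> borel_measurable torus" "g \<in> borel_measurable torus" using assms L2D by auto
  have in_eq: "L2_inner h f = L2_inner h g" if h: "h \<in> L2" for h
  proof -
    show ?thesis unfolding L2_inner_def
      by (rule integral_cong_AE)
        (use assms(3) in \<open>auto intro: borel_measurable_integrable L2_inner_integrable[OF h] assms(1,2)\<close>)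
  qed
  then show "h \<in> L2 ==> L2_inner h f = L2_inner h g" .
  show "fourier_coeff f k = fourier_coeff g k" unfolding fourier_coeff_inner by (simp add: in_eq)
  show "L2_nrm f = L2_nrm g" unfolding L2_nrm_def
    by (rule arg_cong[where f=sqrt], rule integral_cong_AE) (use assms(3) in auto)
qed

lemma norm_fourier_coeff_L2:
  assumes "f \<in> L2"
  shows "norm (fourier_coeff f k) \<le> L2_nrm f / (2 * pi)\<^sup>2"
proof -
  have "norm (L2_inner (plane_wave k) f) \<le> (2 * pi)\<^sup>2 * L2_nrm f"
    using L2_Cauchy_Schwarz[OF plane_wave_L2 assms, of k] by simp
  then have "norm (L2_inner (plane_wave k) f) / (2 * pi) ^ 4 \<le> (2 * pi)\<^sup>2 * L2_nrm f / (2 * pi) ^ 4"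
    by (rule divide_right_mono) simp
  also have "... = L2_nrm f / (2 * pi)\<^sup>2" by (simp add: power2_eq_square power4_eq_xxxx field_simps)
  finally show ?thesis by (simp add: fourier_coeff_inner norm_divide norm_power norm_mult)
qed

lemma
  assumes T: "bounded_op T"
  shows bounded_op_L2: "f \<in> L2 ==> T f \<in> L2"
    and bounded_op_coeff_linear: "f \<in> L2 ==> h \<in> L2 ==> 
        fourier_coeff (T (\<lambda>y. a * f y + b * h y)) k = a * fourier_coeff (T f) k + b * fourier_coeff (T h) k"
proof -
  show TL: "f \<in> L2 ==> T f \<in> L2" for f using T by (simp add: bounded_op_def)
  assume f: "f \<in> L2" and h: "h \<in> L2"
  have L: "(\<lambda>y. a * f y + b * h y) \<in> L2" using f h by (intro L2_add L2_cmult)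
  have R: "(\<lambda>y. a * T f y + b * T h y) \<in> L2" using f h by (intro L2_add L2_cmult TL)
  have "fourier_coeff (T (\<lambda>y. a * f y + b * h y)) k = fourier_coeff (\<lambda>y. a * T f y + b * T h y) k"
    using T f h by (intro fourier_coeff_AE[OF TL[OF L] R]) (simp add: bounded_op_def)
  then show "fourier_coeff (T (\<lambda>y. a * f y + b * h y)) k = a * fourier_coeff (T f) k + b * fourier_coeff (T h) k"
    using f h by (simp add: fourier_coeff_add fourier_coeff_cmult L2_cmult TL)
qed

lemma bounded_op_coeff_zero: "bounded_op T ==> fourier_coeff (T (\<lambda>_. 0)) k = 0"
  using bounded_op_coeff_linear[of T "\<lambda>_. 0" "\<lambda>_. 0" 0 0 k] by simp

lemma bounded_op_coeff_cmult: "bounded_op T ==> f \<in> L2 ==> fourier_coeff (T (\<lambda>y. a * f y)) k = a * fourier_coeff (T f) k"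
  using bounded_op_coeff_linear[of T f f a 0 k] by simp

lemma bounded_op_coeff_diff: "bounded_op T ==> f \<in> L2 ==> h \<in> L2 ==> 
    fourier_coeff (T (\<lambda>y. f y - h y)) k = fourier_coeff (T f) k - fourier_coeff (T h) k"
  using bounded_op_coeff_linear[of T f h 1 "-1" k] by simp

lemma bounded_op_coeff_sum:
  assumes T: "bounded_op T" and F: "finite F" and f: "\<And>l. f l \<in> L2"
  shows "fourier_coeff (T (\<lambda>y. \<Sum>l\<in>F. c l * f l y)) k = (\<Sum>l\<in>F. c l * fourier_coeff (T (f l)) k)"
  using F
proof (induction F rule: finite_induct)
  case empty
  then show ?case using bounded_op_coeff_zero[OF T] by simp
next
  case (insert l F)
  have "(\<lambda>y. \<Sum>l\<in>F. c l * f l y) \<in> L2" by (intro L2_sum insert L2_cmult f)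
  then show ?case using insert bounded_op_coeff_linear[OF T f, where h="\<lambda>y. \<Sum>l\<in>F. c l * f l y" and b=1] by simp
qed

text \<open>A bounded operator is determined by its matrix in the plane waves: apply it to the
  partial sums, which converge in L2, and use that coefficients are continuous in the L2
  norm.\<close>

lemma bounded_op_coeff_has_sum:
  assumes T: "bounded_op T" and f: "f \<in> L2"
  shows "((\<lambda>l. fourier_coeff f l * fourier_coeff (T (plane_wave l)) k) has_sum fourier_coeff (T f) k) UNIV"
proof -
  obtain C where C: "\<And>f. f \<in> L2 ==> L2_nrm (T f) \<le> C * L2_nrm f" using T unfolding bounded_op_def by blast
  let ?p = "\<lambda>F x. \<Sum>l\<in>F. fourier_coeff f l * plane_wave l x"
  let ?s = "\<lambda>F. \<Sum>l\<in>F. fourier_coeff f l * fourier_coeff (T (plane_wave l)) k"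
  have ev: "\<forall>\<^sub>F F in finite_subsets_at_top (UNIV :: (int ^ 4) set). finite F"
    by (rule eventually_finite_subsets_at_top_weakI) auto
  have "((\<lambda>F. ?s F - fourier_coeff (T f) k) \<longlongrightarrow> 0) (finite_subsets_at_top UNIV)"
  proof (rule Lim_null_comparison)
    show "\<forall>\<^sub>F F in finite_subsets_at_top UNIV. norm (?s F - fourier_coeff (T f) k)
        \<le> C / (2 * pi)\<^sup>2 * L2_nrm (\<lambda>x. f x - ?p F x)"
      using ev
    proof eventually_elim
      case (elim F)
      have p: "?p F \<in> L2" using elim by (intro L2_sum L2_cmult) auto
      have d: "(\<lambda>x. f x - ?p F x) \<in> L2" by (rule L2_diff[OF f p])
      have "norm (?s F - fourier_coeff (T f) k) = norm (fourier_coeff (T (\<lambda>x. f x - ?p F x)) k)"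
        unfolding bounded_op_coeff_diff[OF T f p] bounded_op_coeff_sum[OF T elim plane_wave_L2] by (rule norm_minus_commute)
      also have "... \<le> L2_nrm (T (\<lambda>x. f x - ?p F x)) / (2 * pi)\<^sup>2"
        by (rule norm_fourier_coeff_L2[OF bounded_op_L2[OF T d]])
      also have "... \<le> C * L2_nrm (\<lambda>x. f x - ?p F x) / (2 * pi)\<^sup>2" by (intro divide_right_mono C d) simp
      finally show ?case by simp
    qed
    have "((\<lambda>F. C / (2 * pi)\<^sup>2 * L2_nrm (\<lambda>x. f x - ?p F x)) \<longlongrightarrow> C / (2 * pi)\<^sup>2 * 0) (finite_subsets_at_top UNIV)"
      by (intro tendsto_intros fourier_partial_sum_limit f)
    then show "((\<lambda>F. C / (2 * pi)\<^sup>2 * L2_nrm (\<lambda>x. f x - ?p F x)) \<longlongrightarrow> 0) (finite_subsets_at_top UNIV)" by simp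
  qed
  then show ?thesis unfolding has_sum_def using LIM_zero_cancel by blast
qed

text \<open>The family is closed under partial derivatives, so smoothness is an induction over
  varying coefficients. Two waves are allowed in order to cover the real modes used as test
  functions.\<close>

lemma torus_smooth_two_waves: "torus_smooth (\<lambda>x. c * plane_wave k x + d * plane_wave l x)"
proof -
  have der: "((\<lambda>x. c * plane_wave k x + d * plane_wave l x) has_derivative
      (\<lambda>h. c * (\<i> * of_real (lat k \<bullet> h) * plane_wave k x) + d * (\<i> * of_real (lat l \<bullet> h) * plane_wave l x))) (at x)" for c d x
    by (intro has_derivative_add has_derivative_mult_right plane_wave_has_derivative)
  have p: "partial i (\<lambda>x. c * plane_wave k x + d * plane_wave l x)
      = (\<lambda>x. (\<i> * of_int (k $ i) * c) * plane_wave k x + (\<i> * of_int (l $ i) * d) * plane_wave l x)" for i c d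
    unfolding partial_def frechet_derivative_at[OF der, symmetric]
    by (simp add: inner_axis mult_ac)
  have "Cdiff n (\<lambda>x. c * plane_wave k x + d * plane_wave l x)" for n
  proof (induction n arbitrary: c d)
    case 0
    show ?case by (auto intro!: continuous_intros)
  next
    case (Suc n)
    then show ?case using der unfolding Cdiff.simps(2) p differentiable_def by blast
  qed
  moreover have "plane_wave k (x + (2 * pi) *\<^sub>R lat r) = plane_wave k x" for k x r
    by (simp add: plane_wave_add_arg)
  ultimately show ?thesis by (simp add: torus_smooth_def)
qed

lemma torus_smooth_plane_wave: "torus_smooth (plane_wave k)"
  using torus_smooth_two_waves[of 1 k 0 0] by simp

text \<open>Of the operator only its action on Fourier coefficients of smooth functions is retained,
  in the form D + V.\<close>

locale heat_op = nc_heat +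
  fixes P :: "(real ^ 4 => complex) => real ^ 4 => complex"
  assumes P_L2: "torus_smooth f ==> P f \<in> L2"
    and P_coeff: "torus_smooth f ==> fourier_coeff (P f) k = of_real (DD k) * fourier_coeff f k + (\<Sum>l. VV k l * fourier_coeff f l)"
begin

lemma P_plane_wave_coeff: "fourier_coeff (P (plane_wave k)) l = (if k = l then of_real (DD k) else 0) + VV l k"
  unfolding P_coeff[OF torus_smooth_plane_wave] fourier_coeff_plane_wave
  using infsum_delta[of "\<lambda>r. VV l r" k] by (simp add: eq_commute[of k])

context
  fixes T assumes T: "heat_semigroup P T"
begin

lemma T_bounded: "0 \<le> t ==> bounded_op (T t)"
  using T by (simp add: heat_semigroup_def C0_semigroup_def)

lemma T_L2: "0 \<le> t ==> f \<in> L2 ==> T t f \<in> L2"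
  by (rule bounded_op_L2[OF T_bounded])

lemma T_coeff_bound:
  obtains C where "0 \<le> C" "\<And>t f j. 0 \<le> t ==> t \<le> \<tau> ==> f \<in> L2 ==> norm (fourier_coeff (T t f) j) \<le> C * L2_nrm f"
proof -
  obtain M \<omega> where M: "\<And>t f. 0 \<le> t ==> f \<in> L2 ==> L2_nrm (T t f) \<le> M * exp (\<omega> * t) * L2_nrm f"
    using T unfolding heat_semigroup_def C0_semigroup_def by blast
  show ?thesis
  proof (rule that[of "\<bar>M\<bar> * exp (\<bar>\<omega>\<bar> * \<tau>) / (2 * pi)\<^sup>2"])
    fix t f j assume t: "0 \<le> t" "t \<le> \<tau>" and f: "f \<in> L2"
    have "\<omega> * t \<le> \<bar>\<omega>\<bar> * \<tau>" using t by (intro mult_mono) auto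
    then have "M * exp (\<omega> * t) \<le> \<bar>M\<bar> * exp (\<bar>\<omega>\<bar> * \<tau>)" by (intro mult_mono) auto
    then have "M * exp (\<omega> * t) * L2_nrm f \<le> \<bar>M\<bar> * exp (\<bar>\<omega>\<bar> * \<tau>) * L2_nrm f" by (intro mult_right_mono) auto
    with M[OF t(1) f] have "L2_nrm (T t f) / (2 * pi)\<^sup>2 \<le> \<bar>M\<bar> * exp (\<bar>\<omega>\<bar> * \<tau>) * L2_nrm f / (2 * pi)\<^sup>2"
      by (intro divide_right_mono) auto
    then show "norm (fourier_coeff (T t f) j) \<le> \<bar>M\<bar> * exp (\<bar>\<omega>\<bar> * \<tau>) / (2 * pi)\<^sup>2 * L2_nrm f"
      using norm_fourier_coeff_L2[OF T_L2[OF t(1) f], of j] by simp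
  qed simp
qed

lemma T_coeff_add:
  assumes "0 \<le> s" "0 \<le> t" "f \<in> L2"
  shows "fourier_coeff (T (s + t) f) j = fourier_coeff (T s (T t f)) j"
  using T assms by (intro fourier_coeff_AE T_L2) (auto simp: heat_semigroup_def C0_semigroup_def)

text \<open>Strong continuity at 0 spreads to all times through T(s+h) - T(s) = T(s)(T(h) - 1) and
  local uniform boundedness. The estimate depends on |y - s| only, so it is two-sided.\<close>

lemma T_coeff_continuous:
  assumes f: "f \<in> L2"
  shows "continuous_on {0..\<tau>} (\<lambda>t. fourier_coeff (T t f) j)"
proof -
  obtain C where C: "0 \<le> C" "\<And>t f j. 0 \<le> t ==> t \<le> \<tau> ==> f \<in> L2 ==> norm (fourier_coeff (T t f) j) \<le> C * L2_nrm f"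
    by (rule T_coeff_bound[of \<tau>]) blast
  let ?F = "\<lambda>t. fourier_coeff (T t f) j"
  let ?\<nu> = "\<lambda>h. L2_nrm (\<lambda>x. T h f x - f x)"
  have step: "norm (?F (s + h) - ?F s) \<le> C * ?\<nu> h" if "0 \<le> s" "s \<le> \<tau>" "0 \<le> h" for s h
  proof -
    have "norm (?F (s + h) - ?F s) = norm (fourier_coeff (T s (\<lambda>x. T h f x - f x)) j)"
      using that f by (simp add: T_coeff_add bounded_op_coeff_diff T_bounded T_L2)
    also have "... \<le> C * ?\<nu> h" using that f by (intro C L2_diff T_L2)
    finally show ?thesis .
  qed
  have sym: "norm (?F y - ?F s) \<le> C * ?\<nu> \<bar>y - s\<bar>" if "s \<in> {0..\<tau>}" "y \<in> {0..\<tau>}" for s y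
    using that step[of s "y - s"] step[of y "s - y"] by (cases "s \<le> y") (auto simp: norm_minus_commute)
  have nu: "(?\<nu> \<longlongrightarrow> 0) (at_right 0)" using T f by (simp add: heat_semigroup_def C0_semigroup_def)
  show "continuous_on {0..\<tau>} ?F"
    unfolding continuous_on
  proof
    fix s assume s: "s \<in> {0..\<tau>}"
    have a: "filterlim (\<lambda>y. \<bar>y - s\<bar>) (at_right 0) (at s within {0..\<tau>})"
      unfolding filterlim_at
      by (auto simp: eventually_at_filter intro!: tendsto_eq_intros)
    have "((\<lambda>y. ?F y - ?F s) \<longlongrightarrow> 0) (at s within {0..\<tau>})"
    proof (rule Lim_null_comparison)
      show "\<forall>\<^sub>F y in at s within {0..\<tau>}. norm (?F y - ?F s) \<le> C * ?\<nu> \<bar>y - s\<bar>"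
        unfolding eventually_at_filter using sym[OF s] by (auto intro: always_eventually)
      show "((\<lambda>y. C * ?\<nu> \<bar>y - s\<bar>) \<longlongrightarrow> 0) (at s within {0..\<tau>})"
        using tendsto_mult_right_zero[OF filterlim_compose[OF nu a]] by simp
    qed
    then show "(?F \<longlongrightarrow> ?F s) (at s within {0..\<tau>})" by (rule LIM_zero_cancel)
  qed
qed

text \<open>Written as d/dt T f = - T (P f), the equation uses the generator on the smooth f only
  and never on T f. The right derivative is immediate; the left one also requires continuity of the
  coefficient of T(P f).\<close>

lemma T_coeff_derivative:
  assumes f: "torus_smooth f" and s: "s \<in> {0..\<tau>}"
  shows "((\<lambda>t. fourier_coeff (T t f) j) has_vector_derivative - fourier_coeff (T s (P f)) j) (at s within {0..\<tau>})"
proof -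
  note fL = torus_smooth_L2[OF f] and PL = P_L2[OF f]
  obtain C where C: "0 \<le> C" "\<And>t f j. 0 \<le> t ==> t \<le> \<tau> ==> f \<in> L2 ==> norm (fourier_coeff (T t f) j) \<le> C * L2_nrm f"
    by (rule T_coeff_bound[of \<tau>]) blast
  let ?F = "\<lambda>t. fourier_coeff (T t f) j" and ?G = "\<lambda>t. fourier_coeff (T t (P f)) j"
  let ?\<rho> = "\<lambda>h. L2_nrm (\<lambda>x. (T h f x - f x) / of_real h - (- P f x))"
  have step: "norm (?F (s + h) - ?F s + of_real h * ?G s) \<le> h * (C * ?\<rho> h)" if "0 \<le> s" "s \<le> \<tau>" "0 < h" for s h
  proof -
    let ?d = "\<lambda>x. T h f x - f x"
    have d: "?d \<in> L2" using that fL by (intro L2_diff T_L2) auto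
    have L: "(\<lambda>x. (1 / of_real h) * ?d x + 1 * P f x) \<in> L2" by (intro L2_add L2_cmult d PL)
    have "fourier_coeff (T s (\<lambda>x. (1 / of_real h) * ?d x + 1 * P f x)) j = (1 / of_real h) * (?F (s + h) - ?F s) + 1 * ?G s"
      using that fL unfolding bounded_op_coeff_linear[OF T_bounded[OF that(1)] d PL]
      by (simp add: T_coeff_add bounded_op_coeff_diff T_bounded T_L2)
    then have "?F (s + h) - ?F s + of_real h * ?G s = of_real h * fourier_coeff (T s (\<lambda>x. (1 / of_real h) * ?d x + 1 * P f x)) j"
      using that by (simp add: field_simps)
    then have "norm (?F (s + h) - ?F s + of_real h * ?G s) = h * norm (fourier_coeff (T s (\<lambda>x. (1 / of_real h) * ?d x + 1 * P f x)) j)"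
      using that by (simp add: norm_mult)
    also have "... \<le> h * (C * L2_nrm (\<lambda>x. (1 / of_real h) * ?d x + 1 * P f x))"
      using that by (intro mult_left_mono C L) auto
    finally show ?thesis by simp
  qed
  let ?r = "\<lambda>y. C * ?\<rho> \<bar>y - s\<bar> + norm (?G y - ?G s)"
  have bound: "norm (?F y - ?F s - (y - s) *\<^sub>R (- ?G s)) \<le> \<bar>y - s\<bar> * ?r y" if y: "y \<in> {0..\<tau>}" "y \<noteq> s" for y
  proof (cases "s < y")
    case True
    have "norm (?F y - ?F s + of_real (y - s) * ?G s) \<le> (y - s) * (C * ?\<rho> (y - s))"
      using step[of s "y - s"] True s y by simp
    also have "... \<le> (y - s) * ?r y" using True by (intro mult_left_mono) auto
    finally show ?thesis using True by (simp add: scaleR_conv_of_real)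
  next
    case False
    then have lt: "y < s" using y by simp
    \<comment> \<open>To the left of s the increment is computed from the earlier time y, and the
      generator term at y is then compared with that at s.\<close>
    have eq: "?F y - ?F s - (y - s) *\<^sub>R (- ?G s) = - ((?F (y + (s - y)) - ?F y + of_real (s - y) * ?G y) - of_real (s - y) * (?G y - ?G s))"
      by (simp add: scaleR_conv_of_real algebra_simps)
    have "norm (?F y - ?F s - (y - s) *\<^sub>R (- ?G s)) \<le> norm (?F (y + (s - y)) - ?F y + of_real (s - y) * ?G y) + norm (of_real (s - y) * (?G y - ?G s))"
      unfolding eq norm_minus_cancel by (rule norm_triangle_ineq4)
    also have "... \<le> (s - y) * (C * ?\<rho> (s - y)) + (s - y) * norm (?G y - ?G s)"
      unfolding norm_mult norm_of_real using step[of y "s - y"] lt s y by (intro add_mono) auto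
    also have "... = \<bar>y - s\<bar> * ?r y" using lt by (simp add: algebra_simps)
    finally show ?thesis .
  qed
  have a: "filterlim (\<lambda>y. \<bar>y - s\<bar>) (at_right 0) (at s within {0..\<tau>})"
    unfolding filterlim_at by (auto simp: eventually_at_filter intro!: tendsto_eq_intros)
  have rho: "(?\<rho> \<longlongrightarrow> 0) (at_right 0)" using T f by (simp add: heat_semigroup_def)
  have "(?G \<longlongrightarrow> ?G s) (at s within {0..\<tau>})" using T_coeff_continuous[OF PL, of \<tau> j] s by (simp add: continuous_on)
  then have "((\<lambda>y. C * ?\<rho> \<bar>y - s\<bar> + norm (?G y - ?G s)) \<longlongrightarrow> C * 0 + norm (?G s - ?G s)) (at s within {0..\<tau>})"
    by (intro tendsto_intros filterlim_compose[OF rho a])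
  then have r: "(?r \<longlongrightarrow> 0) (at s within {0..\<tau>})" by simp
  show ?thesis
    unfolding has_vector_derivative_def
  proof (rule has_derivativeI_sandwich[of 1])
    show "bounded_linear (\<lambda>x. x *\<^sub>R (- ?G s))" by (rule bounded_linear_scaleR_left)
    show "(?r \<longlongrightarrow> 0) (at s within {0..\<tau>})" by (rule r)
    fix y assume y: "y \<in> {0..\<tau>}" "y \<noteq> s" "dist y s < 1"
    have "norm (?F y - ?F s - (y - s) *\<^sub>R (- ?G s)) / norm (y - s) \<le> \<bar>y - s\<bar> * ?r y / norm (y - s)"
      using bound[OF y(1,2)] by (intro divide_right_mono) auto
    then show "norm (?F y - ?F s - (y - s) *\<^sub>R (- ?G s)) / norm (y - s) \<le> ?r y" using y by simp
  qed simp
qed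

text \<open>Expanding P e_k in plane waves turns the derivative formula into an infinite linear
  system for row \<open>j\<close>; the integrating factor exp(s D_k) brings it into Duhamel form.
  The uniform bound over k holds since all plane waves have the same norm.\<close>

lemma T_coeff_duhamel: "duhamel (\<lambda>k t. fourier_coeff (T t (plane_wave k)) j)"
  unfolding duhamel_def
proof (intro conjI allI impI)
  let ?u = "\<lambda>k t. fourier_coeff (T t (plane_wave k)) j"
  have bd: "\<exists>C. \<forall>k. \<forall>t\<in>{0..\<tau>}. norm (?u k t) \<le> C" for \<tau>
  proof -
    obtain C where C: "0 \<le> C" "\<And>t f j. 0 \<le> t ==> t \<le> \<tau> ==> f \<in> L2 ==> norm (fourier_coeff (T t f) j) \<le> C * L2_nrm f"
      by (rule T_coeff_bound[of \<tau>]) blast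
    show ?thesis using C(2)[OF _ _ plane_wave_L2] by (intro exI[of _ "C * (2 * pi)\<^sup>2"]) auto
  qed
  then show "\<exists>C. \<forall>k. \<forall>t\<in>{0..\<tau>}. norm (?u k t) \<le> C" for \<tau> .
  show "continuous_on {0..\<tau>} (?u k)" for \<tau> k by (rule T_coeff_continuous[OF plane_wave_L2])
  fix k and t :: real assume t: "0 \<le> t"
  let ?w = "\<lambda>s. \<Sum>l. ?u l s * VV l k"
  obtain C where C: "\<And>l s. s \<in> {0..t} ==> norm (?u l s) \<le> C" using bd[of t] by blast
  have gen: "fourier_coeff (T s (P (plane_wave k))) j = of_real (DD k) * ?u k s + ?w s" if s: "s \<in> {0..t}" for s
  proof -
    have 1: "((\<lambda>l. (if k = l then of_real (DD k) else 0) * ?u l s) has_sum of_real (DD k) * ?u k s) UNIV"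
      by (rule has_sum_finite_neutralI[of "{k}"]) auto
    have 2: "((\<lambda>l. ?u l s * VV l k) has_sum ?w s) UNIV"
      by (intro has_sum_infsum abs_summable_summable[OF infsum_V_summable[OF C[OF s]]])
    have 3: "((\<lambda>l. ((if k = l then of_real (DD k) else 0) + VV l k) * ?u l s) has_sum of_real (DD k) * ?u k s + ?w s) UNIV"
      using has_sum_add[OF 1 2] by (simp add: distrib_right mult.commute[of _ "VV _ _"] del: of_real_add)
    show ?thesis
      using has_sum_unique[OF bounded_op_coeff_has_sum[OF T_bounded P_L2[OF torus_smooth_plane_wave], of s k j] 3[folded P_plane_wave_coeff]] s
      by simp
  qed
  let ?e = "\<lambda>s. complex_of_real (exp (s * DD k))"
  have der: "((\<lambda>s. ?e s * ?u k s) has_vector_derivative - (?e s * ?w s)) (at s within {0..t})" if s: "s \<in> {0..t}" for s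
  proof -
    have "((\<lambda>s. exp (s * DD k)) has_real_derivative DD k * exp (s * DD k)) (at s within {0..t})"
      by (auto intro!: derivative_eq_intros)
    then have "(?e has_vector_derivative of_real (DD k * exp (s * DD k))) (at s within {0..t})"
      by (intro has_vector_derivative_of_real) (simp add: has_real_derivative_iff_has_vector_derivative)
    from has_vector_derivative_mult[OF this T_coeff_derivative[OF torus_smooth_plane_wave s, of k j]]
    have "((\<lambda>s. ?e s * ?u k s) has_vector_derivative ?e s * - (of_real (DD k) * ?u k s + ?w s) + of_real (DD k * exp (s * DD k)) * ?u k s) (at s within {0..t})"
      unfolding gen[OF s] .
    then show ?thesis by (simp add: algebra_simps)
  qed
  have "((\<lambda>s. - (?e s * ?w s)) has_integral ?e t * ?u k t - ?e 0 * ?u k 0) {0..t}"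
    by (rule fundamental_theorem_of_calculus[OF t]) (use der in auto)
  from has_integral_mult_right[OF this, of "of_real (exp (- t * DD k))"]
  have "((\<lambda>s. - (of_real (exp (- (t - s) * DD k)) * ?w s)) has_integral of_real (exp (- t * DD k)) * (?e t * ?u k t - ?u k 0)) {0..t}"
  proof (rule has_integral_eq_rhs[OF has_integral_eq, rotated])
    show "of_real (exp (- t * DD k)) * - (?e s * ?w s) = - (of_real (exp (- (t - s) * DD k)) * ?w s)" for s
    proof -
      have "exp (- (t - s) * DD k) = exp (- t * DD k) * exp (s * DD k)" unfolding exp_add[symmetric] by (simp add: algebra_simps)
      then show ?thesis by simp
    qed
  qed simp
  moreover have "of_real (exp (- t * DD k)) * ?e t = 1" unfolding of_real_mult[symmetric] exp_add[symmetric] by simp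
  then have "of_real (exp (- t * DD k)) * (?e t * ?u k t - ?u k 0) = ?u k t - of_real (exp (- t * DD k)) * ?u k 0"
    by (simp add: right_diff_distrib mult.assoc[symmetric])
  ultimately have "((\<lambda>s. of_real (exp (- (t - s) * DD k)) * ?w s) has_integral - (?u k t - of_real (exp (- t * DD k)) * ?u k 0)) {0..t}"
    by (simp add: has_integral_neg_iff)
  from integral_unique[OF this] show "?u k t = of_real (exp (- t * DD k)) * ?u k 0 - integral {0..t} (\<lambda>s. of_real (exp (- (t - s) * DD k)) * ?w s)"
    by simp
qed

text \<open>Both sides solve the same Duhamel equation and start from the identity matrix. Hence the
  heat semigroup is unique, and every trace can be computed from \<open>U\<close>.\<close>

lemma T_coeff_eq_U: "0 \<le> t ==> fourier_coeff (T t (plane_wave k)) j = U j k t"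
proof (rule duhamel_unique[OF T_coeff_duhamel duhamel_U])
  fix k
  have "AE x in torus. T 0 (plane_wave k) x = plane_wave k x" using T by (simp add: heat_semigroup_def C0_semigroup_def)
  then have "fourier_coeff (T 0 (plane_wave k)) j = fourier_coeff (plane_wave k) j" by (intro fourier_coeff_AE T_L2) auto
  then show "fourier_coeff (T 0 (plane_wave k)) j = U j k 0" by (auto simp: fourier_coeff_plane_wave U_zero)
qed

end

end

section \<open>Construction of the heat semigroup\<close>

context heat_op
begin

definition semi_coeff :: "real => (real ^ 4 => complex) => int ^ 4 => complex" where
  "semi_coeff t f j = (\<Sum>k. U j k t * fourier_coeff f k)"

text \<open>For positive times the matrix \<open>U\<close> is entrywise summable, so that the series below converges absolutely
  for every square-integrable \<open>f\<close>.\<close>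

definition semi :: "real => (real ^ 4 => complex) => real ^ 4 => complex" where
  "semi t f = (if t = 0 then f else (\<lambda>x. \<Sum>j. semi_coeff t f j * plane_wave j x))"

lemma U_coeff_summable:
  assumes "0 \<le> t" "f \<in> L2"
  shows "(\<lambda>k. norm (U j k t * fourier_coeff f k)) summable_on UNIV"
proof (rule summable_on_comparison_test)
  show "(\<lambda>k. norm (U j k t) * (L2_nrm f / (2 * pi)\<^sup>2)) summable_on UNIV"
    by (intro summable_on_cmult_left U_row_summable assms)
  show "norm (U j k t * fourier_coeff f k) \<le> norm (U j k t) * (L2_nrm f / (2 * pi)\<^sup>2)" for k
    unfolding norm_mult by (intro mult_left_mono norm_fourier_coeff_L2 assms) auto
qed auto

lemma U_total_finite:
  assumes "0 < t"
  shows "(\<Oplus>j. (\<Oplus>k. enorm (U j k t))) < \<infinity>"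
  by (rule le_less_trans[OF U_trace]) (use assms in \<open>simp_all add: theta_eq ennreal_mult_less_top\<close>)

lemma semi_coeff_summable:
  assumes t: "0 < t" and f: "f \<in> L2"
  shows "(\<lambda>j. norm (semi_coeff t f j)) summable_on UNIV"
proof -
  let ?c = "L2_nrm f / (2 * pi)\<^sup>2"
  have "(\<Oplus>j. enorm (semi_coeff t f j))
     \<le> (\<Oplus>j. (\<Oplus>k. enorm (U j k t) * ennreal ?c))"
  proof (rule nn_integral_mono)
    fix j
    have "enorm (semi_coeff t f j) \<le> (\<Oplus>k. enorm (U j k t * fourier_coeff f k))"
      unfolding semi_coeff_def by (rule ennreal_norm_infsum_le)
    also have "... \<le> (\<Oplus>k. enorm (U j k t) * ennreal ?c)"
    proof (rule nn_integral_mono)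
      fix k
      have "enorm (fourier_coeff f k) \<le> ennreal ?c" by (intro ennreal_leI norm_fourier_coeff_L2 f)
      then show "enorm (U j k t * fourier_coeff f k) \<le> enorm (U j k t) * ennreal ?c"
        by (simp only: norm_mult ennreal_mult norm_ge_zero mult_left_mono zero_le)
    qed
    finally show "enorm (semi_coeff t f j) \<le> (\<Oplus>k. enorm (U j k t) * ennreal ?c)" .
  qed
  also have "... < \<infinity>" using U_total_finite[OF t] by (simp add: nn_integral_multc ennreal_mult_less_top)
  finally show ?thesis unfolding summable_norm_iff_nn .
qed

lemma semi_L2: "0 \<le> t ==> f \<in> L2 ==> semi t f \<in> L2"
  using wave_series_L2[OF semi_coeff_summable, of t f "\<lambda>j. j"] by (auto simp: semi_def)

lemma fourier_coeff_semi: "0 \<le> t ==> f \<in> L2 ==> fourier_coeff (semi t f) j = semi_coeff t f j"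
proof (cases "t = 0")
  case True
  have "semi_coeff 0 f j = fourier_coeff f j"
    using infsum_delta[of "fourier_coeff f" j] by (simp add: semi_coeff_def U_zero mult.commute eq_commute[of j])
  then show ?thesis using True by (simp add: semi_def)
qed (simp add: semi_def fourier_coeff_series[OF semi_coeff_summable])

text \<open>Schur's test: writing |U| as a product of two square roots, Cauchy-Schwarz bounds the
  square of each coefficient by a row sum times a weighted square sum, and summation over rows then
  uses the column sums.\<close>

lemma L2_nrm_semi:
  assumes t: "0 \<le> t" and f: "f \<in> L2"
  shows "L2_nrm (semi t f) \<le> exp (Bc * t) * L2_nrm f"
proof -
  let ?a = "\<lambda>k. norm (fourier_coeff f k)" and ?E = "exp (Bc * t)"
  have sq_sum: "(\<lambda>k. norm ((fourier_coeff f k)\<^sup>2)) summable_on UNIV"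
  proof -
    have "(\<lambda>k. (1 / (2 * pi) ^ 4) * ((2 * pi) ^ 4 * (?a k)\<^sup>2)) summable_on UNIV"
      by (intro summable_on_cmult_right has_sum_imp_summable[OF parseval_norm[OF f]])
    then show ?thesis by (simp add: norm_power)
  qed
  have c: "ennreal ((norm (semi_coeff t f j))\<^sup>2) \<le> ennreal ?E * (\<Oplus>k. enorm (U j k t) * ennreal ((?a k)\<^sup>2))" for j
  proof -
    let ?r = "\<lambda>k. ennreal (sqrt (norm (U j k t)))"
    have r: "?r k * (?r k * x) = enorm (U j k t) * x" for k x
      by (simp only: mult.assoc[symmetric] ennreal_mult[symmetric] real_sqrt_ge_0_iff norm_ge_zero real_sqrt_mult_self abs_norm_cancel)
    have "enorm (semi_coeff t f j) \<le> (\<Oplus>k. enorm (U j k t * fourier_coeff f k))"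
      unfolding semi_coeff_def by (rule ennreal_norm_infsum_le)
    also have "... = (\<Oplus>k. ?r k * (?r k * ennreal (?a k)))" unfolding r by (simp add: norm_mult ennreal_mult)
    finally have "(enorm (semi_coeff t f j))\<^sup>2 \<le> (\<Oplus>k. ?r k * (?r k * ennreal (?a k)))\<^sup>2" by (rule power_mono) simp
    also have "... \<le> (\<Oplus>k. (?r k)\<^sup>2) * (\<Oplus>k. (?r k * ennreal (?a k))\<^sup>2)" by (rule Cauchy_Schwarz_nn_integral) auto
    also have "... = (\<Oplus>k. enorm (U j k t)) * (\<Oplus>k. enorm (U j k t) * ennreal ((?a k)\<^sup>2))"
      by (simp add: ennreal_power power_mult_distrib)
    also have "... \<le> ennreal ?E * (\<Oplus>k. enorm (U j k t) * ennreal ((?a k)\<^sup>2))" by (intro mult_right_mono U_row t) simp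
    finally show ?thesis by (simp add: ennreal_power)
  qed
  have "(\<Oplus>j. ennreal ((norm (semi_coeff t f j))\<^sup>2))
      \<le> ennreal ?E * (\<Oplus>j. (\<Oplus>k. enorm (U j k t) * ennreal ((?a k)\<^sup>2)))"
    by (subst nn_integral_cmult[symmetric]) (auto intro!: nn_integral_mono c)
  also have "(\<Oplus>j. (\<Oplus>k. enorm (U j k t) * ennreal ((?a k)\<^sup>2)))
      = (\<Oplus>k. (\<Oplus>j. enorm (U j k t)) * ennreal ((?a k)\<^sup>2))"
    by (subst nn_integral_count_space_swap) (simp add: nn_integral_multc)
  also have "... \<le> (\<Oplus>k. ennreal ?E * ennreal ((?a k)\<^sup>2))"
    by (intro nn_integral_mono mult_right_mono U_col t) auto
  also have "... = ennreal ?E * ennreal (\<Sum>k. (?a k)\<^sup>2)"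
    using nn_integral_count_space_infsum[OF sq_sum] by (simp add: nn_integral_cmult norm_power)
  also have "ennreal ?E * (ennreal ?E * ennreal (\<Sum>k. (?a k)\<^sup>2)) = ennreal (?E\<^sup>2 * (\<Sum>k. (?a k)\<^sup>2))"
    by (simp add: ennreal_mult'' infsum_nonneg power2_eq_square mult.assoc)
  finally have le: "(\<Oplus>j. enorm ((semi_coeff t f j)\<^sup>2)) \<le> ennreal (?E\<^sup>2 * (\<Sum>k. (?a k)\<^sup>2))"
    by (simp add: mult_left_mono norm_power)
  have i: "(\<Sum>j. (norm (semi_coeff t f j))\<^sup>2) \<le> ?E\<^sup>2 * (\<Sum>k. (?a k)\<^sup>2)"
    using infsum_norm_nn_le[OF le] by (simp add: infsum_nonneg norm_power)
  have P: "(L2_nrm g)\<^sup>2 = (2 * pi) ^ 4 * (\<Sum>k. (norm (fourier_coeff g k))\<^sup>2)" if "g \<in> L2" for g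
    using infsumI[OF parseval_norm[OF that]] by (simp only: infsum_cmult_right')
  have "(L2_nrm (semi t f))\<^sup>2 \<le> (2 * pi) ^ 4 * (?E\<^sup>2 * (\<Sum>k. (?a k)\<^sup>2))"
    unfolding P[OF semi_L2[OF t f]] fourier_coeff_semi[OF t f] by (intro mult_left_mono i) simp
  also have "... = (?E * L2_nrm f)\<^sup>2" unfolding power_mult_distrib P[OF f] by (simp only: mult.left_commute)
  finally show ?thesis by (rule power2_le_imp_le) simp
qed

lemma semi_coeff_linear:
  assumes t: "0 \<le> t" and f: "f \<in> L2" and h: "h \<in> L2"
  shows "semi_coeff t (\<lambda>y. a * f y + b * h y) j = a * semi_coeff t f j + b * semi_coeff t h j"
proof -
  have 1: "((\<lambda>k. a * (U j k t * fourier_coeff f k) + b * (U j k t * fourier_coeff h k)) has_sum a * semi_coeff t f j + b * semi_coeff t h j) UNIV"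
    unfolding semi_coeff_def
    by (rule has_sum_add; rule has_sum_cmult_right; rule has_sum_infsum; rule abs_summable_summable; rule U_coeff_summable[OF t])
      (rule f h)+
  have "fourier_coeff (\<lambda>y. a * f y + b * h y) k = a * fourier_coeff f k + b * fourier_coeff h k" for k
    using fourier_coeff_add[OF L2_cmult(1)[OF f] L2_cmult(1)[OF h]] by (simp add: fourier_coeff_cmult)
  then show ?thesis
    unfolding semi_coeff_def[of t "\<lambda>y. a * f y + b * h y"] using infsumI[OF 1] by (simp add: algebra_simps)
qed

lemma semi_bounded_op: "0 \<le> t ==> bounded_op (semi t)"
  unfolding bounded_op_def
proof (intro conjI ballI allI)
  assume t: "0 \<le> t"
  show "semi t f \<in> L2" if "f \<in> L2" for f by (rule semi_L2[OF t that])
  show "\<exists>C. \<forall>f\<in>L2. L2_nrm (semi t f) \<le> C * L2_nrm f" using L2_nrm_semi[OF t] by blast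
  fix f h a b assume f: "f \<in> L2" and h: "h \<in> L2"
  have L: "(\<lambda>y. a * f y + b * h y) \<in> L2" by (intro L2_add L2_cmult f h)
  show "AE x in torus. semi t (\<lambda>y. a * f y + b * h y) x = a * semi t f x + b * semi t h x"
  proof (rule L2_eqI)
    show "fourier_coeff (semi t (\<lambda>y. a * f y + b * h y)) k = fourier_coeff (\<lambda>x. a * semi t f x + b * semi t h x) k" for k
      using fourier_coeff_add[OF L2_cmult(1)[OF semi_L2[OF t f]] L2_cmult(1)[OF semi_L2[OF t h]]]
      by (simp add: fourier_coeff_semi[OF t] L f h semi_coeff_linear[OF t f h] fourier_coeff_cmult)
  qed (intro semi_L2 t L L2_add L2_cmult f h)+
qed

text \<open>The semigroup law of the matrix \<open>U\<close>, transferred to functions by comparing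
  Fourier coefficients; the exchange of sums uses that coefficients of an L2 function are bounded
  and rows of \<open>U\<close> are summable.\<close>

lemma semi_add:
  assumes s: "0 \<le> s" and t: "0 \<le> t" and f: "f \<in> L2"
  shows "AE x in torus. semi (s + t) f x = semi s (semi t f) x"
proof (rule L2_eqI)
  have st: "0 \<le> s + t" using s t by simp
  show "semi (s + t) f \<in> L2" "semi s (semi t f) \<in> L2" by (intro semi_L2 st s t f)+
  fix j
  let ?h = "\<lambda>k l. U j l s * (U l k t * fourier_coeff f k)"
  define c where "c = L2_nrm f / (2 * pi)\<^sup>2"
  have c0: "0 \<le> c" by (simp add: c_def)
  have "(\<Oplus>l. (\<Oplus>k. enorm (?h k l)))
     \<le> (\<Oplus>l. enorm (U j l s) * (ennreal c * ennreal (exp (Bc * t))))"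
  proof (rule nn_integral_mono)
    fix l
    have le: "enorm (?h k l) \<le> enorm (U j l s) * (ennreal c * enorm (U l k t))" for k
    proof -
      have "norm (?h k l) \<le> norm (U j l s) * (c * norm (U l k t))"
        unfolding norm_mult c_def mult.commute[of _ "norm (U l k t)"]
        by (intro mult_left_mono norm_fourier_coeff_L2 f) auto
      then show ?thesis using c0 by (simp add: ennreal_leI flip: ennreal_mult)
    qed
    have "(\<Oplus>k. enorm (?h k l)) \<le> (\<Oplus>k. enorm (U j l s) * (ennreal c * enorm (U l k t)))"
      by (intro nn_integral_mono le)
    also have "... \<le> enorm (U j l s) * (ennreal c * ennreal (exp (Bc * t)))"
      by (simp add: nn_integral_cmult mult_left_mono U_row t)
    finally show "(\<Oplus>k. enorm (?h k l)) \<le> enorm (U j l s) * (ennreal c * ennreal (exp (Bc * t)))" .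
  qed
  also have "... = (\<Oplus>l. enorm (U j l s)) * (ennreal c * ennreal (exp (Bc * t)))"
    by (rule nn_integral_multc) simp
  also have "... < \<infinity>"
    using le_less_trans[OF U_row[OF s, of j]] by (simp add: ennreal_mult_less_top)
  finally have sw: "(\<lambda>(l,k). ?h k l) summable_on UNIV \<times> UNIV" by (rule summable_on_product_nnI(2))
  have "semi_coeff (s + t) f j = (\<Sum>k. \<Sum>l. ?h k l)"
    unfolding semi_coeff_def U_semigroup[OF s t] infsum_cmult_left'[symmetric] mult.assoc ..
  also have "... = (\<Sum>l. \<Sum>k. ?h k l)" by (rule infsum_swap_banach[OF sw, symmetric])
  also have "... = (\<Sum>l. U j l s * fourier_coeff (semi t f) l)"
    unfolding fourier_coeff_semi[OF t f] semi_coeff_def infsum_cmult_right' ..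
  also have "... = semi_coeff s (semi t f) j" unfolding semi_coeff_def ..
  finally show "fourier_coeff (semi (s + t) f) j = fourier_coeff (semi s (semi t f)) j"
    by (simp add: fourier_coeff_semi st s t f semi_L2)
qed

text \<open>The L2 norm is bounded by the sum norm of the coefficients, and the columns are
  estimated by \<open>U_generator_column\<close>. The error in column k is at most a constant times
  the squared weight, which the coefficients of a smooth function absorb; dominated convergence over
  k gives the limit.\<close>

lemma semi_generator:
  assumes f: "torus_smooth f"
  shows "((\<lambda>t. L2_nrm (\<lambda>x. (semi t f x - f x) / of_real t - (- P f x))) \<longlongrightarrow> 0) (at_right 0)"
proof -
  note fL = torus_smooth_L2[OF f] and PL = P_L2[OF f]
  let ?a = "fourier_coeff f"
  obtain C where C: "0 < C" "\<And>k. qform gu k \<le> C * (norm (lat k))\<^sup>2" by (rule qform_bounds) blast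
  define C1 where "C1 = C + m\<^sup>2"
  have C1: "0 \<le> C1" using C by (simp add: C1_def)
  have D0: "0 \<le> DD k" for k using qform_nonneg[of k] by simp
  have D1: "DD k \<le> C1 * wt k" for k
  proof -
    have "C * (norm (lat k))\<^sup>2 + m\<^sup>2 * 1 \<le> C * wt k + m\<^sup>2 * wt k"
      using C wt_ge_1[of k] by (intro add_mono mult_left_mono) (auto simp: wt_def)
    then show ?thesis using C(2)[of k] by (simp add: C1_def algebra_simps)
  qed
  define e where "e t k = t * (DD k)\<^sup>2 + (eps k t + t * (Bc\<^sup>2 * exp Bc))" for t k
  have e0: "0 \<le> e t k" if "0 \<le> t" for t k
    using eps_nonneg[OF that, of k] that by (simp only: e_def add_nonneg_nonneg mult_nonneg_nonneg zero_le_power2 exp_ge_zero)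
  define C2 where "C2 = C1\<^sup>2 + (Bc + Bc\<^sup>2 * exp Bc)"
  have e1: "e t k \<le> C2 * wt k ^ 2" if t: "0 < t" "t \<le> 1" for t k
  proof -
    have w: "1 \<le> wt k ^ 2" using wt_ge_1[of k] by simp
    have "t * (DD k)\<^sup>2 \<le> 1 * (C1 * wt k)\<^sup>2" using t D0 D1 by (intro mult_mono power_mono) auto
    moreover have "eps k t + t * (Bc\<^sup>2 * exp Bc) \<le> (Bc + 1 * (Bc\<^sup>2 * exp Bc)) * 1"
      unfolding mult_1_right using t by (intro add_mono eps_le mult_right_mono) auto
    moreover have "... \<le> (Bc + 1 * (Bc\<^sup>2 * exp Bc)) * wt k ^ 2" using w B_nonneg by (intro mult_left_mono) auto
    ultimately show ?thesis unfolding e_def C2_def by (simp add: power_mult_distrib distrib_right)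
  qed
  have sum2: "(\<lambda>k. C2 * (wt k ^ 2 * norm (?a k))) summable_on UNIV"
    by (intro summable_on_cmult_right fourier_coeff_wt_summable f)
  have as: "(\<lambda>k. norm (?a k)) summable_on UNIV" by (rule fourier_coeff_summable[OF f])
  have es: "(\<lambda>k. norm (?a k) * e t k) summable_on UNIV" if t: "0 < t" "t \<le> 1" for t
    by (rule summable_on_comparison_test[OF sum2])
      (use e1[OF t] e0 t in \<open>auto simp: mult.commute[of "norm _"] mult.assoc[symmetric] intro!: mult_right_mono\<close>)
  let ?g = "\<lambda>t x. (semi t f x - f x) / of_real t - (- P f x)"
  have main: "L2_nrm (?g t) \<le> (2 * pi)\<^sup>2 * (\<Sum>k. norm (?a k) * e t k)" if t: "0 < t" "t \<le> 1" for t
  proof -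
    have t0: "0 \<le> t" using t by simp
    have geq: "?g t = (\<lambda>x. (1 / of_real t) * (semi t f x - f x) + P f x)" by (simp add: fun_eq_iff)
    have gL: "?g t \<in> L2" unfolding geq by (intro L2_add L2_cmult L2_diff semi_L2 t0 fL PL)
    let ?M = "\<lambda>j k. U j k t - (if j = k then 1 else 0) + of_real t * ((if j = k then of_real (DD k) else 0) + VV j k)"
    have Mnn: "(\<Oplus>j. enorm (?M j k)) \<le> ennreal (t * e t k)" for k
      unfolding e_def by (rule U_generator_column[OF t])
    have co: "fourier_coeff (?g t) j = (1 / of_real t) * (\<Sum>k. ?M j k * ?a k)" for j
    proof -
      have h1: "((\<lambda>k. U j k t * ?a k) has_sum semi_coeff t f j) UNIV"
        unfolding semi_coeff_def by (rule has_sum_infsum[OF abs_summable_summable[OF U_coeff_summable[OF t0 fL]]])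
      have h2: "((\<lambda>k. (if j = k then c k else 0) * ?a k) has_sum c j * ?a j) UNIV" for c :: "int ^ 4 => complex"
        by (rule has_sum_finite_neutralI[of "{j}"]) auto
      have Vs: "(\<lambda>k. norm (VV j k * ?a k)) summable_on UNIV"
      proof (rule summable_on_comparison_test)
        show "(\<lambda>k. Bc * norm (?a k)) summable_on UNIV" by (intro summable_on_cmult_right as)
        have "norm (VV j k) \<le> Bc" for k
        proof -
          have "enorm (VV j k) \<le> ennreal Bc"
            using nn_integral_ge_point[of k UNIV "\<lambda>k. enorm (VV j k)"] V_row[of j] by (simp add: order_trans)
          then show ?thesis by (simp add: B_nonneg)
        qed
        then show "norm (VV j k * ?a k) \<le> Bc * norm (?a k)" for k by (simp add: norm_mult mult_right_mono)
      qed auto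
      have h3: "((\<lambda>k. VV j k * ?a k) has_sum (\<Sum>k. VV j k * ?a k)) UNIV"
        by (rule has_sum_infsum[OF abs_summable_summable[OF Vs]])
      have "((\<lambda>k. U j k t * ?a k + (- 1) * ((if j = k then 1 else 0) * ?a k) + of_real t * ((if j = k then of_real (DD k) else 0) * ?a k + VV j k * ?a k))
          has_sum semi_coeff t f j + (- 1) * (1 * ?a j) + of_real t * (of_real (DD j) * ?a j + (\<Sum>k. VV j k * ?a k))) UNIV"
        by (intro has_sum_add has_sum_cmult_right h1 h2 h3)
      then have "((\<lambda>k. ?M j k * ?a k) has_sum semi_coeff t f j - ?a j + of_real t * fourier_coeff (P f) j) UNIV"
        unfolding P_coeff[OF f] by (simp only: distrib_right left_diff_distrib mult.assoc mult_1 mult_minus1 add_uminus_conv_diff)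
      from infsumI[OF this] have sumeq: "(\<Sum>k. ?M j k * ?a k) = semi_coeff t f j - ?a j + of_real t * fourier_coeff (P f) j" .
      have coeq: "fourier_coeff (?g t) j = (1 / of_real t) * (semi_coeff t f j - ?a j) + fourier_coeff (P f) j"
        unfolding geq
        by (simp add: fourier_coeff_add[OF L2_cmult(1)[OF L2_diff(1)[OF semi_L2[OF t0 fL] fL]] PL] fourier_coeff_cmult
            fourier_coeff_diff[OF semi_L2[OF t0 fL] fL] fourier_coeff_semi[OF t0 fL] del: times_divide_eq_left)
      show ?thesis unfolding coeq sumeq using t by (simp add: field_simps)
    qed
    have nn: "(\<Oplus>j. enorm (fourier_coeff (?g t) j)) \<le> ennreal (\<Sum>k. norm (?a k) * e t k)"
    proof -
      have "enorm (fourier_coeff (?g t) j) \<le> (\<Oplus>k. ennreal (1 / t) * (enorm (?M j k) * enorm (?a k)))" for j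
      proof -
        have "enorm (fourier_coeff (?g t) j) = ennreal (1 / t) * enorm (\<Sum>k. ?M j k * ?a k)"
          unfolding co norm_mult using t by (subst ennreal_mult) (auto simp: norm_divide)
        also have "... \<le> ennreal (1 / t) * (\<Oplus>k. enorm (?M j k * ?a k))"
          by (intro mult_left_mono ennreal_norm_infsum_le) simp
        finally show ?thesis by (simp add: norm_mult ennreal_mult nn_integral_cmult)
      qed
      then have "(\<Oplus>j. enorm (fourier_coeff (?g t) j))
         \<le> (\<Oplus>j. (\<Oplus>k. ennreal (1 / t) * (enorm (?M j k) * enorm (?a k))))"
        by (rule nn_integral_mono)
      also have "... = (\<Oplus>k. ennreal (1 / t) * ((\<Oplus>j. enorm (?M j k)) * enorm (?a k)))"
        by (subst nn_integral_count_space_swap) (simp add: nn_integral_cmult nn_integral_multc)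
      also have "... \<le> (\<Oplus>k. ennreal (1 / t) * (ennreal (t * e t k) * enorm (?a k)))"
        by (intro nn_integral_mono mult_left_mono mult_right_mono Mnn) auto
      also have "... = (\<Oplus>k. enorm (complex_of_real (norm (?a k) * e t k)))"
      proof (rule nn_integral_cong)
        fix k
        have "1 / t * (t * e t k * norm (?a k)) = norm (complex_of_real (norm (?a k) * e t k))"
          using t e0[OF t0, of k] by (simp add: norm_mult)
        then show "ennreal (1 / t) * (ennreal (t * e t k) * enorm (?a k)) = enorm (complex_of_real (norm (?a k) * e t k))"
          using t e0[OF t0, of k] by (simp only: ennreal_mult[symmetric] mult_nonneg_nonneg norm_ge_zero less_imp_le divide_nonneg_nonneg zero_le_one)
      qed
      also have "... = ennreal (\<Sum>k. norm (complex_of_real (norm (?a k) * e t k)))"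
        by (rule nn_integral_count_space_infsum) (use es[OF t] e0[OF t0] in \<open>simp add: norm_mult\<close>)
      also have "... = ennreal (\<Sum>k. norm (?a k) * e t k)" using e0[OF t0] by (simp add: norm_mult)
      finally show ?thesis .
    qed
    have S0: "0 \<le> (\<Sum>k. norm (?a k) * e t k)" using e0[OF t0] by (intro infsum_nonneg) auto
    have "L2_nrm (?g t) \<le> (2 * pi)\<^sup>2 * (\<Sum>j. norm (fourier_coeff (?g t) j))"
      by (rule L2_nrm_le_coeff[OF gL summable_on_norm_nnI[OF nn S0]])
    also have "... \<le> (2 * pi)\<^sup>2 * (\<Sum>k. norm (?a k) * e t k)"
      by (intro mult_left_mono infsum_norm_nn_le[OF nn S0]) simp
    finally show ?thesis .
  qed
  have lim: "((\<lambda>t. \<Sum>k. norm (?a k) * e t k) \<longlongrightarrow> (\<Sum>\<^sub>\<infinity>k::int ^ 4. 0)) (at_right 0)"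
  proof (rule infsum_dominated_tendsto[OF _ _ sum2])
    show "((\<lambda>t. norm (?a k) * e t k) \<longlongrightarrow> 0) (at_right 0)" for k
    proof -
      have "((\<lambda>t. norm (?a k) * e t k) \<longlongrightarrow> norm (?a k) * (0 * (DD k)\<^sup>2 + (0 + 0 * (Bc\<^sup>2 * exp Bc)))) (at_right 0)"
        unfolding e_def by (intro tendsto_intros eps_tendsto)
      then show ?thesis by simp
    qed
    show "\<forall>\<^sub>F t in at_right 0. \<forall>k. norm (norm (?a k) * e t k) \<le> C2 * (wt k ^ 2 * norm (?a k))"
      using eventually_unit
    proof eventually_elim
      case (elim t)
      then show ?case using e1[of t] e0[of t]
        by (auto simp: abs_mult mult.commute[of "norm _"] mult.assoc[symmetric] intro!: mult_right_mono)
    qed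
  qed
  show ?thesis
  proof (rule Lim_null_comparison)
    show "\<forall>\<^sub>F t in at_right 0. norm (L2_nrm (?g t)) \<le> (2 * pi)\<^sup>2 * (\<Sum>k. norm (?a k) * e t k)"
      using eventually_unit by eventually_elim (use main in auto)
    show "((\<lambda>t. (2 * pi)\<^sup>2 * (\<Sum>k. norm (?a k) * e t k)) \<longlongrightarrow> 0) (at_right 0)"
      using tendsto_mult_left[OF lim, of "(2 * pi)\<^sup>2"] by simp
  qed
qed

text \<open>On a plane wave the increment is t times a quantity that stays bounded by the generator
  limit. Density will extend this to all of \<open>L2\<close>.\<close>

lemma semi_continuous_wave: "((\<lambda>t. L2_nrm (\<lambda>x. semi t (plane_wave k) x - plane_wave k x)) \<longlongrightarrow> 0) (at_right 0)"
proof (rule Lim_null_comparison)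
  note f = torus_smooth_plane_wave[of k]
  let ?g = "\<lambda>t x. (semi t (plane_wave k) x - plane_wave k x) / of_real t - (- P (plane_wave k) x)"
  show "\<forall>\<^sub>F t in at_right 0. norm (L2_nrm (\<lambda>x. semi t (plane_wave k) x - plane_wave k x)) \<le> t * (L2_nrm (?g t) + L2_nrm (P (plane_wave k)))"
    using eventually_unit
  proof eventually_elim
    case (elim t)
    have geq: "?g t = (\<lambda>x. (1 / of_real t) * (semi t (plane_wave k) x - plane_wave k x) + P (plane_wave k) x)" by (simp add: fun_eq_iff)
    have gL: "?g t \<in> L2" unfolding geq using elim by (intro L2_add L2_cmult L2_diff semi_L2 plane_wave_L2 P_L2 f) auto
    have "(\<lambda>x. semi t (plane_wave k) x - plane_wave k x) = (\<lambda>x. of_real t * (?g t x - P (plane_wave k) x))"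
      using elim by (simp add: fun_eq_iff)
    then have "L2_nrm (\<lambda>x. semi t (plane_wave k) x - plane_wave k x) = t * L2_nrm (\<lambda>x. ?g t x - P (plane_wave k) x)"
      using elim by (simp only: L2_cmult(2)[OF L2_diff(1)[OF gL P_L2[OF f]]]) simp
    also have "... \<le> t * (L2_nrm (?g t) + L2_nrm (P (plane_wave k)))"
      using elim by (intro mult_left_mono L2_diff(2)[OF gL P_L2[OF f]]) auto
    finally show ?case by simp
  qed
  have "((\<lambda>t. t * (L2_nrm (?g t) + L2_nrm (P (plane_wave k)))) \<longlongrightarrow> 0 * (0 + L2_nrm (P (plane_wave k)))) (at_right 0)"
    by (intro tendsto_intros semi_generator[OF f])
  then show "((\<lambda>t. t * (L2_nrm (?g t) + L2_nrm (P (plane_wave k)))) \<longlongrightarrow> 0) (at_right 0)" by simp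
qed

end

section \<open>Traces with respect to arbitrary orthonormal bases\<close>

lemma orthonormal_basis_parseval:
  assumes b: "orthonormal_basis b" and f: "f \<in> L2" and g: "g \<in> L2"
  shows "(\<lambda>n. norm (L2_inner (b n) f * cnj (L2_inner (b n) g))) summable_on UNIV"
    and "((\<lambda>n. L2_inner (b n) f * cnj (L2_inner (b n) g)) has_sum L2_inner g f) UNIV"
proof -
  have bL: "b n \<in> L2" for n using b by (simp add: orthonormal_basis_def)
  have sums: "(\<lambda>n. L2_inner (b n) f * cnj (L2_inner (b n) g)) sums L2_inner g f" if f: "f \<in> L2" and g: "g \<in> L2" for f g
    unfolding sums_def
  proof (rule LIM_zero_cancel)
    let ?p = "\<lambda>N x. \<Sum>n<N. L2_inner (b n) f * b n x"
    have p: "?p N \<in> L2" for N by (intro L2_sum L2_cmult bL) auto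
    show "(\<lambda>N. (\<Sum>n<N. L2_inner (b n) f * cnj (L2_inner (b n) g)) - L2_inner g f) \<longlonglongrightarrow> 0"
    proof (rule Lim_null_comparison)
      show "\<forall>\<^sub>F N in sequentially. norm ((\<Sum>n<N. L2_inner (b n) f * cnj (L2_inner (b n) g)) - L2_inner g f)
          \<le> L2_nrm g * L2_nrm (\<lambda>x. f x - ?p N x)"
      proof (rule always_eventually, rule allI)
        fix N
        have "(\<Sum>n<N. L2_inner (b n) f * cnj (L2_inner (b n) g)) = L2_inner g (?p N)"
          by (subst L2_inner_sum) (auto simp: L2_inner_cmult L2_inner_cnj intro!: g L2_cmult bL)
        then have "norm ((\<Sum>n<N. L2_inner (b n) f * cnj (L2_inner (b n) g)) - L2_inner g f) = norm (L2_inner g (\<lambda>x. f x - ?p N x))"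
          by (simp add: L2_inner_diff[OF g f p] norm_minus_commute)
        then show "norm ((\<Sum>n<N. L2_inner (b n) f * cnj (L2_inner (b n) g)) - L2_inner g f) \<le> L2_nrm g * L2_nrm (\<lambda>x. f x - ?p N x)"
          using L2_Cauchy_Schwarz[OF g L2_diff(1)[OF f p]] by simp
      qed
      show "(\<lambda>N. L2_nrm g * L2_nrm (\<lambda>x. f x - ?p N x)) \<longlonglongrightarrow> 0"
        using b f by (intro tendsto_mult_right_zero) (simp add: orthonormal_basis_def)
    qed
  qed
  have sq: "(\<lambda>n. (norm (L2_inner (b n) f))\<^sup>2) summable_on UNIV" if f: "f \<in> L2" for f
  proof -
    have "summable (\<lambda>n. Re (L2_inner (b n) f * cnj (L2_inner (b n) f)))"
      using sums_Re[OF sums[OF f f]] by (rule sums_summable)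
    then have "summable (\<lambda>n. norm ((norm (L2_inner (b n) f))\<^sup>2))"
      by (simp only: complex_norm_square[symmetric] Re_complex_of_real real_norm_def abs_power2)
    then show ?thesis by (rule norm_summable_imp_summable_on)
  qed
  show s: "(\<lambda>n. norm (L2_inner (b n) f * cnj (L2_inner (b n) g))) summable_on UNIV"
  proof (rule summable_on_comparison_test[OF summable_on_add[OF sq[OF f] sq[OF g]]])
    fix n
    let ?x = "norm (L2_inner (b n) f)" and ?y = "norm (L2_inner (b n) g)"
    have "0 \<le> (?x - ?y)\<^sup>2" "0 \<le> ?x\<^sup>2 + ?y\<^sup>2" by simp_all
    then have "?x * ?y \<le> ?x\<^sup>2 + ?y\<^sup>2" unfolding power2_diff by linarith
    then show "norm (L2_inner (b n) f * cnj (L2_inner (b n) g)) \<le> ?x\<^sup>2 + ?y\<^sup>2" by (simp add: norm_mult)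
  qed simp
  have h: "((\<lambda>n. L2_inner (b n) f * cnj (L2_inner (b n) g)) has_sum (\<Sum>n. L2_inner (b n) f * cnj (L2_inner (b n) g))) UNIV"
    by (rule has_sum_infsum[OF abs_summable_summable[OF s]])
  from has_sum_imp_sums[OF this] sums[OF f g] have "(\<Sum>n. L2_inner (b n) f * cnj (L2_inner (b n) g)) = L2_inner g f"
    by (rule sums_unique2)
  with h show "((\<lambda>n. L2_inner (b n) f * cnj (L2_inner (b n) g)) has_sum L2_inner g f) UNIV" by simp
qed

text \<open>Parseval for the rows and columns of the matrix with entries \<open>fourier_coeff (b n) k\<close>, which is unitary up to scaling.\<close>

lemma orthonormal_basis_coeff_unitary:
  assumes b: "orthonormal_basis b"
  shows "(\<Oplus>n. enorm (of_real ((2 * pi) ^ 4) * (cnj (fourier_coeff (b n) j) * fourier_coeff (b n) k))) \<le> 1"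
    and "(\<Sum>n. of_real ((2 * pi) ^ 4) * (cnj (fourier_coeff (b n) j) * fourier_coeff (b n) k)) = (if j = k then 1 else 0)"
proof -
  have eq: "of_real ((2 * pi) ^ 4) * (cnj (fourier_coeff (b n) j) * fourier_coeff (b n) k)
     = (1 / of_real ((2 * pi) ^ 4)) * (L2_inner (b n) (plane_wave j) * cnj (L2_inner (b n) (plane_wave k)))" for n j k
    by (simp add: fourier_coeff_inner L2_inner_cnj field_simps)
  have hs: "((\<lambda>n. of_real ((2 * pi) ^ 4) * (cnj (fourier_coeff (b n) j) * fourier_coeff (b n) k)) has_sum (if j = k then 1 else 0)) UNIV" for j k
    using has_sum_cmult_right[OF orthonormal_basis_parseval(2)[OF b plane_wave_L2 plane_wave_L2], of "1 / of_real ((2 * pi) ^ 4)" j k]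
    unfolding eq L2_inner_plane_wave by (auto split: if_splits)
  then show "(\<Sum>n. of_real ((2 * pi) ^ 4) * (cnj (fourier_coeff (b n) j) * fourier_coeff (b n) k)) = (if j = k then 1 else 0)"
    by (rule infsumI)
  let ?q = "\<lambda>j n. (2 * pi) ^ 4 * (norm (fourier_coeff (b n) j))\<^sup>2"
  have sq: "((\<lambda>n. ?q j n) has_sum 1) UNIV" for j
  proof -
    have "of_real ((2 * pi) ^ 4) * (cnj (fourier_coeff (b n) j) * fourier_coeff (b n) j) = complex_of_real (?q j n)" for n
      by (simp add: complex_norm_square[symmetric] mult.commute[of "cnj _"] del: of_real_power)
    with hs[of j j] have "((\<lambda>n. complex_of_real (?q j n)) has_sum of_real 1) UNIV" by simp
    then show ?thesis by (simp only: has_sum_of_real_iff)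
  qed
  let ?r = "\<lambda>n. (1 / 2) * ?q j n + (1 / 2) * ?q k n"
  have r: "(?r has_sum (1 / 2) * 1 + (1 / 2) * 1) UNIV" by (intro has_sum_add has_sum_cmult_right sq)
  have "enorm (of_real ((2 * pi) ^ 4) * (cnj (fourier_coeff (b n) j) * fourier_coeff (b n) k)) \<le> enorm (?r n)" for n
  proof (rule ennreal_leI)
    let ?x = "norm (fourier_coeff (b n) j)" and ?y = "norm (fourier_coeff (b n) k)"
    have "0 \<le> (?x - ?y)\<^sup>2" by simp
    then have "?x * ?y \<le> (1 / 2) * ?x\<^sup>2 + (1 / 2) * ?y\<^sup>2" unfolding power2_diff by linarith
    then have "(2 * pi) ^ 4 * (?x * ?y) \<le> (2 * pi) ^ 4 * ((1 / 2) * ?x\<^sup>2 + (1 / 2) * ?y\<^sup>2)" by (rule mult_left_mono) simp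
    also have "... = ?r n" by (simp add: algebra_simps)
    also have "?r n \<le> norm (?r n)" by simp
    finally show "norm (of_real ((2 * pi) ^ 4) * (cnj (fourier_coeff (b n) j) * fourier_coeff (b n) k)) \<le> norm (?r n)"
      by (simp add: norm_mult norm_power)
  qed
  then have "(\<Oplus>n. enorm (of_real ((2 * pi) ^ 4) * (cnj (fourier_coeff (b n) j) * fourier_coeff (b n) k)))
     \<le> (\<Oplus>n. enorm (?r n))" by (rule nn_integral_mono)
  also have "... = ennreal (\<Sum>n. norm (?r n))"
    by (rule nn_integral_count_space_infsum) (use has_sum_imp_summable[OF r] in simp)
  also have "... = 1" using infsumI[OF r] by simp
  finally show "(\<Oplus>n. enorm (of_real ((2 * pi) ^ 4) * (cnj (fourier_coeff (b n) j) * fourier_coeff (b n) k))) \<le> 1" .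
qed

text \<open>The notion of trace quantifies over bases indexed by natural numbers, so the lattice is
  enumerated by a bijection and the waves are divided by their norm. This basis identifies the trace
  of a given semigroup.\<close>

lemma plane_wave_orthonormal_basis:
  assumes e: "bij e"
  shows "orthonormal_basis (\<lambda>n x. (1 / of_real ((2 * pi)\<^sup>2)) * plane_wave (e n) x)"
proof -
  let ?c = "1 / complex_of_real ((2 * pi)\<^sup>2)"
  have cc: "cnj ?c = ?c" "?c * ?c * of_real ((2 * pi) ^ 4) = 1" by (simp_all add: power2_eq_square power4_eq_xxxx)
  have inner: "L2_inner (\<lambda>x. ?c * plane_wave k x) f = ?c * of_real ((2 * pi) ^ 4) * fourier_coeff f k" for k f
  proof -
    have "L2_inner (\<lambda>x. ?c * plane_wave k x) f = cnj (L2_inner f (\<lambda>x. ?c * plane_wave k x))" by (simp only: L2_inner_cnj)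
    also have "... = ?c * L2_inner (plane_wave k) f" by (simp only: L2_inner_cmult complex_cnj_mult L2_inner_cnj cc)
    finally show ?thesis by (simp add: fourier_coeff_inner)
  qed
  show ?thesis
    unfolding orthonormal_basis_def
  proof (intro conjI allI ballI)
    show "(\<lambda>x. ?c * plane_wave (e n) x) \<in> L2" for n by (intro L2_cmult plane_wave_L2)
    show "L2_inner (\<lambda>x. ?c * plane_wave (e j) x) (\<lambda>x. ?c * plane_wave (e n) x) = (if j = n then 1 else 0)" for j n
    proof -
      have "e n = e j \<longleftrightarrow> j = n" using e by (auto simp: bij_def inj_eq)
      then show ?thesis unfolding inner fourier_coeff_cmult fourier_coeff_plane_wave using cc(2) by (auto simp: mult_ac)
    qed
    fix f :: "real ^ 4 => complex" assume f: "f \<in> L2"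
    have s: "(\<Sum>n<N. L2_inner (\<lambda>x. ?c * plane_wave (e n) x) f * (?c * plane_wave (e n) x))
        = (\<Sum>k\<in>e ` {..<N}. fourier_coeff f k * plane_wave k x)" for N x
    proof -
      have "L2_inner (\<lambda>x. ?c * plane_wave (e n) x) f * (?c * plane_wave (e n) x) = fourier_coeff f (e n) * plane_wave (e n) x" for n
      proof -
        have "L2_inner (\<lambda>x. ?c * plane_wave (e n) x) f * (?c * plane_wave (e n) x) = (?c * ?c * of_real ((2 * pi) ^ 4)) * (fourier_coeff f (e n) * plane_wave (e n) x)"
          unfolding inner by (simp only: mult_ac)
        then show ?thesis by (simp only: cc(2) mult_1)
      qed
      then show ?thesis using e by (subst sum.reindex) (auto simp: bij_def intro: inj_on_subset)
    qed
    have "filterlim (\<lambda>N. e ` {..<N}) (finite_subsets_at_top UNIV) sequentially"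
      unfolding filterlim_finite_subsets_at_top
    proof (intro allI impI)
      fix X :: "(int ^ 4) set" assume X: "finite X \<and> X \<subseteq> UNIV"
      obtain N where N: "inv e ` X \<subseteq> {..<N}" using X finite_nat_iff_bounded[of "inv e ` X"] by auto
      show "\<forall>\<^sub>F y in sequentially. finite (e ` {..<y}) \<and> X \<subseteq> e ` {..<y} \<and> e ` {..<y} \<subseteq> UNIV"
        using eventually_ge_at_top[of N]
      proof eventually_elim
        case (elim y)
        have "x \<in> e ` {..<y}" if "x \<in> X" for x
        proof (rule image_eqI[of _ _ "inv e x"])
          show "x = e (inv e x)" using e by (simp add: bij_def surj_f_inv_f)
          show "inv e x \<in> {..<y}" using N that elim by fastforce
        qed
        then show ?case by auto
      qed
    qed
    from filterlim_compose[OF fourier_partial_sum_limit[OF f] this]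
    show "(\<lambda>N. L2_nrm (\<lambda>x. f x - (\<Sum>n<N. L2_inner (\<lambda>x. ?c * plane_wave (e n) x) f * (?c * plane_wave (e n) x)))) \<longlonglongrightarrow> 0"
      unfolding s .
  qed
qed

lemma lattice_bijection: obtains e :: "nat => int ^ 4" where "bij e"
proof -
  have "infinite (range (\<lambda>n. \<chi> i::4. int n))"
    by (intro range_inj_infinite) (auto simp: inj_on_def vec_eq_iff)
  then have "infinite (UNIV :: (int ^ 4) set)" using infinite_super[OF subset_UNIV] by blast
  then have "bij (from_nat_into (UNIV :: (int ^ 4) set))"
    using bij_betw_from_nat_into[of "UNIV :: (int ^ 4) set"] by simp
  then show ?thesis by (rule that)
qed

context heat_op
begin

text \<open>Strong continuity follows from continuity on plane waves by density: f is approximated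
  by a finite Fourier sum, and the norms of the operators are at most exp \<open>Bc\<close> for t <=
  1, which gives the constant \<open>E\<close>.\<close>

lemma semi_C0: "C0_semigroup semi"
  unfolding C0_semigroup_def
proof (intro conjI allI impI ballI)
  show "bounded_op (semi t)" if "0 \<le> t" for t by (rule semi_bounded_op[OF that])
  show "\<exists>M \<omega>. \<forall>t\<ge>0. \<forall>f\<in>L2. L2_nrm (semi t f) \<le> M * exp (\<omega> * t) * L2_nrm f"
    using L2_nrm_semi by (intro exI[of _ 1] exI[of _ Bc]) simp
  show "AE x in torus. semi 0 f x = f x" for f by (simp add: semi_def)
  show "AE x in torus. semi (s + t) f x = semi s (semi t f) x" if "0 \<le> s" "0 \<le> t" "f \<in> L2" for s t f
    by (rule semi_add[OF that])
  fix f :: "real ^ 4 => complex" assume f: "f \<in> L2"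
  define E where "E = exp Bc + 1"
  have E: "0 < E" unfolding E_def by (simp add: add_pos_pos)
  show "((\<lambda>t. L2_nrm (\<lambda>x. semi t f x - f x)) \<longlongrightarrow> 0) (at_right 0)"
  proof (rule tendstoI)
    fix \<epsilon> :: real assume \<epsilon>: "0 < \<epsilon>"
    let ?p = "\<lambda>F x. \<Sum>k\<in>F. fourier_coeff f k * plane_wave k x"
    have "\<forall>\<^sub>F F in finite_subsets_at_top UNIV. L2_nrm (\<lambda>x. f x - ?p F x) < \<epsilon> / (2 * E)"
      using fourier_partial_sum_limit[OF f] \<epsilon> E by (intro order_tendstoD) auto
    then obtain F where F: "finite F" "L2_nrm (\<lambda>x. f x - ?p F x) < \<epsilon> / (2 * E)"
      unfolding eventually_finite_subsets_at_top by blast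
    let ?w = "\<lambda>t. \<Sum>k\<in>F. norm (fourier_coeff f k) * L2_nrm (\<lambda>x. semi t (plane_wave k) x - plane_wave k x)"
    have p: "?p F \<in> L2" by (intro L2_sum F L2_cmult plane_wave_L2)
    have d: "(\<lambda>x. f x - ?p F x) \<in> L2" by (rule L2_diff[OF f p])
    have main: "L2_nrm (\<lambda>x. semi t f x - f x) \<le> E * L2_nrm (\<lambda>x. f x - ?p F x) + ?w t" if t: "0 < t" "t \<le> 1" for t
    proof -
      have t0: "0 \<le> t" using t by simp
      note bo = semi_bounded_op[OF t0]
      let ?q = "\<lambda>x. \<Sum>k\<in>F. fourier_coeff f k * (semi t (plane_wave k) x - plane_wave k x)"
      have wL: "(\<lambda>x. semi t (plane_wave k) x - plane_wave k x) \<in> L2" for k by (intro L2_diff semi_L2 t0 plane_wave_L2)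
      have qL: "?q \<in> L2" by (intro L2_sum F L2_cmult wL)
      let ?s = "semi t (\<lambda>x. f x - ?p F x)"
      have sL: "?s \<in> L2" by (rule semi_L2[OF t0 d])
      have AE: "AE x in torus. semi t f x - f x = (?s x - (f x - ?p F x)) + ?q x"
      proof (rule L2_eqI)
        show "(\<lambda>x. semi t f x - f x) \<in> L2" by (intro L2_diff semi_L2 t0 f)
        show "(\<lambda>x. (?s x - (f x - ?p F x)) + ?q x) \<in> L2" by (intro L2_add L2_diff(1)[OF sL d] qL)
        fix j
        have cq: "fourier_coeff ?q j = fourier_coeff (semi t (?p F)) j - fourier_coeff (?p F) j"
          unfolding bounded_op_coeff_sum[OF bo F(1) plane_wave_L2] fourier_coeff_sum[OF F(1) L2_cmult(1)[OF wL]]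
            fourier_coeff_sum[OF F(1) L2_cmult(1)[OF plane_wave_L2]] fourier_coeff_cmult
            fourier_coeff_diff[OF semi_L2[OF t0 plane_wave_L2] plane_wave_L2]
          by (simp add: right_diff_distrib sum_subtractf)
        show "fourier_coeff (\<lambda>x. semi t f x - f x) j = fourier_coeff (\<lambda>x. (?s x - (f x - ?p F x)) + ?q x) j"
          unfolding fourier_coeff_add[OF L2_diff(1)[OF sL d] qL] fourier_coeff_diff[OF sL d] fourier_coeff_diff[OF f p]
            fourier_coeff_diff[OF semi_L2[OF t0 f] f] bounded_op_coeff_diff[OF bo f p] cq by simp
      qed
      have "L2_nrm (\<lambda>x. semi t f x - f x) = L2_nrm (\<lambda>x. (?s x - (f x - ?p F x)) + ?q x)"
        by (rule L2_nrm_AE[OF _ _ AE]) (intro L2_diff semi_L2 t0 f L2_add(1)[OF L2_diff(1)[OF sL d] qL])+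
      also have "... \<le> (L2_nrm ?s + L2_nrm (\<lambda>x. f x - ?p F x)) + L2_nrm ?q"
        by (rule order_trans[OF L2_add(2)[OF L2_diff(1)[OF sL d] qL]]) (intro add_mono order_refl L2_diff(2) sL d)
      also have "L2_nrm ?s \<le> exp Bc * L2_nrm (\<lambda>x. f x - ?p F x)"
      proof (rule order_trans[OF L2_nrm_semi[OF t0 d]])
        have "Bc * t \<le> Bc * 1" using t B_nonneg by (intro mult_left_mono) auto
        then show "exp (Bc * t) * L2_nrm (\<lambda>x. f x - ?p F x) \<le> exp Bc * L2_nrm (\<lambda>x. f x - ?p F x)" by (intro mult_right_mono) auto
      qed
      also have "L2_nrm ?q \<le> ?w t"
        using L2_nrm_sum[OF F(1) L2_cmult(1)[OF wL], of "fourier_coeff f" ] by (simp only: L2_cmult(2)[OF wL])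
      finally show ?thesis by (simp add: E_def algebra_simps)
    qed
    have wl: "(?w \<longlongrightarrow> 0) (at_right 0)"
      by (intro tendsto_null_sum tendsto_mult_right_zero semi_continuous_wave)
    have "\<forall>\<^sub>F t in at_right 0. ?w t < \<epsilon> / 2" using wl \<epsilon> by (intro order_tendstoD) auto
    then show "\<forall>\<^sub>F t in at_right 0. dist (L2_nrm (\<lambda>x. semi t f x - f x)) 0 < \<epsilon>"
      using eventually_unit
    proof eventually_elim
      case (elim t)
      have "E * L2_nrm (\<lambda>x. f x - ?p F x) < E * (\<epsilon> / (2 * E))" by (intro mult_strict_left_mono F(2) E)
      also have "... = \<epsilon> / 2" using E by simp
      finally show ?case using main[of t] elim by (simp add: dist_norm)
    qed
  qed
qed

lemma semi_heat: "heat_semigroup P semi"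
  using semi_C0 semi_generator by (simp add: heat_semigroup_def)

text \<open>For positive time the entries of \<open>U\<close> are absolutely summable over both
  indices. The diagonal sum in any orthonormal basis is then an absolutely convergent triple sum,
  and summing first over the basis leaves only the entries with j = k.\<close>

lemma semi_has_trace:
  assumes t: "0 < t"
  shows "has_trace (semi t) (heat_K t)"
  unfolding has_trace_def
proof (intro allI impI)
  fix b assume b: "orthonormal_basis b"
  have t0: "0 \<le> t" using t by simp
  have bL: "b n \<in> L2" for n using b by (simp add: orthonormal_basis_def)
  let ?g = "\<lambda>n j k. of_real ((2 * pi) ^ 4) * (cnj (fourier_coeff (b n) j) * fourier_coeff (b n) k)"
  let ?h = "\<lambda>n x. U (fst x) (snd x) t * ?g n (fst x) (snd x)"
  have U1: "(\<Oplus>x. enorm (U (fst x) (snd x) t)) < \<infinity>"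
    using U_total_finite[OF t] nn_integral_fst_count_space[of "\<lambda>x. enorm (U (fst x) (snd x) t)"] by simp
  have "(\<Oplus>x. (\<Oplus>n. enorm (?h n x)))
     \<le> (\<Oplus>x. enorm (U (fst x) (snd x) t))"
  proof (rule nn_integral_mono)
    fix x :: "(int ^ 4) \<times> (int ^ 4)"
    have "(\<Oplus>n. enorm (?h n x))
       = enorm (U (fst x) (snd x) t) * (\<Oplus>n. enorm (?g n (fst x) (snd x)))"
      unfolding norm_mult[of "U _ _ _"] by (simp only: ennreal_mult norm_ge_zero nn_integral_cmult borel_measurable_count_space)
    also have "... \<le> enorm (U (fst x) (snd x) t) * 1"
      by (intro mult_left_mono orthonormal_basis_coeff_unitary(1) b) simp
    finally show "(\<Oplus>n. enorm (?h n x)) \<le> enorm (U (fst x) (snd x) t)" by simp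
  qed
  also note U1
  finally have hs: "(\<lambda>(x,n). ?h n x) summable_on UNIV \<times> UNIV" by (rule summable_on_product_nnI(2))
  have hn: "(\<lambda>(n,x). ?h n x) summable_on UNIV \<times> UNIV"
    using hs by (subst (asm) summable_on_swap) (simp add: case_prod_beta')
  have slice: "(\<lambda>x. ?h n x) summable_on UNIV" for n
    using summable_on_SigmaD1[of "\<lambda>n x. ?h n x" UNIV "\<lambda>_. UNIV" n] hn by simp
  have inner: "L2_inner (b n) (semi t (b n)) = (\<Sum>x. ?h n x)" for n
  proof -
    have "L2_inner (b n) (semi t (b n)) = (\<Sum>j. of_real ((2 * pi) ^ 4) * (cnj (fourier_coeff (b n) j) * semi_coeff t (b n) j))"
      using infsumI[OF parseval_inner[OF bL semi_L2[OF t0 bL]]] by (simp only: fourier_coeff_semi[OF t0 bL])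
    also have "... = (\<Sum>j. \<Sum>k. ?h n (j, k))"
      unfolding semi_coeff_def infsum_cmult_right'[symmetric] by (simp only: fst_conv snd_conv mult.left_commute mult.assoc)
    also have "... = (\<Sum>\<^sub>\<infinity>(j,k). ?h n (j, k))"
      using infsum_Sigma'_banach[of "\<lambda>j k. ?h n (j, k)" UNIV "\<lambda>_. UNIV"] slice[of n] by (simp add: case_prod_beta')
    finally show ?thesis by (simp add: case_prod_beta')
  qed
  have "(\<Sum>n. \<Sum>x. ?h n x) = (\<Sum>x. \<Sum>n. ?h n x)" by (rule infsum_swap_banach[OF hn])
  also have "... = (\<Sum>x. U (fst x) (snd x) t * (if fst x = snd x then 1 else 0))"
    by (intro infsum_cong)
      (simp only: infsum_cmult_right'[of "U _ _ t"] orthonormal_basis_coeff_unitary(2)[OF b])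
  also have "... = (\<Sum>\<^sub>\<infinity>x\<in>range (\<lambda>k. (k, k)). U (fst x) (snd x) t)"
    by (rule infsum_cong_neutral) auto
  also have "... = heat_K t" unfolding heat_K_def by (subst infsum_reindex) (auto simp: inj_on_def o_def)
  finally have val: "(\<Sum>n. L2_inner (b n) (semi t (b n))) = heat_K t" unfolding inner .
  have "(\<lambda>n. \<Sum>x. ?h n x) summable_on UNIV"
    using summable_on_Sigma_banach[of "\<lambda>n x. ?h n x" UNIV "\<lambda>_. UNIV"] hn by simp
  then show "((\<lambda>n. L2_inner (b n) (semi t (b n))) has_sum heat_K t) UNIV"
    unfolding inner[symmetric] using val has_sum_infsum by metis
qed

text \<open>Evaluating the trace in the normalised plane waves gives the diagonal of
  \<open>U\<close>, whichever semigroup with the given generator was chosen.\<close>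

lemma heat_trace_unique:
  assumes T: "heat_semigroup P T" and t: "0 < t" and K: "has_trace (T t) K"
  shows "K = heat_K t"
proof -
  have t0: "0 \<le> t" using t by simp
  obtain e :: "nat => int ^ 4" where e: "bij e" by (rule lattice_bijection)
  let ?c = "1 / complex_of_real ((2 * pi)\<^sup>2)"
  let ?b = "\<lambda>n x. ?c * plane_wave (e n) x"
  have inner: "L2_inner (?b n) (T t (?b n)) = U (e n) (e n) t" for n
  proof -
    have "L2_inner (?b n) (T t (?b n)) = cnj (L2_inner (T t (?b n)) (?b n))" by (simp only: L2_inner_cnj)
    also have "... = ?c * L2_inner (plane_wave (e n)) (T t (?b n))"
      by (simp only: L2_inner_cmult complex_cnj_mult L2_inner_cnj) simp
    also have "L2_inner (plane_wave (e n)) (T t (?b n)) = of_real ((2 * pi) ^ 4) * (?c * U (e n) (e n) t)"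
    proof -
      have "L2_inner (plane_wave k) g = of_real ((2 * pi) ^ 4) * fourier_coeff g k" for k g
        by (simp add: fourier_coeff_inner)
      then show ?thesis
        by (simp only: bounded_op_coeff_cmult[OF T_bounded[OF T t0] plane_wave_L2] T_coeff_eq_U[OF T t0])
    qed
    also have "?c * (of_real ((2 * pi) ^ 4) * (?c * U (e n) (e n) t)) = U (e n) (e n) t"
      by (simp add: power2_eq_square power4_eq_xxxx)
    finally show ?thesis .
  qed
  have "((\<lambda>n. L2_inner (?b n) (T t (?b n))) has_sum K) UNIV"
    using K plane_wave_orthonormal_basis[OF e] unfolding has_trace_def by blast
  then have "((\<lambda>n. U (e n) (e n) t) has_sum K) UNIV" unfolding inner .
  then have "((\<lambda>k. U k k t) has_sum K) UNIV"
    using has_sum_reindex_bij_betw[of e UNIV UNIV "\<lambda>k. U k k t" K] e by simp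
  then show ?thesis unfolding heat_K_def by (rule infsumI[symmetric])
qed

end

section \<open>Uniqueness of the expansion coefficients\<close>

lemma laurent_coeff_unique:
  fixes d :: "nat => complex"
  assumes "((\<lambda>s. (\<Sum>j\<le>n. d j * of_real s ^ j) / of_real s ^ n) \<longlongrightarrow> 0) (at_right (0::real))"
  shows "d n = 0"
  using assms
proof (induction n arbitrary: d)
  case 0
  then show ?case by (simp add: tendsto_const_iff)
next
  case (Suc n)
  have ev: "\<forall>\<^sub>F s in at_right (0::real). 0 < s" by (rule eventually_at_right_less)
  have "((\<lambda>s. of_real s ^ Suc n * ((\<Sum>j\<le>Suc n. d j * of_real s ^ j) / of_real s ^ Suc n)) \<longlongrightarrow> of_real 0 ^ Suc n * 0) (at_right (0::real))"
    by (intro tendsto_mult[OF tendsto_power Suc.prems] tendsto_intros)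
  then have "((\<lambda>s. of_real s ^ Suc n * ((\<Sum>j\<le>Suc n. d j * of_real s ^ j) / of_real s ^ Suc n)) \<longlongrightarrow> 0) (at_right (0::real))" by simp
  then have 1: "((\<lambda>s. \<Sum>j\<le>Suc n. d j * of_real s ^ j) \<longlongrightarrow> 0) (at_right (0::real))"
    by (rule Lim_transform_eventually) (use ev in eventually_elim, simp)
  have "((\<lambda>s. \<Sum>j\<le>Suc n. d j * of_real s ^ j) \<longlongrightarrow> (\<Sum>j\<le>Suc n. d j * of_real 0 ^ j)) (at_right (0::real))"
    by (intro tendsto_intros)
  also have "(\<Sum>j\<le>Suc n. d j * of_real 0 ^ j) = d 0" by (subst sum.atMost_Suc_shift) simp
  finally have d0: "d 0 = 0" using tendsto_unique[OF _ _ 1] by simp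
  have "((\<lambda>s. (\<Sum>j\<le>n. d (Suc j) * of_real s ^ j) / of_real s ^ n) \<longlongrightarrow> 0) (at_right (0::real))"
  proof (rule Lim_transform_eventually[OF Suc.prems])
    show "\<forall>\<^sub>F s in at_right 0. (\<Sum>j\<le>Suc n. d j * complex_of_real s ^ j) / of_real s ^ Suc n = (\<Sum>j\<le>n. d (Suc j) * of_real s ^ j) / of_real s ^ n"
      using ev
    proof eventually_elim
      case (elim s)
      have "(\<Sum>j\<le>Suc n. d j * complex_of_real s ^ j) = of_real s * (\<Sum>j\<le>n. d (Suc j) * of_real s ^ j)"
        by (subst sum.atMost_Suc_shift) (simp add: d0 sum_distrib_left mult_ac)
      then show ?case using elim by simp
    qed
  qed
  then show ?case by (rule Suc.IH)
qed

text \<open>The substitution t = s^2 turns half-integer powers into integer ones. The lowest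
  coefficient then vanishes, a factor s cancels, and induction reaches the constant term.\<close>

lemma expansion_coeff_unique:
  fixes d :: "nat => complex"
  assumes "((\<lambda>t. \<Sum>j\<le>4. d j * of_real (t powr ((real j - 4) / 2))) \<longlongrightarrow> 0) (at_right (0::real))"
  shows "d 4 = 0"
proof (rule laurent_coeff_unique)
  have f: "filterlim (\<lambda>s::real. s\<^sup>2) (at_right 0) (at_right 0)"
    unfolding filterlim_at
    by (auto simp: eventually_at_filter intro!: tendsto_eq_intros)
  show "((\<lambda>s. (\<Sum>j\<le>4. d j * of_real s ^ j) / of_real s ^ 4) \<longlongrightarrow> 0) (at_right (0::real))"
  proof (rule Lim_transform_eventually[OF filterlim_compose[OF assms f]])
    show "\<forall>\<^sub>F s in at_right 0. (\<Sum>j\<le>4. d j * of_real (s\<^sup>2 powr ((real j - 4) / 2))) = (\<Sum>j\<le>4. d j * of_real s ^ j) / complex_of_real s ^ 4"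
      using eventually_at_right_less[of "0::real"]
    proof eventually_elim
      case (elim s)
      have "s\<^sup>2 powr ((real j - 4) / 2) = s ^ j / s ^ 4" for j :: nat
      proof -
        have "s\<^sup>2 powr ((real j - 4) / 2) = (s powr 2) powr ((real j - 4) / 2)" using elim by (simp add: powr_numeral)
        also have "... = s powr (2 * ((real j - 4) / 2))" by (rule powr_powr)
        also have "... = s powr (real j - real (4::nat))" by (rule arg_cong[where f="(powr) s"]) simp
        also have "... = s ^ j / s ^ 4" using elim by (simp only: powr_diff powr_realpow)
        finally show ?thesis .
      qed
      then show ?case by (simp add: sum_divide_distrib)
    qed
  qed
qed

context heat_op
begin

definition a4 :: complex where
  "a4 = of_real c0 * (of_real (m ^ 4 / 2) + of_real (m\<^sup>2) * \<alpha> 0 0 + M2 / 2)"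

text \<open>Existence comes from \<open>semi\<close> with the expansion of \<open>heat_K\<close>.
  For uniqueness, any competing semigroup has the same trace, so two expansions differ by a
  combination of powers that tends to zero.\<close>

lemma is_heat_coeff_iff: "is_heat_coeff P 4 c \<longleftrightarrow> c = a4"
proof -
  define a where "a j = (if j = 0 then of_real c0 else if j = 2 then - of_real c0 * (of_real (m\<^sup>2) + \<alpha> 0 0) else if j = 4 then a4 else 0)" for j :: nat
  have a: "(\<Sum>j\<le>4. a j * complex_of_real (t powr ((real j - 4) / 2)))
      = of_real (c0 / t\<^sup>2) - of_real (c0 / t) * (of_real (m\<^sup>2) + \<alpha> 0 0) + a4" if t: "0 < t" for t
  proof -
    have "t powr (- 2) = 1 / t\<^sup>2" "t powr (- 1) = 1 / t" "t powr 0 = 1"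
      using t powr_realpow[OF t, of 2] powr_realpow[OF t, of 1] by (simp_all add: powr_minus divide_inverse)
    then show ?thesis using t by (simp add: numeral_eq_Suc a_def)
  qed
  have lim: "((\<lambda>t. heat_K t - (\<Sum>j\<le>4. a j * complex_of_real (t powr ((real j - 4) / 2)))) \<longlongrightarrow> 0) (at_right 0)"
    by (rule Lim_transform_eventually[OF heat_K_limit])
      (use eventually_at_right_less[of "0::real"] in eventually_elim, simp only: a a4_def)
  show ?thesis
  proof
    assume c: "c = a4"
    have "(\<lambda>t. heat_K t - (\<Sum>j\<le>4. a j * complex_of_real (t powr ((real j - 4) / 2)))) \<in> o[at_right 0](\<lambda>t. complex_of_real (t powr ((real (4::nat) - 4) / 2)))"
    proof (rule smalloI_tendsto)
      show "((\<lambda>t. (heat_K t - (\<Sum>j\<le>4. a j * complex_of_real (t powr ((real j - 4) / 2)))) / complex_of_real (t powr ((real (4::nat) - 4) / 2))) \<longlongrightarrow> 0) (at_right 0)"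
        by (rule Lim_transform_eventually[OF lim])
          (use eventually_at_right_less[of "0::real"] in eventually_elim, simp)
      show "\<forall>\<^sub>F t in at_right 0. complex_of_real (t powr ((real (4::nat) - 4) / 2)) \<noteq> 0"
        using eventually_at_right_less[of "0::real"] by eventually_elim simp
    qed
    then have "heat_trace_expansion P 4 a"
      unfolding heat_trace_expansion_def using semi_heat semi_has_trace by blast
    then show "is_heat_coeff P 4 c" unfolding is_heat_coeff_def c by (intro exI[of _ a]) (simp add: a_def)
  next
    assume "is_heat_coeff P 4 c"
    then obtain a' T K where T: "heat_semigroup P T" and K: "\<And>t. 0 < t ==> has_trace (T t) (K t)" and c: "a' 4 = c"
      and o: "(\<lambda>t. K t - (\<Sum>j\<le>4. a' j * complex_of_real (t powr ((real j - 4) / 2)))) \<in> o[at_right 0](\<lambda>t. complex_of_real (t powr ((real (4::nat) - 4) / 2)))"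
      unfolding is_heat_coeff_def heat_trace_expansion_def by blast
    have "((\<lambda>t. (K t - (\<Sum>j\<le>4. a' j * complex_of_real (t powr ((real j - 4) / 2)))) / complex_of_real (t powr ((real (4::nat) - 4) / 2))) \<longlongrightarrow> 0) (at_right 0)"
      using o by (rule smalloD_tendsto)
    then have l2: "((\<lambda>t. heat_K t - (\<Sum>j\<le>4. a' j * complex_of_real (t powr ((real j - 4) / 2)))) \<longlongrightarrow> 0) (at_right 0)"
      by (rule Lim_transform_eventually)
        (use eventually_at_right_less[of "0::real"] in eventually_elim, simp add: heat_trace_unique[OF T _ K])
    have "((\<lambda>t. \<Sum>j\<le>4. (a' j - a j) * complex_of_real (t powr ((real j - 4) / 2))) \<longlongrightarrow> 0) (at_right 0)"
      using tendsto_diff[OF lim l2] by (simp add: left_diff_distrib sum_subtractf)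
    from expansion_coeff_unique[OF this] show "c = a4" using c by (simp add: a_def)
  qed
qed

end

section \<open>Evaluation of the coefficient by integrals over the torus\<close>

lemma torus_int_coeff: "torus_int gu f = of_real (torus_vol gu) * fourier_coeff f 0"
  by (simp add: torus_int_def torus_vol_def fourier_coeff_def)

lemma reflected_product:
  fixes u w :: "int ^ 4 => complex"
  assumes u: "(\<lambda>k. norm (u k)) summable_on UNIV" and w: "(\<lambda>k. norm (w k)) summable_on UNIV"
  shows "(\<lambda>k. u k * w (- k)) summable_on UNIV"
    and "((\<lambda>k. u k * w (- k)) has_sum (\<Sum>k. u k * w (- k))) UNIV"
    and "((\<lambda>k. u (- k) * w k) has_sum (\<Sum>k. u k * w (- k))) UNIV"
proof -
  show s: "(\<lambda>k. u k * w (- k)) summable_on UNIV"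
  proof (rule abs_summable_summable, rule summable_on_comparison_test)
    show "(\<lambda>k. norm (u k) * (\<Sum>k. norm (w k))) summable_on UNIV" by (intro summable_on_cmult_left u)
    show "norm (u k * w (- k)) \<le> norm (u k) * (\<Sum>k. norm (w k))" for k
      unfolding norm_mult by (intro mult_left_mono summable_norm_bounded w) simp
  qed simp
  then show h: "((\<lambda>k. u k * w (- k)) has_sum (\<Sum>k. u k * w (- k))) UNIV" by (rule has_sum_infsum)
  have "bij_betw uminus UNIV (UNIV :: (int ^ 4) set)" by (auto intro!: bij_betw_byWitness[where f'=uminus])
  from has_sum_reindex_bij_betw[OF this, of "\<lambda>k. u k * w (- k)"] h
  show "((\<lambda>k. u (- k) * w k) has_sum (\<Sum>k. u k * w (- k))) UNIV" by simp
qed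

lemma tconv_zero:
  assumes "transpose \<Theta> = - \<Theta>"
  shows "tconv \<Theta> a b 0 = (\<Sum>k. a k * b (- k))"
  by (simp add: tconv_def ph_def sb_minus sb_self[OF assms])

text \<open>The zero mode is the trace of the star algebra, and this is associativity under it.
  After l = r - k the phases agree because ph(r-k,-r) equals ph(k,r-k) for skew \<Theta>.\<close>

lemma tconv_cyclic:
  assumes skew: "transpose \<Theta> = - \<Theta>"
    and a: "(\<lambda>k. norm (a k)) summable_on UNIV" and b: "(\<lambda>k. norm (b k)) summable_on UNIV" and c: "(\<lambda>k. norm (c k)) summable_on UNIV"
  shows "tconv \<Theta> a (tconv \<Theta> b c) 0 = tconv \<Theta> (tconv \<Theta> a b) c 0"
proof -
  let ?f = "\<lambda>k l. a k * (b l * c (- k - l) * ph \<Theta> l (- k - l))"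
  have "(\<Oplus>k. (\<Oplus>l. enorm (?f k l)))
    \<le> (\<Oplus>k. (\<Oplus>l. enorm (a k) * (enorm (b l) * ennreal (\<Sum>k. norm (c k)))))"
  proof (intro nn_integral_mono)
    fix k l
    have "enorm (c (- k - l)) \<le> ennreal (\<Sum>k. norm (c k))" by (intro ennreal_leI summable_norm_bounded c)
    then show "enorm (?f k l) \<le> enorm (a k) * (enorm (b l) * ennreal (\<Sum>k. norm (c k)))"
      by (simp add: norm_mult ennreal_mult mult_left_mono)
  qed
  also have "... < \<infinity>"
    using a b by (simp add: nn_integral_cmult nn_integral_multc ennreal_mult_less_top summable_norm_iff_nn)
  finally have s: "(\<lambda>(k,l). ?f k l) summable_on UNIV \<times> UNIV" by (rule summable_on_product_nnI(2))
  have bij: "bij_betw (\<lambda>(k,r). (k, r - k)) (UNIV \<times> UNIV) (UNIV \<times> (UNIV :: (int ^ 4) set))"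
    by (auto intro!: bij_betw_byWitness[where f'="\<lambda>(k,l). (k, l + k)"])
  have s': "(\<lambda>(k,r). ?f k (r - k)) summable_on UNIV \<times> UNIV"
    using summable_on_reindex_bij_betw[OF bij, of "\<lambda>(k,l). ?f k l"] s by (simp add: case_prod_beta')
  have "tconv \<Theta> a (tconv \<Theta> b c) 0 = (\<Sum>k. \<Sum>l. ?f k l)"
    unfolding tconv_zero[OF skew] unfolding tconv_def infsum_cmult_right' ..
  also have "... = (\<Sum>k. \<Sum>r. ?f k (r - k))"
    by (intro infsum_cong infsum_reindex_bij_betw[symmetric] bij_betw_byWitness[where f'="\<lambda>l. l + _"]) auto
  also have "... = (\<Sum>r. \<Sum>k. ?f k (r - k))" by (rule infsum_swap_banach[OF s'])
  also have "... = (\<Sum>r. tconv \<Theta> a b r * c (- r))"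
    unfolding tconv_def infsum_cmult_left'[symmetric]
  proof (intro infsum_cong)
    fix r k
    have "ph \<Theta> (r - k) (- k - (r - k)) = ph \<Theta> k (r - k)"
      using sb_skew[OF skew, of r k] by (simp add: ph_def sb_diff sb_minus sb_self[OF skew])
    then show "?f k (r - k) = a k * b (r - k) * ph \<Theta> k (r - k) * c (- r)" by (simp add: mult_ac)
  qed
  finally show ?thesis unfolding tconv_zero[OF skew, symmetric] .
qed

text \<open>Parseval applied to f and its conjugate. The resulting sum is also the zero mode of the
  star square, since the phase of (k,-k) is trivial: under the integral the pointwise and the star
  square agree.\<close>

lemma fourier_coeff_square:
  assumes f: "torus_smooth f"
  shows "fourier_coeff (\<lambda>x. (f x)\<^sup>2) 0 = (\<Sum>k. fourier_coeff f k * fourier_coeff f (- k))"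
proof -
  have fL: "f \<in> L2" by (rule torus_smooth_L2[OF f])
  then have cL: "(\<lambda>x. cnj (f x)) \<in> L2"
    by (rule L2_dominated[rotated]) (use L2D(1)[OF fL] in \<open>auto simp: borel_measurable_complex_iff\<close>)
  have c: "fourier_coeff (\<lambda>x. cnj (f x)) k = cnj (fourier_coeff f (- k))" for k
  proof -
    have "cnj (LINT x|torus. f x * cnj (plane_wave (- k) x)) = (LINT x|torus. cnj (f x * cnj (plane_wave (- k) x)))"
      by (rule Bochner_Integration.integral_cnj[symmetric])
    also have "... = (LINT x|torus. cnj (f x) * cnj (plane_wave k x))" by (simp add: plane_wave_cnj)
    finally show ?thesis by (simp add: fourier_coeff_def)
  qed
  have "L2_inner (\<lambda>x. cnj (f x)) f = of_real ((2 * pi) ^ 4) * fourier_coeff (\<lambda>x. (f x)\<^sup>2) 0"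
    by (simp add: L2_inner_def fourier_coeff_def power2_eq_square)
  with infsumI[OF parseval_inner[OF cL fL]]
  have "of_real ((2 * pi) ^ 4) * fourier_coeff (\<lambda>x. (f x)\<^sup>2) 0 = complex_of_real ((2 * pi) ^ 4) * (\<Sum>k. fourier_coeff f (- k) * fourier_coeff f k)"
    unfolding c by (simp add: infsum_cmult_right')
  then have "fourier_coeff (\<lambda>x. (f x)\<^sup>2) 0 = (\<Sum>k. fourier_coeff f (- k) * fourier_coeff f k)" by simp
  then show ?thesis by (simp add: mult.commute)
qed

lemma fourier_coeff_one: "fourier_coeff (\<lambda>_. 1) k = (if k = 0 then 1 else 0)"
proof -
  have "(\<lambda>_. 1) = plane_wave 0" by (simp add: fun_eq_iff)
  then show ?thesis by (simp add: fourier_coeff_plane_wave eq_commute[of 0])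
qed

lemma tconv_one: "tconv \<Theta> a (fourier_coeff (\<lambda>_. 1)) = a"
proof
  fix r
  have "tconv \<Theta> a (fourier_coeff (\<lambda>_. 1)) r = a r * fourier_coeff (\<lambda>_. 1) (r - r) * ph \<Theta> r (r - r)"
    unfolding tconv_def by (rule infsum_singleton_support(1)) (simp add: fourier_coeff_one)
  then show "tconv \<Theta> a (fourier_coeff (\<lambda>_. 1)) r = a r" by (simp add: fourier_coeff_one)
qed

lemma
  assumes f: "torus_smooth f"
  shows star_pow_summable: "(\<lambda>k. norm (fourier_coeff (star_pow \<Theta> f n) k)) summable_on UNIV"
    and fourier_coeff_star_pow_Suc: "fourier_coeff (star_pow \<Theta> f (Suc n)) = tconv \<Theta> (fourier_coeff f) (fourier_coeff (star_pow \<Theta> f n))"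
proof -
  note a = fourier_coeff_summable[OF f]
  have s: "(\<lambda>k. norm (fourier_coeff (star_pow \<Theta> f n) k)) summable_on UNIV" for n
  proof (induction n)
    case 0
    show ?case using infsum_singleton_support(2)[of 0 "\<lambda>k. complex_of_real (norm (fourier_coeff (\<lambda>_. 1) k))"]
      summable_on_Re by (fastforce simp: fourier_coeff_one)
  next
    case (Suc n)
    then show ?case using tconv_summable[OF a Suc] fourier_coeff_star[OF a Suc] by simp
  qed
  then show "(\<lambda>k. norm (fourier_coeff (star_pow \<Theta> f n) k)) summable_on UNIV" .
  show "fourier_coeff (star_pow \<Theta> f (Suc n)) = tconv \<Theta> (fourier_coeff f) (fourier_coeff (star_pow \<Theta> f n))"
    by (rule ext) (simp add: fourier_coeff_star[OF a s])
qed

lemma fourier_coeff_star_pow: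
  assumes f: "torus_smooth f"
  shows "fourier_coeff (star_pow \<Theta> f 3) = tconv \<Theta> (fourier_coeff f) (tconv \<Theta> (fourier_coeff f) (fourier_coeff f))"
    and "fourier_coeff (star_pow \<Theta> f 4) = tconv \<Theta> (fourier_coeff f) (tconv \<Theta> (fourier_coeff f) (tconv \<Theta> (fourier_coeff f) (fourier_coeff f)))"
  by (simp_all add: numeral_eq_Suc fourier_coeff_star_pow_Suc[OF f] tconv_one del: star_pow.simps(2))

text \<open>The analytic input is that \<alpha>(p,-p) decays rapidly: off p = 0 only the product a_p
  a_(-p) remains, and smoothness of the field gives its decay.\<close>

lemma (in metric) heat_op_P_op:
  assumes skew: "transpose \<Theta> = - \<Theta>"
    and dioph: "diophantine \<Theta>"
    and smooth: "torus_smooth \<phi>"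
  shows "heat_op gu \<Theta> (alpha \<Theta> lam (fourier_coeff \<phi>)) m (P_op gu \<Theta> lam m \<phi>)"
proof -
  let ?a = "fourier_coeff \<phi>" and ?\<psi> = "tconv \<Theta> (fourier_coeff \<phi>) (fourier_coeff \<phi>)"
  note a = fourier_coeff_summable[OF smooth]
  define A where "A = (\<Sum>k. norm (?a k))"
  have A: "norm (?a k) \<le> A" for k unfolding A_def by (rule summable_norm_bounded[OF a])
  have diag: "(\<lambda>p. wt p ^ n * norm (alpha \<Theta> lam ?a p (- p))) summable_on UNIV" for n
  proof -
    \<comment> \<open>On the antidiagonal the two one-sided terms are present at p = 0 only, where
      each contributes the zero mode of the star square and the weight is 1.\<close>
    let ?d = "\<lambda>p::int ^ 4. if p = 0 then 2 * norm (?\<psi> 0) else 0"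
    have d: "?d summable_on UNIV"
      using summable_on_cong_neutral[of UNIV "{0}" ?d ?d] by auto
    have s: "(\<lambda>p. \<bar>lam / 6\<bar> * (?d p + A * (wt p ^ n * norm (?a p)))) summable_on UNIV"
      by (intro summable_on_cmult_right summable_on_add d fourier_coeff_wt_summable smooth)
    show ?thesis
    proof (rule summable_on_comparison_test[OF s])
      fix p :: "int ^ 4"
      have m: "norm (?a p * ?a (- p)) \<le> norm (?a p) * A" unfolding norm_mult by (intro mult_left_mono A) simp
      have "norm ((if - p = 0 then ?\<psi> p else 0) + (if p = 0 then ?\<psi> (- p) else 0) + ?a p * ?a (- p)) \<le> ?d p + norm (?a p) * A"
      proof (cases "p = 0")
        case True
        have "norm (?\<psi> 0 + ?\<psi> 0 + ?a 0 * ?a 0) \<le> norm (?\<psi> 0) + norm (?\<psi> 0) + norm (?a 0 * ?a 0)"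
          by (intro order_trans[OF norm_triangle_ineq] add_mono norm_triangle_ineq order_refl)
        then show ?thesis using True m by simp
      qed (use m in simp)
      then have "norm (alpha \<Theta> lam ?a p (- p)) \<le> \<bar>lam / 6\<bar> * (?d p + norm (?a p) * A)"
        unfolding alpha_def norm_mult norm_of_real by (intro mult_left_mono) auto
      then have "wt p ^ n * norm (alpha \<Theta> lam ?a p (- p)) \<le> wt p ^ n * (\<bar>lam / 6\<bar> * (?d p + norm (?a p) * A))"
        by (rule mult_left_mono) (simp add: less_imp_le)
      also have "... = \<bar>lam / 6\<bar> * (wt p ^ n * ?d p + A * (wt p ^ n * norm (?a p)))" by (simp add: algebra_simps)
      also have "wt p ^ n * ?d p = ?d p" by (simp add: wt_def)
      finally show "wt p ^ n * norm (alpha \<Theta> lam ?a p (- p)) \<le> \<bar>lam / 6\<bar> * (?d p + A * (wt p ^ n * norm (?a p)))" .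
    qed (simp add: less_imp_le)
  qed
  show ?thesis
  proof unfold_locales
    show "transpose \<Theta> = - \<Theta>" "diophantine \<Theta>" by fact+
    show "(\<lambda>(p,q). norm (alpha \<Theta> lam ?a p q)) summable_on UNIV" by (rule alpha_summable[OF a])
    show "(\<lambda>p. wt p ^ n * norm (alpha \<Theta> lam ?a p (- p))) summable_on UNIV" for n by (rule diag)
    show "P_op gu \<Theta> lam m \<phi> f \<in> L2" if "torus_smooth f" for f by (rule P_op_L2[OF skew smooth that])
    show "fourier_coeff (P_op gu \<Theta> lam m \<phi> f) k = of_real (qform gu k + m\<^sup>2) * fourier_coeff f k
      + (\<Sum>l. Vmat \<Theta> (alpha \<Theta> lam ?a) k l * fourier_coeff f l)" if "torus_smooth f" for f k
      by (rule fourier_coeff_P_op[OF skew smooth that])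
  qed
qed

text \<open>Expansion of the square of the three-term alpha, summed over both indices. Left with
  left and right with right give the star-fourth-power sum \<open>Q\<close>, hence the factor 2.
  Left with right is concentrated at p = q = 0 and gives twice the squared zero mode of the star
  square, the two-sided term with itself gives it once more, hence 3. A one-sided with the two-sided
  term gives the zero mode of the field times the star-cube sum \<open>R\<close>, in four
  ways.\<close>

lemma alpha_quadratic_sum:
  fixes a :: "int ^ 4 => complex"
  assumes skew: "transpose \<Theta> = - \<Theta>" and a: "(\<lambda>k. norm (a k)) summable_on UNIV"
  shows "(\<Sum>p. \<Sum>q. alpha \<Theta> lam a p q * alpha \<Theta> lam a (- p) (- q)) = (of_real (lam / 6))\<^sup>2 *
     (2 * tconv \<Theta> a (tconv \<Theta> a (tconv \<Theta> a a)) 0 + 3 * (tconv \<Theta> a a 0)\<^sup>2 + 4 * a 0 * tconv \<Theta> a (tconv \<Theta> a a) 0)"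
proof -
  define \<psi> where "\<psi> = tconv \<Theta> a a"
  have psi: "(\<lambda>k. norm (\<psi> k)) summable_on UNIV" unfolding \<psi>_def by (rule tconv_summable[OF a a])
  define Q where "Q = (\<Sum>k. \<psi> k * \<psi> (- k))"
  define R where "R = (\<Sum>k. a k * \<psi> (- k))"
  define T where "T = (\<Sum>k. a k * a (- k))"
  note hQ = reflected_product(2)[OF psi psi, folded Q_def]
  note hR = reflected_product(2,3)[OF a psi, folded R_def]
  note hT = reflected_product(2)[OF a a, folded T_def]
  have T: "\<psi> 0 = T" unfolding \<psi>_def T_def by (rule tconv_zero[OF skew])
  have delta: "((\<lambda>q :: int ^ 4. if q = 0 then x else 0) has_sum x) UNIV" for x :: complex
    by (rule has_sum_finite_neutralI[of "{0 :: int ^ 4}"]) auto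
  define L where "L = complex_of_real (lam / 6)"
  let ?\<delta> = "\<lambda>p x. if p = (0 :: int ^ 4) then x else (0::complex)"
  let ?t = "\<lambda>p q. ?\<delta> q (\<psi> p * \<psi> (- p) + a 0 * (a (- p) * \<psi> p + a p * \<psi> (- p)))
     + ?\<delta> p 1 * (\<psi> q * \<psi> (- q) + a 0 * (a (- q) * \<psi> q + a q * \<psi> (- q))) + ?\<delta> q (?\<delta> p (2 * \<psi> 0 * \<psi> 0)) + (a p * a (- p)) * (a q * a (- q))"
  have al: "alpha \<Theta> lam a p q = L * ((if q = 0 then \<psi> p else 0) + (if p = 0 then \<psi> q else 0) + a p * a q)" for p q
    by (simp only: alpha_def \<psi>_def L_def)
  have e: "alpha \<Theta> lam a p q * alpha \<Theta> lam a (- p) (- q) = L\<^sup>2 * ?t p q" for p q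
    by (cases "p = 0"; cases "q = 0") (simp_all add: al power2_eq_square algebra_simps)
  have inner: "(\<Sum>q. ?t p q) = (\<psi> p * \<psi> (- p) + a 0 * (a (- p) * \<psi> p + a p * \<psi> (- p)))
     + ?\<delta> p 1 * (Q + a 0 * (R + R)) + ?\<delta> p (2 * \<psi> 0 * \<psi> 0) + (a p * a (- p)) * T" for p
    by (intro infsumI has_sum_add has_sum_cmult_right delta hQ hR hT)
  have outer: "(\<Sum>p. (\<psi> p * \<psi> (- p) + a 0 * (a (- p) * \<psi> p + a p * \<psi> (- p)))
     + ?\<delta> p 1 * (Q + a 0 * (R + R)) + ?\<delta> p (2 * \<psi> 0 * \<psi> 0) + (a p * a (- p)) * T)
     = (Q + a 0 * (R + R)) + 1 * (Q + a 0 * (R + R)) + 2 * \<psi> 0 * \<psi> 0 + T * T"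
    by (intro infsumI has_sum_add has_sum_cmult_right has_sum_cmult_left delta hQ hR hT)
  have "(\<Sum>p. \<Sum>q. alpha \<Theta> lam a p q * alpha \<Theta> lam a (- p) (- q)) = L\<^sup>2 * (\<Sum>p. \<Sum>q. ?t p q)"
    unfolding e infsum_cmult_right' ..
  also have "... = L\<^sup>2 * (2 * Q + 3 * (\<psi> 0)\<^sup>2 + 4 * a 0 * R)"
    unfolding inner unfolding outer unfolding T by (simp add: power2_eq_square algebra_simps)
  also have "Q = tconv \<Theta> a (tconv \<Theta> a \<psi>) 0"
    unfolding tconv_cyclic[OF skew a a psi] \<psi>_def[symmetric] unfolding tconv_zero[OF skew] Q_def ..
  also have "R = tconv \<Theta> a \<psi> 0" unfolding tconv_zero[OF skew] R_def ..
  finally show ?thesis unfolding \<psi>_def L_def .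
qed

text \<open>The abstract coefficient with alpha inserted; c0/2 is taken out as a common factor, and
  each remaining factor is a zero mode of a star power or a product of such zero modes.\<close>

lemma (in metric) heat_coeff_formula:
  fixes lam m :: real
  assumes skew: "transpose \<Theta> = - \<Theta>"
    and dioph: "diophantine \<Theta>"
    and smooth: "torus_smooth \<phi>"
  defines "a \<equiv> fourier_coeff \<phi>"
  defines "b \<equiv> of_real (pi\<^sup>2 * sqrt_g gu / 2) * (of_real (m ^ 4) + of_real (lam * m\<^sup>2 / 3) * (2 * tconv \<Theta> a a 0 + (a 0)\<^sup>2)
      + (of_real (lam / 6))\<^sup>2 * (2 * tconv \<Theta> a (tconv \<Theta> a (tconv \<Theta> a a)) 0 + 3 * (tconv \<Theta> a a 0)\<^sup>2 + 4 * a 0 * tconv \<Theta> a (tconv \<Theta> a a) 0))"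
  shows "is_heat_coeff (P_op gu \<Theta> lam m \<phi>) 4 c \<longleftrightarrow> c = b"
    and "heat_coeff (P_op gu \<Theta> lam m \<phi>) 4 = b"
proof -
  interpret heat_op gu \<Theta> "alpha \<Theta> lam a" m "P_op gu \<Theta> lam m \<phi>"
    unfolding a_def by (rule heat_op_P_op[OF skew dioph smooth])
  have s: "(\<lambda>k. norm (a k)) summable_on UNIV" unfolding a_def by (rule fourier_coeff_summable[OF smooth])
  have f: "\<gamma> * (M / 2 + \<mu> * (L * (2 * X + Z)) + L\<^sup>2 * W / 2) = \<gamma> / 2 * (M + (2 * \<mu> * L) * (2 * X + Z) + L\<^sup>2 * W)"
    for \<gamma> M \<mu> L X Z W :: complex by (simp add: algebra_simps)
  have al: "alpha \<Theta> lam a 0 0 = of_real (lam / 6) * (2 * tconv \<Theta> a a 0 + (a 0)\<^sup>2)"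
    by (simp add: alpha_def power2_eq_square)
  have "complex_of_real (lam * m\<^sup>2 / 3) = 2 * of_real (m\<^sup>2) * of_real (lam / 6)"
    "complex_of_real (pi\<^sup>2 * sqrt_g gu / 2) = of_real (pi\<^sup>2 * sqrt_g gu) / 2"
    "complex_of_real (m ^ 4 / 2) = of_real (m ^ 4) / 2" by simp_all
  then have "a4 = b"
    unfolding a4_def M2_def alpha_quadratic_sum[OF skew s] b_def c0_def al by (simp only: f)
  then show 1: "is_heat_coeff (P_op gu \<Theta> lam m \<phi>) 4 c \<longleftrightarrow> c = b" for c using is_heat_coeff_iff by simp
  show "heat_coeff (P_op gu \<Theta> lam m \<phi>) 4 = b" unfolding heat_coeff_def 1 by simp
qed

lemma torus_int_powers:
  fixes gu \<Theta> :: "real ^ 4 ^ 4"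
  assumes skew: "transpose \<Theta> = - \<Theta>" and smooth: "torus_smooth \<phi>"
  defines "a \<equiv> fourier_coeff \<phi>" and "v \<equiv> complex_of_real (torus_vol gu)"
  shows "torus_int gu \<phi> = v * a 0" "torus_int gu (\<lambda>x. (\<phi> x)\<^sup>2) = v * tconv \<Theta> a a 0"
    "torus_int gu (star_pow \<Theta> \<phi> 3) = v * tconv \<Theta> a (tconv \<Theta> a a) 0"
    "torus_int gu (star_pow \<Theta> \<phi> 4) = v * tconv \<Theta> a (tconv \<Theta> a (tconv \<Theta> a a)) 0"
  unfolding a_def v_def torus_int_coeff fourier_coeff_star_pow[OF smooth] fourier_coeff_square[OF smooth] tconv_zero[OF skew, of a a for a]
  by simp_all

section \<open>Failure of locality\<close>

lemma fourier_coeff_two_waves: "fourier_coeff (\<lambda>x. c * plane_wave k x + d * plane_wave l x) r = (if k = r then c else 0) + (if l = r then d else 0)"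
  by (simp add: fourier_coeff_add[OF L2_cmult(1)[OF plane_wave_L2] L2_cmult(1)[OF plane_wave_L2]] fourier_coeff_cmult fourier_coeff_plane_wave)

lemma tconv_two_waves:
  fixes g :: "int ^ 4 => complex"
  shows "tconv \<Theta> (\<lambda>r. (if k = r then c else 0) + (if l = r then d else 0)) g r
    = c * g (r - k) * ph \<Theta> k (r - k) + d * g (r - l) * ph \<Theta> l (r - l)"
proof -
  have 1: "((\<lambda>q. (if k = q then c else 0) * g (r - q) * ph \<Theta> q (r - q)) has_sum c * g (r - k) * ph \<Theta> k (r - k)) UNIV" for c k
    by (rule has_sum_finite_neutralI[of "{k}"]) auto
  have "((\<lambda>q. ((if k = q then c else 0) + (if l = q then d else 0)) * g (r - q) * ph \<Theta> q (r - q)) has_sum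
     c * g (r - k) * ph \<Theta> k (r - k) + d * g (r - l) * ph \<Theta> l (r - l)) UNIV"
    using has_sum_add[OF 1[of k c] 1[of l d]] by (simp only: distrib_right)
  then show ?thesis unfolding tconv_def by (rule infsumI)
qed

text \<open>Test functions for the locality question: on constants and on a single real Fourier mode, the quartic part of
  the heat coefficient is in the ratios 9 and 4 to the integral of the fourth star power.\<close>

lemma
  assumes "a = (\<lambda>r. (if 0 = r then c else 0) + (if 0 = r then 0 else (0::complex)))"
  shows tconv_constant: "tconv \<Theta> a a 0 = c\<^sup>2" "tconv \<Theta> a (tconv \<Theta> a a) 0 = c ^ 3"
    "tconv \<Theta> a (tconv \<Theta> a (tconv \<Theta> a a)) 0 = c ^ 4" "a 0 = c"
proof -
  have t: "tconv \<Theta> a g r = c * g r" for g r unfolding assms tconv_two_waves by simp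
  show 0: "a 0 = c" by (simp add: assms)
  show "tconv \<Theta> a a 0 = c\<^sup>2" "tconv \<Theta> a (tconv \<Theta> a a) 0 = c ^ 3" "tconv \<Theta> a (tconv \<Theta> a (tconv \<Theta> a a)) 0 = c ^ 4"
    unfolding t 0 by (simp_all add: power2_eq_square power3_eq_cube power4_eq_xxxx)
qed

text \<open>All frequencies that occur are multiples of k, on which the skew form vanishes, so star
  powers are ordinary powers here. The values 2 and 6 count the ways in which two or four signs sum
  to zero.\<close>

lemma
  assumes skew: "transpose \<Theta> = - \<Theta>" and k: "k \<noteq> 0"
    and a: "a = (\<lambda>r. (if k = r then c else 0) + (if - k = r then c else (0::complex)))"
  shows tconv_mode: "tconv \<Theta> a a 0 = 2 * c\<^sup>2" "tconv \<Theta> a (tconv \<Theta> a (tconv \<Theta> a a)) 0 = 6 * c ^ 4" "a 0 = 0"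
proof -
  obtain i where i: "k $ i \<noteq> 0" using k by (auto simp: vec_eq_iff)
  have ne: "k \<noteq> - k" "- k \<noteq> k" "- k \<noteq> k + k + k" "k + k + k \<noteq> - k" "k \<noteq> k + k + k" "k \<noteq> - k - k - k" "k + k + k \<noteq> k" "- k \<noteq> - k - k - k"
    using i by (auto simp: vec_eq_iff intro!: exI[of _ i])
  have ph: "ph \<Theta> k k = 1" "ph \<Theta> k (- k) = 1" "ph \<Theta> (- k) k = 1" "ph \<Theta> (- k) (- k) = 1"
    "ph \<Theta> k (k + k + k) = 1" "ph \<Theta> (- k) (k + k + k) = 1" "ph \<Theta> k (- k - k - k) = 1" "ph \<Theta> (- k) (- k - k - k) = 1"
    "ph \<Theta> k (k + k) = 1" "ph \<Theta> (- k) (k + k) = 1" "ph \<Theta> k (- k - k) = 1" "ph \<Theta> (- k) (- k - k) = 1"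
    by (simp_all only: ph_def sb_add sb_diff sb_minus sb_self[OF skew]) simp_all
  have ar: "a k = c" "a (- k) = c" "a 0 = 0" "a (k + k + k) = 0" "a (- k - k - k) = 0"
    unfolding a using k ne by auto
  have t: "tconv \<Theta> a g r = c * g (r - k) * ph \<Theta> k (r - k) + c * g (r + k) * ph \<Theta> (- k) (r + k)" for g r
    unfolding a tconv_two_waves by simp
  define \<psi> where "\<psi> = tconv \<Theta> a a"
  have p: "\<psi> 0 = 2 * c\<^sup>2" "\<psi> (k + k) = c\<^sup>2" "\<psi> (- k - k) = c\<^sup>2"
    using t[of a 0] t[of a "k + k"] t[of a "- k - k"] ar ph unfolding \<psi>_def by (simp_all add: power2_eq_square del: mult_2 mult_2_right)
  define \<eta> where "\<eta> = tconv \<Theta> a \<psi>"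
  have q: "\<eta> k = 3 * c ^ 3" "\<eta> (- k) = 3 * c ^ 3"
    using t[of \<psi> k] t[of \<psi> "- k"] p ph unfolding \<eta>_def by (simp_all add: power2_eq_square power3_eq_cube)
  show "a 0 = 0" by (rule ar)
  show "tconv \<Theta> a a 0 = 2 * c\<^sup>2" using p(1) by (simp add: \<psi>_def)
  show "tconv \<Theta> a (tconv \<Theta> a (tconv \<Theta> a a)) 0 = 6 * c ^ 4"
    using t[of \<eta> 0] q ph unfolding \<eta>_def \<psi>_def by (simp add: power3_eq_cube power4_eq_xxxx)
qed

text \<open>The combination f(2) - 4 f(1) + 3 f(0) annihilates the constant and quadratic parts and
  equals 12 times the quartic coefficient.\<close>

lemma quartic_coeff_unique:
  fixes \<alpha> \<beta> \<gamma> \<alpha>' \<beta>' \<gamma>' :: complex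
  assumes "\<And>x. x \<in> \<real> ==> \<alpha> + \<beta> * x\<^sup>2 + \<gamma> * x ^ 4 = \<alpha>' + \<beta>' * x\<^sup>2 + \<gamma>' * x ^ 4"
  shows "\<gamma> = \<gamma>'"
proof -
  have e: "12 * \<gamma> = (\<alpha> + \<beta> * 2\<^sup>2 + \<gamma> * 2 ^ 4) - 4 * (\<alpha> + \<beta> * 1\<^sup>2 + \<gamma> * 1 ^ 4) + 3 * (\<alpha> + \<beta> * 0\<^sup>2 + \<gamma> * 0 ^ 4)" for \<alpha> \<beta> \<gamma> :: complex
    by (simp add: algebra_simps)
  have "12 * \<gamma> = 12 * \<gamma>'" unfolding e[of \<gamma> \<alpha> \<beta>] e[of \<gamma>' \<alpha>' \<beta>'] by (simp only: assms Reals_0 Reals_1 Reals_numeral)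
  then show ?thesis by simp
qed

theorem mainTheorem6:
  fixes gu \<Theta> :: "real ^ 4 ^ 4" and lam m :: real and \<phi> :: "real ^ 4 \<Rightarrow> complex"
  assumes gu_sym: "transpose gu = gu"
    and gu_pos: "\<And>x. x \<noteq> 0 \<Longrightarrow> 0 < x \<bullet> (gu *v x)"
    and \<Theta>_skew: "transpose \<Theta> = - \<Theta>"
    and \<Theta>_dioph: "diophantine \<Theta>"
    and \<phi>_smooth: "torus_smooth \<phi>"
    and \<phi>_real: "real_valued \<phi>"
  shows
    "let P = P_op gu \<Theta> lam m;
         v = complex_of_real (torus_vol gu);
         lam' = complex_of_real lam;
         m' = complex_of_real m;
         I = torus_int gu;
         A = 1 / (32 * (complex_of_real pi)\<^sup>2) *
               (v * m' ^ 4
                + lam' * m'\<^sup>2 / 3 * (2 * I (\<lambda>x. (\<phi> x)\<^sup>2) + inverse v * (I \<phi>)\<^sup>2)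
                + lam'\<^sup>2 / 36 *
                    (2 * I (star_pow \<Theta> \<phi> 4)
                     + 3 * inverse v * (I (\<lambda>x. (\<phi> x)\<^sup>2))\<^sup>2
                     + 4 * inverse v * I (star_pow \<Theta> \<phi> 3) * I \<phi>))
     in (\<exists>!c. is_heat_coeff (P \<phi>) 4 c) \<and>
        heat_coeff (P \<phi>) 4 = A \<and>
        (\<forall>s. s \<noteq> 0 \<longrightarrow> W_div (P \<phi>) s = - (1 / (2 * s)) * A) \<and>
        (lam \<noteq> 0 \<longrightarrow>
          \<not> (\<exists>c0 c1 c2. \<forall>\<psi>. torus_smooth \<psi> \<and> real_valued \<psi> \<longrightarrow>
               heat_coeff (P \<psi>) 4 =
                 c0 + c1 * I (\<lambda>x. (\<psi> x)\<^sup>2) + c2 * I (star_pow \<Theta> \<psi> 4)))"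
proof -
  interpret metric gu by unfold_locales (rule gu_sym, rule gu_pos)
  note formula = heat_coeff_formula[OF \<Theta>_skew \<Theta>_dioph]
  note ints = torus_int_powers[OF \<Theta>_skew, where gu=gu]
  define v where "v = complex_of_real (torus_vol gu)"
  have g0: "sqrt_g gu \<noteq> 0" using sqrt_g_pos by simp
  have v0: "v \<noteq> 0" using g0 by (simp add: v_def torus_vol_def)
  have pv: "of_real (pi\<^sup>2 * sqrt_g gu / 2) = v / (32 * (complex_of_real pi)\<^sup>2)"
    by (simp add: v_def torus_vol_def power2_eq_square power4_eq_xxxx)
  define A where "A = 1 / (32 * (complex_of_real pi)\<^sup>2) *
               (v * of_real m ^ 4
                + of_real lam * (of_real m)\<^sup>2 / 3 * (2 * torus_int gu (\<lambda>x. (\<phi> x)\<^sup>2) + inverse v * (torus_int gu \<phi>)\<^sup>2)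
                + (of_real lam)\<^sup>2 / 36 *
                    (2 * torus_int gu (star_pow \<Theta> \<phi> 4)
                     + 3 * inverse v * (torus_int gu (\<lambda>x. (\<phi> x)\<^sup>2))\<^sup>2
                     + 4 * inverse v * torus_int gu (star_pow \<Theta> \<phi> 3) * torus_int gu \<phi>))"
  have A: "heat_coeff (P_op gu \<Theta> lam m \<phi>) 4 = A"
  proof -
    have f: "1 / p * (v * M + l / 3 * (2 * (v * s) + inverse v * (v * z)\<^sup>2) + L / 36 * (2 * (v * w) + 3 * inverse v * (v * s)\<^sup>2 + 4 * inverse v * (v * u) * (v * z)))
       = v / p * (M + l / 3 * (2 * s + z\<^sup>2) + L / 36 * (2 * w + 3 * s\<^sup>2 + 4 * z * u))" for p M l s z L w u
    proof -
      have i: "inverse v * (v * z)\<^sup>2 = v * z\<^sup>2" "3 * inverse v * (v * s)\<^sup>2 = v * (3 * s\<^sup>2)"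
        "4 * inverse v * (v * u) * (v * z) = v * (4 * z * u)"
        using v0 by (simp_all add: power2_eq_square)
      have "v * M + l / 3 * (2 * (v * s) + v * z\<^sup>2) + L / 36 * (2 * (v * w) + v * (3 * s\<^sup>2) + v * (4 * z * u))
        = v * (M + l / 3 * (2 * s + z\<^sup>2) + L / 36 * (2 * w + 3 * s\<^sup>2 + 4 * z * u))"
        by (simp add: distrib_left mult_ac)
      then show ?thesis unfolding i by simp
    qed
    show ?thesis
      unfolding formula(2)[OF \<phi>_smooth] pv A_def ints[OF \<phi>_smooth, folded v_def] f
      by (simp add: power_divide)
  qed
  have ex1: "\<exists>!c. is_heat_coeff (P_op gu \<Theta> lam m \<phi>) 4 c" unfolding formula(1)[OF \<phi>_smooth] by blast
  \<comment> \<open>A local formula is tested on x times a constant and on x times a real mode; the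
    quartic coefficients in x of the two families put incompatible demands on
    \<open>c2\<close>.\<close>
  have nonlocal: False
    if lam: "lam \<noteq> 0" and loc: "\<And>\<psi>. torus_smooth \<psi> ==> real_valued \<psi> ==> heat_coeff (P_op gu \<Theta> lam m \<psi>) 4 =
      c0 + c1 * torus_int gu (\<lambda>x. (\<psi> x)\<^sup>2) + c2 * torus_int gu (star_pow \<Theta> \<psi> 4)" for c0 c1 c2
  proof -
    define K where "K = v / (32 * (complex_of_real pi)\<^sup>2)"
    define M where "M = complex_of_real (m ^ 4)"
    define l where "l = complex_of_real (lam * m\<^sup>2 / 3)"
    define L where "L = (complex_of_real (lam / 6))\<^sup>2"
    have KL: "K * L \<noteq> 0" using lam v0 by (simp add: K_def L_def)
    \<comment> \<open>On constants every star power is an ordinary power, so the quadratic bracket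
      gives 2 + 1 = 3 and the quartic one 2 + 3 + 4 = 9.\<close>
    have con: "K * (M + l * (3 * x\<^sup>2) + L * (9 * x ^ 4)) = c0 + c1 * (v * x\<^sup>2) + c2 * (v * x ^ 4)" if "x \<in> \<real>" for x
    proof -
      let ?w = "\<lambda>y. x * plane_wave 0 y + 0 * plane_wave 0 y"
      have sm: "torus_smooth ?w" by (rule torus_smooth_two_waves)
      have re: "real_valued ?w" using that by (simp add: real_valued_def)
      have fc: "fourier_coeff ?w = (\<lambda>r. (if 0 = r then x else 0) + (if 0 = r then 0 else 0))" by (rule ext) (rule fourier_coeff_two_waves)
      note tc = tconv_constant(1-3)[OF fc, of \<Theta>] tconv_constant(4)[OF fc]
      show ?thesis
        using loc[OF sm re] unfolding formula(2)[OF sm] ints[OF sm, folded v_def] tc pv K_def[symmetric] M_def[symmetric] l_def[symmetric] L_def[symmetric]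
        by (simp add: power2_eq_square power3_eq_cube power4_eq_xxxx algebra_simps)
    qed
    define k :: "int ^ 4" where "k = axis 1 1"
    have k: "k \<noteq> 0" by (simp add: k_def axis_eq_0_iff)
    \<comment> \<open>The zero mode of the field vanishes, so the quadratic bracket is 2 times 2 and
      the quartic one is 2 times 6 plus 3 times 4.\<close>
    have mode: "K * (M + l * (4 * x\<^sup>2) + L * (24 * x ^ 4)) = c0 + c1 * (v * (2 * x\<^sup>2)) + c2 * (v * (6 * x ^ 4))" if "x \<in> \<real>" for x
    proof -
      let ?w = "\<lambda>y. x * plane_wave k y + x * plane_wave (- k) y"
      have sm: "torus_smooth ?w" by (rule torus_smooth_two_waves)
      have "plane_wave k y + plane_wave (- k) y = of_real (2 * cos (lat k \<bullet> y))" for y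
        by (simp add: plane_wave_def lat_minus complex_eq_iff)
      then have "?w y = x * of_real (2 * cos (lat k \<bullet> y))" for y by (simp only: distrib_left[symmetric])
      then have re: "real_valued ?w" using that unfolding real_valued_def by (metis Reals_mult Reals_of_real)
      have fc: "fourier_coeff ?w = (\<lambda>r. (if k = r then x else 0) + (if - k = r then x else 0))" by (rule ext) (rule fourier_coeff_two_waves)
      note tc = tconv_mode[OF \<Theta>_skew k fc]
      show ?thesis
        using loc[OF sm re] unfolding formula(2)[OF sm] ints[OF sm, folded v_def] tc pv K_def[symmetric] M_def[symmetric] l_def[symmetric] L_def[symmetric]
        by (simp add: power2_eq_square power4_eq_xxxx algebra_simps)
    qed
    have "9 * (K * L) = c2 * v"
      by (rule quartic_coeff_unique[of "K * M" "3 * K * l" _ c0 "c1 * v"]) (use con in \<open>simp add: algebra_simps\<close>)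
    moreover have "24 * (K * L) = 6 * (c2 * v)"
      by (rule quartic_coeff_unique[of "K * M" "4 * K * l" _ c0 "2 * c1 * v"]) (use mode in \<open>simp add: algebra_simps\<close>)
    \<comment> \<open>The constants fix \<open>c2\<close>, and the mode would then need 24 =
      54.\<close>
    ultimately have "24 * (K * L) = 6 * (9 * (K * L))" by (simp only:)
    moreover have "y = 0" if "24 * y = 6 * (9 * y)" for y :: complex using that by simp
    ultimately have "K * L = 0" by blast
    then show False using KL by simp
  qed
  show ?thesis
    unfolding Let_def v_def[symmetric] A_def[symmetric] W_div_def A
    using ex1 nonlocal by blast
qed

end
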